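(* Let $H$ be a finite-dimensional Hilbert space and $A\subseteq\mathcal{L}(H)$ a nondegenerate $C^{*}$-subalgebra; let $N$ be a finite-dimensional $C^{*}$-algebra with a faithful state $\mu$ and injective unital $*$-homomorphisms $\rho\colon N^{op}\to A$, $\sigma\colon N\to A$ such that $\rho(N^{op})$ and $\sigma(N)$ commute; let $(\mathfrak{H},\mathfrak{B},\mathfrak{B}^{\dagger})$ be a finite-dimensional standard $C^{*}$-base with bicyclic vector $\zeta\in\mathfrak{H}$, and let $\alpha\in\mathrm{C}^{*}\text{-fact}(A;(\mathfrak{H},\mathfrak{B},\mathfrak{B}^{\dagger}))$ and $\beta\in\mathrm{C}^{*}\text{-fact}(A;(\mathfrak{H},\mathfrak{B}^{\dagger},\mathfrak{B}))$ be compatible $C^{*}$-factorizations. Let $U\colon\mathfrak{H}\to H_{\mu}$ be a unitary such that $$U\mathfrak{B}U^{*}=\pi_{\mu}(N),\quad U\mathfrak{B}^{\dagger}U^{*}=\pi_{\mu}^{op}(N^{op}),\quad U\zeta=\zeta_{\mu},\quad \rho=\rho_{\alpha}\circ\mathrm{Ad}_{U^{*}}\circ\pi_{\mu}^{op},\quad \sigma=\rho_{\beta}\circ\mathrm{Ad}_{U^{*}}\circ\pi_{\mu}.$$ Let $\Delta_{\mu}\colon A\to A\,{}_{\rho}\underset{\mu}{\ast}{}_{\sigma}\,A$ and $\Delta_{\mathfrak{H}}\colon A\to A\,{}_{\alpha}\underset{\mathfrak{H}}{\ast}{}_{\beta}\,A$ be $*$-homomorphisms such that $\Delta_{\mathfrak{H}}=\phi^{U,\zeta}_{\alpha,\beta}\circ\Delta_{\mu}$.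 Then $(N,\mu,A,\rho,\sigma,\Delta_{\mu})$ is a Hopf-von Neumann bimodule if and only if $((\mathfrak{H},\mathfrak{B},\mathfrak{B}^{\dagger}),H,A,\alpha,\beta,\Delta_{\mathfrak{H}})$ is a concrete Hopf $C^{*}$-bimodule.
   Context: Inner products are conjugate-linear in the first variable. $[Y]$ denotes the closed linear span; $XY$ the set of products; $X'$ the commutant; $\mathrm{Ad}_{U}(x)=UxU^{*}$. For a $*$-homomorphism $\pi\colon A\to C$, $A\subseteq\mathcal{L}(H)$, $C\subseteq\mathcal{L}(L)$, put $\mathcal{L}^{\pi}(H,L)=\{T\in\mathcal{L}(H,L)\mid Ta=\pi(a)T\ \forall a\in A\}$. $C^{*}$-bases and factorizations. A $C^{*}$-base is a triple $(\mathfrak{H},\mathfrak{B},\mathfrak{B}^{\dagger})$ of a Hilbert space and two commuting nondegenerate $C^{*}$-algebras $\mathfrak{B},\mathfrak{B}^{\dagger}\subseteq\mathcal{L}(\mathfrak{H})$; it is finite-dimensional if $\dim\mathfrak{H}<\infty$, and standard if there is a bicyclic vector (cyclic for both $\mathfrak{B}$ and $\mathfrak{B}^{\dagger}$). A $C^{*}$-factorization of $H$ with respect to it is a closed subspace $\alpha\subseteq\mathcal{L}(\mathfrak{H},H)$ with $[\alpha^{*}\alpha]=\mathfrak{B}$, $[\alpha\mathfrak{B}]=\alpha$, $[\alpha\mathfrak{H}]=H$; it determines a representation $\rho_{\alpha}\colon\mathfrak{B}^{\dagger}\to\mathcal{L}(H)$, $\rho_{\alpha}(b^{\dagger})\xi\omega=\xi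 b^{\dagger}\omega$ ($\xi\in\alpha,\omega\in\mathfrak{H}$). For a nondegenerate $C^{*}$-algebra $A\subseteq\mathcal{L}(H)$, $\mathrm{C}^{*}\text{-fact}(A;(\mathfrak{H},\mathfrak{B},\mathfrak{B}^{\dagger}))$ is the set of those $\alpha$ with $\rho_{\alpha}(\mathfrak{B}^{\dagger})\subseteq A$. The same definitions apply to the $C^{*}$-base $(\mathfrak{H},\mathfrak{B}^{\dagger},\mathfrak{B})$, so $\beta$ determines $\rho_{\beta}\colon\mathfrak{B}\to\mathcal{L}(H)$. $\alpha$ and $\beta$ are compatible if $[\rho_{\alpha}(\mathfrak{B}^{\dagger})\beta]=\beta$ and $[\rho_{\beta}(\mathfrak{B})\alpha]=\alpha$. GNS. $(H_{\mu},\pi_{\mu},\zeta_{\mu})$ is a GNS-representation for $\mu$, $J_{\mu}$ the modular conjugation (antiunitary part of the polar decomposition of $\pi_{\mu}(b)\zeta_{\mu}\mapsto\pi_{\mu}(b^{*})\zeta_{\mu}$), $\pi_{\mu}^{op}(b^{op})=J_{\mu}\pi_{\mu}(b)^{*}J_{\mu}$. Relative tensor products. For finite-dimensional $H,K$ with nondegenerate faithful representations $\rho\colon N^{op}\to\mathcal{L}(H)$, $\sigma\colon N\to\mathcal{L}(K)$, put $R^{\rho}_{\mu^{op}}(\xi)\colon\pi_{\mu}^{op}(b^{op})\zeta_{\mu}\mapsto\rho(b^{op})\xi$ and $R^{\sigma}_{\mu}(\eta)\colon\pi_{\mu}(b)\zeta_{\mu}\mapsto\sigma(b)\eta$; $H\,{}_{\rho}\underset{\mu}{\otimes}{}_{\sigma}\,K$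 is the quotient of $H\otimes K$ by the null space of $\langle\xi\otimes\eta|\xi'\otimes\eta'\rangle_{\mu}=\langle R^{\rho}_{\mu^{op}}(\xi')^{*}R^{\rho}_{\mu^{op}}(\xi)\zeta_{\mu}|R^{\sigma}_{\mu}(\eta)^{*}R^{\sigma}_{\mu}(\eta')\zeta_{\mu}\rangle$; the class of $\xi\otimes\eta$ is $\xi\underset{\mu}{\otimes}\eta$. For $C^{*}$-factorizations $\alpha$ of $H$ w.r.t. $(\mathfrak{H},\mathfrak{B},\mathfrak{B}^{\dagger})$ and $\beta$ of $K$ w.r.t. $(\mathfrak{H},\mathfrak{B}^{\dagger},\mathfrak{B})$, $H\,{}_{\alpha}\underset{\mathfrak{H}}{\otimes}{}_{\beta}\,K$ is the separated completion of the algebraic tensor product of $\alpha,\mathfrak{H},\beta$ for $\langle\xi\otimes\omega\otimes\eta|\xi'\otimes\omega'\otimes\eta'\rangle=\langle\omega|(\xi^{*}\xi')(\eta^{*}\eta')\omega'\rangle$. For $\xi\in\alpha$, $\eta\in\beta$ define $|\xi\rangle_{[1]}\colon K\to H\,{}_{\alpha}\underset{\mathfrak{H}}{\otimes}{}_{\beta}\,K$, $\eta'\omega\mapsto\xi\otimes\omega\otimes\eta'$ and $|\eta\rangle_{[2]}\colon H\to H\,{}_{\alpha}\underset{\mathfrak{H}}{\otimes}{}_{\beta}\,K$, $\xi'\omega\mapsto\xi'\otimes\omega\otimes\eta$ ($\xi'\in\alpha,\eta'\in\beta,\omega\in\mathfrak{H}$); $|\alpha\rangle_{[1]}$, $|\beta\rangle_{[2]}$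 denote the sets of all such operators. Operators act as usual: $S\underset{\mu}{\otimes}T\colon\xi\underset{\mu}{\otimes}\eta\mapsto S\xi\underset{\mu}{\otimes}T\eta$ and $S\underset{\mathfrak{H}}{\otimes}T\colon\xi\otimes\omega\otimes\eta\mapsto S\xi\otimes\omega\otimes T\eta$ whenever $S,T$ intertwine the representations of $N^{op}$ and $N$ (respectively map the $C^{*}$-factorizations into one another). Fiber products. For $A\subseteq\mathcal{L}(H)$, $B\subseteq\mathcal{L}(K)$ nondegenerate with $\rho(N^{op})\subseteq A$, $\sigma(N)\subseteq B$: $A\,{}_{\rho}\underset{\mu}{\ast}{}_{\sigma}\,B=\{S\underset{\mu}{\otimes}T\mid S\in A',T\in B'\}'$. For $\alpha\in\mathrm{C}^{*}\text{-fact}(A;(\mathfrak{H},\mathfrak{B},\mathfrak{B}^{\dagger}))$, $\beta\in\mathrm{C}^{*}\text{-fact}(B;(\mathfrak{H},\mathfrak{B}^{\dagger},\mathfrak{B}))$: $A\,{}_{\alpha}\underset{\mathfrak{H}}{\ast}{}_{\beta}\,B$ is the set of $T\in\mathcal{L}(H\,{}_{\alpha}\underset{\mathfrak{H}}{\otimes}{}_{\beta}\,K)$ such that $T|\alpha\rangle_{[1]},T^{*}|\alpha\rangle_{[1]}\subseteq[|\alpha\rangle_{[1]}B]$ and $T|\beta\rangle_{[2]},T^{*}|\beta\rangle_{[2]}\subseteq[|\beta\rangle_{[2]}A]$. In the situation of the claim, $\Phi\colon\xi\underset{\mu}{\otimes}\eta\mapsto R^{\rho}_{\mu^{op}}(\xi)U\otimes\zeta\otimes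 R^{\sigma}_{\mu}(\eta)U$ is a unitary $H\,{}_{\rho}\underset{\mu}{\otimes}{}_{\sigma}\,H\to H\,{}_{\alpha}\underset{\mathfrak{H}}{\otimes}{}_{\beta}\,H$, and $\phi^{U,\zeta}_{\alpha,\beta}\colon A\,{}_{\rho}\underset{\mu}{\ast}{}_{\sigma}\,A\to A\,{}_{\alpha}\underset{\mathfrak{H}}{\ast}{}_{\beta}\,A$ is the isomorphism $x\mapsto\Phi x\Phi^{*}$. Morphisms. For finite-dimensional $H,L$, nondegenerate $C^{*}$-algebras $A\subseteq\mathcal{L}(H)$, $C\subseteq\mathcal{L}(L)$, and $\alpha\in\mathrm{C}^{*}\text{-fact}(A;\cdot)$, $\gamma\in\mathrm{C}^{*}\text{-fact}(C;\cdot)$ with respect to the same $C^{*}$-base, $\mathrm{Mor}(A_{\alpha},C_{\gamma})$ is the set of $*$-homomorphisms $\pi\colon A\to C$ with $\gamma=[I_{\pi}\alpha]$, where $I_{\pi}=\{V\in\mathcal{L}^{\pi}(H,L)\mid V\alpha\subseteq\gamma,\ V^{*}\gamma\subseteq\alpha\}$. Fiber products of morphisms. Let $\phi\colon A\to C$, $\psi\colon B\to D$ be unital $*$-homomorphisms ($A,B,C,D$ nondegenerate on $H,K,L,M$). If $\phi\circ\rho=\upsilon$, $\psi\circ\sigma=\tau$ for injective unital $*$-homomorphisms $\upsilon\colon N^{op}\to C$, $\tau\colon N\to D$, then $\phi\underset{\mu}{\ast}\psi\colon A\,{}_{\rho}\underset{\mu}{\ast}{}_{\sigma}\,B\to C\,{}_{\upsilon}\underset{\mu}{\ast}{}_{\tau}\,D$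 is the unique $*$-homomorphism with $(\phi\underset{\mu}{\ast}\psi)(S)(X\underset{\mu}{\otimes}Y)=(X\underset{\mu}{\otimes}Y)S$ for all $X\in\mathcal{L}^{\phi}(H,L)$, $Y\in\mathcal{L}^{\psi}(K,M)$ and all $S$. If $\phi\in\mathrm{Mor}(A_{\alpha},C_{\gamma})$, $\psi\in\mathrm{Mor}(B_{\beta},D_{\delta})$, then $\phi\underset{\mathfrak{H}}{\ast}\psi\colon A\,{}_{\alpha}\underset{\mathfrak{H}}{\ast}{}_{\beta}\,B\to C\,{}_{\gamma}\underset{\mathfrak{H}}{\ast}{}_{\delta}\,D$ is the unique $*$-homomorphism with $(\phi\underset{\mathfrak{H}}{\ast}\psi)(T)(X\underset{\mathfrak{H}}{\otimes}Y)=(X\underset{\mathfrak{H}}{\otimes}Y)T$ for all such $X,Y$ and all $T$. Hopf-von Neumann bimodule. Put $\rho_{[2]}(x)=1\underset{\mu}{\otimes}\rho(x)$ and $\sigma_{[1]}(y)=\sigma(y)\underset{\mu}{\otimes}1$; these are $*$-homomorphisms $N^{op}\to A\,{}_{\rho}\underset{\mu}{\ast}{}_{\sigma}\,A$ and $N\to A\,{}_{\rho}\underset{\mu}{\ast}{}_{\sigma}\,A$. The tuple $(N,\mu,A,\rho,\sigma,\Delta)$ is a (finite-dimensional) Hopf-von Neumann bimodule if $\Delta\colon A\to A\,{}_{\rho}\underset{\mu}{\ast}{}_{\sigma}\,A$ is a $*$-homomorphism with $\Delta\circ\rho=\rho_{[2]}$, $\Delta\circ\sigma=\sigma_{[1]}$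 and $(\Delta\underset{\mu}{\ast}\mathrm{id})\circ\Delta=(\mathrm{id}\underset{\mu}{\ast}\Delta)\circ\Delta$. Here both sides take values in $A\,{}_{\rho}\underset{\mu}{\ast}{}_{\sigma}\,A\,{}_{\rho}\underset{\mu}{\ast}{}_{\sigma}\,A$, where $(A\,{}_{\rho}\underset{\mu}{\ast}{}_{\sigma}\,A)\,{}_{\rho_{[2]}}\underset{\mu}{\ast}{}_{\sigma}\,A$ and $A\,{}_{\rho}\underset{\mu}{\ast}{}_{\sigma_{[1]}}(A\,{}_{\rho}\underset{\mu}{\ast}{}_{\sigma}\,A)$ are identified via $(\xi\underset{\mu}{\otimes}\eta)\underset{\mu}{\otimes}\vartheta\mapsto\xi\underset{\mu}{\otimes}(\eta\underset{\mu}{\otimes}\vartheta)$. Concrete Hopf $C^{*}$-bimodule. Put $\alpha\triangleright\alpha=[|\alpha\rangle_{[1]}\alpha]\in\mathrm{C}^{*}\text{-fact}(A\,{}_{\alpha}\underset{\mathfrak{H}}{\ast}{}_{\beta}\,A;(\mathfrak{H},\mathfrak{B},\mathfrak{B}^{\dagger}))$ and $\beta\triangleleft\beta=[|\beta\rangle_{[2]}\beta]\in\mathrm{C}^{*}\text{-fact}(A\,{}_{\alpha}\underset{\mathfrak{H}}{\ast}{}_{\beta}\,A;(\mathfrak{H},\mathfrak{B}^{\dagger},\mathfrak{B}))$; the associated representations are $b^{\dagger}\mapsto1\underset{\mathfrak{H}}{\otimes}\rho_{\alpha}(b^{\dagger})$ and $b\mapsto\rho_{\beta}(b)\underset{\mathfrak{H}}{\otimes}1$.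 The tuple $((\mathfrak{H},\mathfrak{B},\mathfrak{B}^{\dagger}),H,A,\alpha,\beta,\Delta)$ is a (finite-dimensional) concrete Hopf $C^{*}$-bimodule if $\Delta\in\mathrm{Mor}(A_{\alpha},(A\,{}_{\alpha}\underset{\mathfrak{H}}{\ast}{}_{\beta}\,A)_{\alpha\triangleright\alpha})\cap\mathrm{Mor}(A_{\beta},(A\,{}_{\alpha}\underset{\mathfrak{H}}{\ast}{}_{\beta}\,A)_{\beta\triangleleft\beta})$ and $(\Delta\underset{\mathfrak{H}}{\ast}\mathrm{id})\circ\Delta=(\mathrm{id}\underset{\mathfrak{H}}{\ast}\Delta)\circ\Delta$. Here the two sides take values in $(A\,{}_{\alpha}\underset{\mathfrak{H}}{\ast}{}_{\beta}\,A)\,{}_{\alpha\triangleright\alpha}\underset{\mathfrak{H}}{\ast}{}_{\beta}\,A$ and $A\,{}_{\alpha}\underset{\mathfrak{H}}{\ast}{}_{\beta\triangleleft\beta}(A\,{}_{\alpha}\underset{\mathfrak{H}}{\ast}{}_{\beta}\,A)$, and both are regarded as algebras of operators on the same Hilbert space $H\,{}_{\alpha}\underset{\mathfrak{H}}{\otimes}{}_{\beta}\,H\,{}_{\alpha}\underset{\mathfrak{H}}{\otimes}{}_{\beta}\,H$, by canonically identifying both underlying Hilbert spaces with the separated completion of the algebraic tensor product of $\alpha,H,\beta$ for $\langle\xi\otimes x\otimes\eta|\xi'\otimes x'\otimes\eta'\rangle=\langle x|\rho_{\beta}(\xi^{*}\xi')\rho_{\alpha}(\eta^{*}\eta')x'\rangle$: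 explicitly, $\xi\otimes x\otimes\eta$ corresponds to $|\eta\rangle_{[2]}(|\xi\rangle_{[1]}x)$ in the first space and to $|\xi\rangle_{[1]}(|\eta\rangle_{[2]}x)$ in the second. *)

theory Defs
  imports Complex_Main "HOL-Library.Function_Algebras" "HOL-Library.Nonpos_Ints"
begin

text \<open>
  Conventions. Everything is finite-dimensional. Hence every linear map is bounded, every linear
  subspace (of a Hilbert space or of a space of operators) is closed, and every separated
  inner product space is complete; so \<open>\<L>(H, K)\<close> consists of all linear maps, the closed linear span
  \<open>[Y]\<close> is the linear span, ``closed subspace'' is ``subspace'', and the separated completion of a
  space with a positive semidefinite form is its quotient by the null space.

  Inner products are conjugate-linear in the first variable.
\<close>

section \<open>Complex vector spaces and abstract C*-algebras\<close>

class complex_vector = ab_group_add +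
  fixes scaleC :: "complex \<Rightarrow> 'a \<Rightarrow> 'a"  (infixr "*\<^sub>C" 75)
  assumes scaleC_add_right: "a *\<^sub>C (x + y) = a *\<^sub>C x + a *\<^sub>C y"
    and scaleC_add_left: "(a + b) *\<^sub>C x = a *\<^sub>C x + b *\<^sub>C x"
    and scaleC_scaleC: "a *\<^sub>C b *\<^sub>C x = (a * b) *\<^sub>C x"
    and scaleC_one: "1 *\<^sub>C x = x"

global_interpretation complex_vector: vector_space "scaleC :: complex \<Rightarrow> 'a \<Rightarrow> 'a::complex_vector"
  by standard (rule scaleC_add_right scaleC_add_left scaleC_scaleC scaleC_one)+

instantiation complex :: complex_vector
begin
definition scaleC_complex :: "complex \<Rightarrow> complex \<Rightarrow> complex"
  where "scaleC_complex a x = a * x"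
instance by standard (simp_all add: scaleC_complex_def algebra_simps)
end

instantiation "fun" :: (type, complex_vector) complex_vector
begin
definition scaleC_fun :: "complex \<Rightarrow> ('a \<Rightarrow> 'b) \<Rightarrow> 'a \<Rightarrow> 'b"
  where "scaleC_fun a f = (\<lambda>x. a *\<^sub>C f x)"
instance by standard
  (simp_all add: scaleC_fun_def fun_eq_iff scaleC_add_right scaleC_add_left scaleC_scaleC scaleC_one)
end

abbreviation cspan :: "'a::complex_vector set \<Rightarrow> 'a set"
  where "cspan \<equiv> complex_vector.span"

abbreviation csubspace :: "'a::complex_vector set \<Rightarrow> bool"
  where "csubspace \<equiv> complex_vector.subspace"

class cstar_algebra = complex_vector + real_normed_algebra_1 + banach +
  fixes star :: "'a \<Rightarrow> 'a"
  assumes scaleR_scaleC: "scaleR r x = complex_of_real r *\<^sub>C x"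
    and scaleC_mult_left: "(a *\<^sub>C x) * y = a *\<^sub>C (x * y)"
    and scaleC_mult_right: "x * (a *\<^sub>C y) = a *\<^sub>C (x * y)"
    and norm_scaleC: "norm (a *\<^sub>C x) = cmod a * norm x"
    and star_add: "star (x + y) = star x + star y"
    and star_scaleC: "star (a *\<^sub>C x) = cnj a *\<^sub>C star x"
    and star_mult: "star (x * y) = star y * star x"
    and star_star: "star (star x) = x"
    and norm_star_mult: "norm (star x * x) = (norm x)\<^sup>2"

definition faithful_state :: "('n::cstar_algebra \<Rightarrow> complex) \<Rightarrow> bool" where
  "faithful_state \<mu> \<longleftrightarrow>
     (\<forall>x y. \<mu> (x + y) = \<mu> x + \<mu> y) \<and> (\<forall>a x. \<mu> (a *\<^sub>C x) = a * \<mu> x) \<and>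
     (\<forall>x. \<mu> (star x * x) \<in> \<real>\<^sub>\<ge>\<^sub>0) \<and> \<mu> 1 = 1 \<and>
     (\<forall>x. \<mu> (star x * x) = 0 \<longrightarrow> x = 0)"

section \<open>Hilbert spaces and operators\<close>

text \<open>
  A Hilbert space is a subspace of an ambient complex vector space (given by its type)
  together with an inner product on that subspace; the values of \<open>hinner\<close> elsewhere are irrelevant.
\<close>

record 'a hilb =
  hspace :: "'a set"
  hinner :: "'a \<Rightarrow> 'a \<Rightarrow> complex"

locale fd_hilbert =
  fixes H :: "'a::complex_vector hilb"
  assumes subspace: "csubspace (hspace H)"
    and finite_dim: "\<exists>S. finite S \<and> cspan S = hspace H"
    and inner_add_right: "\<lbrakk>x \<in> hspace H; y \<in> hspace H; z \<in> hspace H\<rbrakk> \<Longrightarrow>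
          hinner H x (y + z) = hinner H x y + hinner H x z"
    and inner_scaleC_right: "\<lbrakk>x \<in> hspace H; y \<in> hspace H\<rbrakk> \<Longrightarrow>
          hinner H x (a *\<^sub>C y) = a * hinner H x y"
    and inner_commute: "\<lbrakk>x \<in> hspace H; y \<in> hspace H\<rbrakk> \<Longrightarrow> hinner H y x = cnj (hinner H x y)"
    and inner_nonneg: "x \<in> hspace H \<Longrightarrow> hinner H x x \<in> \<real>\<^sub>\<ge>\<^sub>0"
    and inner_definite: "\<lbrakk>x \<in> hspace H; hinner H x x = 0\<rbrakk> \<Longrightarrow> x = 0"

text \<open>
  \<open>ops H K\<close> is \<open>\<L>(H, K)\<close>. Operators are extended by \<open>0\<close> outside their domain, so that equality,
  composition, sums and scalar multiples of operators are those of functions.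
\<close>

definition ops :: "'a::complex_vector hilb \<Rightarrow> 'b::complex_vector hilb \<Rightarrow> ('a \<Rightarrow> 'b) set" where
  "ops H K = {T. T ` hspace H \<subseteq> hspace K \<and> (\<forall>x. x \<notin> hspace H \<longrightarrow> T x = 0) \<and>
     (\<forall>x\<in>hspace H. \<forall>y\<in>hspace H. T (x + y) = T x + T y) \<and>
     (\<forall>a. \<forall>x\<in>hspace H. T (a *\<^sub>C x) = a *\<^sub>C T x)}"

definition idop :: "'a::complex_vector hilb \<Rightarrow> 'a \<Rightarrow> 'a" where
  "idop H = (\<lambda>x. if x \<in> hspace H then x else 0)"

definition adj :: "'a::complex_vector hilb \<Rightarrow> 'b::complex_vector hilb \<Rightarrow> ('a \<Rightarrow> 'b) \<Rightarrow> 'b \<Rightarrow> 'a" where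
  "adj H K T = (THE S. S \<in> ops K H \<and>
     (\<forall>y\<in>hspace K. \<forall>x\<in>hspace H. hinner H (S y) x = hinner K y (T x)))"

definition unitary_op :: "'a::complex_vector hilb \<Rightarrow> 'b::complex_vector hilb \<Rightarrow> ('a \<Rightarrow> 'b) \<Rightarrow> bool" where
  "unitary_op H K U \<longleftrightarrow> U \<in> ops H K \<and> adj H K U \<circ> U = idop H \<and> U \<circ> adj H K U = idop K"

definition op_prods :: "('b \<Rightarrow> 'c) set \<Rightarrow> ('a \<Rightarrow> 'b) set \<Rightarrow> ('a \<Rightarrow> 'c) set"  (infixl "\<odot>" 70) where
  "X \<odot> Y = {S \<circ> T | S T. S \<in> X \<and> T \<in> Y}"

definition op_vecs :: "('a \<Rightarrow> 'b) set \<Rightarrow> 'a set \<Rightarrow> 'b set"  (infixl "\<cdot>\<^sub>v" 70) where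
  "X \<cdot>\<^sub>v V = {T v | T v. T \<in> X \<and> v \<in> V}"

definition commutant :: "'a::complex_vector hilb \<Rightarrow> ('a \<Rightarrow> 'a) set \<Rightarrow> ('a \<Rightarrow> 'a) set" where
  "commutant H X = {T \<in> ops H H. \<forall>S\<in>X. T \<circ> S = S \<circ> T}"

definition nondeg_cstar :: "'a::complex_vector hilb \<Rightarrow> ('a \<Rightarrow> 'a) set \<Rightarrow> bool" where
  "nondeg_cstar H A \<longleftrightarrow> A \<subseteq> ops H H \<and> csubspace A \<and> A \<odot> A \<subseteq> A \<and> adj H H ` A \<subseteq> A \<and>
     cspan (A \<cdot>\<^sub>v hspace H) = hspace H"

definition star_hom ::
  "'a::complex_vector hilb \<Rightarrow> ('a \<Rightarrow> 'a) set \<Rightarrow> 'b::complex_vector hilb \<Rightarrow> ('b \<Rightarrow> 'b) set \<Rightarrow>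
     (('a \<Rightarrow> 'a) \<Rightarrow> 'b \<Rightarrow> 'b) \<Rightarrow> bool" where
  "star_hom H A L C \<pi> \<longleftrightarrow> \<pi> ` A \<subseteq> C \<and>
     (\<forall>S\<in>A. \<forall>T\<in>A. \<pi> (S + T) = \<pi> S + \<pi> T) \<and> (\<forall>a. \<forall>T\<in>A. \<pi> (a *\<^sub>C T) = a *\<^sub>C \<pi> T) \<and>
     (\<forall>S\<in>A. \<forall>T\<in>A. \<pi> (S \<circ> T) = \<pi> S \<circ> \<pi> T) \<and> (\<forall>T\<in>A. \<pi> (adj H H T) = adj L L (\<pi> T))"

text \<open>\<open>intertwiners H A L \<pi>\<close> is \<open>\<L>\<^sup>\<pi>(H, L)\<close>.\<close>

definition intertwiners ::
  "'a::complex_vector hilb \<Rightarrow> ('a \<Rightarrow> 'a) set \<Rightarrow> 'b::complex_vector hilb \<Rightarrow>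
     (('a \<Rightarrow> 'a) \<Rightarrow> 'b \<Rightarrow> 'b) \<Rightarrow> ('a \<Rightarrow> 'b) set" where
  "intertwiners H A L \<pi> = {T \<in> ops H L. \<forall>a\<in>A. T \<circ> a = \<pi> a \<circ> T}"

text \<open>
  Unital *-homomorphisms from an abstract C*-algebra into a nondegenerate C*-algebra \<open>A\<close> on \<open>H\<close>;
  the unit of \<open>A\<close> is then \<open>idop H\<close>. The multiplication of the domain is a parameter:
  \<open>N\<^sup>o\<^sup>p\<close> is \<open>N\<close> as a normed space with involution, with multiplication \<open>\<lambda>x y. y * x\<close>, and
  \<open>b\<^sup>o\<^sup>p\<close> is written \<open>b\<close>.
\<close>

definition unital_star_rep ::
  "('n::cstar_algebra \<Rightarrow> 'n \<Rightarrow> 'n) \<Rightarrow> 'a::complex_vector hilb \<Rightarrow> ('a \<Rightarrow> 'a) set \<Rightarrow>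
     ('n \<Rightarrow> 'a \<Rightarrow> 'a) \<Rightarrow> bool" where
  "unital_star_rep mul H A \<pi> \<longleftrightarrow> range \<pi> \<subseteq> A \<and>
     (\<forall>x y. \<pi> (x + y) = \<pi> x + \<pi> y) \<and> (\<forall>a x. \<pi> (a *\<^sub>C x) = a *\<^sub>C \<pi> x) \<and>
     (\<forall>x y. \<pi> (mul x y) = \<pi> x \<circ> \<pi> y) \<and> (\<forall>x. \<pi> (star x) = adj H H (\<pi> x)) \<and> \<pi> 1 = idop H"

abbreviation op_mult :: "'n::cstar_algebra \<Rightarrow> 'n \<Rightarrow> 'n" where
  "op_mult \<equiv> (\<lambda>x y. y * x)"

section \<open>The Hilbert space generated by a positive semidefinite kernel\<close>

text \<open>
  Let \<open>k\<close> be a positive semidefinite kernel on a set \<open>X\<close>, and extend it to a form on the free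
  complex vector space \<open>free_vecs X\<close> over \<open>X\<close>. The quotient of \<open>free_vecs X\<close> by the null space of
  this form is implemented as follows: the class of \<open>c\<close> is the function \<open>x \<mapsto> \<langle>x|c\<rangle>\<close> on \<open>X\<close> (extended
  by \<open>0\<close>), and \<open>kclass_eq_iff\<close> below shows that \<open>c\<close> and \<open>d\<close> have the same class if and
  only if \<open>c - d\<close> is in the null space.

  If \<open>X\<close> is a product of vector spaces and \<open>k\<close> is sesquilinear in the corresponding tuples, then the
  form factors through the algebraic tensor product, and the quotient is the same as the separated
  quotient of the algebraic tensor product. The class of an elementary tensor is \<open>kgen X k x\<close>.
\<close>

definition free_vecs :: "'x set \<Rightarrow> ('x \<Rightarrow> complex) set" where
  "free_vecs X = {c. finite {x. c x \<noteq> 0} \<and> {x. c x \<noteq> 0} \<subseteq> X}"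

definition kform :: "('x \<Rightarrow> 'x \<Rightarrow> complex) \<Rightarrow> ('x \<Rightarrow> complex) \<Rightarrow> ('x \<Rightarrow> complex) \<Rightarrow> complex" where
  "kform k c d = (\<Sum>x | c x \<noteq> 0. \<Sum>y | d y \<noteq> 0. cnj (c x) * d y * k x y)"

definition kclass :: "'x set \<Rightarrow> ('x \<Rightarrow> 'x \<Rightarrow> complex) \<Rightarrow> ('x \<Rightarrow> complex) \<Rightarrow> 'x \<Rightarrow> complex" where
  "kclass X k c = (\<lambda>x. if x \<in> X then \<Sum>y | c y \<noteq> 0. c y * k x y else 0)"

definition kquot :: "'x set \<Rightarrow> ('x \<Rightarrow> 'x \<Rightarrow> complex) \<Rightarrow> ('x \<Rightarrow> complex) hilb" where
  "kquot X k = \<lparr>hspace = kclass X k ` free_vecs X,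
     hinner = (\<lambda>f g. THE z. \<exists>c\<in>free_vecs X. \<exists>d\<in>free_vecs X.
        f = kclass X k c \<and> g = kclass X k d \<and> z = kform k c d)\<rparr>"

definition kgen :: "'x set \<Rightarrow> ('x \<Rightarrow> 'x \<Rightarrow> complex) \<Rightarrow> 'x \<Rightarrow> 'x \<Rightarrow> complex" where
  "kgen X k x = kclass X k (\<lambda>y. if y = x then 1 else 0)"

lemma kform_superset:
  assumes "finite S" "{x. c x \<noteq> 0} \<subseteq> S" "{x. d x \<noteq> 0} \<subseteq> S"
  shows "kform k c d = (\<Sum>x\<in>S. \<Sum>y\<in>S. cnj (c x) * d y * k x y)"
proof -
  have "(\<Sum>y | d y \<noteq> 0. cnj (c x) * d y * k x y) = (\<Sum>y\<in>S. cnj (c x) * d y * k x y)" for x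
    using assms by (intro sum.mono_neutral_left) auto
  then show ?thesis
    unfolding kform_def using assms by (simp, intro sum.mono_neutral_left) auto
qed

lemma kclass_superset:
  assumes "finite S" "{x. c x \<noteq> 0} \<subseteq> S" "x \<in> X"
  shows "kclass X k c x = (\<Sum>y\<in>S. c y * k x y)"
proof -
  have "(\<Sum>y | c y \<noteq> 0. c y * k x y) = (\<Sum>y\<in>S. c y * k x y)"
    using assms by (intro sum.mono_neutral_left) auto
  with assms show ?thesis by (simp add: kclass_def)
qed

lemma kclass_eq_iff:
  assumes herm: "\<And>x y. \<lbrakk>x \<in> X; y \<in> X\<rbrakk> \<Longrightarrow> k y x = cnj (k x y)"
    and pos: "\<And>e. e \<in> free_vecs X \<Longrightarrow> kform k e e \<in> \<real>\<^sub>\<ge>\<^sub>0"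
    and c: "c \<in> free_vecs X" and d: "d \<in> free_vecs X"
  shows "kclass X k c = kclass X k d \<longleftrightarrow> kform k (c - d) (c - d) = 0"
proof -
  define e where "e = c - d"
  define S where "S = {x. c x \<noteq> 0} \<union> {x. d x \<noteq> 0}"
  have S: "finite S" "S \<subseteq> X" "{x. c x \<noteq> 0} \<subseteq> S" "{x. d x \<noteq> 0} \<subseteq> S" "{x. e x \<noteq> 0} \<subseteq> S"
    using c d by (auto simp: S_def e_def free_vecs_def)
  have ke: "kclass X k e x = kclass X k c x - kclass X k d x" for x
  proof (cases "x \<in> X")
    case True
    then show ?thesis
      using S by (simp add: kclass_superset[of S] e_def sum_subtractf left_diff_distrib)
  qed (simp add: kclass_def)
  have form: "kform k e e = (\<Sum>x\<in>S. cnj (e x) * kclass X k e x)"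
  proof -
    have "kform k e e = (\<Sum>x\<in>S. \<Sum>y\<in>S. cnj (e x) * e y * k x y)"
      by (rule kform_superset[OF S(1) S(5) S(5)])
    also have "\<dots> = (\<Sum>x\<in>S. cnj (e x) * kclass X k e x)"
      using S by (intro sum.cong refl) (simp add: kclass_superset[of S] sum_distrib_left mult.assoc subset_iff)
    finally show ?thesis .
  qed
  have "kform k e e = 0 \<Longrightarrow> kclass X k e x = 0" for x
  proof (rule ccontr)
    assume 0: "kform k e e = 0" and nz: "kclass X k e x \<noteq> 0"
    have x: "x \<in> X" using nz by (auto simp: kclass_def split: if_splits)
    define z where "z = kclass X k e x"
    define u where "u t = (\<lambda>y. e y + (if y = x then t else 0))" for t :: complex
    let ?S = "insert x S"
    have e': "{y. e y \<noteq> 0} \<subseteq> ?S" "finite ?S" "?S \<subseteq> X" using S x by auto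
    have zs: "z = (\<Sum>y\<in>?S. e y * k x y)"
      unfolding z_def by (rule kclass_superset[OF e'(2,1) x])
    have zs': "cnj z = (\<Sum>y\<in>?S. cnj (e y) * k y x)"
      unfolding zs cnj_sum
    proof (intro sum.cong refl)
      fix y assume "y \<in> ?S"
      then have "y \<in> X" using e'(3) by blast
      from herm[OF x this] show "cnj (e y * k x y) = cnj (e y) * k y x" by simp
    qed
    have f0: "(\<Sum>a\<in>?S. \<Sum>b\<in>?S. cnj (e a) * e b * k a b) = 0"
      using kform_superset[OF e'(2,1,1)] 0 by simp
    have sd: "(\<Sum>a\<in>?S. (if a = x then t else 0) * f a) = t * f x" for t and f :: "'a \<Rightarrow> complex"
      using e'(2) by (simp add: if_distrib[of "\<lambda>a. a * _"] sum.delta' cong: if_cong)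
    have expand: "kform k (u t) (u t) = t * cnj z + cnj t * z + cnj t * t * k x x" for t
    proof -
      have cu: "cnj (u t a) = cnj (e a) + (if a = x then cnj t else 0)" for a by (simp add: u_def)
      have sub: "{y. u t y \<noteq> 0} \<subseteq> ?S"
        using e'(1) by (auto simp: u_def split: if_splits)
      have inner: "(\<Sum>b\<in>?S. u t b * k a b) = (\<Sum>b\<in>?S. e b * k a b) + t * k a x" for a
        unfolding u_def distrib_right sum.distrib sd ..
      have "kform k (u t) (u t) = (\<Sum>a\<in>?S. \<Sum>b\<in>?S. cnj (u t a) * u t b * k a b)"
        by (rule kform_superset[OF e'(2) sub sub])
      also have "\<dots> = (\<Sum>a\<in>?S. cnj (u t a) * (\<Sum>b\<in>?S. u t b * k a b))"
        by (simp only: sum_distrib_left mult.assoc)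
      also have "\<dots> =
        (\<Sum>a\<in>?S. cnj (e a) * (\<Sum>b\<in>?S. e b * k a b)) + t * (\<Sum>a\<in>?S. cnj (e a) * k a x)
          + cnj t * ((\<Sum>b\<in>?S. e b * k x b) + t * k x x)"
        unfolding inner cu distrib_right sum.distrib sd
        by (simp add: algebra_simps sum.distrib sum_distrib_left)
      also have "(\<Sum>a\<in>?S. cnj (e a) * (\<Sum>b\<in>?S. e b * k a b)) = 0"
        using f0 by (simp only: sum_distrib_left mult.assoc)
      finally show ?thesis by (simp only: zs[symmetric] zs'[symmetric]) (simp add: algebra_simps)
    qed
    have "u t \<in> free_vecs X" for t
      unfolding free_vecs_def
      using e' by (auto simp: u_def intro!: finite_subset[OF _ e'(2)] split: if_splits)
    then have P: "0 \<le> Re (kform k (u t) (u t))" for t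
      using pos by (auto simp: complex_nonneg_Reals_iff)
    define n where "n = (cmod z)\<^sup>2"
    have n: "n > 0" using nz by (simp add: n_def z_def)
    define r where "r = Re (k x x)"
    have Q: "0 \<le> - 2 * s * n + s\<^sup>2 * n * r" for s :: real
    proof -
      have zz: "z * cnj z = of_real n" unfolding n_def by (rule complex_norm_square[symmetric])
      have "kform k (u (- of_real s * z)) (u (- of_real s * z)) =
          - of_real s * (z * cnj z) - of_real s * (z * cnj z) + (of_real s)\<^sup>2 * (z * cnj z) * k x x"
        unfolding expand by (simp add: algebra_simps power2_eq_square)
      also have "\<dots> = of_real (- 2 * s * n) + of_real (s\<^sup>2 * n) * k x x"
        unfolding zz by simp
      finally have "Re (kform k (u (- of_real s * z)) (u (- of_real s * z))) = - 2 * s * n + s\<^sup>2 * n * r"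
        unfolding r_def by simp
      with P show ?thesis by metis
    qed
    define s where "s = 1 / (1 + \<bar>r\<bar>)"
    have s: "s > 0" "s * r < 2" 
      by (auto simp: s_def field_simps) 
    have "- 2 * s * n + s\<^sup>2 * n * r = (s * n) * (s * r - 2)"
      by (simp add: algebra_simps power2_eq_square)
    also have "\<dots> < 0" using s n by (simp add: mult_pos_neg)
    finally show False using Q[of s] by simp
  qed
  then have "kform k e e = 0 \<longleftrightarrow> (\<forall>x. kclass X k e x = 0)"
    using form by auto
  then show ?thesis by (auto simp: ke fun_eq_iff e_def[symmetric])
qed

section \<open>GNS-representations\<close>

record ('n, 'g) gns =
  gns_space :: "'g hilb"
  gns_rep :: "'n \<Rightarrow> 'g \<Rightarrow> 'g"
  gns_vec :: 'g

definition gns_representation ::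
  "('n::cstar_algebra \<Rightarrow> complex) \<Rightarrow> ('n, 'g::complex_vector) gns \<Rightarrow> bool" where
  "gns_representation \<mu> G \<longleftrightarrow> fd_hilbert (gns_space G) \<and>
     unital_star_rep (*) (gns_space G) (ops (gns_space G) (gns_space G)) (gns_rep G) \<and>
     gns_vec G \<in> hspace (gns_space G) \<and>
     cspan (range (\<lambda>b. gns_rep G b (gns_vec G))) = hspace (gns_space G) \<and>
     (\<forall>b. \<mu> b = hinner (gns_space G) (gns_vec G) (gns_rep G b (gns_vec G)))"

definition antiunitary_op :: "'a::complex_vector hilb \<Rightarrow> ('a \<Rightarrow> 'a) \<Rightarrow> bool" where
  "antiunitary_op H J \<longleftrightarrow> J ` hspace H = hspace H \<and> (\<forall>x. x \<notin> hspace H \<longrightarrow> J x = 0) \<and>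
     (\<forall>x\<in>hspace H. \<forall>y\<in>hspace H. J (x + y) = J x + J y) \<and>
     (\<forall>a. \<forall>x\<in>hspace H. J (a *\<^sub>C x) = cnj a *\<^sub>C J x) \<and>
     (\<forall>x\<in>hspace H. \<forall>y\<in>hspace H. hinner H (J x) (J y) = hinner H y x)"

definition positive_op :: "'a::complex_vector hilb \<Rightarrow> ('a \<Rightarrow> 'a) \<Rightarrow> bool" where
  "positive_op H P \<longleftrightarrow> P \<in> ops H H \<and> (\<forall>x\<in>hspace H. hinner H x (P x) \<in> \<real>\<^sub>\<ge>\<^sub>0)"

text \<open>
  The antilinear operator \<open>S : \<pi>(b)\<zeta> \<mapsto> \<pi>(b\<^sup>*)\<zeta>\<close> is bijective, so \<open>J\<close> is determined by its polar
  decomposition \<open>S = J P\<close>.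
\<close>

definition modular_conj :: "('n::cstar_algebra, 'g::complex_vector) gns \<Rightarrow> 'g \<Rightarrow> 'g" where
  "modular_conj G = (THE J. antiunitary_op (gns_space G) J \<and>
     (\<exists>P. positive_op (gns_space G) P \<and>
        (\<forall>b. J (P (gns_rep G b (gns_vec G))) = gns_rep G (star b) (gns_vec G))))"

definition gns_rep_op :: "('n::cstar_algebra, 'g::complex_vector) gns \<Rightarrow> 'n \<Rightarrow> 'g \<Rightarrow> 'g" where
  "gns_rep_op G b =
     modular_conj G \<circ> adj (gns_space G) (gns_space G) (gns_rep G b) \<circ> modular_conj G"

section \<open>Relative tensor products and fiber products over a C*-algebra with a faithful state\<close>

text \<open>
  The order of the arguments follows the notation: \<open>mu_tensor G H \<rho> \<sigma> K\<close> is
  \<open>H \<^sub>\<rho>\<otimes>\<^sub>\<sigma> K\<close>, where \<open>\<rho>\<close> is a representation of \<open>N\<^sup>o\<^sup>p\<close> on \<open>H\<close> and \<open>\<sigma>\<close> one of \<open>N\<close> on \<open>K\<close>.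
\<close>

definition R_left ::
  "('n::cstar_algebra, 'g::complex_vector) gns \<Rightarrow> 'h::complex_vector hilb \<Rightarrow> ('n \<Rightarrow> 'h \<Rightarrow> 'h) \<Rightarrow>
     'h \<Rightarrow> 'g \<Rightarrow> 'h" where
  "R_left G H \<rho> \<xi> = (THE T. T \<in> ops (gns_space G) H \<and>
     (\<forall>b. T (gns_rep_op G b (gns_vec G)) = \<rho> b \<xi>))"

definition R_right ::
  "('n::cstar_algebra, 'g::complex_vector) gns \<Rightarrow> 'k::complex_vector hilb \<Rightarrow> ('n \<Rightarrow> 'k \<Rightarrow> 'k) \<Rightarrow>
     'k \<Rightarrow> 'g \<Rightarrow> 'k" where
  "R_right G K \<sigma> \<eta> = (THE T. T \<in> ops (gns_space G) K \<and>
     (\<forall>b. T (gns_rep G b (gns_vec G)) = \<sigma> b \<eta>))"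

definition mu_kernel where
  "mu_kernel G H \<rho> \<sigma> K = (\<lambda>(\<xi>, \<eta>) (\<xi>', \<eta>').
     hinner (gns_space G)
       (adj (gns_space G) H (R_left G H \<rho> \<xi>') (R_left G H \<rho> \<xi> (gns_vec G)))
       (adj (gns_space G) K (R_right G K \<sigma> \<eta>) (R_right G K \<sigma> \<eta>' (gns_vec G))))"

definition mu_tensor ::
  "('n::cstar_algebra, 'g::complex_vector) gns \<Rightarrow> 'h::complex_vector hilb \<Rightarrow> ('n \<Rightarrow> 'h \<Rightarrow> 'h) \<Rightarrow>
     ('n \<Rightarrow> 'k \<Rightarrow> 'k) \<Rightarrow> 'k::complex_vector hilb \<Rightarrow> ('h \<times> 'k \<Rightarrow> complex) hilb" where
  "mu_tensor G H \<rho> \<sigma> K = kquot (hspace H \<times> hspace K) (mu_kernel G H \<rho> \<sigma> K)"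

definition mu_elem ::
  "('n::cstar_algebra, 'g::complex_vector) gns \<Rightarrow> 'h::complex_vector hilb \<Rightarrow> ('n \<Rightarrow> 'h \<Rightarrow> 'h) \<Rightarrow>
     ('n \<Rightarrow> 'k \<Rightarrow> 'k) \<Rightarrow> 'k::complex_vector hilb \<Rightarrow> 'h \<Rightarrow> 'k \<Rightarrow> 'h \<times> 'k \<Rightarrow> complex" where
  "mu_elem G H \<rho> \<sigma> K \<xi> \<eta> = kgen (hspace H \<times> hspace K) (mu_kernel G H \<rho> \<sigma> K) (\<xi>, \<eta>)"

text \<open>\<open>mu_op G H \<rho> \<sigma> K L \<upsilon> \<tau> M S T\<close> is \<open>S \<otimes> T\<close> from \<open>H \<^sub>\<rho>\<otimes>\<^sub>\<sigma> K\<close> to \<open>L \<^sub>\<upsilon>\<otimes>\<^sub>\<tau> M\<close>.\<close>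

definition mu_op where
  "mu_op G H \<rho> \<sigma> K L \<upsilon> \<tau> M S T =
     (THE X. X \<in> ops (mu_tensor G H \<rho> \<sigma> K) (mu_tensor G L \<upsilon> \<tau> M) \<and>
        (\<forall>\<xi>\<in>hspace H. \<forall>\<eta>\<in>hspace K.
           X (mu_elem G H \<rho> \<sigma> K \<xi> \<eta>) = mu_elem G L \<upsilon> \<tau> M (S \<xi>) (T \<eta>)))"

definition mu_fiber where
  "mu_fiber G H A \<rho> \<sigma> K B = commutant (mu_tensor G H \<rho> \<sigma> K)
     {mu_op G H \<rho> \<sigma> K H \<rho> \<sigma> K S T | S T. S \<in> commutant H A \<and> T \<in> commutant K B}"

text \<open>
  The fiber product of \<open>\<phi> : A \<rightarrow> C\<close> and \<open>\<psi> : B \<rightarrow> D\<close>, for \<open>A, B, C, D\<close> acting on \<open>H, K, L, M\<close>.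
  Here and below, the unique *-homomorphism is made unique as a function by letting it be \<open>0\<close>
  outside of the fiber product.
\<close>

definition mu_fiber_map where
  "mu_fiber_map G H A \<rho> \<sigma> K B L C \<upsilon> \<tau> M D \<phi> \<psi> =
     (THE \<Theta>. star_hom (mu_tensor G H \<rho> \<sigma> K) (mu_fiber G H A \<rho> \<sigma> K B)
              (mu_tensor G L \<upsilon> \<tau> M) (mu_fiber G L C \<upsilon> \<tau> M D) \<Theta> \<and>
        (\<forall>S. S \<notin> mu_fiber G H A \<rho> \<sigma> K B \<longrightarrow> \<Theta> S = 0) \<and>
        (\<forall>S\<in>mu_fiber G H A \<rho> \<sigma> K B. \<forall>X\<in>intertwiners H A L \<phi>. \<forall>Y\<in>intertwiners K B M \<psi>.
           \<Theta> S \<circ> mu_op G H \<rho> \<sigma> K L \<upsilon> \<tau> M X Y = mu_op G H \<rho> \<sigma> K L \<upsilon> \<tau> M X Y \<circ> S))"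

section \<open>Hopf-von Neumann bimodules\<close>

definition rho2 where
  "rho2 G H \<rho> \<sigma> b = mu_op G H \<rho> \<sigma> H H \<rho> \<sigma> H (idop H) (\<rho> b)"

definition sigma1 where
  "sigma1 G H \<rho> \<sigma> b = mu_op G H \<rho> \<sigma> H H \<rho> \<sigma> H (\<sigma> b) (idop H)"

text \<open>The identification \<open>(H \<otimes> H) \<^bsub>\<rho>[2]\<^esub>\<otimes>\<^sub>\<sigma> H \<rightarrow> H \<^sub>\<rho>\<otimes>\<^bsub>\<sigma>[1]\<^esub> (H \<otimes> H)\<close>.\<close>

definition mu_assoc where
  "mu_assoc G H \<rho> \<sigma> =
     (let HH = mu_tensor G H \<rho> \<sigma> H; t = mu_elem G H \<rho> \<sigma> H;
          \<rho>2 = rho2 G H \<rho> \<sigma>; \<sigma>1 = sigma1 G H \<rho> \<sigma>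
      in THE W. W \<in> ops (mu_tensor G HH \<rho>2 \<sigma> H) (mu_tensor G H \<rho> \<sigma>1 HH) \<and>
           (\<forall>\<xi>\<in>hspace H. \<forall>\<eta>\<in>hspace H. \<forall>\<theta>\<in>hspace H.
              W (mu_elem G HH \<rho>2 \<sigma> H (t \<xi> \<eta>) \<theta>) = mu_elem G H \<rho> \<sigma>1 HH \<xi> (t \<eta> \<theta>)))"

definition hopf_vn_bimodule ::
  "('n::cstar_algebra, 'g::complex_vector) gns \<Rightarrow> 'h::complex_vector hilb \<Rightarrow> ('h \<Rightarrow> 'h) set \<Rightarrow>
     ('n \<Rightarrow> 'h \<Rightarrow> 'h) \<Rightarrow> ('n \<Rightarrow> 'h \<Rightarrow> 'h) \<Rightarrow>
     (('h \<Rightarrow> 'h) \<Rightarrow> ('h \<times> 'h \<Rightarrow> complex) \<Rightarrow> 'h \<times> 'h \<Rightarrow> complex) \<Rightarrow> bool" where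
  "hopf_vn_bimodule G H A \<rho> \<sigma> \<Delta> \<longleftrightarrow>
     (let HH = mu_tensor G H \<rho> \<sigma> H; AA = mu_fiber G H A \<rho> \<sigma> H A;
          \<rho>2 = rho2 G H \<rho> \<sigma>; \<sigma>1 = sigma1 G H \<rho> \<sigma>;
          \<Delta>_id = mu_fiber_map G H A \<rho> \<sigma> H A HH AA \<rho>2 \<sigma> H A \<Delta> id;
          id_\<Delta> = mu_fiber_map G H A \<rho> \<sigma> H A H A \<rho> \<sigma>1 HH AA id \<Delta>;
          W = mu_assoc G H \<rho> \<sigma>;
          W_star = adj (mu_tensor G HH \<rho>2 \<sigma> H) (mu_tensor G H \<rho> \<sigma>1 HH) W
      in star_hom H A HH AA \<Delta> \<and>
         (\<forall>b. \<Delta> (\<rho> b) = \<rho>2 b) \<and> (\<forall>b. \<Delta> (\<sigma> b) = \<sigma>1 b) \<and>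
         (\<forall>a\<in>A. W \<circ> \<Delta>_id (\<Delta> a) \<circ> W_star = id_\<Delta> (\<Delta> a)))"

section \<open>C*-bases and C*-factorizations\<close>

definition cstar_base ::
  "'k::complex_vector hilb \<Rightarrow> ('k \<Rightarrow> 'k) set \<Rightarrow> ('k \<Rightarrow> 'k) set \<Rightarrow> bool" where
  "cstar_base \<HH> \<BB> \<BB>d \<longleftrightarrow> fd_hilbert \<HH> \<and> nondeg_cstar \<HH> \<BB> \<and> nondeg_cstar \<HH> \<BB>d \<and>
     (\<forall>b\<in>\<BB>. \<forall>c\<in>\<BB>d. b \<circ> c = c \<circ> b)"

definition bicyclic ::
  "'k::complex_vector hilb \<Rightarrow> ('k \<Rightarrow> 'k) set \<Rightarrow> ('k \<Rightarrow> 'k) set \<Rightarrow> 'k \<Rightarrow> bool" where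
  "bicyclic \<HH> \<BB> \<BB>d \<zeta> \<longleftrightarrow> \<zeta> \<in> hspace \<HH> \<and>
     cspan (\<BB> \<cdot>\<^sub>v {\<zeta>}) = hspace \<HH> \<and> cspan (\<BB>d \<cdot>\<^sub>v {\<zeta>}) = hspace \<HH>"

definition cstar_factorization ::
  "'k::complex_vector hilb \<Rightarrow> ('k \<Rightarrow> 'k) set \<Rightarrow> ('k \<Rightarrow> 'k) set \<Rightarrow> 'h::complex_vector hilb \<Rightarrow>
     ('k \<Rightarrow> 'h) set \<Rightarrow> bool" where
  "cstar_factorization \<HH> \<BB> \<BB>d H \<alpha> \<longleftrightarrow> \<alpha> \<subseteq> ops \<HH> H \<and> csubspace \<alpha> \<and>
     cspan ((adj \<HH> H ` \<alpha>) \<odot> \<alpha>) = \<BB> \<and> cspan (\<alpha> \<odot> \<BB>) = \<alpha> \<and>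
     cspan (\<alpha> \<cdot>\<^sub>v hspace \<HH>) = hspace H"

definition fact_rep ::
  "'k::complex_vector hilb \<Rightarrow> 'h::complex_vector hilb \<Rightarrow> ('k \<Rightarrow> 'h) set \<Rightarrow> ('k \<Rightarrow> 'k) \<Rightarrow>
     'h \<Rightarrow> 'h" where
  "fact_rep \<HH> H \<alpha> b = (THE T. T \<in> ops H H \<and>
     (\<forall>\<xi>\<in>\<alpha>. \<forall>\<omega>\<in>hspace \<HH>. T (\<xi> \<omega>) = \<xi> (b \<omega>)))"

definition cstar_fact ::
  "'k::complex_vector hilb \<Rightarrow> ('k \<Rightarrow> 'k) set \<Rightarrow> ('k \<Rightarrow> 'k) set \<Rightarrow> 'h::complex_vector hilb \<Rightarrow>
     ('h \<Rightarrow> 'h) set \<Rightarrow> ('k \<Rightarrow> 'h) set set" where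
  "cstar_fact \<HH> \<BB> \<BB>d H A =
     {\<alpha>. cstar_factorization \<HH> \<BB> \<BB>d H \<alpha> \<and> fact_rep \<HH> H \<alpha> ` \<BB>d \<subseteq> A}"

definition compatible_facts ::
  "'k::complex_vector hilb \<Rightarrow> ('k \<Rightarrow> 'k) set \<Rightarrow> ('k \<Rightarrow> 'k) set \<Rightarrow> 'h::complex_vector hilb \<Rightarrow>
     ('k \<Rightarrow> 'h) set \<Rightarrow> ('k \<Rightarrow> 'h) set \<Rightarrow> bool" where
  "compatible_facts \<HH> \<BB> \<BB>d H \<alpha> \<beta> \<longleftrightarrow>
     cspan (fact_rep \<HH> H \<alpha> ` \<BB>d \<odot> \<beta>) = \<beta> \<and> cspan (fact_rep \<HH> H \<beta> ` \<BB> \<odot> \<alpha>) = \<alpha>"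

section \<open>Relative tensor products and fiber products over a C*-base\<close>

definition cb_kernel where
  "cb_kernel \<HH> H K = (\<lambda>(\<xi>, \<omega>, \<eta>) (\<xi>', \<omega>', \<eta>').
     hinner \<HH> \<omega> ((adj \<HH> H \<xi> \<circ> \<xi>') ((adj \<HH> K \<eta> \<circ> \<eta>') \<omega>')))"

definition cb_tensor ::
  "'k::complex_vector hilb \<Rightarrow> 'h::complex_vector hilb \<Rightarrow> ('k \<Rightarrow> 'h) set \<Rightarrow> ('k \<Rightarrow> 'l) set \<Rightarrow>
     'l::complex_vector hilb \<Rightarrow> (('k \<Rightarrow> 'h) \<times> 'k \<times> ('k \<Rightarrow> 'l) \<Rightarrow> complex) hilb" where
  "cb_tensor \<HH> H \<alpha> \<beta> K = kquot (\<alpha> \<times> hspace \<HH> \<times> \<beta>) (cb_kernel \<HH> H K)"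

definition cb_elem ::
  "'k::complex_vector hilb \<Rightarrow> 'h::complex_vector hilb \<Rightarrow> ('k \<Rightarrow> 'h) set \<Rightarrow> ('k \<Rightarrow> 'l) set \<Rightarrow>
     'l::complex_vector hilb \<Rightarrow> ('k \<Rightarrow> 'h) \<Rightarrow> 'k \<Rightarrow> ('k \<Rightarrow> 'l) \<Rightarrow>
     ('k \<Rightarrow> 'h) \<times> 'k \<times> ('k \<Rightarrow> 'l) \<Rightarrow> complex" where
  "cb_elem \<HH> H \<alpha> \<beta> K \<xi> \<omega> \<eta> = kgen (\<alpha> \<times> hspace \<HH> \<times> \<beta>) (cb_kernel \<HH> H K) (\<xi>, \<omega>, \<eta>)"

definition ket1 where
  "ket1 \<HH> H \<alpha> \<beta> K \<xi> = (THE T. T \<in> ops K (cb_tensor \<HH> H \<alpha> \<beta> K) \<and>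
     (\<forall>\<eta>\<in>\<beta>. \<forall>\<omega>\<in>hspace \<HH>. T (\<eta> \<omega>) = cb_elem \<HH> H \<alpha> \<beta> K \<xi> \<omega> \<eta>))"

definition ket2 where
  "ket2 \<HH> H \<alpha> \<beta> K \<eta> = (THE T. T \<in> ops H (cb_tensor \<HH> H \<alpha> \<beta> K) \<and>
     (\<forall>\<xi>\<in>\<alpha>. \<forall>\<omega>\<in>hspace \<HH>. T (\<xi> \<omega>) = cb_elem \<HH> H \<alpha> \<beta> K \<xi> \<omega> \<eta>))"

text \<open>\<open>cb_op \<HH> H \<alpha> \<beta> K L \<gamma> \<delta> M S T\<close> is \<open>S \<otimes> T\<close> from \<open>H \<^sub>\<alpha>\<otimes>\<^sub>\<beta> K\<close> to \<open>L \<^sub>\<gamma>\<otimes>\<^sub>\<delta> M\<close>.\<close>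

definition cb_op where
  "cb_op \<HH> H \<alpha> \<beta> K L \<gamma> \<delta> M S T =
     (THE X. X \<in> ops (cb_tensor \<HH> H \<alpha> \<beta> K) (cb_tensor \<HH> L \<gamma> \<delta> M) \<and>
        (\<forall>\<xi>\<in>\<alpha>. \<forall>\<omega>\<in>hspace \<HH>. \<forall>\<eta>\<in>\<beta>.
           X (cb_elem \<HH> H \<alpha> \<beta> K \<xi> \<omega> \<eta>) = cb_elem \<HH> L \<gamma> \<delta> M (S \<circ> \<xi>) \<omega> (T \<circ> \<eta>)))"

definition cb_fiber where
  "cb_fiber \<HH> H A \<alpha> \<beta> K B =
     (let E = cb_tensor \<HH> H \<alpha> \<beta> K; k1 = ket1 \<HH> H \<alpha> \<beta> K ` \<alpha>; k2 = ket2 \<HH> H \<alpha> \<beta> K ` \<beta>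
      in {T \<in> ops E E.
            {T} \<odot> k1 \<subseteq> cspan (k1 \<odot> B) \<and> {adj E E T} \<odot> k1 \<subseteq> cspan (k1 \<odot> B) \<and>
            {T} \<odot> k2 \<subseteq> cspan (k2 \<odot> A) \<and> {adj E E T} \<odot> k2 \<subseteq> cspan (k2 \<odot> A)})"

section \<open>Morphisms and concrete Hopf C*-bimodules\<close>

text \<open>\<open>mor_ops H A \<alpha> L \<gamma> \<pi>\<close> is \<open>I\<^sub>\<pi>\<close>, and \<open>Mor H A \<alpha> L C \<gamma>\<close> is \<open>Mor(A\<^sub>\<alpha>, C\<^sub>\<gamma>)\<close>.\<close>

definition mor_ops ::
  "'h::complex_vector hilb \<Rightarrow> ('h \<Rightarrow> 'h) set \<Rightarrow> ('k \<Rightarrow> 'h) set \<Rightarrow>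
     'l::complex_vector hilb \<Rightarrow> ('k \<Rightarrow> 'l) set \<Rightarrow> (('h \<Rightarrow> 'h) \<Rightarrow> 'l \<Rightarrow> 'l) \<Rightarrow> ('h \<Rightarrow> 'l) set" where
  "mor_ops H A \<alpha> L \<gamma> \<pi> =
     {V \<in> intertwiners H A L \<pi>. {V} \<odot> \<alpha> \<subseteq> \<gamma> \<and> {adj H L V} \<odot> \<gamma> \<subseteq> \<alpha>}"

definition Mor ::
  "'h::complex_vector hilb \<Rightarrow> ('h \<Rightarrow> 'h) set \<Rightarrow> ('k \<Rightarrow> 'h) set \<Rightarrow>
     'l::complex_vector hilb \<Rightarrow> ('l \<Rightarrow> 'l) set \<Rightarrow> ('k \<Rightarrow> 'l) set \<Rightarrow>
     (('h \<Rightarrow> 'h) \<Rightarrow> 'l \<Rightarrow> 'l) set" where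
  "Mor H A \<alpha> L C \<gamma> = {\<pi>. star_hom H A L C \<pi> \<and> \<gamma> = cspan (mor_ops H A \<alpha> L \<gamma> \<pi> \<odot> \<alpha>)}"

definition cb_fiber_map where
  "cb_fiber_map \<HH> H A \<alpha> \<beta> K B L C \<gamma> \<delta> M D \<phi> \<psi> =
     (THE \<Theta>. star_hom (cb_tensor \<HH> H \<alpha> \<beta> K) (cb_fiber \<HH> H A \<alpha> \<beta> K B)
              (cb_tensor \<HH> L \<gamma> \<delta> M) (cb_fiber \<HH> L C \<gamma> \<delta> M D) \<Theta> \<and>
        (\<forall>S. S \<notin> cb_fiber \<HH> H A \<alpha> \<beta> K B \<longrightarrow> \<Theta> S = 0) \<and>
        (\<forall>S\<in>cb_fiber \<HH> H A \<alpha> \<beta> K B. \<forall>X\<in>mor_ops H A \<alpha> L \<gamma> \<phi>. \<forall>Y\<in>mor_ops K B \<beta> M \<delta> \<psi>.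
           \<Theta> S \<circ> cb_op \<HH> H \<alpha> \<beta> K L \<gamma> \<delta> M X Y = cb_op \<HH> H \<alpha> \<beta> K L \<gamma> \<delta> M X Y \<circ> S))"

text \<open>\<open>tri_right\<close> is \<open>\<alpha> \<triangleright> \<alpha>\<close> and \<open>tri_left\<close> is \<open>\<beta> \<triangleleft> \<beta>\<close>.\<close>

definition tri_right where
  "tri_right \<HH> H \<alpha> \<beta> = cspan (ket1 \<HH> H \<alpha> \<beta> H ` \<alpha> \<odot> \<alpha>)"

definition tri_left where
  "tri_left \<HH> H \<alpha> \<beta> = cspan (ket2 \<HH> H \<alpha> \<beta> H ` \<beta> \<odot> \<beta>)"

text \<open>
  The Hilbert space \<open>H \<^sub>\<alpha>\<otimes>\<^sub>\<beta> H \<^sub>\<alpha>\<otimes>\<^sub>\<beta> H\<close> and its identifications with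
  \<open>(H \<^sub>\<alpha>\<otimes>\<^sub>\<beta> H) \<^bsub>\<alpha>\<triangleright>\<alpha>\<^esub>\<otimes>\<^sub>\<beta> H\<close> and \<open>H \<^sub>\<alpha>\<otimes>\<^bsub>\<beta>\<triangleleft>\<beta>\<^esub> (H \<^sub>\<alpha>\<otimes>\<^sub>\<beta> H)\<close>.
\<close>

definition triple_kernel where
  "triple_kernel \<HH> H \<alpha> \<beta> = (\<lambda>(\<xi>, x, \<eta>) (\<xi>', x', \<eta>').
     hinner H x (fact_rep \<HH> H \<beta> (adj \<HH> H \<xi> \<circ> \<xi>') (fact_rep \<HH> H \<alpha> (adj \<HH> H \<eta> \<circ> \<eta>') x')))"

definition triple_tensor ::
  "'k::complex_vector hilb \<Rightarrow> 'h::complex_vector hilb \<Rightarrow> ('k \<Rightarrow> 'h) set \<Rightarrow> ('k \<Rightarrow> 'h) set \<Rightarrow>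
     (('k \<Rightarrow> 'h) \<times> 'h \<times> ('k \<Rightarrow> 'h) \<Rightarrow> complex) hilb" where
  "triple_tensor \<HH> H \<alpha> \<beta> = kquot (\<alpha> \<times> hspace H \<times> \<beta>) (triple_kernel \<HH> H \<alpha> \<beta>)"

definition triple_elem ::
  "'k::complex_vector hilb \<Rightarrow> 'h::complex_vector hilb \<Rightarrow> ('k \<Rightarrow> 'h) set \<Rightarrow> ('k \<Rightarrow> 'h) set \<Rightarrow>
     ('k \<Rightarrow> 'h) \<Rightarrow> 'h \<Rightarrow> ('k \<Rightarrow> 'h) \<Rightarrow> ('k \<Rightarrow> 'h) \<times> 'h \<times> ('k \<Rightarrow> 'h) \<Rightarrow> complex" where
  "triple_elem \<HH> H \<alpha> \<beta> \<xi> x \<eta> = kgen (\<alpha> \<times> hspace H \<times> \<beta>) (triple_kernel \<HH> H \<alpha> \<beta>) (\<xi>, x, \<eta>)"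

definition triple_to_left where
  "triple_to_left \<HH> H \<alpha> \<beta> =
     (let E = cb_tensor \<HH> H \<alpha> \<beta> H; \<alpha>\<alpha> = tri_right \<HH> H \<alpha> \<beta>
      in THE V. V \<in> ops (triple_tensor \<HH> H \<alpha> \<beta>) (cb_tensor \<HH> E \<alpha>\<alpha> \<beta> H) \<and>
           (\<forall>\<xi>\<in>\<alpha>. \<forall>x\<in>hspace H. \<forall>\<eta>\<in>\<beta>.
              V (triple_elem \<HH> H \<alpha> \<beta> \<xi> x \<eta>) = ket2 \<HH> E \<alpha>\<alpha> \<beta> H \<eta> (ket1 \<HH> H \<alpha> \<beta> H \<xi> x)))"

definition triple_to_right where
  "triple_to_right \<HH> H \<alpha> \<beta> =
     (let E = cb_tensor \<HH> H \<alpha> \<beta> H; \<beta>\<beta> = tri_left \<HH> H \<alpha> \<beta>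
      in THE V. V \<in> ops (triple_tensor \<HH> H \<alpha> \<beta>) (cb_tensor \<HH> H \<alpha> \<beta>\<beta> E) \<and>
           (\<forall>\<xi>\<in>\<alpha>. \<forall>x\<in>hspace H. \<forall>\<eta>\<in>\<beta>.
              V (triple_elem \<HH> H \<alpha> \<beta> \<xi> x \<eta>) = ket1 \<HH> H \<alpha> \<beta>\<beta> E \<xi> (ket2 \<HH> H \<alpha> \<beta> H \<eta> x)))"

text \<open>The algebras \<open>\<BB>, \<BB>\<^sup>\<dagger>\<close> enter the following condition only through \<open>\<alpha>\<close> and \<open>\<beta>\<close>.\<close>

definition concrete_hopf_cstar_bimodule ::
  "'k::complex_vector hilb \<Rightarrow> 'h::complex_vector hilb \<Rightarrow> ('h \<Rightarrow> 'h) set \<Rightarrow>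
     ('k \<Rightarrow> 'h) set \<Rightarrow> ('k \<Rightarrow> 'h) set \<Rightarrow>
     (('h \<Rightarrow> 'h) \<Rightarrow> (('k \<Rightarrow> 'h) \<times> 'k \<times> ('k \<Rightarrow> 'h) \<Rightarrow> complex) \<Rightarrow>
       ('k \<Rightarrow> 'h) \<times> 'k \<times> ('k \<Rightarrow> 'h) \<Rightarrow> complex) \<Rightarrow> bool" where
  "concrete_hopf_cstar_bimodule \<HH> H A \<alpha> \<beta> \<Delta> \<longleftrightarrow>
     (let E = cb_tensor \<HH> H \<alpha> \<beta> H; AA = cb_fiber \<HH> H A \<alpha> \<beta> H A;
          \<alpha>\<alpha> = tri_right \<HH> H \<alpha> \<beta>; \<beta>\<beta> = tri_left \<HH> H \<alpha> \<beta>;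
          \<Delta>_id = cb_fiber_map \<HH> H A \<alpha> \<beta> H A E AA \<alpha>\<alpha> \<beta> H A \<Delta> id;
          id_\<Delta> = cb_fiber_map \<HH> H A \<alpha> \<beta> H A H A \<alpha> \<beta>\<beta> E AA id \<Delta>;
          V = triple_to_left \<HH> H \<alpha> \<beta>; W = triple_to_right \<HH> H \<alpha> \<beta>;
          V_star = adj (triple_tensor \<HH> H \<alpha> \<beta>) (cb_tensor \<HH> E \<alpha>\<alpha> \<beta> H) V;
          W_star = adj (triple_tensor \<HH> H \<alpha> \<beta>) (cb_tensor \<HH> H \<alpha> \<beta>\<beta> E) W
      in \<Delta> \<in> Mor H A \<alpha> E AA \<alpha>\<alpha> \<inter> Mor H A \<beta> E AA \<beta>\<beta> \<and>
         (\<forall>a\<in>A. V_star \<circ> \<Delta>_id (\<Delta> a) \<circ> V = W_star \<circ> id_\<Delta> (\<Delta> a) \<circ> W))"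

section \<open>The comparison of both fiber products\<close>

definition compare_unitary where
  "compare_unitary G H \<rho> \<sigma> \<HH> \<alpha> \<beta> U \<zeta> =
     (THE \<Phi>. \<Phi> \<in> ops (mu_tensor G H \<rho> \<sigma> H) (cb_tensor \<HH> H \<alpha> \<beta> H) \<and>
        (\<forall>\<xi>\<in>hspace H. \<forall>\<eta>\<in>hspace H. \<Phi> (mu_elem G H \<rho> \<sigma> H \<xi> \<eta>) =
           cb_elem \<HH> H \<alpha> \<beta> H (R_left G H \<rho> \<xi> \<circ> U) \<zeta> (R_right G H \<sigma> \<eta> \<circ> U)))"

definition compare_iso where
  "compare_iso G H \<rho> \<sigma> \<HH> \<alpha> \<beta> U \<zeta> x =
     compare_unitary G H \<rho> \<sigma> \<HH> \<alpha> \<beta> U \<zeta> \<circ> x \<circ>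
       adj (mu_tensor G H \<rho> \<sigma> H) (cb_tensor \<HH> H \<alpha> \<beta> H) (compare_unitary G H \<rho> \<sigma> \<HH> \<alpha> \<beta> U \<zeta>)"

end

theory Submission
  imports Defs
begin

text \<open>
  Evaluation at the bicyclic vector \<open>\<zeta>\<close> identifies a C*-factorization \<open>\<alpha>\<close> of \<open>H\<close> with \<open>H\<close> itself: \<open>\<alpha>\<close>
  consists of all intertwiners from the identity representation of \<open>\<BB>\<^sup>\<dagger>\<close> to \<open>\<rho>\<^sub>\<alpha>\<close>, and every \<open>x \<in> H\<close> is
  \<open>\<xi> \<zeta>\<close> for exactly one \<open>\<xi> \<in> \<alpha>\<close>. Under \<open>U\<close> this \<open>\<xi>\<close> becomes \<open>R(x)\<close>, so the modular conjugation plays no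
  role beyond the equality of \<open>U \<BB>\<^sup>\<dagger> U\<^sup>*\<close> and the range of \<open>\<pi>\<^sub>\<mu>\<^sup>o\<^sup>p\<close>, and both relative tensor products
  are generated by elementary tensors \<open>t x y\<close> with the same inner products
  \<open>\<langle>x| r(R(y)\<^sup>* R(y')) x'\<rangle>\<close>. Fiber products, fiber products of morphisms and the associativity
  constraints are determined by these inner products, hence agree in both models.

  What remains is to translate the two conditions on \<open>\<Delta>\<close>. The fiber product defined by kets is the
  commutant \<open>{A' \<otimes> B'}'\<close> by the bicommutant theorem. As every unital representation of a
  finite-dimensional C*-algebra on a Hilbert space is contained in a multiple of the identity
  representation, \<open>\<Delta>\<close> is a morphism with respect to \<open>\<alpha>\<close> if and only if it maps \<open>\<rho>\<^sub>\<alpha>(b)\<close> to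
  \<open>1 \<otimes> \<rho>\<^sub>\<alpha>(b)\<close>; likewise for \<open>\<beta>\<close>.
\<close>

section \<open>Finite-dimensional Hilbert spaces and their operators\<close>

text \<open>The inclusion of a representation in a multiple of the identity representation carries
  most of the weight: positivity of the kernels, the expansion of operators in kets, the uniqueness
  of fiber products of morphisms and the criterion for morphisms all rest on it. To obtain it
  without any structure theory of C*-algebras, an algebra \<open>A\<close> is made a Hilbert space
  by the trace. For a Parseval frame \<open>E\<close> of it, the average
  \<open>\<Sum> \<pi>(e) X e*\<close> of any operator \<open>X\<close> is an intertwiner. The same
  average yields the bicommutant theorem.

  A second obstacle is that most operators are definite descriptions, on spaces whose types differ
  between the models. A map on generators extends to an operator as soon as it has an adjoint on a
  spanning set. This one criterion settles \<open>fact_rep\<close>, \<open>X \<otimes> Y\<close>,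
  fiber products of morphisms and the associativity maps.

  Finally, coassociativity cannot be compared unconditionally: \<open>\<Delta> * id\<close> is
  characterized only when \<Delta> respects the representations. That condition is therefore
  transferred separately; if it fails, both sides of the equivalence are false.\<close>

lemma fun_sum_apply: "(\<Sum>i\<in>I. F i) x = (\<Sum>i\<in>I. F i x)"
  for F :: "'i \<Rightarrow> 'a \<Rightarrow> 'b::comm_monoid_add"
  by (induction I rule: infinite_finite_induct) auto

declare scaleC_one [simp]

text \<open>\<open>fd_hilbert\<close> asks for a finite set whose span is the carrier itself. The
  carriers constructed below are first seen to lie in the span of some finite set, which need not
  consist of their own elements.\<close>

lemma finite_spanning_subset:
  assumes "finite S" "W \<subseteq> cspan S" "csubspace W"
  shows "\<exists>S'. finite S' \<and> cspan S' = W"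
proof -
  obtain B where B: "B \<subseteq> W" "complex_vector.independent B" "W \<subseteq> cspan B"
    using complex_vector.maximal_independent_subset[of W] by blast
  have "finite B"
    using complex_vector.independent_span_bound[OF assms(1) B(2)] B(1) assms(2) by blast
  moreover have "cspan B = W"
    using B complex_vector.span_minimal[OF B(1) assms(3)] by blast
  ultimately show ?thesis by blast
qed

text \<open>Membership in the span is kept in the induction steps because operators and inner
  products are linear only on carriers.\<close>

lemma cspan_induct [consumes 1, case_names zero base add scale]:
  assumes "x \<in> cspan S" "P 0" "\<And>x. x \<in> S \<Longrightarrow> P x"
    "\<And>x y. x \<in> cspan S \<Longrightarrow> y \<in> cspan S \<Longrightarrow> P x \<Longrightarrow> P y \<Longrightarrow> P (x + y)"
    "\<And>c x. x \<in> cspan S \<Longrightarrow> P x \<Longrightarrow> P (c *\<^sub>C x)"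
  shows "P x"
proof -
  have "x \<in> cspan S \<and> P x"
    using assms(1)
  proof (induct rule: complex_vector.span_induct_alt)
    case base
    then show ?case using assms(2) complex_vector.span_zero by blast
  next
    case (step c x y)
    then have "c *\<^sub>C x \<in> cspan S" "P (c *\<^sub>C x)"
      using assms(3,5) complex_vector.span_base complex_vector.span_scale by blast+
    then show ?case using assms(4) step complex_vector.span_add by blast
  qed
  then show ?thesis ..
qed

section \<open>Inner products and Parseval frames\<close>

context fd_hilbert
begin

lemma zero_in [simp]: "0 \<in> hspace H"
  by (rule complex_vector.subspace_0[OF subspace])

lemma add_in [intro]: "x \<in> hspace H \<Longrightarrow> y \<in> hspace H \<Longrightarrow> x + y \<in> hspace H"
  by (rule complex_vector.subspace_add[OF subspace])

lemma scale_in [intro]: "x \<in> hspace H \<Longrightarrow> c *\<^sub>C x \<in> hspace H"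
  by (rule complex_vector.subspace_scale[OF subspace])

lemma diff_in [intro]: "x \<in> hspace H \<Longrightarrow> y \<in> hspace H \<Longrightarrow> x - y \<in> hspace H"
  by (rule complex_vector.subspace_diff[OF subspace])

lemma sum_in [intro]: "(\<And>i. i \<in> I \<Longrightarrow> f i \<in> hspace H) \<Longrightarrow> (\<Sum>i\<in>I. f i) \<in> hspace H"
  by (rule complex_vector.subspace_sum[OF subspace])

lemma span_in: "S \<subseteq> hspace H \<Longrightarrow> cspan S \<subseteq> hspace H"
  by (rule complex_vector.span_minimal[OF _ subspace])

lemma inner_add_left:
  "x \<in> hspace H \<Longrightarrow> y \<in> hspace H \<Longrightarrow> z \<in> hspace H \<Longrightarrow>
    hinner H (x + y) z = hinner H x z + hinner H y z"
  using inner_add_right[of z x y] inner_commute[of z "x + y"] inner_commute[of z x]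
    inner_commute[of z y] by auto

lemma inner_scaleC_left:
  "x \<in> hspace H \<Longrightarrow> y \<in> hspace H \<Longrightarrow> hinner H (a *\<^sub>C x) y = cnj a * hinner H x y"
  using inner_scaleC_right[of y x a] inner_commute[of y "a *\<^sub>C x"] inner_commute[of y x] by auto

lemma inner_zero_right [simp]: "x \<in> hspace H \<Longrightarrow> hinner H x 0 = 0"
  using inner_scaleC_right[of x 0 0] by simp

lemma inner_zero_left [simp]: "x \<in> hspace H \<Longrightarrow> hinner H 0 x = 0"
  using inner_scaleC_left[of 0 x 0] by simp

lemma inner_sum_right:
  assumes "x \<in> hspace H" "\<And>i. i \<in> I \<Longrightarrow> f i \<in> hspace H"
  shows "hinner H x (\<Sum>i\<in>I. f i) = (\<Sum>i\<in>I. hinner H x (f i))"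
  using assms(2)
  by (induction I rule: infinite_finite_induct) (auto simp: assms(1) inner_add_right sum_in)

lemma inner_sum_left:
  assumes "x \<in> hspace H" "\<And>i. i \<in> I \<Longrightarrow> f i \<in> hspace H"
  shows "hinner H (\<Sum>i\<in>I. f i) x = (\<Sum>i\<in>I. hinner H (f i) x)"
  using assms(2)
  by (induction I rule: infinite_finite_induct) (auto simp: assms(1) inner_add_left sum_in)

lemma inner_diff_right:
  "x \<in> hspace H \<Longrightarrow> y \<in> hspace H \<Longrightarrow> z \<in> hspace H \<Longrightarrow>
    hinner H x (y - z) = hinner H x y - hinner H x z"
  using inner_add_right[of x "y - z" z] diff_in[of y z] by auto

lemma inner_eqI:
  assumes "x \<in> hspace H" "y \<in> hspace H" "\<And>z. z \<in> hspace H \<Longrightarrow> hinner H z x = hinner H z y"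
  shows "x = y"
proof -
  have "hinner H (x - y) (x - y) = 0"
    using assms by (simp add: inner_diff_right diff_in)
  then show ?thesis
    using inner_definite[of "x - y"] assms by auto
qed

lemma inner_eqI_span:
  assumes "x \<in> hspace H" "y \<in> hspace H" "cspan G = hspace H"
    "\<And>g. g \<in> G \<Longrightarrow> hinner H g x = hinner H g y"
  shows "x = y"
proof (rule inner_eqI[OF assms(1,2)])
  fix z assume "z \<in> hspace H"
  then have "z \<in> cspan G" using assms(3) by simp
  then show "hinner H z x = hinner H z y"
    by (induction rule: cspan_induct)
      (use assms in \<open>auto simp: inner_add_left inner_scaleC_left\<close>)
qed

text \<open>Gram-Schmidt, one vector at a time. Only the reconstruction formula is recorded, as this
  is the form in which bases enter all later sums.\<close>

lemma parseval_span:
  assumes "finite S" "S \<subseteq> hspace H"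
  shows "\<exists>F. finite F \<and> F \<subseteq> cspan S \<and> (\<forall>v\<in>cspan S. (\<Sum>f\<in>F. hinner H f v *\<^sub>C f) = v)"
  using assms
proof (induction S rule: finite_induct)
  case empty
  then show ?case by (intro exI[of _ "{}"]) auto
next
  case (insert x S)
  then obtain F where F: "finite F" "F \<subseteq> cspan S"
    "\<And>v. v \<in> cspan S \<Longrightarrow> (\<Sum>f\<in>F. hinner H f v *\<^sub>C f) = v" by auto
  have SH: "cspan S \<subseteq> hspace H" using insert.prems span_in by simp
  have FH: "\<And>f. f \<in> F \<Longrightarrow> f \<in> hspace H" using F SH by blast
  have x: "x \<in> hspace H" using insert.prems by simp
  define p where "p = (\<Sum>f\<in>F. hinner H f x *\<^sub>C f)"
  have p: "p \<in> cspan S" unfolding p_def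
    using F(2) by (intro complex_vector.span_sum complex_vector.span_scale) auto
  have pH: "p \<in> hspace H" using p SH by auto
  define y where "y = x - p"
  have y: "y \<in> hspace H" using x pH by (auto simp: y_def)
  \<comment> \<open>By the reconstruction formula for \<open>v\<close>, the vectors \<open>p\<close>
    and \<open>x\<close> have the same inner products with \<open>cspan S\<close>, so
    \<open>y\<close> is the component of \<open>x\<close> orthogonal to it.\<close>
  have orth: "hinner H v y = 0" if v: "v \<in> cspan S" for v
  proof -
    have vH: "v \<in> hspace H" using v SH by auto
    have "hinner H v x = hinner H (\<Sum>f\<in>F. hinner H f v *\<^sub>C f) x" using F(3)[OF v] by simp
    also have "\<dots> = (\<Sum>f\<in>F. cnj (hinner H f v) * hinner H f x)"
      using FH x by (subst inner_sum_left) (auto simp: inner_scaleC_left)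
    also have "\<dots> = (\<Sum>f\<in>F. hinner H f x * hinner H v f)"
      using FH vH by (intro sum.cong refl) (simp add: inner_commute[symmetric])
    also have "\<dots> = hinner H v p"
      unfolding p_def using FH vH by (subst inner_sum_right) (auto simp: inner_scaleC_right)
    finally show ?thesis
      using vH x pH by (simp add: y_def inner_diff_right)
  qed
  have sub: "cspan S \<subseteq> cspan (insert x S)"
    by (rule complex_vector.span_mono) auto
  have yspan: "y \<in> cspan (insert x S)"
    unfolding y_def
    by (rule complex_vector.span_diff) (use p sub complex_vector.span_base in blast)+
  show ?case
  proof (cases "y = 0")
    case True
    then have "x \<in> cspan S" using p by (simp add: y_def)
    then have "cspan (insert x S) = cspan S" by (rule complex_vector.span_redundant)
    then show ?thesis using F by auto
  next
    case False
    define n where "n = Re (hinner H y y)"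
    have yy: "hinner H y y = of_real n" "n > 0"
    proof -
      have r: "hinner H y y \<in> \<real>\<^sub>\<ge>\<^sub>0" by (rule inner_nonneg[OF y])
      then show "hinner H y y = of_real n"
        by (auto simp: n_def complex_nonneg_Reals_iff complex_eq_iff)
      moreover have "hinner H y y \<noteq> 0" using inner_definite[OF y] False by auto
      ultimately show "n > 0" using r by (auto simp: complex_nonneg_Reals_iff)
    qed
    define u where "u = complex_of_real (1 / sqrt n) *\<^sub>C y"
    have u: "u \<in> hspace H" using y by (auto simp: u_def)
    \<comment> \<open>The projection onto \<open>u\<close> fixes \<open>y\<close>. The scalar
      \<open>k\<close> will be the coefficient of \<open>y\<close> in
      \<open>v = s + k *\<^sub>C y\<close>.\<close>
    have uy: "(k * hinner H u y) *\<^sub>C u = k *\<^sub>C y" for k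
    proof -
      have "complex_of_real (1 / sqrt n) * complex_of_real (1 / sqrt n) * complex_of_real n = 1"
        unfolding of_real_mult[symmetric] using yy(2) by (simp add: field_simps)
      then have "k * (complex_of_real (1 / sqrt n) * complex_of_real n) * complex_of_real (1 / sqrt n) = k"
        by (metis mult.assoc mult.commute mult.right_neutral)
      then show ?thesis
        using y by (simp add: u_def inner_scaleC_left yy(1) scaleC_scaleC)
    qed
    have "u \<noteq> 0" using uy[of 1] False by auto
    have ou: "hinner H u v = 0" if v: "v \<in> cspan S" for v
      using orth[OF v] v SH y inner_commute[of v y] by (auto simp: u_def inner_scaleC_left)
    \<comment> \<open>\<open>u\<close> is nonzero and orthogonal to the span that contains
      \<open>F\<close>; this lets the sum over \<open>insert u F\<close> split.\<close>
    have uF: "u \<notin> F"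
      using ou[of u] F(2) inner_definite[OF u] \<open>u \<noteq> 0\<close> by blast
    show ?thesis
    proof (intro exI[of _ "insert u F"] conjI ballI)
      show "finite (insert u F)" using F by simp
      show "insert u F \<subseteq> cspan (insert x S)"
        using yspan F(2) sub by (auto simp: u_def intro!: complex_vector.span_scale)
    next
      fix v assume "v \<in> cspan (insert x S)"
      then obtain k where k: "v - k *\<^sub>C x \<in> cspan S"
        unfolding complex_vector.span_breakdown_eq by blast
      define s where "s = v - k *\<^sub>C x + k *\<^sub>C p"
      have s: "s \<in> cspan S" unfolding s_def
        using k p by (intro complex_vector.span_add complex_vector.span_scale) auto
      have sH: "s \<in> hspace H" using s SH by auto
      have v: "v = s + k *\<^sub>C y" unfolding s_def y_def
        by (simp add: complex_vector.scale_right_diff_distrib)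
      have 1: "hinner H f v = hinner H f s" if "f \<in> F" for f
        using that FH[OF that] orth[of f] F(2) sH y unfolding v
        by (auto simp: inner_add_right inner_scaleC_right scale_in)
      have 2: "hinner H u v = k * hinner H u y"
        unfolding v using ou[OF s] u sH y
        by (simp add: inner_add_right inner_scaleC_right scale_in)
      have "(\<Sum>f\<in>insert u F. hinner H f v *\<^sub>C f) = k *\<^sub>C y + (\<Sum>f\<in>F. hinner H f s *\<^sub>C f)"
        using F(1) uF by (simp add: 1 2 uy)
      then show "(\<Sum>f\<in>insert u F. hinner H f v *\<^sub>C f) = v"
        using F(3)[OF s] v by (simp add: add.commute)
    qed
  qed
qed

lemma parseval_frame:
  obtains F where "finite F" "F \<subseteq> hspace H"
    "\<And>v. v \<in> hspace H \<Longrightarrow> (\<Sum>f\<in>F. hinner H f v *\<^sub>C f) = v"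
proof -
  obtain S where S: "finite S" "cspan S = hspace H" using finite_dim by blast
  then show thesis
    using parseval_span[OF S(1)] complex_vector.span_superset[of S] that by (metis (no_types))
qed

lemma sub_hilbert:
  assumes "csubspace S" "S \<subseteq> hspace H"
  shows "fd_hilbert \<lparr>hspace = S, hinner = hinner H\<rparr>"
proof
  obtain T where "finite T" "cspan T = hspace H" using finite_dim by blast
  then show "\<exists>T. finite T \<and> cspan T = hspace \<lparr>hspace = S, hinner = hinner H\<rparr>"
    using finite_spanning_subset[of T S] assms by auto
qed (use assms in \<open>auto simp: subset_iff inner_add_right inner_scaleC_right inner_nonneg
  intro: inner_definite inner_commute\<close>)

text \<open>A frame of \<open>S\<close> gives the orthogonal projection \<open>p\<close> of
  \<open>v\<close> to \<open>S\<close>; the difference \<open>v - p\<close> is orthogonal to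
  \<open>S\<close>, hence zero.\<close>

lemma orthogonal_complement_zero:
  assumes "csubspace S" "S \<subseteq> hspace H"
    and 0: "\<And>v. v \<in> hspace H \<Longrightarrow> (\<And>s. s \<in> S \<Longrightarrow> hinner H s v = 0) \<Longrightarrow> v = 0"
  shows "S = hspace H"
proof
  interpret S: fd_hilbert "\<lparr>hspace = S, hinner = hinner H\<rparr>"
    by (rule sub_hilbert[OF assms(1,2)])
  obtain F where F: "finite F" "F \<subseteq> S" "\<And>v. v \<in> S \<Longrightarrow> (\<Sum>f\<in>F. hinner H f v *\<^sub>C f) = v"
    using S.parseval_frame by (metis hilb.select_convs)
  have FH: "\<And>f. f \<in> F \<Longrightarrow> f \<in> hspace H" using F(2) assms(2) by auto
  show "hspace H \<subseteq> S"
  proof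
    fix v assume v: "v \<in> hspace H"
    define p where "p = (\<Sum>f\<in>F. hinner H f v *\<^sub>C f)"
    have p: "p \<in> S" unfolding p_def
      using F(2) by (intro complex_vector.subspace_sum[OF assms(1)]
          complex_vector.subspace_scale[OF assms(1)]) auto
    have pH: "p \<in> hspace H" using p assms(2) by auto
    have "hinner H s (v - p) = 0" if s: "s \<in> S" for s
    proof -
      have sH: "s \<in> hspace H" using s assms(2) by auto
      have "hinner H s v = hinner H (\<Sum>f\<in>F. hinner H f s *\<^sub>C f) v" using F(3)[OF s] by simp
      also have "\<dots> = (\<Sum>f\<in>F. cnj (hinner H f s) * hinner H f v)"
        using FH v by (subst inner_sum_left) (auto simp: inner_scaleC_left)
      also have "\<dots> = (\<Sum>f\<in>F. hinner H f v * hinner H s f)"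
        using FH sH by (intro sum.cong refl) (simp add: inner_commute[symmetric])
      also have "\<dots> = hinner H s p"
        unfolding p_def using FH sH by (subst inner_sum_right) (auto simp: inner_scaleC_right)
      finally show ?thesis using sH v pH by (simp add: inner_diff_right)
    qed
    then have "v - p = 0" using 0[of "v - p"] v pH by blast
    then show "v \<in> S" using p by simp
  qed
qed (rule assms(2))

end

section \<open>Operators, adjoints and operators prescribed on generators\<close>

lemma opsI:
  assumes "\<And>x. x \<in> hspace H \<Longrightarrow> T x \<in> hspace K" "\<And>x. x \<notin> hspace H \<Longrightarrow> T x = 0"
    "\<And>x y. x \<in> hspace H \<Longrightarrow> y \<in> hspace H \<Longrightarrow> T (x + y) = T x + T y"
    "\<And>a x. x \<in> hspace H \<Longrightarrow> T (a *\<^sub>C x) = a *\<^sub>C T x"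
  shows "T \<in> ops H K"
  using assms by (auto simp: ops_def)

lemma ops_in: "T \<in> ops H K \<Longrightarrow> x \<in> hspace H \<Longrightarrow> T x \<in> hspace K"
  and ops_out: "T \<in> ops H K \<Longrightarrow> x \<notin> hspace H \<Longrightarrow> T x = 0"
  and ops_add: "T \<in> ops H K \<Longrightarrow> x \<in> hspace H \<Longrightarrow> y \<in> hspace H \<Longrightarrow> T (x + y) = T x + T y"
  and ops_scale: "T \<in> ops H K \<Longrightarrow> x \<in> hspace H \<Longrightarrow> T (a *\<^sub>C x) = a *\<^sub>C T x"
  by (auto simp: ops_def)

lemma ops_zero_arg [simp]:
  assumes "T \<in> ops H K"
  shows "T 0 = 0"
proof (cases "0 \<in> hspace H")
  case True
  then show ?thesis using ops_scale[OF assms True, of 0] by simp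
qed (rule ops_out[OF assms])

lemma ops_sum:
  assumes "fd_hilbert H" "T \<in> ops H K" "\<And>i. i \<in> I \<Longrightarrow> f i \<in> hspace H"
  shows "T (\<Sum>i\<in>I. f i) = (\<Sum>i\<in>I. T (f i))"
proof -
  interpret fd_hilbert H by fact
  show ?thesis
    using assms(3)
    by (induction I rule: infinite_finite_induct)
      (auto simp: ops_zero_arg[OF assms(2)] ops_add[OF assms(2)] sum_in)
qed

lemma ops_eqI:
  assumes "S \<in> ops H K" "T \<in> ops H K" "\<And>x. x \<in> hspace H \<Longrightarrow> S x = T x"
  shows "S = T"
  using assms by (metis ext ops_out)

lemma ops_eqI_span:
  assumes "S \<in> ops H K" "T \<in> ops H K" "cspan G = hspace H" "\<And>g. g \<in> G \<Longrightarrow> S g = T g"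
  shows "S = T"
proof (rule ops_eqI[OF assms(1,2)])
  fix x assume "x \<in> hspace H"
  then have "x \<in> cspan G" using assms(3) by simp
  then show "S x = T x"
  proof (induction rule: cspan_induct)
    case zero
    show ?case using assms(1,2) by simp
  next
    case (add x y)
    then show ?case using assms(1-3) by (metis ops_add)
  next
    case (scale c x)
    then show ?case using assms(1-3) by (metis ops_scale)
  qed (use assms in auto)
qed

lemma ops_comp: "S \<in> ops K L \<Longrightarrow> T \<in> ops H K \<Longrightarrow> S \<circ> T \<in> ops H L"
  by (rule opsI) (auto simp: ops_in ops_out ops_add ops_scale)

lemma idop_ops: "fd_hilbert H \<Longrightarrow> idop H \<in> ops H H"
proof -
  assume "fd_hilbert H"
  then interpret fd_hilbert H .
  show ?thesis by (rule opsI) (auto simp: idop_def)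
qed

lemma idop_apply [simp]: "x \<in> hspace H \<Longrightarrow> idop H x = x"
  by (simp add: idop_def)

lemma comp_idop: "T \<in> ops H K \<Longrightarrow> T \<circ> idop H = T"
  by (auto simp: idop_def fun_eq_iff ops_out)

lemma idop_comp: "fd_hilbert K \<Longrightarrow> T \<in> ops H K \<Longrightarrow> idop K \<circ> T = T"
  by (auto simp: idop_def fun_eq_iff dest: ops_in) (metis ops_in ops_out)

lemma csubspace_ops:
  assumes "fd_hilbert K" shows "csubspace (ops H K)"
proof -
  interpret fd_hilbert K by fact
  show ?thesis
    unfolding complex_vector.subspace_def
    by (auto simp: ops_def scaleC_fun_def scaleC_add_right scaleC_scaleC mult.commute
        add.assoc add.left_commute image_subset_iff)
qed

lemma csubspace_intertwiners:
  assumes "fd_hilbert L" "\<And>a. a \<in> A \<Longrightarrow> \<pi> a \<in> ops L L"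
  shows "csubspace (intertwiners H A L \<pi>)"
  unfolding complex_vector.subspace_def
proof (intro conjI ballI allI)
  have s: "csubspace (ops H L)" by (rule csubspace_ops[OF assms(1)])
  have z: "\<pi> a 0 = 0" if "a \<in> A" for a using assms(2)[OF that] by simp
  show "0 \<in> intertwiners H A L \<pi>"
    using complex_vector.subspace_0[OF s] by (auto simp: intertwiners_def fun_eq_iff z)
  show "S + T \<in> intertwiners H A L \<pi>"
    if S: "S \<in> intertwiners H A L \<pi>" and T: "T \<in> intertwiners H A L \<pi>" for S T
  proof -
    have "(S + T) \<circ> a = \<pi> a \<circ> (S + T)" if a: "a \<in> A" for a
    proof
      fix x
      have "S (a x) = \<pi> a (S x)" "T (a x) = \<pi> a (T x)"
        using S T a by (auto simp: intertwiners_def fun_eq_iff)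
      moreover have "\<pi> a (S x + T x) = \<pi> a (S x) + \<pi> a (T x)"
      proof (cases "x \<in> hspace H")
        case True
        then show ?thesis using S T assms(2)[OF a]
          by (intro ops_add[of _ L L]) (auto simp: intertwiners_def ops_in)
      next
        case False
        then show ?thesis using S T z[OF a] by (auto simp: intertwiners_def ops_out)
      qed
      ultimately show "((S + T) \<circ> a) x = (\<pi> a \<circ> (S + T)) x" by simp
    qed
    then show ?thesis
      using S T complex_vector.subspace_add[OF s, of S T] by (auto simp: intertwiners_def)
  qed
  show "c *\<^sub>C T \<in> intertwiners H A L \<pi>" if T: "T \<in> intertwiners H A L \<pi>" for c T
  proof -
    have "(c *\<^sub>C T) \<circ> a = \<pi> a \<circ> (c *\<^sub>C T)" if a: "a \<in> A" for a
    proof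
      fix x
      have "T (a x) = \<pi> a (T x)"
        using T a by (auto simp: intertwiners_def fun_eq_iff)
      moreover have "\<pi> a (c *\<^sub>C T x) = c *\<^sub>C \<pi> a (T x)"
      proof (cases "x \<in> hspace H")
        case True
        then show ?thesis using T assms(2)[OF a]
          by (intro ops_scale[of _ L L]) (auto simp: intertwiners_def ops_in)
      next
        case False
        then show ?thesis using T z[OF a] by (auto simp: intertwiners_def ops_out)
      qed
      ultimately show "((c *\<^sub>C T) \<circ> a) x = (\<pi> a \<circ> (c *\<^sub>C T)) x" by (simp add: scaleC_fun_def)
    qed
    then show ?thesis
      using T complex_vector.subspace_scale[OF s, of T c] by (auto simp: intertwiners_def)
  qed
qed

lemma adj_unique:
  assumes "fd_hilbert H" "S \<in> ops K H"
    "\<And>y x. y \<in> hspace K \<Longrightarrow> x \<in> hspace H \<Longrightarrow> hinner H (S y) x = hinner K y (T x)"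
  shows "adj H K T = S"
  unfolding adj_def
proof (rule the_equality)
  interpret fd_hilbert H by fact
  fix S' assume S': "S' \<in> ops K H \<and> (\<forall>y\<in>hspace K. \<forall>x\<in>hspace H. hinner H (S' y) x = hinner K y (T x))"
  show "S' = S"
  proof (rule ops_eqI[OF _ assms(2)])
    fix y assume y: "y \<in> hspace K"
    show "S' y = S y"
    proof (rule inner_eqI)
      fix z assume z: "z \<in> hspace H"
      have m: "S' y \<in> hspace H" "S y \<in> hspace H"
        using S' assms(2) y by (auto intro: ops_in)
      have "hinner H (S' y) z = hinner H (S y) z" using S' assms(3) y z by simp
      then show "hinner H z (S' y) = hinner H z (S y)"
        using inner_commute m z by metis
    qed (use S' assms(2) y in \<open>auto intro: ops_in\<close>)
  qed (use S' in auto)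
qed (use assms in auto)

text \<open>A Parseval frame makes the adjoint explicit: \<open>T* y\<close> is the sum of
  \<open><T f|y> f\<close>.\<close>

lemma adj_ex:
  assumes "fd_hilbert H" "fd_hilbert K" "T \<in> ops H K"
  shows "adj H K T \<in> ops K H \<and>
    (\<forall>y\<in>hspace K. \<forall>x\<in>hspace H. hinner H (adj H K T y) x = hinner K y (T x))"
proof -
  interpret H: fd_hilbert H by fact
  interpret K: fd_hilbert K by fact
  obtain F where F: "finite F" "F \<subseteq> hspace H"
    "\<And>v. v \<in> hspace H \<Longrightarrow> (\<Sum>f\<in>F. hinner H f v *\<^sub>C f) = v"
    using H.parseval_frame by blast
  have FH: "\<And>f. f \<in> F \<Longrightarrow> f \<in> hspace H" using F by auto
  define S where "S y = (if y \<in> hspace K then \<Sum>f\<in>F. hinner K (T f) y *\<^sub>C f else 0)" for y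
  have S: "S \<in> ops K H"
  proof (rule opsI)
    show "S y \<in> hspace H" if "y \<in> hspace K" for y
      using FH by (auto simp: S_def)
    show "S (x + y) = S x + S y" if "x \<in> hspace K" "y \<in> hspace K" for x y
      using that FH ops_in[OF assms(3)]
      by (simp add: S_def K.add_in K.inner_add_right scaleC_add_left sum.distrib)
    show "S (a *\<^sub>C x) = a *\<^sub>C S x" if "x \<in> hspace K" for a x
      using that FH ops_in[OF assms(3)]
      by (simp add: S_def K.scale_in K.inner_scaleC_right complex_vector.scale_sum_right scaleC_scaleC)
  qed (simp add: S_def)
  have a: "hinner H (S y) x = hinner K y (T x)" if y: "y \<in> hspace K" and x: "x \<in> hspace H" for x y
  proof -
    have "hinner K y (T x) = hinner K y (T (\<Sum>f\<in>F. hinner H f x *\<^sub>C f))" using F(3)[OF x] by simp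
    also have "\<dots> = (\<Sum>f\<in>F. hinner H f x * hinner K y (T f))"
      using FH y ops_in[OF assms(3)]
      by (simp add: ops_sum[OF assms(1,3)] H.scale_in ops_scale[OF assms(3)]
          K.inner_sum_right K.scale_in K.inner_scaleC_right)
    also have "\<dots> = (\<Sum>f\<in>F. cnj (hinner K (T f) y) * hinner H f x)"
      using FH y ops_in[OF assms(3)]
      by (intro sum.cong refl) (simp add: K.inner_commute[symmetric])
    also have "\<dots> = hinner H (S y) x"
      using FH x y by (simp add: S_def H.inner_sum_left H.scale_in H.inner_scaleC_left)
    finally show ?thesis by simp
  qed
  have "adj H K T = S" using adj_unique[OF assms(1) S] a by blast
  then show ?thesis using S a by simp
qed

lemma adj_in: "fd_hilbert H \<Longrightarrow> fd_hilbert K \<Longrightarrow> T \<in> ops H K \<Longrightarrow> adj H K T \<in> ops K H"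
  using adj_ex by blast

lemma adj_left:
  "fd_hilbert H \<Longrightarrow> fd_hilbert K \<Longrightarrow> T \<in> ops H K \<Longrightarrow> y \<in> hspace K \<Longrightarrow> x \<in> hspace H \<Longrightarrow>
    hinner H (adj H K T y) x = hinner K y (T x)"
  using adj_ex by blast

lemma adj_right:
  assumes "fd_hilbert H" "fd_hilbert K" "T \<in> ops H K" "y \<in> hspace K" "x \<in> hspace H"
  shows "hinner H x (adj H K T y) = hinner K (T x) y"
  using adj_left[OF assms] fd_hilbert.inner_commute[OF assms(1), of "adj H K T y" x]
    fd_hilbert.inner_commute[OF assms(2), of y "T x"] ops_in[OF assms(3,5)] assms
    ops_in[OF adj_in[OF assms(1-3)] assms(4)] by simp

lemma adj_adj: "fd_hilbert H \<Longrightarrow> fd_hilbert K \<Longrightarrow> T \<in> ops H K \<Longrightarrow> adj K H (adj H K T) = T"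
  by (rule adj_unique) (auto simp: adj_right)

lemma adj_comp:
  assumes "fd_hilbert H" "fd_hilbert K" "fd_hilbert L" "T \<in> ops H K" "S \<in> ops K L"
  shows "adj H L (S \<circ> T) = adj H K T \<circ> adj K L S"
proof (rule adj_unique[OF assms(1)])
  have a: "adj H K T \<in> ops K H" "adj K L S \<in> ops L K" using assms by (auto intro: adj_in)
  then show "adj H K T \<circ> adj K L S \<in> ops L H" by (rule ops_comp)
  show "hinner H ((adj H K T \<circ> adj K L S) y) x = hinner L y ((S \<circ> T) x)"
    if "y \<in> hspace L" "x \<in> hspace H" for x y
    using adj_left[OF assms(1,2,4) ops_in[OF a(2) that(1)] that(2)]
      adj_left[OF assms(2,3,5) that(1) ops_in[OF assms(4) that(2)]] by simp
qed

lemma adj_idop: "fd_hilbert H \<Longrightarrow> adj H H (idop H) = idop H"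
  by (rule adj_unique) (auto simp: idop_ops)

text \<open>Linear relations among the \<open>g j\<close> need not be discussed: it suffices that
  for \<open>h\<close> in a spanning set the functional \<open>g j \<mapsto> <h|f j>\<close> is
  represented by a vector of \<open>E\<close>, which is to become \<open>T* h\<close>. In
  applications this vector comes from a candidate for the adjoint.\<close>

lemma ex1_op_generators:
  fixes g :: "'j \<Rightarrow> 'a::complex_vector" and f :: "'j \<Rightarrow> 'b::complex_vector"
  assumes E: "fd_hilbert E" and F: "fd_hilbert F"
    and g: "cspan (g ` J) = hspace E" and f: "\<And>j. j \<in> J \<Longrightarrow> f j \<in> hspace F"
    and D: "cspan D = hspace F"
    and dual: "\<And>h. h \<in> D \<Longrightarrow> \<exists>e\<in>hspace E. \<forall>j\<in>J. hinner F h (f j) = hinner E e (g j)"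
  shows "\<exists>!T. T \<in> ops E F \<and> (\<forall>j\<in>J. T (g j) = f j)"
proof -
  interpret E: fd_hilbert E by fact
  interpret F: fd_hilbert F by fact
  have gE: "g j \<in> hspace E" if "j \<in> J" for j
    using complex_vector.span_base[of "g j" "g ` J"] g that by auto
  have "\<exists>e\<in>hspace E. \<forall>j\<in>J. hinner F h (f j) = hinner E e (g j)" if "h \<in> hspace F" for h
    using that unfolding D[symmetric]
  proof (induction rule: cspan_induct)
    case zero
    then show ?case using f gE by (intro bexI[of _ 0]) auto
  next
    case (base h)
    then show ?case using dual by blast
  next
    case (add x y)
    then obtain e e' where "e \<in> hspace E" "e' \<in> hspace E"
      "\<forall>j\<in>J. hinner F x (f j) = hinner E e (g j)" "\<forall>j\<in>J. hinner F y (f j) = hinner E e' (g j)"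
      by blast
    then show ?case
      using add(1,2) D f gE
      by (intro bexI[of _ "e + e'"]) (auto simp: E.inner_add_left F.inner_add_left)
  next
    case (scale c x)
    then obtain e where "e \<in> hspace E" "\<forall>j\<in>J. hinner F x (f j) = hinner E e (g j)"
      by blast
    then show ?case
      using scale(1) D f gE
      by (intro bexI[of _ "c *\<^sub>C e"]) (auto simp: E.inner_scaleC_left F.inner_scaleC_left)
  qed
  then obtain e where e: "\<And>h. h \<in> hspace F \<Longrightarrow> e h \<in> hspace E"
    "\<And>h j. h \<in> hspace F \<Longrightarrow> j \<in> J \<Longrightarrow> hinner F h (f j) = hinner E (e h) (g j)" by metis
  obtain B where B: "finite B" "B \<subseteq> hspace F"
    "\<And>v. v \<in> hspace F \<Longrightarrow> (\<Sum>h\<in>B. hinner F h v *\<^sub>C h) = v"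
    using F.parseval_frame by blast
  have BF: "\<And>h. h \<in> B \<Longrightarrow> h \<in> hspace F" using B by auto
  \<comment> \<open>The choice of \<open>e h\<close> need not be linear in \<open>h\<close>, since
    only its values at the frame vectors enter.\<close>
  define T where "T v = (if v \<in> hspace E then \<Sum>h\<in>B. hinner E (e h) v *\<^sub>C h else 0)" for v
  have T: "T \<in> ops E F"
  proof (rule opsI)
    show "T y \<in> hspace F" if "y \<in> hspace E" for y
      using BF by (auto simp: T_def)
    show "T (x + y) = T x + T y" if "x \<in> hspace E" "y \<in> hspace E" for x y
      using that BF e(1)
      by (simp add: T_def E.add_in E.inner_add_right scaleC_add_left sum.distrib)
    show "T (a *\<^sub>C x) = a *\<^sub>C T x" if "x \<in> hspace E" for a x
      using that BF e(1)
      by (simp add: T_def E.scale_in E.inner_scaleC_right complex_vector.scale_sum_right scaleC_scaleC)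
  qed (simp add: T_def)
  have Tg: "T (g j) = f j" if "j \<in> J" for j
    using B(3)[OF f[OF that]] gE[OF that] e(2)[OF BF that] by (simp add: T_def)
  show ?thesis
  proof (rule ex1I[of _ T])
    show "T \<in> ops E F \<and> (\<forall>j\<in>J. T (g j) = f j)" using T Tg by blast
    show "T' = T" if "T' \<in> ops E F \<and> (\<forall>j\<in>J. T' (g j) = f j)" for T'
      by (rule ops_eqI_span[OF _ T g]) (use that Tg in auto)
  qed
qed

lemma unitary_opD:
  assumes "unitary_op H K U" "fd_hilbert H" "fd_hilbert K"
  shows "U \<in> ops H K" "adj H K U \<in> ops K H"
    "x \<in> hspace H \<Longrightarrow> adj H K U (U x) = x" "y \<in> hspace K \<Longrightarrow> U (adj H K U y) = y"
    "x \<in> hspace H \<Longrightarrow> x' \<in> hspace H \<Longrightarrow> hinner K (U x) (U x') = hinner H x x'"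
proof -
  show U: "U \<in> ops H K" and U': "adj H K U \<in> ops K H"
    using assms by (auto simp: unitary_op_def adj_in)
  show 1: "adj H K U (U x) = x" if "x \<in> hspace H" for x
    using assms(1) that by (metis comp_apply idop_apply unitary_op_def)
  show "U (adj H K U y) = y" if "y \<in> hspace K" for y
    using assms(1) that by (metis comp_apply idop_apply unitary_op_def)
  show "hinner K (U x) (U x') = hinner H x x'" if "x \<in> hspace H" "x' \<in> hspace H" for x x'
    using adj_left[OF assms(2,3) U ops_in[OF U that(1)] that(2)] 1[OF that(1)] by simp
qed

text \<open>As the Gram matrices agree, \<open>g i\<close> is the dual vector for
  \<open>f i\<close>, and the adjoint maps \<open>f i\<close> back to \<open>g i\<close>.\<close>

lemma ex1_unitary_generators:
  fixes g :: "'j \<Rightarrow> 'a::complex_vector" and f :: "'j \<Rightarrow> 'b::complex_vector"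
  assumes E: "fd_hilbert E" and F: "fd_hilbert F"
    and g: "cspan (g ` J) = hspace E" and f: "cspan (f ` J) = hspace F"
    and inner: "\<And>i j. i \<in> J \<Longrightarrow> j \<in> J \<Longrightarrow> hinner F (f i) (f j) = hinner E (g i) (g j)"
  shows "\<exists>!T. T \<in> ops E F \<and> (\<forall>j\<in>J. T (g j) = f j)"
    and "T \<in> ops E F \<Longrightarrow> \<forall>j\<in>J. T (g j) = f j \<Longrightarrow> unitary_op E F T"
proof -
  interpret E: fd_hilbert E by fact
  interpret F: fd_hilbert F by fact
  have gE: "g j \<in> hspace E" "f j \<in> hspace F" if "j \<in> J" for j
    using complex_vector.span_base[of "g j" "g ` J"] g
      complex_vector.span_base[of "f j" "f ` J"] f that by auto
  show "\<exists>!T. T \<in> ops E F \<and> (\<forall>j\<in>J. T (g j) = f j)"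
    by (rule ex1_op_generators[OF E F g gE(2) f]) (use gE inner in auto)
  assume T: "T \<in> ops E F" "\<forall>j\<in>J. T (g j) = f j"
  have a: "adj E F T (f i) = g i" if i: "i \<in> J" for i
  proof (rule E.inner_eqI_span[OF _ _ g])
    fix h assume "h \<in> g ` J"
    then show "hinner E h (adj E F T (f i)) = hinner E h (g i)"
      using T i gE inner by (auto simp: adj_right[OF E F T(1)])
  qed (use gE i adj_in[OF E F T(1)] in \<open>auto intro: ops_in\<close>)
  have "adj E F T \<circ> T = idop E"
    by (rule ops_eqI_span[OF _ _ g])
      (use T a gE adj_in[OF E F T(1)] in \<open>auto intro: ops_comp simp: idop_ops[OF E]\<close>)
  moreover have "T \<circ> adj E F T = idop F"
    by (rule ops_eqI_span[OF _ _ f])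
      (use T a gE adj_in[OF E F T(1)] in \<open>auto intro: ops_comp simp: idop_ops[OF F]\<close>)
  ultimately show "unitary_op E F T" using T by (simp add: unitary_op_def)
qed

section \<open>Unital operator algebras and their representations\<close>

text \<open>In finite dimensions a nondegenerate C*-algebra contains the identity operator; this is
  the form in which nondegeneracy is used.\<close>

definition unital_alg :: "'a::complex_vector hilb \<Rightarrow> ('a \<Rightarrow> 'a) set \<Rightarrow> bool" where
  "unital_alg H A \<longleftrightarrow> fd_hilbert H \<and> A \<subseteq> ops H H \<and> csubspace A \<and>
     (\<forall>S\<in>A. \<forall>T\<in>A. S \<circ> T \<in> A) \<and> (\<forall>T\<in>A. adj H H T \<in> A) \<and> idop H \<in> A"

definition unital_rep ::
  "'a::complex_vector hilb \<Rightarrow> ('a \<Rightarrow> 'a) set \<Rightarrow> 'b::complex_vector hilb \<Rightarrow>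
     (('a \<Rightarrow> 'a) \<Rightarrow> 'b \<Rightarrow> 'b) \<Rightarrow> bool" where
  "unital_rep H A L \<pi> \<longleftrightarrow> fd_hilbert L \<and> star_hom H A L (ops L L) \<pi> \<and> \<pi> (idop H) = idop L"

lemma unital_algD:
  assumes "unital_alg H A"
  shows "fd_hilbert H" "csubspace A" "idop H \<in> A" "T \<in> A \<Longrightarrow> T \<in> ops H H"
    "S \<in> A \<Longrightarrow> T \<in> A \<Longrightarrow> S \<circ> T \<in> A" "T \<in> A \<Longrightarrow> adj H H T \<in> A"
  using assms by (auto simp: unital_alg_def)

lemma unital_repD:
  assumes "unital_rep H A L \<pi>"
  shows "fd_hilbert L" "T \<in> A \<Longrightarrow> \<pi> T \<in> ops L L" "\<pi> (idop H) = idop L"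
    "S \<in> A \<Longrightarrow> T \<in> A \<Longrightarrow> \<pi> (S + T) = \<pi> S + \<pi> T" "T \<in> A \<Longrightarrow> \<pi> (c *\<^sub>C T) = c *\<^sub>C \<pi> T"
    "S \<in> A \<Longrightarrow> T \<in> A \<Longrightarrow> \<pi> (S \<circ> T) = \<pi> S \<circ> \<pi> T" "T \<in> A \<Longrightarrow> \<pi> (adj H H T) = adj L L (\<pi> T)"
  using assms by (auto simp: unital_rep_def star_hom_def image_subset_iff)

lemma unital_rep_sum:
  assumes "unital_alg H A" "unital_rep H A L \<pi>" "\<And>i. i \<in> I \<Longrightarrow> T i \<in> A"
  shows "\<pi> (\<Sum>i\<in>I. c i *\<^sub>C T i) = (\<Sum>i\<in>I. c i *\<^sub>C \<pi> (T i))"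
proof -
  have sub: "csubspace A" by (rule unital_algD(2)[OF assms(1)])
  have 0: "\<pi> 0 = 0"
    using unital_repD(5)[OF assms(2) unital_algD(3)[OF assms(1)], of 0] by simp
  have "(\<Sum>i\<in>I. c i *\<^sub>C T i) \<in> A \<and> \<pi> (\<Sum>i\<in>I. c i *\<^sub>C T i) = (\<Sum>i\<in>I. c i *\<^sub>C \<pi> (T i))"
    using assms(3)
  proof (induction I rule: infinite_finite_induct)
    case (insert i I)
    have m: "c i *\<^sub>C T i \<in> A" using insert.prems complex_vector.subspace_scale[OF sub] by simp
    have IH: "(\<Sum>i\<in>I. c i *\<^sub>C T i) \<in> A"
      "\<pi> (\<Sum>i\<in>I. c i *\<^sub>C T i) = (\<Sum>i\<in>I. c i *\<^sub>C \<pi> (T i))"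
      using insert by auto
    have "T i \<in> A" using insert.prems by simp
    then show ?case
      unfolding sum.insert[OF insert.hyps] unital_repD(4)[OF assms(2) m IH(1)] IH(2)
        unital_repD(5)[OF assms(2) \<open>T i \<in> A\<close>]
      using complex_vector.subspace_add[OF sub m IH(1)] by (intro conjI refl)
  qed (use 0 complex_vector.subspace_0[OF sub] in auto)
  then show ?thesis ..
qed

lemma unital_rep_id: "unital_alg H A \<Longrightarrow> unital_rep H A H id"
  by (auto simp: unital_alg_def unital_rep_def star_hom_def)

lemma commutant_eq_intertwiners: "commutant H A = intertwiners H A H id"
  by (auto simp: commutant_def intertwiners_def)

lemma commutantD:
  "T \<in> commutant H A \<Longrightarrow> T \<in> ops H H" "T \<in> commutant H A \<Longrightarrow> S \<in> A \<Longrightarrow> T (S x) = S (T x)"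
  by (auto simp: commutant_def fun_eq_iff)

lemma intertwinersD:
  "T \<in> intertwiners H A L \<pi> \<Longrightarrow> T \<in> ops H L"
  "T \<in> intertwiners H A L \<pi> \<Longrightarrow> a \<in> A \<Longrightarrow> T (a x) = \<pi> a (T x)"
  by (auto simp: intertwiners_def fun_eq_iff)

lemma intertwinersI:
  assumes "T \<in> ops H L" "\<And>a. a \<in> A \<Longrightarrow> a \<in> ops H H" "\<And>a. a \<in> A \<Longrightarrow> \<pi> a \<in> ops L L"
    "\<And>a x. a \<in> A \<Longrightarrow> x \<in> hspace H \<Longrightarrow> T (a x) = \<pi> a (T x)"
  shows "T \<in> intertwiners H A L \<pi>"
  using assms
  by (auto simp: intertwiners_def intro!: ops_eqI[of "T \<circ> _" H L] ops_comp)

text \<open>\<open>\<pi>\<close> preserves adjoints, so \<open>S*\<close> intertwines in the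
  opposite direction. This will place operators \<open>\<xi>* \<xi>'\<close> in one algebra of the
  base because they commute with the other, and operators \<open>X'* X\<close> in the commutant that
  defines fiber products.\<close>

lemma intertwiner_adj_comp:
  assumes A: "unital_alg H A" and \<pi>: "unital_rep H A L \<pi>"
    and S: "S \<in> intertwiners H A L \<pi>" and T: "T \<in> intertwiners H A L \<pi>"
  shows "adj H L S \<circ> T \<in> commutant H A"
proof -
  note H = unital_algD[OF A] and L = unital_repD[OF \<pi>]
  note S' = intertwinersD[OF S] and T' = intertwinersD[OF T]
  interpret H: fd_hilbert H by (rule H(1))
  have Sa: "adj H L S \<in> ops L H" by (rule adj_in[OF H(1) L(1) S'(1)])
  have "adj H L S \<circ> T \<in> intertwiners H A H id"
  proof (rule intertwinersI)
    show "adj H L S \<circ> T \<in> ops H H" using Sa T'(1) by (rule ops_comp)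
    fix a x assume a: "a \<in> A" and x: "x \<in> hspace H"
    have Tx: "T x \<in> hspace L" using T'(1) x by (rule ops_in)
    have "adj H L S (\<pi> a (T x)) = a (adj H L S (T x))"
    proof (rule H.inner_eqI)
      show "adj H L S (\<pi> a (T x)) \<in> hspace H" "a (adj H L S (T x)) \<in> hspace H"
        using Sa L(2)[OF a] H(4)[OF a] Tx by (auto intro: ops_in)
      fix z assume z: "z \<in> hspace H"
      have az: "adj H H a z \<in> hspace H" using H(4)[OF H(6)[OF a]] z by (rule ops_in)
      have Sz: "S z \<in> hspace L" using S'(1) z by (rule ops_in)
      have "hinner H z (adj H L S (\<pi> a (T x))) = hinner L (S z) (\<pi> a (T x))"
        by (rule adj_right[OF H(1) L(1) S'(1) ops_in[OF L(2)[OF a] Tx] z])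
      also have "\<dots> = hinner L (\<pi> (adj H H a) (S z)) (T x)"
        unfolding L(7)[OF a] by (rule adj_left[OF L(1,1) L(2)[OF a] Sz Tx, symmetric])
      also have "\<dots> = hinner L (S (adj H H a z)) (T x)"
        using S'(2)[OF H(6)[OF a]] by simp
      also have "\<dots> = hinner H (adj H H a z) (adj H L S (T x))"
        by (rule adj_right[OF H(1) L(1) S'(1) Tx az, symmetric])
      also have "\<dots> = hinner H z (a (adj H L S (T x)))"
        by (rule adj_left[OF H(1,1) H(4)[OF a] z ops_in[OF Sa Tx]])
      finally show "hinner H z (adj H L S (\<pi> a (T x))) = hinner H z (a (adj H L S (T x)))" .
    qed
    then show "(adj H L S \<circ> T) (a x) = id a ((adj H L S \<circ> T) x)"
      using T'(2)[OF a] by simp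
  qed (use H in auto)
  then show ?thesis by (simp add: commutant_eq_intertwiners)
qed

section \<open>Hilbert-Schmidt inner products on operator algebras\<close>

definition rank1 :: "'a::complex_vector hilb \<Rightarrow> 'b::complex_vector \<Rightarrow> 'a \<Rightarrow> 'a \<Rightarrow> 'b" where
  "rank1 H w k = (\<lambda>v. if v \<in> hspace H then hinner H k v *\<^sub>C w else 0)"

lemma rank1_ops:
  assumes "fd_hilbert H" "fd_hilbert L" "w \<in> hspace L" "k \<in> hspace H"
  shows "rank1 H w k \<in> ops H L"
proof -
  interpret H: fd_hilbert H by fact
  interpret L: fd_hilbert L by fact
  show ?thesis
    by (rule opsI) (use assms in \<open>auto simp: rank1_def H.inner_add_right H.inner_scaleC_right
      scaleC_add_left scaleC_scaleC\<close>)
qed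

text \<open>The trace of \<open>S* T\<close>, computed in a Parseval frame \<open>F\<close>.\<close>

definition hs :: "'a::complex_vector hilb \<Rightarrow> 'a set \<Rightarrow> ('a \<Rightarrow> 'a) \<Rightarrow> ('a \<Rightarrow> 'a) \<Rightarrow> complex" where
  "hs H F S T = (\<Sum>f\<in>F. hinner H (S f) (T f))"

lemma (in fd_hilbert) inner_sum_eq_0:
  assumes "finite I" "\<And>i. i \<in> I \<Longrightarrow> x i \<in> hspace H" "(\<Sum>i\<in>I. hinner H (x i) (x i)) = 0" "i \<in> I"
  shows "x i = 0"
proof -
  have nn: "0 \<le> Re (hinner H (x j) (x j))" "Im (hinner H (x j) (x j)) = 0" if "j \<in> I" for j
    using inner_nonneg[OF assms(2)[OF that]] by (auto simp: complex_nonneg_Reals_iff)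
  have "(\<Sum>i\<in>I. Re (hinner H (x i) (x i))) = 0"
    using assms(3) by (metis Re_sum zero_complex.sel(1))
  then have "Re (hinner H (x i) (x i)) = 0"
    using sum_nonneg_eq_0_iff[OF assms(1), of "\<lambda>i. Re (hinner H (x i) (x i))"] nn(1) assms(4) by auto
  then have "hinner H (x i) (x i) = 0" using nn(2)[OF assms(4)] by (simp add: complex_eq_iff)
  then show ?thesis using inner_definite[OF assms(2)[OF assms(4)]] by blast
qed

lemma (in fd_hilbert) inner_sum_nonneg:
  assumes "\<And>i. i \<in> I \<Longrightarrow> x i \<in> hspace H"
  shows "(\<Sum>i\<in>I. hinner H (x i) (x i)) \<in> \<real>\<^sub>\<ge>\<^sub>0"
proof -
  have "0 \<le> Re (hinner H (x j) (x j))" "Im (hinner H (x j) (x j)) = 0" if "j \<in> I" for j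
    using inner_nonneg[OF assms[OF that]] by (auto simp: complex_nonneg_Reals_iff)
  then show ?thesis by (auto simp: complex_nonneg_Reals_iff intro: sum_nonneg sum.neutral)
qed

locale parseval = fd_hilbert H for H :: "'a::complex_vector hilb" +
  fixes F :: "'a set"
  assumes fin: "finite F" and FH: "f \<in> F \<Longrightarrow> f \<in> hspace H"
    and frame: "v \<in> hspace H \<Longrightarrow> (\<Sum>f\<in>F. hinner H f v *\<^sub>C f) = v"
begin

lemma H: "fd_hilbert H" ..

lemma inner_frame:
  assumes "x \<in> hspace H" "y \<in> hspace H"
  shows "hinner H x y = (\<Sum>f\<in>F. hinner H x f * hinner H f y)"
proof -
  have "hinner H x y = hinner H x (\<Sum>f\<in>F. hinner H f y *\<^sub>C f)" using frame[OF assms(2)] by simp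
  also have "\<dots> = (\<Sum>f\<in>F. hinner H f y * hinner H x f)"
    using assms FH by (simp add: inner_sum_right scale_in inner_scaleC_right)
  finally show ?thesis by (simp add: mult.commute)
qed

lemma hs_commute:
  "S \<in> ops H H \<Longrightarrow> T \<in> ops H H \<Longrightarrow> hs H F T S = cnj (hs H F S T)"
  unfolding hs_def cnj_sum by (rule sum.cong[OF refl], rule inner_commute) (blast intro: ops_in FH)+

lemma hs_move_left:
  assumes "a \<in> ops H H" "S \<in> ops H H" "T \<in> ops H H"
  shows "hs H F (adj H H a \<circ> S) T = hs H F S (a \<circ> T)"
  unfolding hs_def comp_apply
  by (rule sum.cong[OF refl], rule adj_left[OF H H assms(1)]) (blast intro: ops_in FH assms)+

text \<open>Cyclicity of the trace of \<open>b* S* T\<close>: the frame is inserted between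
  \<open>b*\<close> and \<open>S* T\<close>, and the sum over \<open>f\<close> then reassembles
  \<open>T b*\<close>.\<close>

lemma hs_cyclic:
  assumes b: "b \<in> ops H H" and S: "S \<in> ops H H" and T: "T \<in> ops H H"
  shows "hs H F (S \<circ> b) T = hs H F S (T \<circ> adj H H b)"
proof -
  have b': "adj H H b \<in> ops H H" by (rule adj_in[OF H H b])
  have Sa: "adj H H S \<in> ops H H" by (rule adj_in[OF H H S])
  have m: "b f \<in> hspace H" "S f \<in> hspace H" "T f \<in> hspace H" "adj H H b f \<in> hspace H"
    "adj H H S (T f) \<in> hspace H" "T (adj H H b f) \<in> hspace H" if "f \<in> F" for f
    using FH[OF that] b S T b' Sa by (auto intro: ops_in)
  have "hs H F (S \<circ> b) T = (\<Sum>f\<in>F. hinner H (b f) (adj H H S (T f)))"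
    unfolding hs_def comp_apply
    by (intro sum.cong refl adj_right[OF H H S, symmetric]) (use m in auto)
  also have "\<dots> = (\<Sum>f\<in>F. \<Sum>g\<in>F. hinner H (b f) g * hinner H g (adj H H S (T f)))"
    using m by (intro sum.cong refl inner_frame) auto
  also have "\<dots> = (\<Sum>f\<in>F. \<Sum>g\<in>F. hinner H f (adj H H b g) * hinner H (S g) (T f))"
    using m FH by (intro sum.cong refl) (simp add: adj_right[OF H H S] adj_right[OF H H b])
  also have "\<dots> = (\<Sum>g\<in>F. \<Sum>f\<in>F. hinner H f (adj H H b g) * hinner H (S g) (T f))"
    by (rule sum.swap)
  also have "\<dots> = (\<Sum>g\<in>F. hinner H (S g) (T (adj H H b g)))"
  proof (rule sum.cong[OF refl])
    fix g assume g: "g \<in> F"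
    have "T (adj H H b g) = T (\<Sum>f\<in>F. hinner H f (adj H H b g) *\<^sub>C f)"
      using frame[OF m(4)[OF g]] by simp
    also have "\<dots> = (\<Sum>f\<in>F. hinner H f (adj H H b g) *\<^sub>C T f)"
      using FH by (simp add: ops_sum[OF H T] scale_in ops_scale[OF T])
    finally show "(\<Sum>f\<in>F. hinner H f (adj H H b g) * hinner H (S g) (T f)) =
        hinner H (S g) (T (adj H H b g))"
      using m g by (simp add: inner_sum_right scale_in inner_scaleC_right)
  qed
  finally show ?thesis by (simp add: hs_def)
qed

text \<open>Matrix units: \<open>T\<close> is the combination of the operators \<open>|g><f|\<close>
  with coefficients \<open><g|T f>\<close>.\<close>

lemma finite_dim_ops: "\<exists>S. finite S \<and> ops H H \<subseteq> cspan S"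
proof (intro exI conjI subsetI)
  let ?S = "(\<lambda>(f, g). rank1 H g f) ` (F \<times> F)"
  show "finite ?S" using fin by simp
  fix T assume T: "T \<in> ops H H"
  have eq: "T = (\<Sum>(f, g)\<in>F \<times> F. hinner H g (T f) *\<^sub>C rank1 H g f)"
  proof
    fix v
    show "T v = (\<Sum>(f, g)\<in>F \<times> F. hinner H g (T f) *\<^sub>C rank1 H g f) v"
    proof (cases "v \<in> hspace H")
      case True
      have "T v = T (\<Sum>f\<in>F. hinner H f v *\<^sub>C f)" using frame[OF True] by simp
      also have "\<dots> = (\<Sum>f\<in>F. hinner H f v *\<^sub>C T f)"
        using FH by (simp add: ops_sum[OF H T] scale_in ops_scale[OF T])
      also have "\<dots> = (\<Sum>f\<in>F. hinner H f v *\<^sub>C (\<Sum>g\<in>F. hinner H g (T f) *\<^sub>C g))"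
        using FH T by (simp add: frame ops_in)
      also have "\<dots> = (\<Sum>(f, g)\<in>F \<times> F. hinner H g (T f) *\<^sub>C rank1 H g f v)"
        using True by (simp add: rank1_def complex_vector.scale_sum_right
            sum.cartesian_product[symmetric] scaleC_scaleC mult.commute)
      finally show ?thesis
        by (simp add: fun_sum_apply case_prod_beta scaleC_fun_def)
    next
      case False
      then show ?thesis
        by (simp add: fun_sum_apply case_prod_beta scaleC_fun_def ops_out[OF T] rank1_def)
    qed
  qed
  have "(\<Sum>(f, g)\<in>F \<times> F. hinner H g (T f) *\<^sub>C rank1 H g f) \<in> cspan ?S"
  proof (rule complex_vector.span_sum)
    fix p assume "p \<in> F \<times> F"
    then show "(case p of (f, g) \<Rightarrow> hinner H g (T f) *\<^sub>C rank1 H g f) \<in> cspan ?S"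
      unfolding case_prod_beta
      by (intro complex_vector.span_scale complex_vector.span_base) (rule image_eqI[of _ _ p], simp_all)
  qed
  then show "T \<in> cspan ?S" by (simp only: eq[symmetric])
qed

lemma ops_eq_0:
  assumes "T \<in> ops H H" "\<And>f. f \<in> F \<Longrightarrow> T f = 0"
  shows "T = 0"
proof
  fix v
  show "T v = 0 v"
  proof (cases "v \<in> hspace H")
    case True
    have "T v = T (\<Sum>f\<in>F. hinner H f v *\<^sub>C f)" using frame[OF True] by simp
    also have "\<dots> = (\<Sum>f\<in>F. hinner H f v *\<^sub>C T f)"
      using FH by (simp add: ops_sum[OF H assms(1)] scale_in ops_scale[OF assms(1)])
    finally show ?thesis using assms(2) by simp
  qed (simp add: ops_out[OF assms(1)])
qed

text \<open>Definiteness holds because an operator that vanishes on the frame \<open>F\<close> is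
  zero. The benefit is that \<open>A\<close> gets a Parseval frame of its own.\<close>

lemma hs_hilbert:
  assumes "unital_alg H A"
  shows "fd_hilbert \<lparr>hspace = A, hinner = hs H F\<rparr>"
proof (rule fd_hilbert.intro, unfold hilb.select_convs)
  note A = unital_algD[OF assms]
  have m: "S f \<in> hspace H" if "S \<in> A" "f \<in> F" for S f
    using A(4)[OF that(1)] FH[OF that(2)] by (rule ops_in)
  show "csubspace A" by (rule A(2))
  obtain S where "finite S" "ops H H \<subseteq> cspan S" using finite_dim_ops by blast
  moreover have "A \<subseteq> ops H H" using A(4) by blast
  ultimately show "\<exists>S. finite S \<and> cspan S = A"
    using finite_spanning_subset[of S A] A(2) by blast
  show "hs H F S (T + R) = hs H F S T + hs H F S R" if "S \<in> A" "T \<in> A" "R \<in> A" for S T R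
    unfolding hs_def sum.distrib[symmetric] plus_fun_apply
    by (rule sum.cong[OF refl], rule inner_add_right) (simp_all add: m that)
  show "hs H F S (c *\<^sub>C T) = c * hs H F S T" if "S \<in> A" "T \<in> A" for c S T
    unfolding hs_def sum_distrib_left scaleC_fun_def
    by (rule sum.cong[OF refl], rule inner_scaleC_right) (simp_all add: m that)
  show "hs H F T S = cnj (hs H F S T)" if "S \<in> A" "T \<in> A" for S T
    by (rule hs_commute) (use A(4) that in blast)+
  show "hs H F S S \<in> \<real>\<^sub>\<ge>\<^sub>0" if "S \<in> A" for S
    unfolding hs_def by (rule inner_sum_nonneg) (rule m[OF that])
  show "S = 0" if S: "S \<in> A" "hs H F S S = 0" for S
  proof (rule ops_eq_0[OF A(4)[OF S(1)]])
    show "S f = 0" if f: "f \<in> F" for f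
      by (rule inner_sum_eq_0[OF fin m[OF S(1)] _ f]) (use S(2) in \<open>simp_all add: hs_def\<close>)
  qed
qed

end

text \<open>The sum of \<open>e \<otimes> e*\<close> over \<open>E\<close> is a Casimir element:
  multiplying its first leg by \<open>a\<close> from the left has the same effect as multiplying its
  second leg by \<open>a\<close> from the right.\<close>

locale alg_frame = parseval H F for H :: "'a::complex_vector hilb" and F +
  fixes A E :: "('a \<Rightarrow> 'a) set"
  assumes alg: "unital_alg H A"
    and finE: "finite E" and EA: "e \<in> E \<Longrightarrow> e \<in> A"
    and Eframe: "T \<in> A \<Longrightarrow> (\<Sum>e\<in>E. hs H F e T *\<^sub>C e) = T"
begin

section \<open>Averaging over an operator algebra\<close>

lemmas A = unital_algD[OF alg]

lemma Eframe_apply: "T \<in> A \<Longrightarrow> (\<Sum>e\<in>E. hs H F e T *\<^sub>C e v) = T v"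
  using fun_cong[OF Eframe[of T], of v] by (simp add: fun_sum_apply scaleC_fun_def)

lemma E_ops: "e \<in> E \<Longrightarrow> e \<in> ops H H" "e \<in> E \<Longrightarrow> adj H H e \<in> ops H H"
  using EA A by auto

text \<open>Half of the Casimir property: \<open>a* e\<close> is expanded in the frame and adjoints
  are taken. The coefficient of \<open>j*\<close> becomes \<open>hs e (a j)\<close>, which is also
  the coefficient of \<open>e\<close> in the expansion of \<open>a j\<close>.\<close>

lemma adj_E_apply:
  assumes e: "e \<in> E" and a: "a \<in> A" and v: "v \<in> hspace H"
  shows "adj H H e (a v) = (\<Sum>j\<in>E. hs H F e (a \<circ> j) *\<^sub>C adj H H j v)"
proof (rule inner_eqI)
  have a': "adj H H a \<in> A" "a \<in> ops H H" "adj H H a \<in> ops H H" using A a by auto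
  have av: "a v \<in> hspace H" using a'(2) v by (rule ops_in)
  show "adj H H e (a v) \<in> hspace H" using E_ops(2)[OF e] av by (rule ops_in)
  have jv: "\<And>j. j \<in> E \<Longrightarrow> adj H H j v \<in> hspace H" using E_ops(2) v by (rule ops_in)
  show "(\<Sum>j\<in>E. hs H F e (a \<circ> j) *\<^sub>C adj H H j v) \<in> hspace H"
    using jv by auto
  fix w assume w: "w \<in> hspace H"
  have jw: "\<And>j. j \<in> E \<Longrightarrow> j w \<in> hspace H" using E_ops(1) w by (rule ops_in)
  have "hinner H w (adj H H e (a v)) = hinner H (e w) (a v)"
    by (rule adj_right[OF H H E_ops(1)[OF e] av w])
  also have "\<dots> = hinner H ((adj H H a \<circ> e) w) v"
    using adj_left[OF H H a'(2) jw[OF e] v] by simp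
  also have "\<dots> = hinner H (\<Sum>j\<in>E. hs H F j (adj H H a \<circ> e) *\<^sub>C j w) v"
    using Eframe_apply[OF A(5)[OF a'(1) EA[OF e]], of w] by simp
  also have "\<dots> = (\<Sum>j\<in>E. cnj (hs H F j (adj H H a \<circ> e)) * hinner H (j w) v)"
    using jw v by (simp add: inner_sum_left scale_in inner_scaleC_left)
  also have "\<dots> = (\<Sum>j\<in>E. hs H F e (a \<circ> j) * hinner H w (adj H H j v))"
  proof (rule sum.cong[OF refl])
    fix j assume j: "j \<in> E"
    have "cnj (hs H F j (adj H H a \<circ> e)) = hs H F (adj H H a \<circ> e) j"
      using hs_commute[OF E_ops(1)[OF j] ops_comp[OF a'(3) E_ops(1)[OF e]]] by simp
    also have "\<dots> = hs H F e (a \<circ> j)"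
      by (rule hs_move_left[OF a'(2) E_ops(1)[OF e] E_ops(1)[OF j]])
    finally show "cnj (hs H F j (adj H H a \<circ> e)) * hinner H (j w) v =
        hs H F e (a \<circ> j) * hinner H w (adj H H j v)"
      using adj_right[OF H H E_ops(1)[OF j] v w] by simp
  qed
  also have "\<dots> = hinner H w (\<Sum>j\<in>E. hs H F e (a \<circ> j) *\<^sub>C adj H H j v)"
    using jv w by (simp add: inner_sum_right scale_in inner_scaleC_right)
  finally show "hinner H w (adj H H e (a v)) = hinner H w (\<Sum>j\<in>E. hs H F e (a \<circ> j) *\<^sub>C adj H H j v)" .
qed

text \<open>The analogue of averaging over a group, with the Casimir element in place of the Haar
  measure. It is not normalized: the identity averages to \<open>cent\<close>.\<close>

definition avg :: "(('a \<Rightarrow> 'a) \<Rightarrow> 'b \<Rightarrow> 'b) \<Rightarrow> ('a \<Rightarrow> 'b) \<Rightarrow> 'a \<Rightarrow> 'b::complex_vector" where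
  "avg \<pi> X = (\<Sum>e\<in>E. \<pi> e \<circ> X \<circ> adj H H e)"

lemma avg_apply: "avg \<pi> X v = (\<Sum>e\<in>E. \<pi> e (X (adj H H e v)))"
  by (simp add: avg_def fun_sum_apply)

text \<open>Expanding \<open>e* a\<close> by \<open>adj_E_apply\<close> gives the double sum of
  \<open>hs e (a j) \<pi>(e) X j*\<close>. Summing over \<open>e\<close> first yields
  \<open>\<pi>(a j) X j*\<close>, since \<open>\<pi>\<close> is linear and \<open>a j\<close> lies
  in \<open>A\<close>.\<close>

lemma avg_intertwiner:
  assumes \<pi>: "unital_rep H A L \<pi>" and X: "X \<in> ops H L"
  shows "avg \<pi> X \<in> intertwiners H A L \<pi>"
proof (rule intertwinersI)
  note L = unital_repD[OF \<pi>]
  interpret L: fd_hilbert L by (rule L(1))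
  show "avg \<pi> X \<in> ops H L"
    unfolding avg_def
    by (intro complex_vector.subspace_sum[OF csubspace_ops[OF L(1)]] ops_comp[of _ L L] ops_comp[of _ H L])
      (auto intro: L(2) EA X E_ops)
  fix a v assume a: "a \<in> A" and v: "v \<in> hspace H"
  have m: "adj H H j v \<in> hspace H" "X (adj H H j v) \<in> hspace L" if "j \<in> E" for j
    using E_ops(2)[OF that] v X by (auto intro: ops_in)
  have m2: "\<pi> e (X (adj H H j v)) \<in> hspace L" if "e \<in> E" "j \<in> E" for e j
    by (rule ops_in[OF L(2)[OF EA[OF that(1)]] m(2)[OF that(2)]])
  have "avg \<pi> X (a v) = (\<Sum>e\<in>E. \<Sum>j\<in>E. hs H F e (a \<circ> j) *\<^sub>C \<pi> e (X (adj H H j v)))"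
    unfolding avg_apply
  proof (rule sum.cong[OF refl])
    fix e assume e: "e \<in> E"
    have "X (adj H H e (a v)) = (\<Sum>j\<in>E. hs H F e (a \<circ> j) *\<^sub>C X (adj H H j v))"
      unfolding adj_E_apply[OF e a v] using m(1)
      by (simp add: ops_sum[OF H X] scale_in ops_scale[OF X])
    then show "\<pi> e (X (adj H H e (a v))) = (\<Sum>j\<in>E. hs H F e (a \<circ> j) *\<^sub>C \<pi> e (X (adj H H j v)))"
      using m(2) by (simp add: ops_sum[OF L(1) L(2)[OF EA[OF e]]] L.scale_in ops_scale[OF L(2)[OF EA[OF e]]])
  qed
  also have "\<dots> = (\<Sum>j\<in>E. \<Sum>e\<in>E. hs H F e (a \<circ> j) *\<^sub>C \<pi> e (X (adj H H j v)))"
    by (rule sum.swap)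
  also have "\<dots> = (\<Sum>j\<in>E. \<pi> a (\<pi> j (X (adj H H j v))))"
  proof (rule sum.cong[OF refl])
    fix j assume j: "j \<in> E"
    have aj: "a \<circ> j \<in> A" using A a EA[OF j] by blast
    have "\<pi> a \<circ> \<pi> j = \<pi> (a \<circ> j)" using L(6)[OF a EA[OF j]] by simp
    also have "\<dots> = \<pi> (\<Sum>e\<in>E. hs H F e (a \<circ> j) *\<^sub>C e)"
      using Eframe[OF aj] by simp
    also have "\<dots> = (\<Sum>e\<in>E. hs H F e (a \<circ> j) *\<^sub>C \<pi> e)"
      by (rule unital_rep_sum[OF alg \<pi> EA])
    finally have "\<pi> a \<circ> \<pi> j = (\<Sum>e\<in>E. hs H F e (a \<circ> j) *\<^sub>C \<pi> e)" .
    from fun_cong[OF this, of "X (adj H H j v)"]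
    show "(\<Sum>e\<in>E. hs H F e (a \<circ> j) *\<^sub>C \<pi> e (X (adj H H j v))) = \<pi> a (\<pi> j (X (adj H H j v)))"
      by (simp add: fun_sum_apply scaleC_fun_def)
  qed
  also have "\<dots> = \<pi> a (avg \<pi> X v)"
    unfolding avg_apply using m2 by (simp add: ops_sum[OF L(1) L(2)[OF a]])
  finally show "avg \<pi> X (a v) = \<pi> a (avg \<pi> X v)" .
qed (use A unital_repD[OF \<pi>] in auto)

text \<open>No amplification is used. The averages of \<open>|w><f|\<close> lie in the commutant of
  \<open>A\<close> and map \<open>v\<close> to the sum of \<open><e f|v> e w\<close>. At
  \<open>v = f\<close>, summed over \<open>f\<close>, they give the frame expansion of the identity
  applied to \<open>w\<close>. As \<open>T\<close> commutes with them, \<open>T w\<close> is the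
  same sum at \<open>v = T f\<close>, which is the sum of \<open>hs e T\<close> times
  \<open>e w\<close>: \<open>T\<close> equals its Hilbert-Schmidt projection to
  \<open>A\<close>.\<close>

lemma bicommutant_le:
  assumes T: "T \<in> commutant H (commutant H A)"
  shows "T \<in> A"
proof -
  note T' = commutantD[OF T]
  have eq: "T = (\<Sum>e\<in>E. hs H F e T *\<^sub>C e)"
  proof (rule ops_eqI[OF T'(1)])
    show "(\<Sum>e\<in>E. hs H F e T *\<^sub>C e) \<in> ops H H"
      using E_ops by (intro complex_vector.subspace_sum[OF csubspace_ops[OF H]]
          complex_vector.subspace_scale[OF csubspace_ops[OF H]])
    fix w assume w: "w \<in> hspace H"
    have av: "avg id (rank1 H w f) v = (\<Sum>e\<in>E. hinner H (e f) v *\<^sub>C e w)"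
      if f: "f \<in> F" and v: "v \<in> hspace H" for f v
      unfolding avg_apply
    proof (rule sum.cong[OF refl])
      fix e assume e: "e \<in> E"
      have "adj H H e v \<in> hspace H" using E_ops(2)[OF e] v by (rule ops_in)
      then show "id e (rank1 H w f (adj H H e v)) = hinner H (e f) v *\<^sub>C e w"
        using adj_right[OF H H E_ops(1)[OF e] v FH[OF f]] ops_scale[OF E_ops(1)[OF e] w]
        by (simp add: rank1_def)
    qed
    have ew: "\<And>e. e \<in> E \<Longrightarrow> e w \<in> hspace H" using E_ops(1) w by (rule ops_in)
    have "T w = T (\<Sum>e\<in>E. hs H F e (idop H) *\<^sub>C e w)"
      using Eframe_apply[OF A(3), of w] w by simp
    also have "\<dots> = (\<Sum>e\<in>E. \<Sum>f\<in>F. hinner H (e f) f *\<^sub>C T (e w))"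
      using ew FH by (simp add: ops_sum[OF H T'(1)] scale_in sum_in ops_scale[OF T'(1)] hs_def
          complex_vector.scale_sum_left)
    also have "\<dots> = (\<Sum>f\<in>F. \<Sum>e\<in>E. hinner H (e f) f *\<^sub>C T (e w))" by (rule sum.swap)
    also have "\<dots> = (\<Sum>f\<in>F. T (avg id (rank1 H w f) f))"
      using ew FH by (simp add: av ops_sum[OF H T'(1)] scale_in ops_scale[OF T'(1)])
    also have "\<dots> = (\<Sum>f\<in>F. avg id (rank1 H w f) (T f))"
    proof (rule sum.cong[OF refl])
      fix f assume f: "f \<in> F"
      have "avg id (rank1 H w f) \<in> commutant H A"
        unfolding commutant_eq_intertwiners
        by (rule avg_intertwiner[OF unital_rep_id[OF alg] rank1_ops[OF H H w FH[OF f]]])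
      then show "T (avg id (rank1 H w f) f) = avg id (rank1 H w f) (T f)" by (rule T'(2))
    qed
    also have "\<dots> = (\<Sum>f\<in>F. \<Sum>e\<in>E. hinner H (e f) (T f) *\<^sub>C e w)"
      using FH ops_in[OF T'(1)] by (simp add: av)
    also have "\<dots> = (\<Sum>e\<in>E. \<Sum>f\<in>F. hinner H (e f) (T f) *\<^sub>C e w)" by (rule sum.swap)
    also have "\<dots> = (\<Sum>e\<in>E. hs H F e T *\<^sub>C e) w"
      by (simp add: fun_sum_apply scaleC_fun_def hs_def complex_vector.scale_sum_left)
    finally show "T w = (\<Sum>e\<in>E. hs H F e T *\<^sub>C e) w" .
  qed
  have "(\<Sum>e\<in>E. hs H F e T *\<^sub>C e) \<in> A"
    using EA by (intro complex_vector.subspace_sum[OF A(2)] complex_vector.subspace_scale[OF A(2)])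
  then show ?thesis by (simp only: eq[symmetric])
qed

section \<open>The central element of the frame and the frame of a representation\<close>

definition cent :: "'a \<Rightarrow> 'a" where
  "cent = (\<Sum>e\<in>E. e \<circ> adj H H e)"

lemma cent_apply: "cent v = (\<Sum>e\<in>E. e (adj H H e v))"
  by (simp add: cent_def fun_sum_apply)

lemma cent_in: "cent \<in> A"
  unfolding cent_def using A EA by (intro complex_vector.subspace_sum[OF A(2)]) auto

text \<open>\<open>cent\<close> is the average of the identity, hence an intertwiner of the identity
  representation with itself.\<close>

lemma cent_comm: "a \<in> A \<Longrightarrow> cent \<circ> a = a \<circ> cent"
proof -
  assume a: "a \<in> A"
  have "avg id (idop H) = cent"
    unfolding avg_def cent_def using EA A(4,6)
    by (intro sum.cong refl) (simp add: comp_assoc idop_comp[OF H, of _ H])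
  then have "cent \<in> intertwiners H A H id"
    using avg_intertwiner[OF unital_rep_id[OF alg] idop_ops[OF H]] by simp
  then show ?thesis using a by (auto simp: intertwiners_def)
qed

text \<open>\<open><v|cent v>\<close> is the sum of the squared norms of \<open>e* v\<close>. If
  these vanish, then so does \<open><v|v>\<close>, because the identity is a combination of the
  \<open>e\<close>.\<close>

lemma cent_definite:
  assumes v: "v \<in> hspace H" and 0: "hinner H v (cent v) = 0"
  shows "v = 0"
proof -
  have m: "adj H H e v \<in> hspace H" if "e \<in> E" for e using E_ops(2)[OF that] v by (rule ops_in)
  have "(\<Sum>e\<in>E. hinner H (adj H H e v) (adj H H e v)) = hinner H v (cent v)"
    unfolding cent_apply using m v ops_in[OF E_ops(1) m] adj_left[OF H H E_ops(1) v m]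
    by (simp add: inner_sum_right)
  then have z: "adj H H e v = 0" if "e \<in> E" for e
    using inner_sum_eq_0[OF finE, of "\<lambda>e. adj H H e v", OF m _ that] 0 by simp
  have ev: "e v \<in> hspace H" if "e \<in> E" for e using E_ops(1)[OF that] v by (rule ops_in)
  have "hinner H v v = hinner H (\<Sum>e\<in>E. hs H F e (idop H) *\<^sub>C e v) v"
    using Eframe_apply[OF A(3), of v] v by simp
  also have "\<dots> = (\<Sum>e\<in>E. cnj (hs H F e (idop H)) * hinner H v (adj H H e v))"
    using ev v by (simp add: inner_sum_left scale_in inner_scaleC_left adj_right[OF H H E_ops(1) v v])
  also have "\<dots> = 0" using z v by simp
  finally show "v = 0" using inner_definite v by blast
qed

text \<open>The inverse is needed inside \<open>A\<close>, so left multiplication by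
  \<open>cent\<close> is shown to be onto in the Hilbert space \<open>A\<close>. For
  \<open>T\<close> orthogonal to its image, \<open>hs (cent T) T\<close> is the sum of the squared
  norms of \<open>e* T f\<close>; these vanish, and \<open>cent_definite\<close> gives
  \<open>T f = 0\<close>. On a block of \<open>n\<close> by \<open>n\<close> matrices with
  multiplicity \<open>m\<close>, \<open>cent\<close> is the scalar \<open>n / m\<close>, so a
  correction by \<open>D\<close> is needed in general.\<close>

lemma cent_inverse:
  obtains D where "D \<in> A" "cent \<circ> D = idop H" "D \<circ> cent = idop H" "adj H H D = D"
    "\<And>a. a \<in> A \<Longrightarrow> a \<circ> D = D \<circ> a"
proof -
  interpret hsA: fd_hilbert "\<lparr>hspace = A, hinner = hs H F\<rparr>" by (rule hs_hilbert[OF alg])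
  have cops: "cent \<in> ops H H" using cent_in A by blast
  have cadj: "adj H H cent = cent"
  proof (rule adj_unique[OF H cops])
    fix x y assume y: "y \<in> hspace H" and x: "x \<in> hspace H"
    have m: "adj H H e x \<in> hspace H" "adj H H e y \<in> hspace H" if "e \<in> E" for e
      using E_ops(2)[OF that] x y by (auto intro: ops_in)
    show "hinner H (cent y) x = hinner H y (cent x)"
      unfolding cent_apply using m x y ops_in[OF E_ops(1) m(1)] ops_in[OF E_ops(1) m(2)]
      by (simp add: inner_sum_right inner_sum_left adj_left[OF H H E_ops(1) y m(1), symmetric]
          adj_right[OF H H E_ops(1) x m(2), symmetric])
  qed
  let ?S = "(\<lambda>a. cent \<circ> a) ` A"
  have "?S = A"
  proof (rule hsA.orthogonal_complement_zero[simplified])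
    show "csubspace ?S"
      unfolding complex_vector.subspace_def
    proof (intro conjI ballI allI)
      have "cent \<circ> 0 = 0" using cops by auto
      then show "0 \<in> ?S" using complex_vector.subspace_0[OF A(2)] by (metis image_iff)
      show "x + y \<in> ?S" if xy: "x \<in> ?S" "y \<in> ?S" for x y
      proof -
        obtain a b where a: "a \<in> A" "b \<in> A" "x = cent \<circ> a" "y = cent \<circ> b" using xy by blast
        have "x + y = cent \<circ> (a + b)"
        proof
          fix v
          show "(x + y) v = (cent \<circ> (a + b)) v"
            using ops_in[OF A(4)[OF a(1)]] ops_in[OF A(4)[OF a(2)]] ops_out[OF A(4)[OF a(1)]]
              ops_out[OF A(4)[OF a(2)]] a(3,4) cops
            by (cases "v \<in> hspace H") (auto simp: ops_add[OF cops])
        qed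
        then show ?thesis using a complex_vector.subspace_add[OF A(2)] by blast
      qed
      show "c *\<^sub>C x \<in> ?S" if x: "x \<in> ?S" for c x
      proof -
        obtain a where a: "a \<in> A" "x = cent \<circ> a" using x by blast
        have "c *\<^sub>C x = cent \<circ> (c *\<^sub>C a)"
        proof
          fix v
          show "(c *\<^sub>C x) v = (cent \<circ> (c *\<^sub>C a)) v"
            using ops_in[OF A(4)[OF a(1)]] ops_out[OF A(4)[OF a(1)]] a(2) cops
            by (cases "v \<in> hspace H") (auto simp: scaleC_fun_def ops_scale[OF cops])
        qed
        then show ?thesis using a complex_vector.subspace_scale[OF A(2)] by blast
      qed
    qed
    show "?S \<subseteq> A" using cent_in A by auto
    fix T assume T: "T \<in> A" "\<And>s. s \<in> ?S \<Longrightarrow> hs H F s T = 0"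
    have Tops: "T \<in> ops H H" using T A by blast
    have Tf: "T f \<in> hspace H" if "f \<in> F" for f using Tops FH[OF that] by (rule ops_in)
    have m: "adj H H e (T f) \<in> hspace H" if "f \<in> F" "e \<in> E" for f e
      using E_ops(2)[OF that(2)] Tf[OF that(1)] by (rule ops_in)
    have "hinner H (cent (T f)) (T f) = (\<Sum>e\<in>E. hinner H (adj H H e (T f)) (adj H H e (T f)))"
      if "f \<in> F" for f
      unfolding cent_apply using m[OF that] Tf[OF that] ops_in[OF E_ops(1) m[OF that]]
      by (simp add: inner_sum_left adj_right[OF H H E_ops(1) Tf[OF that] m[OF that]])
    then have "hs H F (cent \<circ> T) T =
        (\<Sum>f\<in>F. \<Sum>e\<in>E. hinner H (adj H H e (T f)) (adj H H e (T f)))"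
      by (simp add: hs_def)
    then have s0: "(\<Sum>(f, e)\<in>F \<times> E. hinner H (adj H H e (T f)) (adj H H e (T f))) = 0"
      using T by (simp add: sum.cartesian_product[symmetric])
    have z: "adj H H e (T f) = 0" if "f \<in> F" "e \<in> E" for e f
      using inner_sum_eq_0[of "F \<times> E" "\<lambda>(f, e). adj H H e (T f)" "(f, e)"] s0 m that fin finE
      by (auto simp: case_prod_beta)
    show "T = 0"
    proof (rule ops_eq_0[OF Tops])
      fix f assume f: "f \<in> F"
      show "T f = 0"
      proof (rule cent_definite[OF Tf[OF f]])
        have "cent (T f) = 0" using z[OF f] ops_zero_arg[OF E_ops(1)] by (simp add: cent_apply sum.neutral)
        then show "hinner H (T f) (cent (T f)) = 0" using Tf[OF f] by simp
      qed
    qed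
  qed
  then obtain D where D: "D \<in> A" "cent \<circ> D = idop H" using A(3) by (metis (no_types, lifting) imageE)
  have Dops: "D \<in> ops H H" "adj H H D \<in> ops H H" using D A by auto
  \<comment> \<open>\<open>cent\<close> is self-adjoint, so the adjoint of the right inverse
    \<open>D\<close> is a left inverse; the two must coincide.\<close>
  have D': "adj H H D \<circ> cent = idop H"
    using adj_comp[OF H H H Dops(1) cops] cadj D(2) adj_idop[OF H] by simp
  have DD: "adj H H D = D"
    using D D' comp_assoc[of "adj H H D" cent D] comp_idop[OF Dops(2)] idop_comp[OF H Dops(1)] by simp
  have cen: "a \<circ> D = D \<circ> a" if a: "a \<in> A" for a
  proof -
    have aops: "a \<in> ops H H" using a A by blast
    have "a \<circ> D = (D \<circ> cent) \<circ> (a \<circ> D)"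
      using D' DD idop_comp[OF H ops_comp[OF aops Dops(1)]] by simp
    also have "\<dots> = D \<circ> (cent \<circ> a) \<circ> D" by (simp add: comp_assoc)
    also have "\<dots> = D \<circ> (a \<circ> cent) \<circ> D" by (simp only: cent_comm[OF a])
    also have "\<dots> = (D \<circ> a) \<circ> (cent \<circ> D)" by (simp add: comp_assoc)
    also have "\<dots> = D \<circ> a" using D(2) comp_idop[OF ops_comp[OF Dops(1) aops]] by simp
    finally show ?thesis .
  qed
  show thesis using that D D' DD cen by simp
qed

text \<open>
  For \<open>X w g = avg \<pi> (|w\<rangle>\<langle>g|)\<close>, letting \<open>w\<close> and \<open>g\<close> run through Parseval frames gives
  \<open>\<Sum> X w g (X w g)\<^sup>* = \<pi> cent\<close>. The inverse \<open>D\<close> of \<open>cent\<close> satisfies \<open>D = \<Sum> (D e) (D e)\<^sup>*\<close>, so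
  replacing \<open>g\<close> by the vectors \<open>D (e f)\<close> normalizes the sum to \<open>1\<close> without a square root of \<open>D\<close>.
\<close>

lemma sum_intertwiners:
  assumes \<pi>: "unital_rep H A L \<pi>"
  shows "\<exists>n X. (\<forall>i<n. X i \<in> intertwiners H A L \<pi>) \<and>
    (\<forall>v\<in>hspace L. (\<Sum>i<n::nat. X i (adj H L (X i) v)) = v)"
proof -
  note L = unital_repD[OF \<pi>]
  interpret L: fd_hilbert L by (rule L(1))
  obtain M where M: "finite M" "M \<subseteq> hspace L"
    "\<And>v. v \<in> hspace L \<Longrightarrow> (\<Sum>f\<in>M. hinner L f v *\<^sub>C f) = v"
    using L.parseval_frame by blast
  have MLs: "\<And>w. w \<in> M \<Longrightarrow> w \<in> hspace L" using M(2) by blast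
  obtain D where D: "D \<in> A" "cent \<circ> D = idop H" "D \<circ> cent = idop H" "adj H H D = D"
    "\<And>a. a \<in> A \<Longrightarrow> a \<circ> D = D \<circ> a" by (rule cent_inverse) blast
  have Dops: "D \<in> ops H H" using D A by blast
  define X where "X w g = avg \<pi> (rank1 H w g)" for w g
  have X_int: "X w g \<in> intertwiners H A L \<pi>" if "w \<in> hspace L" "g \<in> hspace H" for w g
    unfolding X_def by (rule avg_intertwiner[OF \<pi> rank1_ops[OF H L(1) that]])
  have \<pi>L: "\<pi> a w \<in> hspace L" if "a \<in> A" "w \<in> hspace L" for a w
    using L(2)[OF that(1)] that(2) by (rule ops_in)
  have eH: "e g \<in> hspace H" if "e \<in> E" "g \<in> hspace H" for e g
    using E_ops(1)[OF that(1)] that(2) by (rule ops_in)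
  have X_apply: "X w g u = (\<Sum>l\<in>E. hinner H (l g) u *\<^sub>C \<pi> l w)"
    if w: "w \<in> hspace L" and g: "g \<in> hspace H" and u: "u \<in> hspace H" for w g u
    unfolding X_def avg_apply
  proof (rule sum.cong[OF refl])
    fix e assume e: "e \<in> E"
    have "adj H H e u \<in> hspace H" using E_ops(2)[OF e] u by (rule ops_in)
    then show "\<pi> e (rank1 H w g (adj H H e u)) = hinner H (e g) u *\<^sub>C \<pi> e w"
      using adj_right[OF H H E_ops(1)[OF e] u g] ops_scale[OF L(2)[OF EA[OF e]] w]
      by (simp add: rank1_def)
  qed
  have X_adj: "adj H L (X w g) v = (\<Sum>j\<in>E. hinner L (\<pi> j w) v *\<^sub>C j g)"
    if w: "w \<in> hspace L" and g: "g \<in> hspace H" and v: "v \<in> hspace L" for w g v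
  proof (rule inner_eqI)
    have Xo: "X w g \<in> ops H L" using X_int[OF w g] by (rule intertwinersD)
    show "adj H L (X w g) v \<in> hspace H" using adj_in[OF H L(1) Xo] v by (rule ops_in)
    show "(\<Sum>j\<in>E. hinner L (\<pi> j w) v *\<^sub>C j g) \<in> hspace H" using eH g by auto
    fix u assume u: "u \<in> hspace H"
    have "hinner H u (adj H L (X w g) v) = hinner L (X w g u) v"
      by (rule adj_right[OF H L(1) Xo v u])
    also have "\<dots> = (\<Sum>l\<in>E. cnj (hinner H (l g) u) * hinner L (\<pi> l w) v)"
      unfolding X_apply[OF w g u] using v \<pi>L[OF EA w]
      by (simp add: L.inner_sum_left L.scale_in L.inner_scaleC_left)
    also have "\<dots> = (\<Sum>l\<in>E. hinner L (\<pi> l w) v * hinner H u (l g))"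
      using inner_commute[OF eH[OF _ g] u] by (intro sum.cong refl) simp
    also have "\<dots> = hinner H u (\<Sum>j\<in>E. hinner L (\<pi> j w) v *\<^sub>C j g)"
      using u eH[OF _ g] by (simp add: inner_sum_right scale_in inner_scaleC_right)
    finally show "hinner H u (adj H L (X w g) v) = hinner H u (\<Sum>j\<in>E. hinner L (\<pi> j w) v *\<^sub>C j g)" .
  qed
  \<comment> \<open>Expanding both averages leaves the terms
    \<open><l g|j g> <\<pi>(j) w|v> \<pi>(l) w\<close>. The sum over the frame \<open>M\<close>
    turns the last two factors into \<open>\<pi>(l) \<pi>(j)* v\<close>.\<close>
  have XX: "(\<Sum>w\<in>M. X w g (adj H L (X w g) v)) =
      (\<Sum>j\<in>E. \<Sum>l\<in>E. hinner H (l g) (j g) *\<^sub>C \<pi> l (\<pi> (adj H H j) v))"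
    if g: "g \<in> hspace H" and v: "v \<in> hspace L" for g v
  proof -
    have a: "X w g (adj H L (X w g) v) =
        (\<Sum>j\<in>E. \<Sum>l\<in>E. hinner H (l g) (j g) *\<^sub>C (hinner L (\<pi> j w) v *\<^sub>C \<pi> l w))" if w: "w \<in> M" for w
    proof -
      have Xo: "X w g \<in> ops H L" using X_int[OF MLs[OF w] g] by (rule intertwinersD)
      show ?thesis
        unfolding X_adj[OF MLs[OF w] g v] using eH[OF _ g]
        by (simp add: ops_sum[OF H Xo] scale_in ops_scale[OF Xo] X_apply[OF MLs[OF w] g]
            complex_vector.scale_sum_right scaleC_scaleC inner_scaleC_right mult.commute)
    qed
    have b: "(\<Sum>w\<in>M. hinner L (\<pi> j w) v *\<^sub>C \<pi> l w) = \<pi> l (\<pi> (adj H H j) v)"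
      if j: "j \<in> E" and l: "l \<in> E" for j l
    proof -
      have j': "adj H H j \<in> A" "j \<in> A" using A EA j by auto
      have "\<pi> (adj H H j) v = (\<Sum>w\<in>M. hinner L w (\<pi> (adj H H j) v) *\<^sub>C w)"
        using M(3)[OF \<pi>L[OF j'(1) v]] by simp
      also have "\<dots> = (\<Sum>w\<in>M. hinner L (\<pi> j w) v *\<^sub>C w)"
        unfolding L(7)[OF j'(2)] using MLs by (simp add: adj_right[OF L(1,1) L(2)[OF j'(2)] v])
      finally show ?thesis
        using MLs by (simp add: ops_sum[OF L(1) L(2)[OF EA[OF l]]] L.scale_in
            ops_scale[OF L(2)[OF EA[OF l]]])
    qed
    have "(\<Sum>w\<in>M. X w g (adj H L (X w g) v)) =
        (\<Sum>w\<in>M. \<Sum>j\<in>E. \<Sum>l\<in>E. hinner H (l g) (j g) *\<^sub>C (hinner L (\<pi> j w) v *\<^sub>C \<pi> l w))"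
      using a by simp
    also have "\<dots> = (\<Sum>j\<in>E. \<Sum>w\<in>M. \<Sum>l\<in>E. hinner H (l g) (j g) *\<^sub>C (hinner L (\<pi> j w) v *\<^sub>C \<pi> l w))"
      by (rule sum.swap)
    also have "\<dots> = (\<Sum>j\<in>E. \<Sum>l\<in>E. \<Sum>w\<in>M. hinner H (l g) (j g) *\<^sub>C (hinner L (\<pi> j w) v *\<^sub>C \<pi> l w))"
      by (intro sum.cong refl sum.swap)
    also have "\<dots> = (\<Sum>j\<in>E. \<Sum>l\<in>E. hinner H (l g) (j g) *\<^sub>C \<pi> l (\<pi> (adj H H j) v))"
      by (intro sum.cong refl) (simp add: b[symmetric] complex_vector.scale_sum_right)
    finally show ?thesis .
  qed
  have Df: "D (e f) \<in> hspace H" if "e \<in> E" "f \<in> F" for e f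
    using Dops eH[OF that(1) FH[OF that(2)]] by (rule ops_in)
  \<comment> \<open>By cyclicity \<open>D e\<close> moves to the other side and produces
    \<open>D e e* D\<close>; the sum over \<open>e\<close> is \<open>D cent D = D\<close>.\<close>
  have hsD: "(\<Sum>e\<in>E. \<Sum>f\<in>F. hinner H (l (D (e f))) (j (D (e f)))) = hs H F l (j \<circ> D)"
    if l: "l \<in> E" and j: "j \<in> E" for l j
  proof -
    have m: "D f \<in> hspace H" "adj H H e (D f) \<in> hspace H" "e (adj H H e (D f)) \<in> hspace H"
      "D (e (adj H H e (D f))) \<in> hspace H" "j (D (e (adj H H e (D f)))) \<in> hspace H" "l f \<in> hspace H"
      if "e \<in> E" "f \<in> F" for e f
      using that E_ops Dops FH l j by (blast intro: ops_in)+
    have "(\<Sum>f\<in>F. hinner H (l (D (e f))) (j (D (e f)))) =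
        (\<Sum>f\<in>F. hinner H (l f) (j (D (e (adj H H e (D f))))))" if e: "e \<in> E" for e
    proof -
      have De: "D \<circ> e \<in> ops H H" using Dops E_ops(1)[OF e] by (rule ops_comp)
      have "adj H H (D \<circ> e) = adj H H e \<circ> D"
        using adj_comp[OF H H H E_ops(1)[OF e] Dops] D(4) by simp
      then show ?thesis
        using hs_cyclic[OF De E_ops(1)[OF l] ops_comp[OF E_ops(1)[OF j] De]]
        by (simp add: hs_def)
    qed
    then have "(\<Sum>e\<in>E. \<Sum>f\<in>F. hinner H (l (D (e f))) (j (D (e f)))) =
        (\<Sum>f\<in>F. \<Sum>e\<in>E. hinner H (l f) (j (D (e (adj H H e (D f))))))"
      by (simp add: sum.swap[of _ F E])
    also have "\<dots> = (\<Sum>f\<in>F. hinner H (l f) (j (D f)))"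
    proof (rule sum.cong[OF refl])
      fix f assume f: "f \<in> F"
      have "D f = D (cent (D f))" using fun_cong[OF D(2), of f] FH[OF f] by simp
      also have "\<dots> = (\<Sum>e\<in>E. D (e (adj H H e (D f))))"
        unfolding cent_apply using m[OF _ f] by (simp add: ops_sum[OF H Dops])
      finally have "j (D f) = j (\<Sum>e\<in>E. D (e (adj H H e (D f))))" by (rule arg_cong)
      also have "\<dots> = (\<Sum>e\<in>E. j (D (e (adj H H e (D f)))))"
        using m[OF _ f] by (simp add: ops_sum[OF H E_ops(1)[OF j]])
      finally have "j (D f) = (\<Sum>e\<in>E. j (D (e (adj H H e (D f)))))" .
      then show "(\<Sum>e\<in>E. hinner H (l f) (j (D (e (adj H H e (D f)))))) = hinner H (l f) (j (D f))"
        using m[OF l f] m(5)[OF _ f] by (simp add: inner_sum_right)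
    qed
    finally show ?thesis by (simp add: hs_def)
  qed
  have total: "(\<Sum>e\<in>E. \<Sum>f\<in>F. \<Sum>w\<in>M. X w (D (e f)) (adj H L (X w (D (e f))) v)) = v"
    if v: "v \<in> hspace L" for v
  proof -
    have "(\<Sum>e\<in>E. \<Sum>f\<in>F. \<Sum>w\<in>M. X w (D (e f)) (adj H L (X w (D (e f))) v)) =
        (\<Sum>e\<in>E. \<Sum>f\<in>F. \<Sum>j\<in>E. \<Sum>l\<in>E.
          hinner H (l (D (e f))) (j (D (e f))) *\<^sub>C \<pi> l (\<pi> (adj H H j) v))"
      by (intro sum.cong refl XX Df v)
    also have "\<dots> = (\<Sum>j\<in>E. \<Sum>l\<in>E. \<Sum>e\<in>E. \<Sum>f\<in>F.
          hinner H (l (D (e f))) (j (D (e f))) *\<^sub>C \<pi> l (\<pi> (adj H H j) v))"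
    proof -
      have "(\<Sum>e\<in>E. \<Sum>f\<in>F. \<Sum>j\<in>E. \<Sum>l\<in>E. G e f j l) = (\<Sum>j\<in>E. \<Sum>l\<in>E. \<Sum>e\<in>E. \<Sum>f\<in>F. G e f j l)"
        for G :: "_ \<Rightarrow> _ \<Rightarrow> _ \<Rightarrow> _ \<Rightarrow> 'b"
      proof -
        have "(\<Sum>(e, f)\<in>E \<times> F. \<Sum>(j, l)\<in>E \<times> E. G e f j l) = (\<Sum>(j, l)\<in>E \<times> E. \<Sum>(e, f)\<in>E \<times> F. G e f j l)"
          unfolding case_prod_beta by (rule sum.swap)
        then show ?thesis by (simp add: sum.cartesian_product[symmetric])
      qed
      then show ?thesis .
    qed
    also have "\<dots> = (\<Sum>j\<in>E. \<Sum>l\<in>E. hs H F l (j \<circ> D) *\<^sub>C \<pi> l (\<pi> (adj H H j) v))"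
      by (intro sum.cong refl) (simp add: hsD complex_vector.scale_sum_left[symmetric])
    \<comment> \<open>The sum over \<open>l\<close> is the frame expansion of
      \<open>\<pi>(j D)\<close>. Since \<open>D\<close> is central, it can be pulled out on the left
      and there cancels \<open>\<pi>(cent)\<close>.\<close>
    also have "\<dots> = (\<Sum>j\<in>E. \<pi> D (\<pi> j (\<pi> (adj H H j) v)))"
    proof (rule sum.cong[OF refl])
      fix j assume j: "j \<in> E"
      have jD: "j \<circ> D \<in> A" using A(5)[OF EA[OF j] D(1)] .
      have "\<pi> D \<circ> \<pi> j = \<pi> (j \<circ> D)" using D(5)[OF EA[OF j]] L(6)[OF D(1) EA[OF j]] by simp
      also have "\<dots> = \<pi> (\<Sum>l\<in>E. hs H F l (j \<circ> D) *\<^sub>C l)" using Eframe[OF jD] by simp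
      also have "\<dots> = (\<Sum>l\<in>E. hs H F l (j \<circ> D) *\<^sub>C \<pi> l)"
        by (rule unital_rep_sum[OF alg \<pi> EA])
      finally have "\<pi> D \<circ> \<pi> j = (\<Sum>l\<in>E. hs H F l (j \<circ> D) *\<^sub>C \<pi> l)" .
      from fun_cong[OF this, of "\<pi> (adj H H j) v"]
      show "(\<Sum>l\<in>E. hs H F l (j \<circ> D) *\<^sub>C \<pi> l (\<pi> (adj H H j) v)) = \<pi> D (\<pi> j (\<pi> (adj H H j) v))"
        by (simp add: fun_sum_apply scaleC_fun_def)
    qed
    also have "\<dots> = \<pi> D (\<Sum>j\<in>E. \<pi> j (\<pi> (adj H H j) v))"
      using \<pi>L A(6) EA v by (simp add: ops_sum[OF L(1) L(2)[OF D(1)]])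
    also have "(\<Sum>j\<in>E. \<pi> j (\<pi> (adj H H j) v)) = \<pi> cent v"
    proof -
      have "\<pi> cent = \<pi> (\<Sum>j\<in>E. 1 *\<^sub>C (j \<circ> adj H H j))" by (simp add: cent_def)
      also have "\<dots> = (\<Sum>j\<in>E. 1 *\<^sub>C \<pi> (j \<circ> adj H H j))"
        by (rule unital_rep_sum[OF alg \<pi>]) (use A EA in auto)
      also have "\<dots> = (\<Sum>j\<in>E. \<pi> j \<circ> \<pi> (adj H H j))"
        using L(6)[OF EA A(6)[OF EA]] by simp
      finally show ?thesis by (simp add: fun_sum_apply)
    qed
    also have "\<pi> D (\<pi> cent v) = v"
      using L(6)[OF D(1) cent_in] D(3) L(3) v by (metis comp_apply idop_apply)
    finally show ?thesis .
  qed
  \<comment> \<open>Reindexing by natural numbers keeps the types of the frames out of the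
    statement.\<close>
  let ?J = "E \<times> F \<times> M" and ?X = "\<lambda>(e, f, w). X w (D (e f))"
  have "finite ?J" using finE fin M(1) by simp
  then obtain h where h: "bij_betw h {0..<card ?J} ?J" using ex_bij_betw_nat_finite by blast
  show ?thesis
  proof (intro exI[of _ "card ?J"] exI[of _ "\<lambda>i. ?X (h i)"] conjI allI impI ballI)
    fix i assume "i < card ?J"
    then have "h i \<in> ?J" using bij_betwE[OF h] by simp
    then show "?X (h i) \<in> intertwiners H A L \<pi>" using X_int MLs Df by auto
  next
    fix v assume v: "v \<in> hspace L"
    have "(\<Sum>i<card ?J. ?X (h i) (adj H L (?X (h i)) v)) = (\<Sum>p\<in>?J. ?X p (adj H L (?X p) v))"
      unfolding lessThan_atLeast0 by (rule sum.reindex_bij_betw[OF h])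
    also have "\<dots> = (\<Sum>e\<in>E. \<Sum>f\<in>F. \<Sum>w\<in>M. X w (D (e f)) (adj H L (X w (D (e f))) v))"
      by (simp add: sum.cartesian_product case_prod_beta)
    also have "\<dots> = v" by (rule total[OF v])
    finally show "(\<Sum>i<card ?J. ?X (h i) (adj H L (?X (h i)) v)) = v" .
  qed
qed

end

section \<open>The bicommutant theorem and frames of representations\<close>

lemma unital_alg_frame:
  assumes "unital_alg H A"
  obtains F E where "alg_frame H F A E"
proof -
  interpret fd_hilbert H by (rule unital_algD(1)[OF assms])
  obtain F where F: "finite F" "F \<subseteq> hspace H"
    "\<And>v. v \<in> hspace H \<Longrightarrow> (\<Sum>f\<in>F. hinner H f v *\<^sub>C f) = v"
    using parseval_frame by blast
  interpret parseval H F by standard (use F in auto)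
  interpret hsA: fd_hilbert "\<lparr>hspace = A, hinner = hs H F\<rparr>" by (rule hs_hilbert[OF assms])
  obtain E where E: "finite E" "E \<subseteq> A" "\<And>T. T \<in> A \<Longrightarrow> (\<Sum>e\<in>E. hs H F e T *\<^sub>C e) = T"
    using hsA.parseval_frame by auto
  have "alg_frame H F A E"
    by unfold_locales (use E assms in auto)
  then show thesis by (rule that)
qed

lemma bicommutant:
  assumes "unital_alg H A"
  shows "commutant H (commutant H A) = A"
proof
  obtain F E where "alg_frame H F A E" by (rule unital_alg_frame[OF assms])
  then interpret alg_frame H F A E .
  show "commutant H (commutant H A) \<subseteq> A" using bicommutant_le by blast
  show "A \<subseteq> commutant H (commutant H A)" using A(4) by (auto simp: commutant_def)
qed

text \<open>The second property says that \<open>v \<mapsto> (X 0* v, ..., X (n-1)* v)\<close> is an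
  isometry of \<open>L\<close> into the sum of \<open>n\<close> copies of \<open>H\<close>; it
  intertwines \<open>\<pi>\<close> with the diagonal action of \<open>A\<close>.\<close>

lemma rep_frame:
  assumes "unital_alg H A" "unital_rep H A L \<pi>"
  obtains n :: nat and X where "\<And>i. i < n \<Longrightarrow> X i \<in> intertwiners H A L \<pi>"
    "\<And>v. v \<in> hspace L \<Longrightarrow> (\<Sum>i<n. X i (adj H L (X i) v)) = v"
proof -
  obtain F E where "alg_frame H F A E" by (rule unital_alg_frame[OF assms(1)])
  then interpret alg_frame H F A E .
  show thesis using sum_intertwiners[OF assms(2)] that by blast
qed

section \<open>The Hilbert space of a kernel of finite rank\<close>

lemma kgen_apply: "kgen X k y x = (if x \<in> X then k x y else 0)"
proof -
  have "{z. (if z = y then 1 else 0 :: complex) \<noteq> 0} = {y}" by auto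
  then show ?thesis by (simp add: kgen_def kclass_def)
qed

lemma kgen_eqI:
  assumes "\<And>x. x \<in> X \<Longrightarrow> k x y = k x z"
  shows "kgen X k y = kgen X k z"
  using assms by (auto simp: kgen_apply)

lemma kgen_free: "x \<in> X \<Longrightarrow> (\<lambda>y. if y = x then 1 else 0) \<in> free_vecs X"
  by (auto simp: free_vecs_def)

text \<open>The kernel is given as the Gram kernel of the families \<open>(\<tau> i x)\<close> in
  the sum of copies of \<open>H\<close> over \<open>J\<close>. Hermitian symmetry, positivity and
  finite dimension of the quotient all follow from this.\<close>

locale finite_rank_kernel = fd_hilbert H for H :: "'a::complex_vector hilb" +
  fixes X :: "'x set" and k :: "'x \<Rightarrow> 'x \<Rightarrow> complex" and J :: "'j set" and \<tau> :: "'j \<Rightarrow> 'x \<Rightarrow> 'a"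
  assumes finJ: "finite J" and \<tau>: "i \<in> J \<Longrightarrow> x \<in> X \<Longrightarrow> \<tau> i x \<in> hspace H"
    and k: "x \<in> X \<Longrightarrow> y \<in> X \<Longrightarrow> k x y = (\<Sum>i\<in>J. hinner H (\<tau> i x) (\<tau> i y))"
begin

abbreviation "supp \<equiv> (\<lambda>c :: 'x \<Rightarrow> complex. {x. c x \<noteq> 0})"

text \<open>The component of \<open>c\<close> in the copy of \<open>H\<close> with index
  \<open>i\<close>.\<close>

definition vec :: "'j \<Rightarrow> ('x \<Rightarrow> complex) \<Rightarrow> 'a" where
  "vec i c = (\<Sum>y\<in>supp c. c y *\<^sub>C \<tau> i y)"

lemma freeD: "c \<in> free_vecs X \<Longrightarrow> finite (supp c)" "c \<in> free_vecs X \<Longrightarrow> c x \<noteq> 0 \<Longrightarrow> x \<in> X"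
  by (auto simp: free_vecs_def)

lemma vec_in: "c \<in> free_vecs X \<Longrightarrow> i \<in> J \<Longrightarrow> vec i c \<in> hspace H"
  unfolding vec_def using \<tau> freeD(2) by blast

lemma kclass_vec:
  assumes c: "c \<in> free_vecs X" and x: "x \<in> X"
  shows "kclass X k c x = (\<Sum>i\<in>J. hinner H (\<tau> i x) (vec i c))"
proof -
  have "kclass X k c x = (\<Sum>y\<in>supp c. \<Sum>i\<in>J. c y * hinner H (\<tau> i x) (\<tau> i y))"
    using x freeD(2)[OF c] by (simp add: kclass_def k sum_distrib_left)
  also have "\<dots> = (\<Sum>i\<in>J. \<Sum>y\<in>supp c. c y * hinner H (\<tau> i x) (\<tau> i y))"
    by (rule sum.swap)
  also have "\<dots> = (\<Sum>i\<in>J. hinner H (\<tau> i x) (vec i c))"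
    unfolding vec_def
  proof (rule sum.cong[OF refl])
    fix i assume i: "i \<in> J"
    have m: "\<tau> i y \<in> hspace H" if "y \<in> supp c" for y using \<tau>[OF i] freeD(2)[OF c] that by simp
    show "(\<Sum>y\<in>supp c. c y * hinner H (\<tau> i x) (\<tau> i y)) =
        hinner H (\<tau> i x) (\<Sum>y\<in>supp c. c y *\<^sub>C \<tau> i y)"
      by (subst inner_sum_right) (auto simp: inner_scaleC_right \<tau> i x m intro!: sum.cong)
  qed
  finally show ?thesis .
qed

lemma kform_kclass:
  assumes "c \<in> free_vecs X"
  shows "kform k c d = (\<Sum>x\<in>supp c. cnj (c x) * kclass X k d x)"
  using freeD(2)[OF assms] by (simp add: kform_def kclass_def sum_distrib_left mult.assoc)

lemma kform_vec:
  assumes c: "c \<in> free_vecs X" and d: "d \<in> free_vecs X"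
  shows "kform k c d = (\<Sum>i\<in>J. hinner H (vec i c) (vec i d))"
proof -
  have "kform k c d = (\<Sum>x\<in>supp c. \<Sum>i\<in>J. cnj (c x) * hinner H (\<tau> i x) (vec i d))"
    unfolding kform_kclass[OF c] using freeD(2)[OF c] by (simp add: kclass_vec[OF d] sum_distrib_left)
  also have "\<dots> = (\<Sum>i\<in>J. \<Sum>x\<in>supp c. cnj (c x) * hinner H (\<tau> i x) (vec i d))"
    by (rule sum.swap)
  also have "\<dots> = (\<Sum>i\<in>J. hinner H (vec i c) (vec i d))"
    unfolding vec_def[of _ c]
  proof (rule sum.cong[OF refl])
    fix i assume i: "i \<in> J"
    have m: "\<tau> i y \<in> hspace H" if "y \<in> supp c" for y using \<tau>[OF i] freeD(2)[OF c] that by simp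
    show "(\<Sum>x\<in>supp c. cnj (c x) * hinner H (\<tau> i x) (vec i d)) =
        hinner H (\<Sum>y\<in>supp c. c y *\<^sub>C \<tau> i y) (vec i d)"
      by (subst inner_sum_left) (auto simp: inner_scaleC_left vec_in[OF d i] m intro!: sum.cong)
  qed
  finally show ?thesis .
qed

lemma kform_commute:
  assumes "c \<in> free_vecs X" "d \<in> free_vecs X"
  shows "kform k d c = cnj (kform k c d)"
  unfolding kform_vec[OF assms] kform_vec[OF assms(2,1)] cnj_sum
  by (rule sum.cong[OF refl], rule inner_commute) (use vec_in assms in auto)

text \<open>The form depends on its second argument only through the class of that argument, by
  \<open>kform_kclass\<close>, and by symmetry the same holds for the first argument. So the
  description of the inner product is unambiguous.\<close>

lemma hinner_kquot:
  assumes c: "c \<in> free_vecs X" and d: "d \<in> free_vecs X"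
  shows "hinner (kquot X k) (kclass X k c) (kclass X k d) = kform k c d"
proof -
  have "z = kform k c d"
    if "c' \<in> free_vecs X" "d' \<in> free_vecs X" "kclass X k c = kclass X k c'"
      "kclass X k d = kclass X k d'" "z = kform k c' d'" for z c' d'
  proof -
    have "kform k c' d' = kform k c' d"
      unfolding kform_kclass[OF that(1)] that(4) ..
    also have "\<dots> = cnj (kform k d c')" by (rule kform_commute[OF d that(1)])
    also have "kform k d c' = kform k d c"
      unfolding kform_kclass[OF d] that(3) ..
    also have "cnj (kform k d c) = kform k c d" by (rule kform_commute[OF d c, symmetric])
    finally show ?thesis using that(5) by simp
  qed
  then show ?thesis
    unfolding kquot_def hilb.select_convs using c d by (intro the_equality) blast+
qed

lemma free_add: "c \<in> free_vecs X \<Longrightarrow> d \<in> free_vecs X \<Longrightarrow> c + d \<in> free_vecs X"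
proof -
  assume c: "c \<in> free_vecs X" "d \<in> free_vecs X"
  have "supp (c + d) \<subseteq> supp c \<union> supp d" by auto
  then show ?thesis using c by (auto simp: free_vecs_def intro: finite_subset)
qed

lemma free_scale: "c \<in> free_vecs X \<Longrightarrow> a *\<^sub>C c \<in> free_vecs X"
  by (auto simp: free_vecs_def scaleC_fun_def scaleC_complex_def intro: finite_subset[of _ "supp c"])

lemma kclass_add:
  assumes c: "c \<in> free_vecs X" and d: "d \<in> free_vecs X"
  shows "kclass X k (c + d) = kclass X k c + kclass X k d"
proof
  fix x
  show "kclass X k (c + d) x = (kclass X k c + kclass X k d) x"
  proof (cases "x \<in> X")
    case True
    have S: "finite (supp c \<union> supp d)" using freeD c d by auto
    moreover have "supp (c + d) \<subseteq> supp c \<union> supp d" by auto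
    ultimately show ?thesis
      using True kclass_superset[OF S _ True, of c] kclass_superset[OF S _ True, of d]
        kclass_superset[OF S _ True, of "c + d"]
      by (simp add: distrib_right sum.distrib)
  qed (simp add: kclass_def)
qed

lemma kclass_scale:
  assumes c: "c \<in> free_vecs X"
  shows "kclass X k (a *\<^sub>C c) = a *\<^sub>C kclass X k c"
proof
  fix x
  show "kclass X k (a *\<^sub>C c) x = (a *\<^sub>C kclass X k c) x"
  proof (cases "x \<in> X")
    case True
    have S: "finite (supp c)" using freeD c by auto
    then show ?thesis
      using True kclass_superset[OF S _ True, of c] kclass_superset[OF S _ True, of "a *\<^sub>C c"]
      by (auto simp: scaleC_fun_def scaleC_complex_def sum_distrib_left mult.assoc)
  qed (simp add: kclass_def scaleC_fun_def)
qed

lemma hspace_kquot: "hspace (kquot X k) = kclass X k ` free_vecs X"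
  by (simp add: kquot_def)

lemma csubspace_kquot: "csubspace (hspace (kquot X k))"
  unfolding hspace_kquot complex_vector.subspace_def
proof (intro conjI ballI allI)
  have "(0 :: 'x \<Rightarrow> complex) \<in> free_vecs X" "kclass X k 0 = 0"
    by (auto simp: free_vecs_def kclass_def)
  then show "0 \<in> kclass X k ` free_vecs X" by (metis image_eqI)
  show "v + w \<in> kclass X k ` free_vecs X"
    if "v \<in> kclass X k ` free_vecs X" "w \<in> kclass X k ` free_vecs X" for v w
    using that by (auto simp: kclass_add[symmetric] intro: free_add)
  show "a *\<^sub>C v \<in> kclass X k ` free_vecs X" if "v \<in> kclass X k ` free_vecs X" for a v
    using that by (auto simp: kclass_scale[symmetric] intro: free_scale)
qed

lemma kquot_hilbert: "fd_hilbert (kquot X k)"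
proof (rule fd_hilbert.intro)
  show "csubspace (hspace (kquot X k))" by (rule csubspace_kquot)
  obtain F where F: "finite F" "F \<subseteq> hspace H"
    "\<And>v. v \<in> hspace H \<Longrightarrow> (\<Sum>f\<in>F. hinner H f v *\<^sub>C f) = v"
    using parseval_frame by blast
  \<comment> \<open>By \<open>kclass_vec\<close> a class is
    \<open>x \<mapsto> \<Sum> <\<tau> i x|vec i c>\<close>. Expanding \<open>vec i c\<close> in the
    frame \<open>F\<close> leaves combinations of these finitely many functions.\<close>
  define u where "u i g x = (if x \<in> X then hinner H (\<tau> i x) g else 0)" for i g x
  let ?S = "(\<lambda>(i, g). u i g) ` (J \<times> F)"
  have "hspace (kquot X k) \<subseteq> cspan ?S"
  proof
    fix v assume "v \<in> hspace (kquot X k)"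
    then obtain c where c: "c \<in> free_vecs X" "v = kclass X k c" by (auto simp: hspace_kquot)
    have "v = (\<Sum>i\<in>J. \<Sum>g\<in>F. hinner H g (vec i c) *\<^sub>C u i g)"
    proof
      fix x
      show "v x = (\<Sum>i\<in>J. \<Sum>g\<in>F. hinner H g (vec i c) *\<^sub>C u i g) x"
      proof (cases "x \<in> X")
        case True
        have "hinner H (\<tau> i x) (vec i c) = (\<Sum>g\<in>F. hinner H g (vec i c) * hinner H (\<tau> i x) g)"
          if i: "i \<in> J" for i
        proof -
          have "hinner H (\<tau> i x) (\<Sum>g\<in>F. hinner H g (vec i c) *\<^sub>C g) =
              (\<Sum>g\<in>F. hinner H g (vec i c) * hinner H (\<tau> i x) g)"
            using \<tau>[OF i True] F(2)
            by (subst inner_sum_right) (auto simp: subset_iff inner_scaleC_right)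
          then show ?thesis using F(3)[OF vec_in[OF c(1) i]] by simp
        qed
        then show ?thesis
          using True by (simp add: c kclass_vec[OF c(1) True] fun_sum_apply scaleC_fun_def u_def
              scaleC_complex_def)
      qed (simp add: c kclass_def fun_sum_apply scaleC_fun_def u_def scaleC_complex_def)
    qed
    then show "v \<in> cspan ?S"
      by (simp only:) (intro complex_vector.span_sum complex_vector.span_scale
          complex_vector.span_base, force)
  qed
  then show "\<exists>S. finite S \<and> cspan S = hspace (kquot X k)"
    using finJ F(1) by (intro finite_spanning_subset[OF _ _ csubspace_kquot]) auto
  note h = hinner_kquot
  have ex: "\<exists>c\<in>free_vecs X. x = kclass X k c" if "x \<in> hspace (kquot X k)" for x
    using that by (auto simp: hspace_kquot)
  fix x y z a
  assume x: "x \<in> hspace (kquot X k)" and y: "y \<in> hspace (kquot X k)"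
  obtain c where c: "c \<in> free_vecs X" "x = kclass X k c" using ex[OF x] by blast
  obtain d where d: "d \<in> free_vecs X" "y = kclass X k d" using ex[OF y] by blast
  show "hinner (kquot X k) x (y + z) = hinner (kquot X k) x y + hinner (kquot X k) x z"
    if z: "z \<in> hspace (kquot X k)"
  proof -
    obtain e where e: "e \<in> free_vecs X" "z = kclass X k e" using ex[OF z] by blast
    have "kform k c (d + e) = kform k c d + kform k c e"
      unfolding kform_kclass[OF c(1)] kclass_add[OF d(1) e(1)]
      by (simp add: distrib_left sum.distrib)
    then show ?thesis
      using c d e by (simp add: h kclass_add[symmetric] free_add)
  qed
  show "hinner (kquot X k) x (a *\<^sub>C y) = a * hinner (kquot X k) x y"
  proof -
    have "kform k c (a *\<^sub>C d) = a * kform k c d"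
      unfolding kform_kclass[OF c(1)] kclass_scale[OF d(1)]
      by (simp add: scaleC_fun_def scaleC_complex_def sum_distrib_left algebra_simps)
    then show ?thesis
      using c d by (simp add: h kclass_scale[symmetric] free_scale)
  qed
  show "hinner (kquot X k) y x = cnj (hinner (kquot X k) x y)"
    using c d by (simp add: h kform_commute[of c d])
next
  fix x assume "x \<in> hspace (kquot X k)"
  then obtain c where c: "c \<in> free_vecs X" "x = kclass X k c" by (auto simp: hspace_kquot)
  show "hinner (kquot X k) x x \<in> \<real>\<^sub>\<ge>\<^sub>0"
    unfolding c(2) hinner_kquot[OF c(1,1)] kform_vec[OF c(1,1)]
    by (rule inner_sum_nonneg) (rule vec_in[OF c(1)])
  show "x = 0" if "hinner (kquot X k) x x = 0"
  proof -
    have 0: "(\<Sum>i\<in>J. hinner H (vec i c) (vec i c)) = 0"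
      using that unfolding c(2) hinner_kquot[OF c(1,1)] kform_vec[OF c(1,1)] .
    have "vec i c = 0" if "i \<in> J" for i
      by (rule inner_sum_eq_0[OF finJ _ 0 that]) (rule vec_in[OF c(1)])
    then have "kclass X k c y = 0" for y
      using \<tau> by (cases "y \<in> X") (simp_all add: kclass_vec[OF c(1)], simp add: kclass_def)
    then show ?thesis by (auto simp: c)
  qed
qed

lemma kgen_in: "x \<in> X \<Longrightarrow> kgen X k x \<in> hspace (kquot X k)"
  unfolding hspace_kquot kgen_def by (rule imageI) (rule kgen_free)

lemma kgen_span: "cspan (kgen X k ` X) = hspace (kquot X k)"
proof
  show "cspan (kgen X k ` X) \<subseteq> hspace (kquot X k)"
    using kgen_in by (intro complex_vector.span_minimal csubspace_kquot) auto
  show "hspace (kquot X k) \<subseteq> cspan (kgen X k ` X)"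
  proof
    fix v assume "v \<in> hspace (kquot X k)"
    then obtain c where c: "c \<in> free_vecs X" "v = kclass X k c" by (auto simp: hspace_kquot)
    have "v = (\<Sum>y\<in>supp c. c y *\<^sub>C kgen X k y)"
      by (auto simp: c kclass_def fun_sum_apply scaleC_fun_def scaleC_complex_def kgen_apply)
    also have "\<dots> \<in> cspan (kgen X k ` X)"
      using freeD(2)[OF c(1)]
      by (intro complex_vector.span_sum complex_vector.span_scale complex_vector.span_base) auto
    finally show "v \<in> cspan (kgen X k ` X)" .
  qed
qed

lemma hinner_kgen: "x \<in> X \<Longrightarrow> y \<in> X \<Longrightarrow> hinner (kquot X k) (kgen X k x) (kgen X k y) = k x y"
proof -
  assume x: "x \<in> X" and y: "y \<in> X"
  have "{z. (if z = x then 1 else 0 :: complex) \<noteq> 0} = {x}" for x :: 'x by auto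
  then show ?thesis
    using hinner_kquot[OF kgen_free[OF x] kgen_free[OF y]] by (simp add: kgen_def kform_def)
qed

end

section \<open>Standard C*-bases\<close>

locale cyc = fd_hilbert hh for hh :: "'k::complex_vector hilb" +
  fixes C :: "('k \<Rightarrow> 'k) set" and z :: 'k
  assumes algC: "unital_alg hh C" and z_in [simp]: "z \<in> hspace hh"
    and cyclic: "w \<in> hspace hh \<Longrightarrow> \<exists>c\<in>C. c z = w"
    and separating: "c \<in> C \<Longrightarrow> d \<in> C \<Longrightarrow> c z = d z \<Longrightarrow> c = d"
begin

lemmas C = unital_algD[OF algC]

definition cof :: "'k \<Rightarrow> 'k \<Rightarrow> 'k" where
  "cof w = (THE c. c \<in> C \<and> c z = w)"

lemma cof_eq: "c \<in> C \<Longrightarrow> cof (c z) = c"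
  unfolding cof_def using separating by blast

lemma cof: "w \<in> hspace hh \<Longrightarrow> cof w \<in> C" "w \<in> hspace hh \<Longrightarrow> cof w z = w"
  using cyclic cof_eq by metis+

text \<open>This is \<open>c z \<mapsto> r c x\<close>, well defined because \<open>z\<close> is
  separating: the inverse of evaluation at \<open>z\<close> on intertwiners.\<close>

definition lift :: "(('k \<Rightarrow> 'k) \<Rightarrow> 'h \<Rightarrow> 'h) \<Rightarrow> 'h \<Rightarrow> 'k \<Rightarrow> 'h::complex_vector" where
  "lift r x = (\<lambda>w. if w \<in> hspace hh then r (cof w) x else 0)"

lemma lift_apply: "c \<in> C \<Longrightarrow> lift r x (c z) = r c x"
  using ops_in[OF C(4) z_in, of c] by (simp add: lift_def cof_eq)

context
  fixes L :: "'h::complex_vector hilb" and r :: "('k \<Rightarrow> 'k) \<Rightarrow> 'h \<Rightarrow> 'h"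
  assumes rep: "unital_rep hh C L r"
begin

lemmas r = unital_repD[OF rep]

lemma lift_intertwiner:
  assumes x: "x \<in> hspace L"
  shows "lift r x \<in> intertwiners hh C L r"
proof (rule intertwinersI)
  have cz: "c \<in> C \<Longrightarrow> c z \<in> hspace hh" for c by (rule ops_in[OF C(4) z_in])
  have ex: "\<exists>c\<in>C. w = c z" if "w \<in> hspace hh" for w using cyclic[OF that] by metis
  show "lift r x \<in> ops hh L"
  proof (rule opsI)
    fix w assume "w \<in> hspace hh"
    then obtain c where c: "c \<in> C" "w = c z" using ex by blast
    show "lift r x w \<in> hspace L" using ops_in[OF r(2)[OF c(1)] x] c by (simp add: lift_apply)
    show "lift r x (a *\<^sub>C w) = a *\<^sub>C lift r x w" for a
    proof -
      have "lift r x ((a *\<^sub>C c) z) = r (a *\<^sub>C c) x"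
        using c(1) complex_vector.subspace_scale[OF C(2)] by (intro lift_apply)
      then show ?thesis using r(5)[OF c(1)] c by (simp add: lift_apply scaleC_fun_def)
    qed
    fix v assume "v \<in> hspace hh"
    then obtain d where d: "d \<in> C" "v = d z" using ex by blast
    have "lift r x ((c + d) z) = r (c + d) x"
      using c(1) d(1) complex_vector.subspace_add[OF C(2)] by (intro lift_apply)
    then show "lift r x (w + v) = lift r x w + lift r x v"
      using r(4)[OF c(1) d(1)] c d by (simp add: lift_apply)
  qed (simp add: lift_def)
  fix a w assume a: "a \<in> C" and "w \<in> hspace hh"
  then obtain c where c: "c \<in> C" "w = c z" using ex by blast
  have "lift r x ((a \<circ> c) z) = r (a \<circ> c) x" using C(5)[OF a c(1)] by (rule lift_apply)
  then show "lift r x (a w) = r a (lift r x w)"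
    using r(6)[OF a c(1)] c by (simp add: lift_apply)
qed (use C r in auto)

lemma lift_ops: "x \<in> hspace L \<Longrightarrow> lift r x \<in> ops hh L"
  using lift_intertwiner intertwinersD(1) by blast

lemma lift_z [simp]: "x \<in> hspace L \<Longrightarrow> lift r x z = x"
  using lift_apply[OF C(3), of r x] r(3) by simp

lemma lift_eq:
  assumes T: "T \<in> intertwiners hh C L r"
  shows "lift r (T z) = T"
proof (rule ops_eqI)
  have Tz: "T z \<in> hspace L" using intertwinersD(1)[OF T] z_in by (rule ops_in)
  show "lift r (T z) \<in> ops hh L" by (rule lift_ops[OF Tz])
  show "T \<in> ops hh L" by (rule intertwinersD[OF T])
  fix w assume "w \<in> hspace hh"
  then obtain c where c: "c \<in> C" "c z = w" using cyclic by blast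
  then show "lift r (T z) w = T w"
    using intertwinersD(2)[OF T c(1), of z] lift_apply[OF c(1), of r "T z"] by simp
qed

text \<open>Evaluation at \<open>z\<close> is injective on all intertwiners, so a subspace on which
  it is onto contains every intertwiner.\<close>

lemma intertwiners_full:
  assumes sub: "csubspace \<alpha>" "\<alpha> \<subseteq> intertwiners hh C L r"
    and span: "cspan ((\<lambda>T. T z) ` \<alpha>) = hspace L"
  shows "\<alpha> = intertwiners hh C L r"
proof
  show "intertwiners hh C L r \<subseteq> \<alpha>"
  proof
    fix T assume T: "T \<in> intertwiners hh C L r"
    have "csubspace ((\<lambda>T. T z) ` \<alpha>)"
      unfolding complex_vector.subspace_def
    proof (intro conjI ballI allI)
      show "0 \<in> (\<lambda>T. T z) ` \<alpha>" using complex_vector.subspace_0[OF sub(1)] by (intro image_eqI[of _ _ 0]) auto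
      show "x + y \<in> (\<lambda>T. T z) ` \<alpha>" if xy: "x \<in> (\<lambda>T. T z) ` \<alpha>" "y \<in> (\<lambda>T. T z) ` \<alpha>" for x y
      proof -
        obtain S R where "S \<in> \<alpha>" "R \<in> \<alpha>" "x = S z" "y = R z" using xy by blast
        then show ?thesis
          using complex_vector.subspace_add[OF sub(1)] by (intro image_eqI[of _ _ "S + R"]) auto
      qed
      show "a *\<^sub>C x \<in> (\<lambda>T. T z) ` \<alpha>" if x: "x \<in> (\<lambda>T. T z) ` \<alpha>" for a x
      proof -
        obtain S where "S \<in> \<alpha>" "x = S z" using x by blast
        then show ?thesis
          using complex_vector.subspace_scale[OF sub(1)]
          by (intro image_eqI[of _ _ "a *\<^sub>C S"]) (auto simp: scaleC_fun_def)
      qed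
    qed
    then have "(\<lambda>T. T z) ` \<alpha> = hspace L"
      using span complex_vector.span_eq_iff by metis
    moreover have "T z \<in> hspace L" using intertwinersD(1)[OF T] z_in by (rule ops_in)
    ultimately obtain S where S: "S \<in> \<alpha>" "S z = T z" by (metis imageE)
    then have "S = T" using lift_eq[OF T] lift_eq[of S] sub(2) by auto
    then show "T \<in> \<alpha>" using S(1) by simp
  qed
qed (rule sub(2))

end

end

text \<open>Intertwiners between two arbitrary representations of the base algebra, as needed for
  tensor products of operators; in \<open>intertwiners\<close> the algebra acts on the source by
  itself.\<close>

definition iop ::
  "('k \<Rightarrow> 'k) set \<Rightarrow> 'h::complex_vector hilb \<Rightarrow> (('k \<Rightarrow> 'k) \<Rightarrow> 'h \<Rightarrow> 'h) \<Rightarrow>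
     'l::complex_vector hilb \<Rightarrow> (('k \<Rightarrow> 'k) \<Rightarrow> 'l \<Rightarrow> 'l) \<Rightarrow> ('h \<Rightarrow> 'l) set" where
  "iop C H r L r' = {X \<in> ops H L. \<forall>c\<in>C. X \<circ> r c = r' c \<circ> X}"

lemma iopD:
  "X \<in> iop C H r L r' \<Longrightarrow> X \<in> ops H L"
  "X \<in> iop C H r L r' \<Longrightarrow> c \<in> C \<Longrightarrow> X (r c x) = r' c (X x)"
  by (auto simp: iop_def fun_eq_iff)

lemma iop_idop:
  assumes "unital_rep hh C H r"
  shows "idop H \<in> iop C H r H r"
  using unital_repD(1,2)[OF assms] by (auto simp: iop_def idop_ops comp_idop[of _ H H] idop_comp[of H _ H])

lemma iop_adj:
  assumes "unital_alg hh C" "unital_rep hh C H r" "unital_rep hh C L r'" "X \<in> iop C H r L r'"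
  shows "adj H L X \<in> iop C L r' H r"
  unfolding iop_def
proof (intro CollectI conjI ballI)
  note r = unital_repD[OF assms(2)] and r' = unital_repD[OF assms(3)] and C = unital_algD[OF assms(1)]
  have X: "X \<in> ops H L" by (rule iopD[OF assms(4)])
  show "adj H L X \<in> ops L H" by (rule adj_in[OF r(1) r'(1) X])
  fix c assume c: "c \<in> C"
  have c': "adj hh hh c \<in> C" by (rule C(6)[OF c])
  have "adj H L (X \<circ> r (adj hh hh c)) = adj H L (r' (adj hh hh c) \<circ> X)"
    using assms(4) c' by (simp add: iop_def)
  then show "adj H L X \<circ> r' c = r c \<circ> adj H L X"
    using adj_comp[OF r(1) r(1) r'(1) r(2)[OF c'] X] adj_comp[OF r(1) r'(1,1) X r'(2)[OF c']]
      r(7)[OF c'] r'(7)[OF c'] adj_adj[OF C(1,1) C(4)[OF c]] by simp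
qed

context cyc
begin

text \<open>\<open>X \<circ> lift r x\<close> is an intertwiner with value \<open>X x\<close> at
  \<open>z\<close>, and that value determines it.\<close>

lemma lift_iop:
  assumes "unital_rep hh C H r" "unital_rep hh C L r'" "X \<in> iop C H r L r'" "x \<in> hspace H"
  shows "lift r' (X x) = X \<circ> lift r x"
proof -
  have l: "lift r x \<in> intertwiners hh C H r" by (rule lift_intertwiner[OF assms(1,4)])
  have "X \<circ> lift r x \<in> intertwiners hh C L r'"
    using intertwinersD[OF l] iopD[OF assms(3)] C(4) unital_repD(2)[OF assms(2)]
    by (intro intertwinersI) (auto intro: ops_comp)
  from lift_eq[OF assms(2) this] show ?thesis using lift_z[OF assms(1,4)] by simp
qed

lemma rep_apply_lift:
  assumes "unital_rep hh C L r" "x \<in> hspace L" "c \<in> C"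
  shows "r c x = lift r x (c z)"
  by (simp add: lift_apply assms)

end

text \<open>Since \<open>z\<close> is cyclic for \<open>B\<close>, an element of the commutant of
  \<open>B\<close> is determined by its value at \<open>z\<close>; since \<open>z\<close> is cyclic
  for \<open>C\<close>, every value is attained on \<open>C\<close>. So \<open>C\<close> is the
  whole commutant, and in particular it is unital.\<close>

lemma cyc_pair:
  assumes hh: "fd_hilbert hh" and B: "nondeg_cstar hh B" and C: "nondeg_cstar hh C"
    and comm: "\<And>b c. b \<in> B \<Longrightarrow> c \<in> C \<Longrightarrow> b \<circ> c = c \<circ> b"
    and z: "z \<in> hspace hh" "cspan (B \<cdot>\<^sub>v {z}) = hspace hh" "cspan (C \<cdot>\<^sub>v {z}) = hspace hh"
  shows "cyc hh C z" "commutant hh B = C"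
proof -
  interpret fd_hilbert hh by (rule hh)
  have Bops: "\<And>b. b \<in> B \<Longrightarrow> b \<in> ops hh hh" and Cops: "\<And>c. c \<in> C \<Longrightarrow> c \<in> ops hh hh"
    and sub: "csubspace C"
    using B C by (auto simp: nondeg_cstar_def)
  have Cz: "\<exists>c\<in>C. c z = w" if "w \<in> hspace hh" for w
    using that unfolding z(3)[symmetric]
  proof (induction rule: cspan_induct)
    case zero
    then show ?case using complex_vector.subspace_0[OF sub] by (intro bexI[of _ 0]) auto
  next
    case (base w)
    then show ?case by (auto simp: op_vecs_def)
  next
    case (add v w)
    then obtain c d where "c \<in> C" "c z = v" "d \<in> C" "d z = w" by blast
    then show ?case using complex_vector.subspace_add[OF sub] by (intro bexI[of _ "c + d"]) auto
  next
    case (scale a w)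
    then obtain c where "c \<in> C" "c z = w" by blast
    then show ?case
      using complex_vector.subspace_scale[OF sub]
      by (intro bexI[of _ "a *\<^sub>C c"]) (auto simp: scaleC_fun_def)
  qed
  have sep: "S = T" if "S \<in> commutant hh B" "T \<in> commutant hh B" "S z = T z" for S T
  proof (rule ops_eqI_span[OF _ _ z(2)])
    show "S \<in> ops hh hh" "T \<in> ops hh hh" using that by (auto intro: commutantD)
    fix g assume "g \<in> B \<cdot>\<^sub>v {z}"
    then obtain b where "b \<in> B" "g = b z" by (auto simp: op_vecs_def)
    then show "S g = T g" using that commutantD(2) by metis
  qed
  have le: "C \<subseteq> commutant hh B" using comm Cops by (auto simp: commutant_def)
  show eq: "commutant hh B = C"
  proof
    show "commutant hh B \<subseteq> C"
    proof
      fix T assume T: "T \<in> commutant hh B"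
      then have "T z \<in> hspace hh" using commutantD(1) z(1) ops_in by blast
      then obtain c where "c \<in> C" "c z = T z" using Cz by blast
      then have "c = T" using sep T le by blast
      then show "T \<in> C" using \<open>c \<in> C\<close> by simp
    qed
  qed (rule le)
  have "idop hh \<in> commutant hh B"
    using Bops by (auto simp: commutant_def idop_ops[OF hh] idop_comp[OF hh, of _ hh] comp_idop[of _ hh hh])
  then have "unital_alg hh C"
    using hh C eq unfolding unital_alg_def nondeg_cstar_def op_prods_def by blast
  then show "cyc hh C z"
    using Cz sep le z(1) by unfold_locales auto
qed

section \<open>Commuting algebras with a bicyclic vector\<close>

locale std_base =
  fixes hh :: "'k::complex_vector hilb" and B Bd :: "('k \<Rightarrow> 'k) set" and z :: 'k
  assumes base: "cstar_base hh B Bd" and bic: "bicyclic hh B Bd z"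
begin

text \<open>The hypotheses are symmetric in both algebras, so every statement on \<open>Bd\<close>
  and left factors has a mirror image on \<open>B\<close> and right factors.\<close>

lemma swap: "std_base hh Bd B z"
  using base bic by (auto simp: std_base_def cstar_base_def bicyclic_def)

text \<open>\<open>L\<close> concerns \<open>Bd\<close>, which is represented on left tensor
  factors, and \<open>R\<close> concerns \<open>B\<close>, which is represented on right
  ones.\<close>

sublocale L: cyc hh Bd z
  using base bic by (intro cyc_pair(1)[of hh B Bd]) (auto simp: cstar_base_def bicyclic_def)

sublocale R: cyc hh B z
  using base bic by (intro cyc_pair(1)[of hh Bd B]) (auto simp: cstar_base_def bicyclic_def)

lemma hh: "fd_hilbert hh" ..

lemma commutant_B: "commutant hh B = Bd" and commutant_Bd: "commutant hh Bd = B"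
proof -
  have *: "b \<circ> c = c \<circ> b" if "b \<in> B" "c \<in> Bd" for b c
    using base that by (auto simp: cstar_base_def)
  show "commutant hh B = Bd" "commutant hh Bd = B"
    using cyc_pair(2)[of hh B Bd z, OF _ _ _ *] cyc_pair(2)[of hh Bd B z, OF _ _ _ *[symmetric]] base bic
    by (simp_all add: cstar_base_def bicyclic_def)
qed

lemma commute: "b \<in> B \<Longrightarrow> d \<in> Bd \<Longrightarrow> b (d w) = d (b w)"
  using base by (auto simp: cstar_base_def fun_eq_iff)

section \<open>Factorizations as spaces of intertwiners\<close>

context
  fixes H :: "'h::complex_vector hilb" and \<alpha>
  assumes H: "fd_hilbert H" and \<alpha>: "cstar_factorization hh B Bd H \<alpha>"
begin

lemma factD:
  shows "\<xi> \<in> \<alpha> \<Longrightarrow> \<xi> \<in> ops hh H" "csubspace \<alpha>" "cspan (\<alpha> \<cdot>\<^sub>v hspace hh) = hspace H"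
    "\<xi> \<in> \<alpha> \<Longrightarrow> b \<in> B \<Longrightarrow> \<xi> \<circ> b \<in> \<alpha>"
    "\<xi> \<in> \<alpha> \<Longrightarrow> \<eta> \<in> \<alpha> \<Longrightarrow> adj hh H \<xi> \<circ> \<eta> \<in> B"
proof -
  show "\<xi> \<circ> b \<in> \<alpha>" if "\<xi> \<in> \<alpha>" "b \<in> B"
  proof -
    have "\<xi> \<circ> b \<in> \<alpha> \<odot> B" using that by (auto simp: op_prods_def)
    then show ?thesis
      using \<alpha> complex_vector.span_base[of "\<xi> \<circ> b" "\<alpha> \<odot> B"] by (simp add: cstar_factorization_def)
  qed
  show "adj hh H \<xi> \<circ> \<eta> \<in> B" if "\<xi> \<in> \<alpha>" "\<eta> \<in> \<alpha>"
  proof -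
    have "adj hh H \<xi> \<circ> \<eta> \<in> adj hh H ` \<alpha> \<odot> \<alpha>" using that by (auto simp: op_prods_def)
    then show ?thesis
      using \<alpha> complex_vector.span_base[of "adj hh H \<xi> \<circ> \<eta>" "adj hh H ` \<alpha> \<odot> \<alpha>"]
      by (simp add: cstar_factorization_def)
  qed
qed (use \<alpha> in \<open>auto simp: cstar_factorization_def\<close>)

text \<open>\<open>\<xi>'* \<xi>\<close> lies in \<open>B\<close> and commutes with
  \<open>d\<close>. This supplies the dual vectors that make
  \<open>\<xi> w \<mapsto> \<xi> (d w)\<close> a well-defined operator, and it shows that
  \<open>fact_rep\<close> preserves adjoints.\<close>

lemma fact_move:
  assumes \<xi>: "\<xi> \<in> \<alpha>" "\<xi>' \<in> \<alpha>" and d: "d \<in> Bd" and w: "w \<in> hspace hh" "w' \<in> hspace hh"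
  shows "hinner H (\<xi>' w') (\<xi> (d w)) = hinner H (\<xi>' (adj hh hh d w')) (\<xi> w)"
proof -
  note o = factD(1)[OF \<xi>(1)] factD(1)[OF \<xi>(2)]
  have d': "d \<in> ops hh hh" "adj hh hh d \<in> ops hh hh" using L.C d by auto
  have m: "d w \<in> hspace hh" "\<xi> w \<in> hspace H" "adj hh hh d w' \<in> hspace hh" "\<xi> (d w) \<in> hspace H"
    "adj hh H \<xi>' (\<xi> w) \<in> hspace hh"
    using d' w o adj_in[OF hh H o(2)] by (auto intro: ops_in)
  have "hinner H (\<xi>' w') (\<xi> (d w)) = hinner hh w' (adj hh H \<xi>' (\<xi> (d w)))"
    by (rule adj_right[OF hh H o(2) m(4) w(2), symmetric])
  also have "adj hh H \<xi>' (\<xi> (d w)) = d (adj hh H \<xi>' (\<xi> w))"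
    using commute[OF factD(5)[OF \<xi>(2,1)] d, of w] by simp
  also have "hinner hh w' \<dots> = hinner hh (adj hh hh d w') (adj hh H \<xi>' (\<xi> w))"
    by (rule adj_left[OF hh hh d'(1) w(2) m(5), symmetric])
  also have "\<dots> = hinner H (\<xi>' (adj hh hh d w')) (\<xi> w)"
    by (rule adj_right[OF hh H o(2) m(2,3)])
  finally show ?thesis .
qed

lemma fact_rep_ex1:
  assumes d: "d \<in> Bd"
  shows "fact_rep hh H \<alpha> d \<in> ops H H"
    and "\<xi> \<in> \<alpha> \<Longrightarrow> w \<in> hspace hh \<Longrightarrow> fact_rep hh H \<alpha> d (\<xi> w) = \<xi> (d w)"
proof -
  let ?J = "\<alpha> \<times> hspace hh" and ?g = "\<lambda>(\<xi>, w). \<xi> w"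
  have g: "?g ` ?J = \<alpha> \<cdot>\<^sub>v hspace hh" by (force simp: op_vecs_def)
  have d': "d \<in> ops hh hh" "adj hh hh d \<in> ops hh hh" using L.C d by auto
  have "\<exists>!T. T \<in> ops H H \<and> (\<forall>j\<in>?J. T (?g j) = (\<lambda>(\<xi>, w). \<xi> (d w)) j)"
  proof (rule ex1_op_generators[OF H H])
    show "cspan (?g ` ?J) = hspace H" "cspan (?g ` ?J) = hspace H" using factD(3) g by simp_all
    show "(\<lambda>(\<xi>, w). \<xi> (d w)) j \<in> hspace H" if "j \<in> ?J" for j
      using that factD(1) d' by (auto intro: ops_in)
    fix h assume "h \<in> ?g ` ?J"
    then obtain \<xi>' w' where h: "\<xi>' \<in> \<alpha>" "w' \<in> hspace hh" "h = \<xi>' w'" by auto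
    show "\<exists>e\<in>hspace H. \<forall>j\<in>?J. hinner H h ((\<lambda>(\<xi>, w). \<xi> (d w)) j) = hinner H e (?g j)"
      using h fact_move[OF _ h(1) d _ h(2)] ops_in[OF factD(1)[OF h(1)] ops_in[OF d'(2) h(2)]]
      by (intro bexI[of _ "\<xi>' (adj hh hh d w')"]) auto
  qed
  then have "\<exists>!T. T \<in> ops H H \<and> (\<forall>\<xi>\<in>\<alpha>. \<forall>\<omega>\<in>hspace hh. T (\<xi> \<omega>) = \<xi> (d \<omega>))" by simp
  from theI'[OF this]
  show "fact_rep hh H \<alpha> d \<in> ops H H"
    and "\<xi> \<in> \<alpha> \<Longrightarrow> w \<in> hspace hh \<Longrightarrow> fact_rep hh H \<alpha> d (\<xi> w) = \<xi> (d w)"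
    unfolding fact_rep_def by blast+
qed

lemma fact_rep_eqI:
  assumes "S \<in> ops H H" "T \<in> ops H H"
    "\<And>\<xi> w. \<xi> \<in> \<alpha> \<Longrightarrow> w \<in> hspace hh \<Longrightarrow> S (\<xi> w) = T (\<xi> w)"
  shows "S = T"
  by (rule ops_eqI_span[OF assms(1,2) factD(3)]) (auto simp: op_vecs_def assms(3))

lemma unital_rep_fact: "unital_rep hh Bd H (fact_rep hh H \<alpha>)"
  unfolding unital_rep_def star_hom_def
proof (intro conjI ballI allI)
  let ?r = "fact_rep hh H \<alpha>"
  note r = fact_rep_ex1
  interpret H: fd_hilbert H by (rule H)
  note so = csubspace_ops[OF H, of H]
  have m: "\<And>\<xi> w. \<xi> \<in> \<alpha> \<Longrightarrow> w \<in> hspace hh \<Longrightarrow> \<xi> w \<in> hspace H" by (rule ops_in[OF factD(1)])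
  have dm: "\<And>d w. d \<in> Bd \<Longrightarrow> w \<in> hspace hh \<Longrightarrow> d w \<in> hspace hh" by (rule ops_in[OF L.C(4)])
  show "fd_hilbert H" by (rule H)
  show "?r ` Bd \<subseteq> ops H H" using r by auto
  show "?r (idop hh) = idop H"
    by (rule fact_rep_eqI) (use r L.C(3) idop_ops[OF H] m in auto)
  fix S assume S: "S \<in> Bd"
  show "?r (a *\<^sub>C S) = a *\<^sub>C ?r S" for a
  proof (rule fact_rep_eqI)
    have aS: "a *\<^sub>C S \<in> Bd" using S by (rule complex_vector.subspace_scale[OF L.C(2)])
    show "?r (a *\<^sub>C S) \<in> ops H H" by (rule r(1)[OF aS])
    show "a *\<^sub>C ?r S \<in> ops H H" by (rule complex_vector.subspace_scale[OF so r(1)[OF S]])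
    show "?r (a *\<^sub>C S) (\<xi> w) = (a *\<^sub>C ?r S) (\<xi> w)" if "\<xi> \<in> \<alpha>" "w \<in> hspace hh" for \<xi> w
      using that r(2)[OF aS that] r(2)[OF S that] ops_scale[OF factD(1)[OF that(1)] dm[OF S that(2)]]
      by (simp add: scaleC_fun_def)
  qed
  show "?r (adj hh hh S) = adj H H (?r S)"
  proof (rule fact_rep_eqI)
    have S': "adj hh hh S \<in> Bd" by (rule L.C(6)[OF S])
    show a: "?r (adj hh hh S) \<in> ops H H" by (rule r(1)[OF S'])
    show a': "adj H H (?r S) \<in> ops H H" by (rule adj_in[OF H H r(1)[OF S]])
    fix \<xi> w assume \<xi>: "\<xi> \<in> \<alpha>" "w \<in> hspace hh"
    show "?r (adj hh hh S) (\<xi> w) = adj H H (?r S) (\<xi> w)"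
    proof (rule H.inner_eqI_span[OF _ _ factD(3)])
      show "?r (adj hh hh S) (\<xi> w) \<in> hspace H" "adj H H (?r S) (\<xi> w) \<in> hspace H"
        using a a' m[OF \<xi>] by (auto intro: ops_in)
      fix g assume "g \<in> \<alpha> \<cdot>\<^sub>v hspace hh"
      then obtain \<xi>' w' where g: "\<xi>' \<in> \<alpha>" "w' \<in> hspace hh" "g = \<xi>' w'" by (auto simp: op_vecs_def)
      show "hinner H g (?r (adj hh hh S) (\<xi> w)) = hinner H g (adj H H (?r S) (\<xi> w))"
        using g \<xi> m fact_move[OF \<xi>(1) g(1) S' \<xi>(2) g(2)] adj_adj[OF hh hh L.C(4)[OF S]]
        by (simp add: r(2)[OF S'] r(2)[OF S] adj_right[OF H H r(1)[OF S]])
    qed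
  qed
  fix T assume T: "T \<in> Bd"
  show "?r (S + T) = ?r S + ?r T"
  proof (rule fact_rep_eqI)
    have ST: "S + T \<in> Bd" using S T by (rule complex_vector.subspace_add[OF L.C(2)])
    show "?r (S + T) \<in> ops H H" by (rule r(1)[OF ST])
    show "?r S + ?r T \<in> ops H H" by (rule complex_vector.subspace_add[OF so r(1)[OF S] r(1)[OF T]])
    show "?r (S + T) (\<xi> w) = (?r S + ?r T) (\<xi> w)" if "\<xi> \<in> \<alpha>" "w \<in> hspace hh" for \<xi> w
      using that r(2)[OF ST that] r(2)[OF S that] r(2)[OF T that]
        ops_add[OF factD(1)[OF that(1)] dm[OF S that(2)] dm[OF T that(2)]] by simp
  qed
  show "?r (S \<circ> T) = ?r S \<circ> ?r T"
  proof (rule fact_rep_eqI)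
    have ST: "S \<circ> T \<in> Bd" by (rule L.C(5)[OF S T])
    show "?r (S \<circ> T) \<in> ops H H" by (rule r(1)[OF ST])
    show "?r S \<circ> ?r T \<in> ops H H" by (rule ops_comp[OF r(1)[OF S] r(1)[OF T]])
    show "?r (S \<circ> T) (\<xi> w) = (?r S \<circ> ?r T) (\<xi> w)" if "\<xi> \<in> \<alpha>" "w \<in> hspace hh" for \<xi> w
      using that r(2)[OF ST that] r(2)[OF S that(1) dm[OF T that(2)]] r(2)[OF T that] by simp
  qed
qed

text \<open>Every \<open>\<xi> w\<close> is \<open>(\<xi> \<circ> b) z\<close> with
  \<open>b \<in> B\<close>, so the values at \<open>z\<close> already span \<open>H\<close> and
  \<open>intertwiners_full\<close> applies.\<close>

lemma fact_eq_intertwiners: "\<alpha> = intertwiners hh Bd H (fact_rep hh H \<alpha>)"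
proof (rule L.intertwiners_full[OF unital_rep_fact factD(2)])
  show "\<alpha> \<subseteq> intertwiners hh Bd H (fact_rep hh H \<alpha>)"
    using factD(1) L.C(4) fact_rep_ex1 by (auto intro!: intertwinersI)
  have "(\<lambda>T. T z) ` \<alpha> = \<alpha> \<cdot>\<^sub>v hspace hh"
  proof
    show "(\<lambda>T. T z) ` \<alpha> \<subseteq> \<alpha> \<cdot>\<^sub>v hspace hh" using L.z_in unfolding op_vecs_def by blast
    show "\<alpha> \<cdot>\<^sub>v hspace hh \<subseteq> (\<lambda>T. T z) ` \<alpha>"
    proof
      fix v assume "v \<in> \<alpha> \<cdot>\<^sub>v hspace hh"
      then obtain \<xi> w where v: "\<xi> \<in> \<alpha>" "w \<in> hspace hh" "v = \<xi> w" by (auto simp: op_vecs_def)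
      then obtain b where "b \<in> B" "b z = w" using R.cyclic by blast
      then show "v \<in> (\<lambda>T. T z) ` \<alpha>"
        using v factD(4) by (intro image_eqI[of _ _ "\<xi> \<circ> b"]) auto
    qed
  qed
  then show "cspan ((\<lambda>T. T z) ` \<alpha>) = hspace H" using factD(3) by simp
qed

end

end

section \<open>Relative tensor products over a standard C*-base\<close>

text \<open>
  For \<open>X \<in> \<L>(H, H')\<close> and \<open>Y \<in> \<L>(K, K')\<close>, this is \<open>X \<otimes> Y\<close> with respect to elementary tensors
  given by \<open>t\<close> and \<open>t'\<close>.
\<close>

definition tens where
  "tens H K E t E' t' X Y = (THE T. T \<in> ops E E' \<and>
     (\<forall>x\<in>hspace H. \<forall>y\<in>hspace K. T (t x y) = t' (X x) (Y y)))"

definition fib where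
  "fib H A K B E t = commutant E
     {tens H K E t E t S T | S T. S \<in> commutant H A \<and> T \<in> commutant K B}"

definition ket :: "'l::complex_vector hilb \<Rightarrow> ('h \<Rightarrow> 'l \<Rightarrow> 'e) \<Rightarrow> 'h \<Rightarrow> 'l \<Rightarrow> 'e::complex_vector" where
  "ket K t x = (\<lambda>y. if y \<in> hspace K then t x y else 0)"

text \<open>
  \<open>is_tensor H r K s E t\<close> says that \<open>E\<close> with elementary tensors \<open>t x y\<close> realizes the relative tensor
  product of \<open>H\<close> and \<open>K\<close> with respect to a representation \<open>r\<close> of \<open>\<BB>\<^sup>\<dagger>\<close> on \<open>H\<close> and a representation
  \<open>s\<close> of \<open>\<BB>\<close> on \<open>K\<close>. Both the relative tensor product over \<open>\<mu>\<close> and the one over the C*-base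
  satisfy it, so everything that follows applies to both.
\<close>

definition (in std_base) is_tensor where
  "is_tensor H r K s E t \<longleftrightarrow> unital_rep hh Bd H r \<and> unital_rep hh B K s \<and> fd_hilbert E \<and>
     (\<forall>x\<in>hspace H. \<forall>y\<in>hspace K. t x y \<in> hspace E) \<and>
     cspan ((\<lambda>(x, y). t x y) ` (hspace H \<times> hspace K)) = hspace E \<and>
     (\<forall>x\<in>hspace H. \<forall>y\<in>hspace K. \<forall>x'\<in>hspace H. \<forall>y'\<in>hspace K.
        hinner E (t x y) (t x' y') = hinner H x (r (adj hh K (R.lift s y) \<circ> R.lift s y') x'))"

section \<open>Inner products, bilinearity and balancing of elementary tensors\<close>

context std_base
begin

lemma L_lift_in_B:
  assumes "unital_rep hh Bd H r" "x \<in> hspace H" "x' \<in> hspace H"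
  shows "adj hh H (L.lift r x) \<circ> L.lift r x' \<in> B"
  using intertwiner_adj_comp[OF L.algC assms(1) L.lift_intertwiner[OF assms(1,2)]
      L.lift_intertwiner[OF assms(1,3)]] commutant_Bd by simp

lemma R_lift_in_Bd:
  assumes "unital_rep hh B K s" "y \<in> hspace K" "y' \<in> hspace K"
  shows "adj hh K (R.lift s y) \<circ> R.lift s y' \<in> Bd"
  using std_base.L_lift_in_B[OF swap assms] .

text \<open>On the right, both factors enter alike, through elements of \<open>B\<close> and of
  \<open>Bd\<close> applied to \<open>z\<close>. As these commute, the roles of \<open>H\<close> and
  \<open>K\<close> can be exchanged.\<close>

lemma kernel_eq:
  assumes r: "unital_rep hh Bd H r" and s: "unital_rep hh B K s"
    and x: "x \<in> hspace H" "x' \<in> hspace H" and y: "y \<in> hspace K" "y' \<in> hspace K"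
  shows "hinner H x (r (adj hh K (R.lift s y) \<circ> R.lift s y') x') =
      hinner hh z ((adj hh H (L.lift r x) \<circ> L.lift r x') ((adj hh K (R.lift s y) \<circ> R.lift s y') z))"
proof -
  note r' = unital_repD[OF r]
  define d where "d = adj hh K (R.lift s y) \<circ> R.lift s y'"
  have d: "d \<in> Bd" unfolding d_def by (rule R_lift_in_Bd[OF s y])
  have dz: "d z \<in> hspace hh" using L.C(4)[OF d] L.z_in by (rule ops_in)
  note l = L.lift_ops[OF r x(1)] L.lift_ops[OF r x(2)]
  have "hinner H x (r d x') = hinner H (L.lift r x z) (L.lift r x' (d z))"
    using L.rep_apply_lift[OF r x(2) d] L.lift_z[OF r x(1)] by simp
  also have "\<dots> = hinner hh z (adj hh H (L.lift r x) (L.lift r x' (d z)))"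
    by (rule adj_right[OF hh r'(1) l(1) ops_in[OF l(2) dz] L.z_in, symmetric])
  finally show ?thesis unfolding d_def by simp
qed

lemma kernel_swap:
  assumes r: "unital_rep hh Bd H r" and s: "unital_rep hh B K s"
    and x: "x \<in> hspace H" "x' \<in> hspace H" and y: "y \<in> hspace K" "y' \<in> hspace K"
  shows "hinner H x (r (adj hh K (R.lift s y) \<circ> R.lift s y') x') =
      hinner K y (s (adj hh H (L.lift r x) \<circ> L.lift r x') y')"
  unfolding kernel_eq[OF assms] std_base.kernel_eq[OF swap s r y x]
  using commute[OF L_lift_in_B[OF r x] R_lift_in_Bd[OF s y]] by simp

lemma is_tensorD:
  assumes "is_tensor H r K s E t"
  shows "unital_rep hh Bd H r" "unital_rep hh B K s" "fd_hilbert E" "fd_hilbert H" "fd_hilbert K"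
    "x \<in> hspace H \<Longrightarrow> y \<in> hspace K \<Longrightarrow> t x y \<in> hspace E"
    "cspan ((\<lambda>(x, y). t x y) ` (hspace H \<times> hspace K)) = hspace E"
    "x \<in> hspace H \<Longrightarrow> y \<in> hspace K \<Longrightarrow> x' \<in> hspace H \<Longrightarrow> y' \<in> hspace K \<Longrightarrow>
      hinner E (t x y) (t x' y') = hinner H x (r (adj hh K (R.lift s y) \<circ> R.lift s y') x')"
    "x \<in> hspace H \<Longrightarrow> y \<in> hspace K \<Longrightarrow> x' \<in> hspace H \<Longrightarrow> y' \<in> hspace K \<Longrightarrow>
      hinner E (t x y) (t x' y') = hinner K y (s (adj hh H (L.lift r x) \<circ> L.lift r x') y')"
  using assms kernel_swap unfolding is_tensor_def by (auto dest: unital_repD(1))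

lemma is_tensor_swap:
  assumes "is_tensor H r K s E t"
  shows "std_base.is_tensor hh Bd B z K s H r E (\<lambda>y x. t x y)"
proof -
  note T = is_tensorD[OF assms]
  have "(\<lambda>(y, x). t x y) ` (hspace K \<times> hspace H) = (\<lambda>(x, y). t x y) ` (hspace H \<times> hspace K)" by auto
  then show ?thesis
    unfolding std_base.is_tensor_def[OF swap] using T by simp
qed

lemma tensor_eqI:
  assumes "is_tensor H r K s E t" "u \<in> hspace E" "v \<in> hspace E"
    "\<And>x y. x \<in> hspace H \<Longrightarrow> y \<in> hspace K \<Longrightarrow> hinner E (t x y) u = hinner E (t x y) v"
  shows "u = v"
  by (rule fd_hilbert.inner_eqI_span[OF is_tensorD(3)[OF assms(1)] assms(2,3) is_tensorD(7)[OF assms(1)]])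
    (use assms(4) in auto)

lemma tensor_ops_eqI:
  assumes "is_tensor H r K s E t" "S \<in> ops E F" "T \<in> ops E F"
    "\<And>x y. x \<in> hspace H \<Longrightarrow> y \<in> hspace K \<Longrightarrow> S (t x y) = T (t x y)"
  shows "S = T"
  by (rule ops_eqI_span[OF assms(2,3) is_tensorD(7)[OF assms(1)]]) (use assms(4) in auto)

text \<open>Bilinearity is not part of \<open>is_tensor\<close>; it follows because the inner
  products with all elementary tensors are linear in \<open>x\<close>, and these tensors
  span.\<close>

lemma tensor_linear_left:
  assumes T: "is_tensor H r K s E t" and y: "y \<in> hspace K"
  shows "x \<in> hspace H \<Longrightarrow> x' \<in> hspace H \<Longrightarrow> t (x + x') y = t x y + t x' y"
    "x \<in> hspace H \<Longrightarrow> t (a *\<^sub>C x) y = a *\<^sub>C t x y"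
proof -
  note D = is_tensorD[OF T]
  interpret H: fd_hilbert H by (rule D(4))
  interpret E: fd_hilbert E by (rule D(3))
  note rd = unital_repD(2)[OF D(1) R_lift_in_Bd[OF D(2) _ y]]
  show "t (x + x') y = t x y + t x' y" if x: "x \<in> hspace H" "x' \<in> hspace H" for x x'
    by (rule tensor_eqI[OF T]) (use x y rd in
      \<open>auto simp: D(6,8) H.add_in E.add_in E.inner_add_right H.inner_add_right ops_add[OF rd] ops_in[OF rd]\<close>)
  show "t (a *\<^sub>C x) y = a *\<^sub>C t x y" if x: "x \<in> hspace H" for x
    by (rule tensor_eqI[OF T]) (use x y rd in
      \<open>auto simp: D(6,8) H.scale_in E.scale_in E.inner_scaleC_right H.inner_scaleC_right
        ops_scale[OF rd] ops_in[OF rd]\<close>)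
qed

lemma tensor_linear_right:
  assumes T: "is_tensor H r K s E t" and x: "x \<in> hspace H"
  shows "y \<in> hspace K \<Longrightarrow> y' \<in> hspace K \<Longrightarrow> t x (y + y') = t x y + t x y'"
    "y \<in> hspace K \<Longrightarrow> t x (a *\<^sub>C y) = a *\<^sub>C t x y"
  using std_base.tensor_linear_left[OF swap is_tensor_swap[OF T] x] by blast+

text \<open>\<open>d\<close> does not act on \<open>K\<close>, but it acts on the intertwiner of
  \<open>y\<close> from the right: \<open>d\<close> commutes with \<open>B\<close>, so
  \<open>R.lift s y \<circ> d\<close> is again an intertwiner. Its value at \<open>z\<close> is the
  vector that replaces \<open>y\<close>.\<close>

lemma tensor_balanced_left:
  assumes T: "is_tensor H r K s E t" and x: "x \<in> hspace H" and y: "y \<in> hspace K" and d: "d \<in> Bd"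
  shows "t (r d x) y = t x (R.lift s y (d z))"
proof -
  note D = is_tensorD[OF T]
  note r = unital_repD[OF D(1)] and s = unital_repD[OF D(2)]
  have l: "R.lift s y \<in> intertwiners hh B K s" by (rule R.lift_intertwiner[OF D(2) y])
  have "R.lift s y \<circ> d \<in> intertwiners hh B K s"
    using intertwinersD[OF l] L.C(4)[OF d] R.C(4) s(2) commute[OF _ d]
    by (intro intertwinersI) (auto intro!: ops_comp)
  from R.lift_eq[OF D(2) this] have e: "R.lift s (R.lift s y (d z)) = R.lift s y \<circ> d" by simp
  have m: "r d x \<in> hspace H" "d z \<in> hspace hh" using r(2)[OF d] x L.C(4)[OF d] L.z_in by (auto intro: ops_in)
  have m': "R.lift s y (d z) \<in> hspace K" using intertwinersD(1)[OF l] m(2) by (rule ops_in)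
  show ?thesis
  proof (rule tensor_eqI[OF T])
    show "t (r d x) y \<in> hspace E" "t x (R.lift s y (d z)) \<in> hspace E" using m m' x y D(6) by auto
    fix a b assume a: "a \<in> hspace H" and b: "b \<in> hspace K"
    show "hinner E (t a b) (t (r d x) y) = hinner E (t a b) (t x (R.lift s y (d z)))"
      using D(8)[OF a b m(1) y] D(8)[OF a b x m'] e r(6)[OF R_lift_in_Bd[OF D(2) b y] d]
      by (simp add: comp_assoc)
  qed
qed

lemma tensor_balanced_right:
  assumes T: "is_tensor H r K s E t" and x: "x \<in> hspace H" and y: "y \<in> hspace K" and b: "b \<in> B"
  shows "t x (s b y) = t (L.lift r x (b z)) y"
  using std_base.tensor_balanced_left[OF swap is_tensor_swap[OF T] y x b] .

text \<open>The dual vector of \<open>t' u v\<close> is \<open>t (X* u) (Y* v)\<close>. This gives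
  existence and identifies the adjoint at the same time.\<close>

lemma tens_ex:
  assumes T: "is_tensor H r K s E t" and T': "is_tensor H' r' K' s' E' t'"
    and X: "X \<in> iop Bd H r H' r'" and Y: "Y \<in> iop B K s K' s'"
  shows tens_ops: "tens H K E t E' t' X Y \<in> ops E E'"
    and tens_apply: "\<And>x y. x \<in> hspace H \<Longrightarrow> y \<in> hspace K \<Longrightarrow>
      tens H K E t E' t' X Y (t x y) = t' (X x) (Y y)"
    and tens_adj: "adj E E' (tens H K E t E' t' X Y) = tens H' K' E' t' E t (adj H H' X) (adj K K' Y)"
proof -
  \<comment> \<open>Stated for arbitrary data, since it is applied to the pair \<open>X\<close>,
    \<open>Y\<close> and also to the adjoints in the opposite direction.\<close>
  have main: "(\<exists>!S. S \<in> ops E E' \<and> (\<forall>x\<in>hspace H. \<forall>y\<in>hspace K. S (t x y) = t' (X x) (Y y))) \<and>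
     (\<forall>x\<in>hspace H. \<forall>y\<in>hspace K. \<forall>u\<in>hspace H'. \<forall>v\<in>hspace K'.
       hinner E' (t' u v) (t' (X x) (Y y)) = hinner E (t (adj H H' X u) (adj K K' Y v)) (t x y))"
    if T: "is_tensor H r K s E t" and T': "is_tensor H' r' K' s' E' t'"
      and X: "X \<in> iop Bd H r H' r'" and Y: "Y \<in> iop B K s K' s'"
    for H r K s E t H' r' K' s' E' t' X Y
  proof -
    note D = is_tensorD[OF T] and D' = is_tensorD[OF T']
    note r = unital_repD[OF D(1)] and r' = unital_repD[OF D'(1)]
    note Xo = iopD(1)[OF X] and Yo = iopD(1)[OF Y]
    have X': "adj H H' X \<in> ops H' H" and Y': "adj K K' Y \<in> ops K' K"
      using adj_in D(4,5) D'(4,5) Xo Yo by blast+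
    have Y'i: "adj K K' Y \<in> iop B K' s' K s" by (rule iop_adj[OF R.algC D(2) D'(2) Y])
    have dual: "hinner E' (t' u v) (t' (X x) (Y y)) = hinner E (t (adj H H' X u) (adj K K' Y v)) (t x y)"
      if x: "x \<in> hspace H" and y: "y \<in> hspace K" and u: "u \<in> hspace H'" and v: "v \<in> hspace K'" for x y u v
    proof -
      have Yv: "adj K K' Y v \<in> hspace K" using Y' v by (rule ops_in)
      have Xu: "adj H H' X u \<in> hspace H" using X' u by (rule ops_in)
      define d where "d = adj hh K (R.lift s (adj K K' Y v)) \<circ> R.lift s y"
      have d: "d \<in> Bd" unfolding d_def by (rule R_lift_in_Bd[OF D(2) Yv y])
      have l: "R.lift s y \<in> ops hh K" "R.lift s' v \<in> ops hh K'"
        using R.lift_ops[OF D(2) y] R.lift_ops[OF D'(2) v] by auto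
      \<comment> \<open>Writing \<open>R\<close> for the lifts,
        \<open>R(v)* R(Y y) = R(v)* Y R(y) = R(Y* v)* R(y)\<close>: the operator \<open>Y\<close>
        changes sides inside the kernel, and the resulting element of \<open>Bd\<close> then passes
        through \<open>X\<close>.\<close>
      have "adj hh K' (R.lift s' v) \<circ> R.lift s' (Y y) = (adj hh K' (R.lift s' v) \<circ> Y) \<circ> R.lift s y"
        by (simp add: R.lift_iop[OF D(2) D'(2) Y y] comp_assoc)
      also have "adj hh K' (R.lift s' v) \<circ> Y = adj hh K (adj K K' Y \<circ> R.lift s' v)"
        using adj_comp[OF hh D'(5) D(5) l(2) Y'] adj_adj[OF D(5) D'(5) Yo] by simp
      also have "adj K K' Y \<circ> R.lift s' v = R.lift s (adj K K' Y v)"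
        by (rule R.lift_iop[OF D'(2) D(2) Y'i v, symmetric])
      finally have "adj hh K' (R.lift s' v) \<circ> R.lift s' (Y y) = d" unfolding d_def .
      then have "hinner E' (t' u v) (t' (X x) (Y y)) = hinner H' u (X (r d x))"
        using D'(8)[OF u v ops_in[OF Xo x] ops_in[OF Yo y]] iopD(2)[OF X d] by simp
      also have "\<dots> = hinner H (adj H H' X u) (r d x)"
        by (rule adj_left[OF D(4) D'(4) Xo u ops_in[OF r(2)[OF d] x], symmetric])
      also have "\<dots> = hinner E (t (adj H H' X u) (adj K K' Y v)) (t x y)"
        using D(8)[OF Xu Yv x y] by (simp add: d_def)
      finally show ?thesis .
    qed
    have "\<exists>!S. S \<in> ops E E' \<and> (\<forall>j\<in>hspace H \<times> hspace K.
        S ((\<lambda>(x, y). t x y) j) = (\<lambda>(x, y). t' (X x) (Y y)) j)"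
    proof (rule ex1_op_generators[OF D(3) D'(3) D(7) _ D'(7)])
      show "(\<lambda>(x, y). t' (X x) (Y y)) j \<in> hspace E'" if "j \<in> hspace H \<times> hspace K" for j
        using that D'(6)[OF ops_in[OF Xo] ops_in[OF Yo]] by auto
      fix h assume "h \<in> (\<lambda>(x, y). t' x y) ` (hspace H' \<times> hspace K')"
      then obtain u v where h: "u \<in> hspace H'" "v \<in> hspace K'" "h = t' u v" by auto
      show "\<exists>e\<in>hspace E. \<forall>j\<in>hspace H \<times> hspace K.
          hinner E' h ((\<lambda>(x, y). t' (X x) (Y y)) j) = hinner E e ((\<lambda>(x, y). t x y) j)"
        using h dual D(6)[OF ops_in[OF X' h(1)] ops_in[OF Y' h(2)]]
        by (intro bexI[of _ "t (adj H H' X u) (adj K K' Y v)"]) auto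
    qed
    then show ?thesis using dual by simp
  qed
  note D = is_tensorD[OF T] and D' = is_tensorD[OF T']
  have X': "adj H H' X \<in> iop Bd H' r' H r" and Y': "adj K K' Y \<in> iop B K' s' K s"
    by (rule iop_adj[OF L.algC D(1) D'(1) X], rule iop_adj[OF R.algC D(2) D'(2) Y])
  let ?T = "tens H K E t E' t' X Y" and ?T' = "tens H' K' E' t' E t (adj H H' X) (adj K K' Y)"
  have 1: "?T \<in> ops E E' \<and> (\<forall>x\<in>hspace H. \<forall>y\<in>hspace K. ?T (t x y) = t' (X x) (Y y))"
    unfolding tens_def by (rule theI'[OF conjunct1[OF main[OF T T' X Y]]])
  have 2: "?T' \<in> ops E' E \<and> (\<forall>x\<in>hspace H'. \<forall>y\<in>hspace K'. ?T' (t' x y) = t (adj H H' X x) (adj K K' Y y))"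
    unfolding tens_def by (rule theI'[OF conjunct1[OF main[OF T' T X' Y']]])
  show "?T \<in> ops E E'" using 1 by blast
  show "\<And>x y. x \<in> hspace H \<Longrightarrow> y \<in> hspace K \<Longrightarrow> ?T (t x y) = t' (X x) (Y y)" using 1 by blast
  show "adj E E' ?T = ?T'"
  proof (rule tensor_ops_eqI[OF T'])
    show a: "adj E E' ?T \<in> ops E' E" using 1 by (intro adj_in[OF D(3) D'(3)]) blast
    show "?T' \<in> ops E' E" using 2 by blast
    fix u v assume u: "u \<in> hspace H'" and v: "v \<in> hspace K'"
    show "adj E E' ?T (t' u v) = ?T' (t' u v)"
    proof (rule tensor_eqI[OF T])
      show "adj E E' ?T (t' u v) \<in> hspace E" using a D'(6)[OF u v] by (rule ops_in)
      show "?T' (t' u v) \<in> hspace E" using 2 D'(6)[OF u v] ops_in by blast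
      fix x y assume x: "x \<in> hspace H" and y: "y \<in> hspace K"
      have m: "t (adj H H' X u) (adj K K' Y v) \<in> hspace E"
        using D(6)[OF ops_in[OF iopD(1)[OF X'] u] ops_in[OF iopD(1)[OF Y'] v]] .
      have m': "t' (X x) (Y y) \<in> hspace E'"
        using D'(6)[OF ops_in[OF iopD(1)[OF X] x] ops_in[OF iopD(1)[OF Y] y]] .
      have "hinner E (t x y) (adj E E' ?T (t' u v)) = hinner E' (t' (X x) (Y y)) (t' u v)"
        using adj_right[OF D(3) D'(3) _ D'(6)[OF u v] D(6)[OF x y], of ?T] 1 x y by simp
      also have "\<dots> = cnj (hinner E' (t' u v) (t' (X x) (Y y)))"
        by (rule fd_hilbert.inner_commute[OF D'(3) D'(6)[OF u v] m'])
      also have "\<dots> = cnj (hinner E (t (adj H H' X u) (adj K K' Y v)) (t x y))"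
        using main[OF T T' X Y] x y u v by simp
      also have "\<dots> = hinner E (t x y) (?T' (t' u v))"
        using fd_hilbert.inner_commute[OF D(3) m D(6)[OF x y]] 2 u v by simp
      finally show "hinner E (t x y) (adj E E' ?T (t' u v)) = hinner E (t x y) (?T' (t' u v))" .
    qed
  qed
qed

lemma tens_unique:
  assumes "is_tensor H r K s E t" "S \<in> ops E E'"
    "\<And>x y. x \<in> hspace H \<Longrightarrow> y \<in> hspace K \<Longrightarrow> S (t x y) = t' (X x) (Y y)"
  shows "tens H K E t E' t' X Y = S"
  unfolding tens_def using assms tensor_ops_eqI[OF assms(1), of _ E'] by (intro the_equality) auto

lemma tens_comp:
  assumes T: "is_tensor H r K s E t" and T': "is_tensor H' r' K' s' E' t'" and T'': "is_tensor H'' r'' K'' s'' E'' t''"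
    and X: "X \<in> iop Bd H r H' r'" and Y: "Y \<in> iop B K s K' s'"
    and X': "X' \<in> iop Bd H' r' H'' r''" and Y': "Y' \<in> iop B K' s' K'' s''"
  shows "tens H' K' E' t' E'' t'' X' Y' \<circ> tens H K E t E' t' X Y = tens H K E t E'' t'' (X' \<circ> X) (Y' \<circ> Y)"
  by (rule tens_unique[OF T, symmetric])
    (simp_all add: ops_comp[OF tens_ops[OF T' T'' X' Y'] tens_ops[OF T T' X Y]]
      tens_apply[OF T T' X Y] tens_apply[OF T' T'' X' Y'] ops_in[OF iopD(1)[OF X]] ops_in[OF iopD(1)[OF Y]])

lemma ket_ops:
  assumes T: "is_tensor H r K s E t" and x: "x \<in> hspace H"
  shows "ket K t x \<in> ops K E"
proof -
  note D = is_tensorD[OF T]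
  interpret K: fd_hilbert K by (rule D(5))
  show ?thesis
    by (rule opsI) (use x D(6) tensor_linear_right[OF T x] in \<open>auto simp: ket_def\<close>)
qed

text \<open>Read off from the form of the inner product in which the left vectors act on
  \<open>K\<close> through \<open>s\<close>. In particular, products of an adjoint ket with a ket
  lie in the image of \<open>s\<close>.\<close>

lemma adj_ket:
  assumes T: "is_tensor H r K s E t" and x: "x \<in> hspace H" "x' \<in> hspace H" and y: "y \<in> hspace K"
  shows "adj K E (ket K t x) (t x' y) = s (adj hh H (L.lift r x) \<circ> L.lift r x') y"
proof -
  note D = is_tensorD[OF T]
  interpret K: fd_hilbert K by (rule D(5))
  have k: "ket K t x \<in> ops K E" by (rule ket_ops[OF T x(1)])
  show ?thesis
  proof (rule K.inner_eqI)
    show "adj K E (ket K t x) (t x' y) \<in> hspace K"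
      using adj_in[OF D(5,3) k] D(6)[OF x(2) y] by (rule ops_in)
    show "s (adj hh H (L.lift r x) \<circ> L.lift r x') y \<in> hspace K"
      using unital_repD(2)[OF D(2) L_lift_in_B[OF D(1) x]] y by (rule ops_in)
    fix v assume v: "v \<in> hspace K"
    show "hinner K v (adj K E (ket K t x) (t x' y)) = hinner K v (s (adj hh H (L.lift r x) \<circ> L.lift r x') y)"
      using adj_right[OF D(5,3) k D(6)[OF x(2) y] v] D(9)[OF x(1) v x(2) y] v by (simp add: ket_def)
  qed
qed

end

section \<open>Fiber products as commutants and in terms of kets\<close>

lemma unital_alg_commutant:
  assumes H: "fd_hilbert H" and G: "G \<subseteq> ops H H" "\<And>T. T \<in> G \<Longrightarrow> adj H H T \<in> G"
  shows "unital_alg H (commutant H G)"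
  unfolding unital_alg_def
proof (intro conjI ballI)
  show "csubspace (commutant H G)"
    unfolding commutant_eq_intertwiners by (rule csubspace_intertwiners[OF H]) (use G in auto)
  show "idop H \<in> commutant H G"
    using G(1) by (auto simp: commutant_def idop_ops[OF H] subset_iff idop_comp[OF H, of _ H]
        comp_idop[of _ H H])
  show "S \<circ> T \<in> commutant H G" if "S \<in> commutant H G" "T \<in> commutant H G" for S T
  proof -
    have "(S \<circ> T) \<circ> R = R \<circ> (S \<circ> T)" if "R \<in> G" for R
      using that \<open>S \<in> _\<close> \<open>T \<in> _\<close> by (simp add: commutant_def comp_assoc) (simp add: comp_assoc[symmetric])
    then show ?thesis using that by (auto simp: commutant_def intro: ops_comp)
  qed
  show "adj H H T \<in> commutant H G" if T: "T \<in> commutant H G" for T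
  proof -
    note T' = commutantD(1)[OF T]
    have "adj H H T \<circ> S = S \<circ> adj H H T" if S: "S \<in> G" for S
    proof -
      have S': "S \<in> ops H H" "adj H H S \<in> ops H H" using S G by auto
      have "adj H H (adj H H S \<circ> T) = adj H H (T \<circ> adj H H S)"
        using T G(2)[OF S] by (simp add: commutant_def)
      then show ?thesis
        using adj_comp[OF H H H T' S'(2)] adj_comp[OF H H H S'(2) T'] adj_adj[OF H H S'(1)] by simp
    qed
    then show ?thesis using adj_in[OF H H T'] by (simp add: commutant_def)
  qed
qed (use H in \<open>auto dest: commutantD\<close>)

lemma commutant_alg:
  assumes "unital_alg H A"
  shows "unital_alg H (commutant H A)"
  by (rule unital_alg_commutant) (use unital_algD[OF assms] in blast)+

lemma iop_commutant:
  assumes "S \<in> commutant H A" "r ` C \<subseteq> A"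
  shows "S \<in> iop C H r H r"
  using assms unfolding commutant_def iop_def by blast

lemma tens_swap: "tens K H E (\<lambda>y x. t x y) E' (\<lambda>y x. t' x y) Y X = tens H K E t E' t' X Y"
proof -
  have "(\<forall>y\<in>hspace K. \<forall>x\<in>hspace H. T (t x y) = t' (X x) (Y y)) \<longleftrightarrow>
      (\<forall>x\<in>hspace H. \<forall>y\<in>hspace K. T (t x y) = t' (X x) (Y y))" for T by blast
  then show ?thesis by (simp only: tens_def)
qed

context std_base
begin

context
  fixes H :: "'h::complex_vector hilb" and r K s and E :: "'e::complex_vector hilb" and t
    and B0 :: "('l::complex_vector \<Rightarrow> 'l) set"
  assumes T: "is_tensor H r K s E t" and B0: "unital_alg K B0" and sB: "s ` B \<subseteq> B0"
begin

text \<open>With \<open>W = 1 \<otimes> R\<close>, every \<open>V\<close> in the span satisfies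
  \<open>W V = V R\<close>: on generators this is \<open>W |x> b = |x> R b = |x> b R\<close>.
  Applied to \<open>V = S |x>\<close>, it shows that \<open>S W\<close> and \<open>W S\<close> agree
  on elementary tensors.\<close>

lemma commutes_right_of_ket:
  assumes S: "S \<in> ops E E"
    and sub: "{S} \<odot> (ket K t ` hspace H) \<subseteq> cspan ((ket K t ` hspace H) \<odot> B0)"
    and R: "R \<in> commutant K B0"
  shows "S \<circ> tens H K E t E t (idop H) R = tens H K E t E t (idop H) R \<circ> S"
proof -
  note D = is_tensorD[OF T]
  interpret E: fd_hilbert E by (rule D(3))
  interpret K: fd_hilbert K by (rule D(5))
  note i = iop_idop[OF D(1)] iop_commutant[OF R sB]
  define W where "W = tens H K E t E t (idop H) R"
  have W: "W \<in> ops E E" unfolding W_def by (rule tens_ops[OF T T i])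
  have Wt: "W (t x y) = t x (R y)" if "x \<in> hspace H" "y \<in> hspace K" for x y
    using tens_apply[OF T T i that] that by (simp add: W_def)
  note Ro = commutantD(1)[OF R]
  have "V \<in> ops K E \<and> (\<forall>y\<in>hspace K. W (V y) = V (R y))"
    if "V \<in> cspan ((ket K t ` hspace H) \<odot> B0)" for V
    using that
  proof (induction rule: cspan_induct)
    case zero
    then show ?case using complex_vector.subspace_0[OF csubspace_ops[OF D(3), of K]] ops_zero_arg[OF W]
      by (intro conjI ballI) (simp_all add: zero_fun_def)
  next
    case (base V)
    then obtain x b where V: "x \<in> hspace H" "b \<in> B0" "V = ket K t x \<circ> b" by (auto simp: op_prods_def)
    have b: "b \<in> ops K K" using B0 V(2) unital_algD(4) by blast
    show ?case
    proof (intro conjI ballI)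
      show "V \<in> ops K E" unfolding V(3) by (rule ops_comp[OF ket_ops[OF T V(1)] b])
      show "W (V y) = V (R y)" if y: "y \<in> hspace K" for y
        using V commutantD(2)[OF R V(2), of y] ops_in[OF b y] ops_in[OF b ops_in[OF Ro y]]
        by (simp add: ket_def Wt)
    qed
  next
    case (add U V)
    show ?case
    proof (intro conjI ballI)
      show "U + V \<in> ops K E"
        using add complex_vector.subspace_add[OF csubspace_ops[OF D(3), of K]] by blast
      show "W ((U + V) y) = (U + V) (R y)" if "y \<in> hspace K" for y
        using add that by (auto simp: ops_add[OF W] ops_in)
    qed
  next
    case (scale c V)
    show ?case
    proof (intro conjI ballI)
      show "c *\<^sub>C V \<in> ops K E"
        using scale complex_vector.subspace_scale[OF csubspace_ops[OF D(3), of K]] by blast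
      show "W ((c *\<^sub>C V) y) = (c *\<^sub>C V) (R y)" if "y \<in> hspace K" for y
        using scale that by (auto simp: scaleC_fun_def ops_scale[OF W] ops_in)
    qed
  qed
  note V = this
  have *: "W (S (ket K t x y)) = S (ket K t x (R y))" if "x \<in> hspace H" "y \<in> hspace K" for x y
  proof -
    have "S \<circ> ket K t x \<in> cspan ((ket K t ` hspace H) \<odot> B0)"
      using sub that(1) unfolding op_prods_def by blast
    from V[OF this] show ?thesis using that(2) by simp
  qed
  have "S \<circ> W = W \<circ> S"
    by (rule tensor_ops_eqI[OF T ops_comp[OF S W] ops_comp[OF W S]])
      (use * ops_in[OF Ro] in \<open>auto simp: ket_def Wt\<close>)
  then show ?thesis by (simp add: W_def)
qed

text \<open>A frame \<open>X\<close> of the representation \<open>r\<close> induces a decomposition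
  of the identity of \<open>E\<close>: by \<open>adj_ket\<close> and balancing,
  \<open>|X i z><X i z|\<close> maps \<open>x \<otimes> y\<close> to
  \<open>X i X i* x \<otimes> y\<close>.\<close>

lemma ket_frame:
  obtains n :: nat and X where "\<And>i. i < n \<Longrightarrow> X i \<in> hspace H"
    "\<And>e. e \<in> hspace E \<Longrightarrow> (\<Sum>i<n. ket K t (X i) (adj K E (ket K t (X i)) e)) = e"
proof -
  note D = is_tensorD[OF T]
  interpret E: fd_hilbert E by (rule D(3))
  note r = unital_repD[OF D(1)]
  obtain n :: nat and X where X: "\<And>i. i < n \<Longrightarrow> X i \<in> intertwiners hh Bd H r"
    "\<And>v. v \<in> hspace H \<Longrightarrow> (\<Sum>i<n. X i (adj hh H (X i) v)) = v"
    by (rule rep_frame[OF L.algC D(1)]) blast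
  have Xo: "X i \<in> ops hh H" if "i < n" for i using X(1)[OF that] by (rule intertwinersD)
  have Xz: "X i z \<in> hspace H" if "i < n" for i using Xo[OF that] L.z_in by (rule ops_in)
  have k: "ket K t (X i z) \<in> ops K E" if "i < n" for i by (rule ket_ops[OF T Xz[OF that]])
  have "(\<Sum>i<n. ket K t (X i z) \<circ> adj K E (ket K t (X i z))) = idop E"
  proof (rule tensor_ops_eqI[OF T])
    show "(\<Sum>i<n. ket K t (X i z) \<circ> adj K E (ket K t (X i z))) \<in> ops E E"
      by (intro complex_vector.subspace_sum[OF csubspace_ops[OF D(3)]])
        (auto intro!: ops_comp k adj_in[OF D(5,3)])
    show "idop E \<in> ops E E" by (rule idop_ops[OF D(3)])
    fix x y assume x: "x \<in> hspace H" and y: "y \<in> hspace K"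
    have k2: "ket H (\<lambda>y x. t x y) y \<in> ops H E"
      by (rule std_base.ket_ops[OF swap is_tensor_swap[OF T] y])
    have m: "adj hh H (X i) x \<in> hspace hh" "X i (adj hh H (X i) x) \<in> hspace H" if "i < n" for i
      using adj_in[OF hh D(4) Xo[OF that]] Xo[OF that] x by (auto intro: ops_in)
    have "ket K t (X i z) (adj K E (ket K t (X i z)) (t x y)) = ket H (\<lambda>y x. t x y) y (X i (adj hh H (X i) x))"
      if i: "i < n" for i
    proof -
      define b where "b = adj hh H (L.lift r (X i z)) \<circ> L.lift r x"
      have b: "b \<in> B" unfolding b_def by (rule L_lift_in_B[OF D(1) Xz[OF i] x])
      have sb: "s b y \<in> hspace K" using unital_repD(2)[OF D(2) b] y by (rule ops_in)
      have "adj K E (ket K t (X i z)) (t x y) = s b y"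
        unfolding b_def by (rule adj_ket[OF T Xz[OF i] x y])
      moreover have "t (X i z) (s b y) = t (L.lift r (X i z) (b z)) y"
        by (rule tensor_balanced_right[OF T Xz[OF i] y b])
      moreover have "L.lift r (X i z) (b z) = X i (adj hh H (X i) x)"
        using L.lift_eq[OF D(1) X(1)[OF i]] L.lift_z[OF D(1) x] by (simp add: b_def)
      ultimately show ?thesis using m[OF i] sb by (simp add: ket_def)
    qed
    then have "(\<Sum>i<n. ket K t (X i z) \<circ> adj K E (ket K t (X i z))) (t x y) =
        ket H (\<lambda>y x. t x y) y (\<Sum>i<n. X i (adj hh H (X i) x))"
      using m by (subst ops_sum[OF D(4) k2]) (simp_all add: fun_sum_apply)
    then show "(\<Sum>i<n. ket K t (X i z) \<circ> adj K E (ket K t (X i z))) (t x y) = idop E (t x y)"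
      using X(2)[OF x] x D(6)[OF x y] by (simp add: ket_def)
  qed
  from fun_cong[OF this] show thesis
    by (intro that[of n "\<lambda>i. X i z"] Xz) (simp_all add: fun_sum_apply)
qed

text \<open>\<open>ket_frame\<close> gives \<open>S |x> = \<Sum> |X i> V' i\<close> with
  \<open>V' i = <X i| S |x>\<close>. The coefficients commute with the commutant of
  \<open>B0\<close>, so they lie in \<open>B0\<close> by the bicommutant theorem.\<close>

lemma ket_of_commutes_right:
  assumes S: "S \<in> ops E E"
    and comm: "\<And>R. R \<in> commutant K B0 \<Longrightarrow>
      S \<circ> tens H K E t E t (idop H) R = tens H K E t E t (idop H) R \<circ> S"
  shows "{S} \<odot> (ket K t ` hspace H) \<subseteq> cspan ((ket K t ` hspace H) \<odot> B0)"
proof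
  note D = is_tensorD[OF T]
  fix V assume "V \<in> {S} \<odot> (ket K t ` hspace H)"
  then obtain x where x: "x \<in> hspace H" and V: "V = S \<circ> ket K t x" by (auto simp: op_prods_def)
  obtain n :: nat and X where X: "\<And>i. i < n \<Longrightarrow> X i \<in> hspace H"
    "\<And>e. e \<in> hspace E \<Longrightarrow> (\<Sum>i<n. ket K t (X i) (adj K E (ket K t (X i)) e)) = e"
    by (rule ket_frame) blast
  have k: "ket K t x \<in> ops K E" if "x \<in> hspace H" for x by (rule ket_ops[OF T that])
  define V' where "V' i = adj K E (ket K t (X i)) \<circ> S \<circ> ket K t x" for i
  have Vo: "V \<in> ops K E" unfolding V by (rule ops_comp[OF S k[OF x]])
  have V'o: "V' i \<in> ops K K" if "i < n" for i
    unfolding V'_def using ops_comp[OF adj_in[OF D(5,3) k[OF X(1)[OF that]]] Vo]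
    by (simp add: V comp_assoc)
  have V': "V' i \<in> B0" if i: "i < n" for i
  proof -
    have "V' i \<circ> R = R \<circ> V' i" if R: "R \<in> commutant K B0" for R
    proof -
      note Ro = commutantD(1)[OF R]
      note io = iop_idop[OF D(1)] iop_commutant[OF R sB]
      define W where "W = tens H K E t E t (idop H) R"
      have W: "W \<in> ops E E" unfolding W_def by (rule tens_ops[OF T T io])
      have Wt: "W (t x y) = t x (R y)" if "x \<in> hspace H" "y \<in> hspace K" for x y
        using tens_apply[OF T T io that] that by (simp add: W_def)
      note a = adj_in[OF D(5,3) k[OF X(1)[OF i]]]
      have 1: "W \<circ> ket K t x = ket K t x \<circ> R"
        by (rule ops_eqI[OF ops_comp[OF W k[OF x]] ops_comp[OF k[OF x] Ro]])
          (use x ops_in[OF Ro] in \<open>auto simp: ket_def Wt\<close>)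
      \<comment> \<open>On an elementary tensor the adjoint ket acts by an element of
        \<open>s B\<close>, which lies in \<open>B0\<close> and so commutes with
        \<open>R\<close>.\<close>
      have 2: "adj K E (ket K t (X i)) \<circ> W = R \<circ> adj K E (ket K t (X i))"
      proof (rule tensor_ops_eqI[OF T ops_comp[OF a W] ops_comp[OF Ro a]])
        fix u y assume u: "u \<in> hspace H" and y: "y \<in> hspace K"
        have sb: "s (adj hh H (L.lift r (X i)) \<circ> L.lift r u) \<in> B0"
          using sB L_lift_in_B[OF D(1) X(1)[OF i] u] by auto
        show "(adj K E (ket K t (X i)) \<circ> W) (t u y) = (R \<circ> adj K E (ket K t (X i))) (t u y)"
          using adj_ket[OF T X(1)[OF i] u y] adj_ket[OF T X(1)[OF i] u ops_in[OF Ro y]]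
            commutantD(2)[OF R sb] u y by (simp add: Wt)
      qed
      have 3: "S \<circ> W = W \<circ> S" using comm[OF R] by (simp add: W_def)
      have "V' i \<circ> R = adj K E (ket K t (X i)) \<circ> S \<circ> (ket K t x \<circ> R)" by (simp add: V'_def comp_assoc)
      also have "\<dots> = adj K E (ket K t (X i)) \<circ> (S \<circ> W) \<circ> ket K t x" by (simp add: 1[symmetric] comp_assoc)
      also have "\<dots> = (adj K E (ket K t (X i)) \<circ> W) \<circ> S \<circ> ket K t x" by (simp only: 3) (simp add: comp_assoc)
      also have "\<dots> = R \<circ> V' i" by (simp only: 2) (simp add: V'_def comp_assoc)
      finally show ?thesis .
    qed
    then have "V' i \<in> commutant K (commutant K B0)" using V'o[OF i] by (simp add: commutant_def)
    then show ?thesis using bicommutant[OF B0] by simp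
  qed
  have "V = (\<Sum>i<n. ket K t (X i) \<circ> V' i)"
  proof (rule ops_eqI[OF Vo])
    show "(\<Sum>i<n. ket K t (X i) \<circ> V' i) \<in> ops K E"
      by (intro complex_vector.subspace_sum[OF csubspace_ops[OF D(3)]])
        (auto intro!: ops_comp k V'o X)
    show "V y = (\<Sum>i<n. ket K t (X i) \<circ> V' i) y" if "y \<in> hspace K" for y
      using X(2)[OF ops_in[OF Vo that]] by (simp add: fun_sum_apply V'_def V)
  qed
  also have "\<dots> \<in> cspan ((ket K t ` hspace H) \<odot> B0)"
    using X(1) V' by (intro complex_vector.span_sum complex_vector.span_base) (auto simp: op_prods_def)
  finally show "V \<in> cspan ((ket K t ` hspace H) \<odot> B0)" .
qed

end

context
  fixes H :: "'h::complex_vector hilb" and r K s and E :: "'e::complex_vector hilb" and t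
    and A and B0 :: "('l::complex_vector \<Rightarrow> 'l) set"
  assumes T: "is_tensor H r K s E t" and A: "unital_alg H A" and B0: "unital_alg K B0"
    and rA: "r ` Bd \<subseteq> A" and sB: "s ` B \<subseteq> B0"
begin

lemma commutant_tens:
  assumes S: "S \<in> commutant H A" and R: "R \<in> commutant K B0"
  shows "tens H K E t E t S R \<in> ops E E"
    "x \<in> hspace H \<Longrightarrow> y \<in> hspace K \<Longrightarrow> tens H K E t E t S R (t x y) = t (S x) (R y)"
    "tens H K E t E t S R = tens H K E t E t S (idop K) \<circ> tens H K E t E t (idop H) R"
proof -
  note D = is_tensorD[OF T]
  note i = iop_commutant[OF S rA] iop_commutant[OF R sB]
  show "tens H K E t E t S R \<in> ops E E" by (rule tens_ops[OF T T i])
  show "x \<in> hspace H \<Longrightarrow> y \<in> hspace K \<Longrightarrow> tens H K E t E t S R (t x y) = t (S x) (R y)"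
    by (rule tens_apply[OF T T i])
  show "tens H K E t E t S R = tens H K E t E t S (idop K) \<circ> tens H K E t E t (idop H) R"
    using tens_comp[OF T T T iop_idop[OF D(1)] i(2) i(1) iop_idop[OF D(2)]]
      comp_idop[OF commutantD(1)[OF S]] idop_comp[OF D(5) commutantD(1)[OF R]] by simp
qed

lemma fib_alg: "unital_alg E (fib H A K B0 E t)"
  unfolding fib_def
proof (rule unital_alg_commutant[OF is_tensorD(3)[OF T]])
  note D = is_tensorD[OF T]
  show "{tens H K E t E t S R |S R. S \<in> commutant H A \<and> R \<in> commutant K B0} \<subseteq> ops E E"
    using commutant_tens by auto
  fix W assume "W \<in> {tens H K E t E t S R |S R. S \<in> commutant H A \<and> R \<in> commutant K B0}"
  then obtain S R where W: "S \<in> commutant H A" "R \<in> commutant K B0" "W = tens H K E t E t S R" by blast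
  have "adj E E W = tens H K E t E t (adj H H S) (adj K K R)"
    unfolding W(3) by (rule tens_adj[OF T T iop_commutant[OF W(1) rA] iop_commutant[OF W(2) sB]])
  moreover have "adj H H S \<in> commutant H A" "adj K K R \<in> commutant K B0"
    using unital_algD(6)[OF commutant_alg] A B0 W by auto
  ultimately show "adj E E W \<in> {tens H K E t E t S R |S R. S \<in> commutant H A \<and> R \<in> commutant K B0}"
    by blast
qed

text \<open>\<open>S \<otimes> R\<close> is the product of \<open>S \<otimes> 1\<close> and
  \<open>1 \<otimes> R\<close>, so it suffices to commute with one-sided tensors. Each of the two
  ket conditions corresponds to one side, the second by \<open>swap\<close>.\<close>

lemma fib_iff:
  "S \<in> fib H A K B0 E t \<longleftrightarrow> S \<in> ops E E \<and>
    {S} \<odot> (ket K t ` hspace H) \<subseteq> cspan ((ket K t ` hspace H) \<odot> B0) \<and>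
    {S} \<odot> (ket H (\<lambda>y x. t x y) ` hspace K) \<subseteq> cspan ((ket H (\<lambda>y x. t x y) ` hspace K) \<odot> A)"
  (is "_ \<longleftrightarrow> ?R S")
proof
  note D = is_tensorD[OF T]
  note T' = is_tensor_swap[OF T]
  note sw = tens_swap[where K = K and H = H and E = E and t = t and E' = E and t' = t]
  have idA: "idop H \<in> commutant H A" "idop K \<in> commutant K B0"
    using unital_algD(3)[OF commutant_alg] A B0 by auto
  {
    assume S: "S \<in> fib H A K B0 E t"
    then have So: "S \<in> ops E E" by (simp add: fib_def commutant_def)
    have comm: "S \<circ> tens H K E t E t Q R = tens H K E t E t Q R \<circ> S"
      if "Q \<in> commutant H A" "R \<in> commutant K B0" for Q R
      using S that by (auto simp: fib_def commutant_def)
    show "?R S"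
    proof (intro conjI)
      show "{S} \<odot> (ket K t ` hspace H) \<subseteq> cspan ((ket K t ` hspace H) \<odot> B0)"
        by (rule ket_of_commutes_right[OF T B0 sB So comm[OF idA(1)]])
      show "{S} \<odot> (ket H (\<lambda>y x. t x y) ` hspace K) \<subseteq> cspan ((ket H (\<lambda>y x. t x y) ` hspace K) \<odot> A)"
        by (rule std_base.ket_of_commutes_right[OF swap T' A rA So])
          (use comm[OF _ idA(2)] in \<open>simp add: sw\<close>)
    qed (rule So)
  next
    assume R: "?R S"
    have "S \<circ> tens H K E t E t P Q = tens H K E t E t P Q \<circ> S"
      if P: "P \<in> commutant H A" and Q: "Q \<in> commutant K B0" for P Q
    proof -
      have 1: "S \<circ> tens H K E t E t (idop H) Q = tens H K E t E t (idop H) Q \<circ> S"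
        using R by (intro commutes_right_of_ket[OF T B0 sB _ _ Q]) auto
      have 2: "S \<circ> tens H K E t E t P (idop K) = tens H K E t E t P (idop K) \<circ> S"
        using R std_base.commutes_right_of_ket[OF swap T' A rA _ _ P, of S] by (simp add: sw)
      show ?thesis
        unfolding commutant_tens(3)[OF P Q] by (simp only: comp_assoc[symmetric] 2) (simp only: comp_assoc 1)
    qed
    then show "S \<in> fib H A K B0 E t" using R by (auto simp: fib_def commutant_def)
  }
qed

end

end

section \<open>Fiber products of morphisms\<close>

definition fibmap where
  "fibmap H A K B E t L C M D E' t' \<phi> \<psi> = (THE \<Theta>.
     star_hom E (fib H A K B E t) E' (fib L C M D E' t') \<Theta> \<and>
     (\<forall>S. S \<notin> fib H A K B E t \<longrightarrow> \<Theta> S = 0) \<and>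
     (\<forall>S\<in>fib H A K B E t. \<forall>X\<in>intertwiners H A L \<phi>. \<forall>Y\<in>intertwiners K B M \<psi>.
        \<Theta> S \<circ> tens H K E t E' t' X Y = tens H K E t E' t' X Y \<circ> S))"

lemma intertwiners_iop:
  assumes "X \<in> intertwiners H A L \<phi>" "r ` C \<subseteq> A" "\<And>c. c \<in> C \<Longrightarrow> \<phi> (r c) = r' c"
  shows "X \<in> iop C H r L r'"
  using assms unfolding intertwiners_def iop_def by force

lemma unital_rep_of_star_hom:
  assumes "star_hom H A L C \<phi>" "\<phi> (idop H) = idop L" "C \<subseteq> ops L L" "fd_hilbert L"
  shows "unital_rep H A L \<phi>"
  using assms unfolding unital_rep_def star_hom_def by blast

context std_base
begin

section \<open>Construction of the fiber product of two morphisms\<close>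

context
  fixes H :: "'h::complex_vector hilb" and r K s and E :: "'e::complex_vector hilb" and t
    and L :: "'l::complex_vector hilb" and r' M s' and E' :: "'f::complex_vector hilb" and t'
    and A C D \<phi> \<psi> and B0 :: "('m::complex_vector \<Rightarrow> 'm) set"
  assumes T: "is_tensor H r K s E t" and T': "is_tensor L r' M s' E' t'"
    and A: "unital_alg H A" and B0: "unital_alg K B0"
    and rA: "r ` Bd \<subseteq> A" and sB: "s ` B \<subseteq> B0"
    and \<phi>: "star_hom H A L C \<phi>" "\<phi> (idop H) = idop L" "C \<subseteq> ops L L" "\<And>c. c \<in> Bd \<Longrightarrow> \<phi> (r c) = r' c"
    and \<psi>: "star_hom K B0 M D \<psi>" "\<psi> (idop K) = idop M" "D \<subseteq> ops M M" "\<And>b. b \<in> B \<Longrightarrow> \<psi> (s b) = s' b"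
begin

private abbreviation "IX \<equiv> intertwiners H A L \<phi>"
private abbreviation "IY \<equiv> intertwiners K B0 M \<psi>"
private abbreviation "W \<equiv> tens H K E t E' t'"
private abbreviation "FS \<equiv> fib H A K B0 E t"

private lemmas TD = is_tensorD[OF T]
private lemmas TD' = is_tensorD[OF T']
private lemmas rep\<phi> = unital_rep_of_star_hom[OF \<phi>(1,2,3) is_tensorD(4)[OF T']]
private lemmas rep\<psi> = unital_rep_of_star_hom[OF \<psi>(1,2,3) is_tensorD(5)[OF T']]
private lemma Xi: "X \<in> IX \<Longrightarrow> X \<in> iop Bd H r L r'"
  by (erule intertwiners_iop[OF _ rA]) (rule \<phi>(4))

private lemma Yi: "Y \<in> IY \<Longrightarrow> Y \<in> iop B K s M s'"
  by (erule intertwiners_iop[OF _ sB]) (rule \<psi>(4))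

private lemma W_ops: "X \<in> IX \<Longrightarrow> Y \<in> IY \<Longrightarrow> W X Y \<in> ops E E'"
  by (rule tens_ops[OF T T' Xi Yi])

private lemma W_t: "X \<in> IX \<Longrightarrow> Y \<in> IY \<Longrightarrow> x \<in> hspace H \<Longrightarrow> y \<in> hspace K \<Longrightarrow> W X Y (t x y) = t' (X x) (Y y)"
  by (rule tens_apply[OF T T' Xi Yi])

text \<open>Frames of \<phi> and \<psi> write \<open>l\<close> as the sum of
  \<open>X i (X i* l)\<close> and \<open>m\<close> as the sum of \<open>Y j (Y j* m)\<close>;
  bilinearity does the rest. This is what makes the fiber product of morphisms unique.\<close>

private lemma W_span: "cspan (\<Union>X\<in>IX. \<Union>Y\<in>IY. W X Y ` hspace E) = hspace E'" (is "cspan ?G = _")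
proof
  interpret E': fd_hilbert E' by (rule TD'(3))
  show "cspan ?G \<subseteq> hspace E'"
    using ops_in[OF W_ops] by (intro E'.span_in) blast
  have "t' l m \<in> cspan ?G" if l: "l \<in> hspace L" and m: "m \<in> hspace M" for l m
  proof -
    obtain n :: nat and X where X: "\<And>i. i < n \<Longrightarrow> X i \<in> IX"
      "\<And>v. v \<in> hspace L \<Longrightarrow> (\<Sum>i<n. X i (adj H L (X i) v)) = v"
      by (rule rep_frame[OF A rep\<phi>]) blast
    obtain p :: nat and Y where Y: "\<And>i. i < p \<Longrightarrow> Y i \<in> IY"
      "\<And>v. v \<in> hspace M \<Longrightarrow> (\<Sum>i<p. Y i (adj K M (Y i) v)) = v"
      by (rule rep_frame[OF B0 rep\<psi>]) blast
    have Xo: "X i \<in> ops H L" if "i < n" for i using X(1)[OF that] by (rule intertwinersD)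
    have Yo: "Y i \<in> ops K M" if "i < p" for i using Y(1)[OF that] by (rule intertwinersD)
    have mx: "adj H L (X i) l \<in> hspace H" "X i (adj H L (X i) l) \<in> hspace L" if "i < n" for i
      using adj_in[OF TD(4) TD'(4) Xo[OF that]] Xo[OF that] l by (auto intro: ops_in)
    have my: "adj K M (Y i) m \<in> hspace K" "Y i (adj K M (Y i) m) \<in> hspace M" if "i < p" for i
      using adj_in[OF TD(5) TD'(5) Yo[OF that]] Yo[OF that] m by (auto intro: ops_in)
    have k: "ket L (\<lambda>y x. t' x y) m \<in> ops L E'"
      by (rule std_base.ket_ops[OF swap is_tensor_swap[OF T'] m])
    have "t' l m = ket L (\<lambda>y x. t' x y) m (\<Sum>i<n. X i (adj H L (X i) l))"
      using l X(2)[OF l] by (simp add: ket_def)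
    also have "\<dots> = (\<Sum>i<n. t' (X i (adj H L (X i) l)) m)"
      using mx by (subst ops_sum[OF TD'(4) k]) (simp_all add: ket_def)
    also have "\<dots> = (\<Sum>i<n. \<Sum>j<p. t' (X i (adj H L (X i) l)) (Y j (adj K M (Y j) m)))"
    proof (rule sum.cong[OF refl])
      fix i assume "i \<in> {..<n}"
      then have i: "i < n" by simp
      have "t' (X i (adj H L (X i) l)) m = ket M t' (X i (adj H L (X i) l)) (\<Sum>j<p. Y j (adj K M (Y j) m))"
        using Y(2)[OF m] m by (simp add: ket_def)
      also have "\<dots> = (\<Sum>j<p. t' (X i (adj H L (X i) l)) (Y j (adj K M (Y j) m)))"
        using my by (subst ops_sum[OF TD'(5) ket_ops[OF T' mx(2)[OF i]]]) (simp_all add: ket_def)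
      finally show "t' (X i (adj H L (X i) l)) m =
          (\<Sum>j<p. t' (X i (adj H L (X i) l)) (Y j (adj K M (Y j) m)))" .
    qed
    also have "\<dots> = (\<Sum>i<n. \<Sum>j<p. W (X i) (Y j) (t (adj H L (X i) l) (adj K M (Y j) m)))"
      by (intro sum.cong refl W_t[symmetric] X Y mx my) simp_all
    also have "\<dots> \<in> cspan ?G"
      by (intro complex_vector.span_sum complex_vector.span_base, rule UN_I[OF X(1)], simp,
          rule UN_I[OF Y(1)], simp, rule imageI, rule TD(6)[OF mx(1) my(1)]) simp_all
    finally show ?thesis .
  qed
  then have "cspan ((\<lambda>(x, y). t' x y) ` (hspace L \<times> hspace M)) \<subseteq> cspan ?G"
    by (intro complex_vector.span_minimal) auto
  then show "hspace E' \<subseteq> cspan ?G" using TD'(7) by simp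
qed

private lemma fibD: "S \<in> FS \<Longrightarrow> S \<in> ops E E"
  "S \<in> FS \<Longrightarrow> P \<in> commutant H A \<Longrightarrow> Q \<in> commutant K B0 \<Longrightarrow>
    S (tens H K E t E t P Q e) = tens H K E t E t P Q (S e)"
  unfolding fib_def by (blast dest: commutantD(1), rule commutantD(2), blast+)

text \<open>\<open>(W X' Y')* W X Y\<close> is the tensor product of \<open>X'* X\<close> and
  \<open>Y'* Y\<close>, which lie in the commutants of \<open>A\<close> and \<open>B0\<close>; so
  \<open>S\<close> commutes with it.\<close>

private lemma W_inner:
  assumes X: "X \<in> IX" "X' \<in> IX" and Y: "Y \<in> IY" "Y' \<in> IY" and S: "S \<in> FS"
    and e: "e \<in> hspace E" "e' \<in> hspace E"
  shows "hinner E' (W X' Y' e') (W X Y (S e)) = hinner E' (W X' Y' (adj E E S e')) (W X Y e)"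
proof -
  note So = fibD(1)[OF S]
  have Sa: "adj E E S \<in> ops E E" by (rule adj_in[OF TD(3,3) So])
  define P where "P = adj H L X' \<circ> X"
  define Q where "Q = adj K M Y' \<circ> Y"
  have P: "P \<in> commutant H A" unfolding P_def by (rule intertwiner_adj_comp[OF A rep\<phi> X(2,1)])
  have Q: "Q \<in> commutant K B0" unfolding Q_def by (rule intertwiner_adj_comp[OF B0 rep\<psi> Y(2,1)])
  define V where "V = tens H K E t E t P Q"
  have V: "V \<in> ops E E"
    unfolding V_def by (rule tens_ops[OF T T iop_commutant[OF P rA] iop_commutant[OF Q sB]])
  have WW: "adj E E' (W X' Y') \<circ> W X Y = V"
    unfolding tens_adj[OF T T' Xi[OF X(2)] Yi[OF Y(2)]] V_def P_def Q_def
    by (rule tens_comp[OF T T' T Xi[OF X(1)] Yi[OF Y(1)]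
        iop_adj[OF L.algC TD(1) TD'(1) Xi[OF X(2)]] iop_adj[OF R.algC TD(2) TD'(2) Yi[OF Y(2)]]])
  have *: "hinner E' (W X' Y' a) (W X Y b) = hinner E a (V b)" if "a \<in> hspace E" "b \<in> hspace E" for a b
    using adj_right[OF TD(3) TD'(3) W_ops[OF X(2) Y(2)] ops_in[OF W_ops[OF X(1) Y(1)] that(2)] that(1)]
      WW by (simp add: fun_eq_iff)
  have "hinner E' (W X' Y' e') (W X Y (S e)) = hinner E e' (V (S e))"
    using ops_in[OF So] e by (simp add: *)
  also have "V (S e) = S (V e)" using fibD(2)[OF S P Q] by (simp add: V_def)
  also have "hinner E e' (S (V e)) = hinner E (adj E E S e') (V e)"
    by (rule adj_left[OF TD(3,3) So e(2) ops_in[OF V e(1)], symmetric])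
  also have "\<dots> = hinner E' (W X' Y' (adj E E S e')) (W X Y e)"
    using ops_in[OF Sa] e by (simp add: *)
  finally show ?thesis .
qed

text \<open>By \<open>W_inner\<close>, \<open>W X' Y' (S* e')\<close> is the dual vector of
  \<open>W X' Y' e'\<close>, which makes \<open>W X Y e \<mapsto> W X Y (S e)\<close> well
  defined.\<close>

private lemma theta_ex1:
  assumes S: "S \<in> FS"
  shows "\<exists>!Z. Z \<in> ops E' E' \<and> (\<forall>X\<in>IX. \<forall>Y\<in>IY. Z \<circ> W X Y = W X Y \<circ> S)"
proof -
  note So = fibD(1)[OF S]
  have Sa: "adj E E S \<in> ops E E" by (rule adj_in[OF TD(3,3) So])
  let ?J = "IX \<times> IY \<times> hspace E" and ?g = "\<lambda>(X, Y, e). W X Y e"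
  have "?g ` ?J = (\<Union>X\<in>IX. \<Union>Y\<in>IY. W X Y ` hspace E)" by force
  then have sp: "cspan (?g ` ?J) = hspace E'" using W_span by simp
  have "\<exists>!Z. Z \<in> ops E' E' \<and> (\<forall>j\<in>?J. Z (?g j) = (\<lambda>(X, Y, e). W X Y (S e)) j)"
  proof (rule ex1_op_generators[OF TD'(3,3) sp _ sp])
    show "(\<lambda>(X, Y, e). W X Y (S e)) j \<in> hspace E'" if "j \<in> ?J" for j
      using that by (auto intro!: ops_in[OF W_ops] ops_in[OF So])
    fix h assume "h \<in> ?g ` ?J"
    then obtain X' Y' e' where h: "X' \<in> IX" "Y' \<in> IY" "e' \<in> hspace E" "h = W X' Y' e'" by auto
    show "\<exists>e\<in>hspace E'. \<forall>j\<in>?J. hinner E' h ((\<lambda>(X, Y, e). W X Y (S e)) j) = hinner E' e (?g j)"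
      using W_inner[OF _ h(1) _ h(2) S _ h(3)] h(4) ops_in[OF W_ops[OF h(1,2)] ops_in[OF Sa h(3)]]
      by (intro bexI[of _ "W X' Y' (adj E E S e')"]) auto
  qed
  moreover have "(\<forall>j\<in>?J. Z (?g j) = (\<lambda>(X, Y, e). W X Y (S e)) j) \<longleftrightarrow>
      (\<forall>X\<in>IX. \<forall>Y\<in>IY. Z \<circ> W X Y = W X Y \<circ> S)" if "Z \<in> ops E' E'" for Z
  proof -
    have "Z \<circ> W X Y = W X Y \<circ> S \<longleftrightarrow> (\<forall>e\<in>hspace E. Z (W X Y e) = W X Y (S e))"
      if "X \<in> IX" "Y \<in> IY" for X Y
      using ops_eqI[OF ops_comp[OF \<open>Z \<in> _\<close> W_ops[OF that]] ops_comp[OF W_ops[OF that] So]]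
      by (auto simp: fun_eq_iff)
    then show ?thesis by auto
  qed
  ultimately show ?thesis by (auto simp: Ex1_def)
qed

definition theta where
  "theta S = (if S \<in> FS then THE Z. Z \<in> ops E' E' \<and> (\<forall>X\<in>IX. \<forall>Y\<in>IY. Z \<circ> W X Y = W X Y \<circ> S) else 0)"

private lemma theta:
  assumes "S \<in> FS"
  shows theta_ops: "theta S \<in> ops E' E'"
    and theta_W: "X \<in> IX \<Longrightarrow> Y \<in> IY \<Longrightarrow> theta S (W X Y e) = W X Y (S e)"
  using theI'[OF theta_ex1[OF assms]] assms by (auto simp: theta_def fun_eq_iff)

private lemma theta_eqI:
  assumes S: "S \<in> FS" and Z: "Z \<in> ops E' E'"
    and e: "\<And>X Y e. X \<in> IX \<Longrightarrow> Y \<in> IY \<Longrightarrow> e \<in> hspace E \<Longrightarrow> Z (W X Y e) = W X Y (S e)"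
  shows "Z = theta S"
  by (rule ops_eqI_span[OF Z theta_ops[OF S] W_span]) (use e theta_W[OF S] in auto)

private lemma theta_hom: "star_hom E FS E' (fib L C M D E' t') theta"
  unfolding star_hom_def
proof (intro conjI ballI allI)
  note falg = unital_algD[OF fib_alg[OF T A B0 rA sB]]
  note so = csubspace_ops[OF TD'(3), of E']
  interpret E': fd_hilbert E' by (rule TD'(3))
  have We: "W X Y e \<in> hspace E'" if "X \<in> IX" "Y \<in> IY" "e \<in> hspace E" for X Y e
    using W_ops[OF that(1,2)] that(3) by (rule ops_in)
  {
    fix S assume S: "S \<in> FS"
    note So = fibD(1)[OF S]
    note th = theta_ops[OF S]
    show "theta (a *\<^sub>C S) = a *\<^sub>C theta S" for a
    proof (rule theta_eqI[symmetric])
      show "a *\<^sub>C S \<in> FS" by (rule complex_vector.subspace_scale[OF falg(2) S])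
      show "a *\<^sub>C theta S \<in> ops E' E'" by (rule complex_vector.subspace_scale[OF so th])
      show "(a *\<^sub>C theta S) (W X Y e) = W X Y ((a *\<^sub>C S) e)"
        if "X \<in> IX" "Y \<in> IY" "e \<in> hspace E" for X Y e
        using theta_W[OF S that(1,2)] ops_scale[OF W_ops[OF that(1,2)] ops_in[OF So that(3)]]
        by (simp add: scaleC_fun_def)
    qed
    show "theta (adj E E S) = adj E' E' (theta S)"
    proof (rule theta_eqI[symmetric])
      show S': "adj E E S \<in> FS" using falg(6) S by blast
      show a: "adj E' E' (theta S) \<in> ops E' E'" by (rule adj_in[OF TD'(3,3) th])
      fix X Y e assume X: "X \<in> IX" and Y: "Y \<in> IY" and e: "e \<in> hspace E"
      show "adj E' E' (theta S) (W X Y e) = W X Y (adj E E S e)"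
      proof (rule E'.inner_eqI_span[OF _ _ W_span])
        show "adj E' E' (theta S) (W X Y e) \<in> hspace E'" using a We[OF X Y e] by (rule ops_in)
        show "W X Y (adj E E S e) \<in> hspace E'" using We[OF X Y] ops_in[OF fibD(1)[OF S'] e] by blast
        fix g assume "g \<in> (\<Union>X\<in>IX. \<Union>Y\<in>IY. W X Y ` hspace E)"
        then obtain X' Y' e' where g: "X' \<in> IX" "Y' \<in> IY" "e' \<in> hspace E" "g = W X' Y' e'" by auto
        have "hinner E' g (adj E' E' (theta S) (W X Y e)) = hinner E' (W X' Y' (S e')) (W X Y e)"
          using adj_right[OF TD'(3,3) th We[OF X Y e] We[OF g(1-3)]] theta_W[OF S g(1,2)] g(4) by simp
        also have "\<dots> = hinner E' (W X' Y' e') (W X Y (adj E E S e))"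
          using W_inner[OF X g(1) Y g(2) S' e g(3)] adj_adj[OF TD(3,3) So] by simp
        finally show "hinner E' g (adj E' E' (theta S) (W X Y e)) = hinner E' g (W X Y (adj E E S e))"
          by (simp only: g(4))
      qed
    qed
    fix R assume R: "R \<in> FS"
    note Ro = fibD(1)[OF R]
    show "theta (S + R) = theta S + theta R"
    proof (rule theta_eqI[symmetric])
      show "S + R \<in> FS" by (rule complex_vector.subspace_add[OF falg(2) S R])
      show "theta S + theta R \<in> ops E' E'"
        by (rule complex_vector.subspace_add[OF so th theta_ops[OF R]])
      show "(theta S + theta R) (W X Y e) = W X Y ((S + R) e)"
        if "X \<in> IX" "Y \<in> IY" "e \<in> hspace E" for X Y e
        using theta_W[OF S that(1,2)] theta_W[OF R that(1,2)]
          ops_add[OF W_ops[OF that(1,2)] ops_in[OF So that(3)] ops_in[OF Ro that(3)]] by simp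
    qed
    show "theta (S \<circ> R) = theta S \<circ> theta R"
      by (rule theta_eqI[symmetric])
        (use falg(5)[OF S R] ops_comp[OF th theta_ops[OF R]] theta_W[OF S] theta_W[OF R] in auto)
  }
  show "theta ` FS \<subseteq> fib L C M D E' t'"
  proof
    fix Z assume "Z \<in> theta ` FS"
    then obtain S where S: "S \<in> FS" "Z = theta S" by blast
    have "theta S \<circ> tens L M E' t' E' t' P Q = tens L M E' t' E' t' P Q \<circ> theta S"
      if P: "P \<in> commutant L C" and Q: "Q \<in> commutant M D" for P Q
    proof (rule ops_eqI_span[OF _ _ W_span])
      have rC: "r' ` Bd \<subseteq> C" "s' ` B \<subseteq> D" using \<phi>(1,4) \<psi>(1,4) rA sB unfolding star_hom_def by (metis image_subset_iff)+
      note io = iop_commutant[OF P rC(1)] iop_commutant[OF Q rC(2)]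
      note V = tens_ops[OF T' T' io]
      show "theta S \<circ> tens L M E' t' E' t' P Q \<in> ops E' E'"
        "tens L M E' t' E' t' P Q \<circ> theta S \<in> ops E' E'"
        using V theta_ops[OF S(1)] by (auto intro: ops_comp)
      fix g assume "g \<in> (\<Union>X\<in>IX. \<Union>Y\<in>IY. W X Y ` hspace E)"
      then obtain X Y e where g: "X \<in> IX" "Y \<in> IY" "e \<in> hspace E" "g = W X Y e" by auto
      \<comment> \<open>The commutant of \<open>C\<close> acts on the intertwiners of \<phi> from
        the left. So \<open>P \<otimes> Q\<close> only permutes the operators \<open>W X Y\<close>
        by which \<open>theta S\<close> is characterized.\<close>
      have PX: "P \<circ> X \<in> IX"
        using g(1) P \<phi>(1) unfolding intertwiners_def commutant_def star_hom_def
        by (auto intro!: ops_comp simp: fun_eq_iff image_subset_iff)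
      have QY: "Q \<circ> Y \<in> IY"
        using g(2) Q \<psi>(1) unfolding intertwiners_def commutant_def star_hom_def
        by (auto intro!: ops_comp simp: fun_eq_iff image_subset_iff)
      have c: "tens L M E' t' E' t' P Q \<circ> W X Y = W (P \<circ> X) (Q \<circ> Y)"
        by (rule tens_comp[OF T T' T' Xi[OF g(1)] Yi[OF g(2)] io])
      show "(theta S \<circ> tens L M E' t' E' t' P Q) g = (tens L M E' t' E' t' P Q \<circ> theta S) g"
        using theta_W[OF S(1) PX QY, of e] theta_W[OF S(1) g(1,2), of e] fun_cong[OF c, of e] fun_cong[OF c, of "S e"]
        by (simp add: g(4))
    qed
    then show "Z \<in> fib L C M D E' t'"
      using theta_ops[OF S(1)] S(2) unfolding fib_def commutant_def by blast
  qed
qed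

text \<open>The description denotes, and these three facts are all that calculations with
  \<open>fibmap\<close> use.\<close>

lemma fibmap:
  assumes S: "S \<in> fib H A K B0 E t"
  shows "fibmap H A K B0 E t L C M D E' t' \<phi> \<psi> S \<in> ops E' E'"
    and "X \<in> intertwiners H A L \<phi> \<Longrightarrow> Y \<in> intertwiners K B0 M \<psi> \<Longrightarrow>
      fibmap H A K B0 E t L C M D E' t' \<phi> \<psi> S (tens H K E t E' t' X Y e) = tens H K E t E' t' X Y (S e)"
    and fibmap_eqI: "Z \<in> ops E' E' \<Longrightarrow>
      (\<And>X Y e. X \<in> intertwiners H A L \<phi> \<Longrightarrow> Y \<in> intertwiners K B0 M \<psi> \<Longrightarrow> e \<in> hspace E \<Longrightarrow>
         Z (tens H K E t E' t' X Y e) = tens H K E t E' t' X Y (S e)) \<Longrightarrow>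
      Z = fibmap H A K B0 E t L C M D E' t' \<phi> \<psi> S"
proof -
  have "fibmap H A K B0 E t L C M D E' t' \<phi> \<psi> = theta"
    unfolding fibmap_def
  proof (rule the_equality)
    show "star_hom E FS E' (fib L C M D E' t') theta \<and> (\<forall>S. S \<notin> FS \<longrightarrow> theta S = 0) \<and>
      (\<forall>S\<in>FS. \<forall>X\<in>IX. \<forall>Y\<in>IY. theta S \<circ> W X Y = W X Y \<circ> S)"
    proof (intro conjI theta_hom allI impI ballI)
      show "theta S = 0" if "S \<notin> FS" for S using that by (simp add: theta_def)
      show "theta S \<circ> W X Y = W X Y \<circ> S" if "S \<in> FS" "X \<in> IX" "Y \<in> IY" for S X Y
        by (rule ext) (simp only: comp_apply theta_W[OF that])
    qed
    fix \<Theta> assume \<Theta>: "star_hom E FS E' (fib L C M D E' t') \<Theta> \<and> (\<forall>S. S \<notin> FS \<longrightarrow> \<Theta> S = 0) \<and>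
      (\<forall>S\<in>FS. \<forall>X\<in>IX. \<forall>Y\<in>IY. \<Theta> S \<circ> W X Y = W X Y \<circ> S)"
    show "\<Theta> = theta"
    proof
      fix S
      show "\<Theta> S = theta S"
      proof (cases "S \<in> FS")
        case True
        then have "\<Theta> S \<in> ops E' E'"
          using \<Theta> unfolding star_hom_def fib_def[of L] commutant_def[of E'] by blast
        then show ?thesis
        proof (rule theta_eqI[OF True])
          fix X Y e assume "X \<in> IX" "Y \<in> IY"
          then have "\<Theta> S \<circ> W X Y = W X Y \<circ> S" using \<Theta> True by blast
          from fun_cong[OF this, of e] show "\<Theta> S (W X Y e) = W X Y (S e)" by simp
        qed
      qed (use \<Theta> in \<open>simp add: theta_def\<close>)
    qed
  qed
  then show "fibmap H A K B0 E t L C M D E' t' \<phi> \<psi> S \<in> ops E' E'"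
    and "X \<in> intertwiners H A L \<phi> \<Longrightarrow> Y \<in> intertwiners K B0 M \<psi> \<Longrightarrow>
      fibmap H A K B0 E t L C M D E' t' \<phi> \<psi> S (tens H K E t E' t' X Y e) = tens H K E t E' t' X Y (S e)"
    and "Z \<in> ops E' E' \<Longrightarrow>
      (\<And>X Y e. X \<in> intertwiners H A L \<phi> \<Longrightarrow> Y \<in> intertwiners K B0 M \<psi> \<Longrightarrow> e \<in> hspace E \<Longrightarrow>
         Z (tens H K E t E' t' X Y e) = tens H K E t E' t' X Y (S e)) \<Longrightarrow>
      Z = fibmap H A K B0 E t L C M D E' t' \<phi> \<psi> S"
    by (simp_all only: theta_ops[OF S] theta_W[OF S]) (rule theta_eqI[OF S])
qed

end

end

section \<open>The two models of the relative tensor product\<close>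

context std_base
begin

text \<open>Iterated tensor products need an action of \<open>Bd\<close> on \<open>E\<close>; the
  operator \<open>1 \<otimes> q d\<close> exists because \<open>q d\<close> commutes with
  \<open>s\<close>.\<close>

lemma rep_right:
  assumes T: "is_tensor H r K s E t" and q: "unital_rep hh Bd K q"
    and comm: "\<And>d b. d \<in> Bd \<Longrightarrow> b \<in> B \<Longrightarrow> q d \<circ> s b = s b \<circ> q d"
  shows "unital_rep hh Bd E (\<lambda>d. tens H K E t E t (idop H) (q d))"
  unfolding unital_rep_def star_hom_def
proof (intro conjI ballI allI)
  note D = is_tensorD[OF T] and q' = unital_repD[OF q]
  note so = csubspace_ops[OF D(3), of E]
  let ?W = "\<lambda>d. tens H K E t E t (idop H) (q d)"
  note i1 = iop_idop[OF D(1)]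
  have i2: "q d \<in> iop B K s K s" if "d \<in> Bd" for d
    using q'(2)[OF that] comm[OF that] by (simp add: iop_def)
  have Wo: "?W d \<in> ops E E" if "d \<in> Bd" for d by (rule tens_ops[OF T T i1 i2[OF that]])
  have Wt: "?W d (t x y) = t x (q d y)" if "d \<in> Bd" "x \<in> hspace H" "y \<in> hspace K" for d x y
    using tens_apply[OF T T i1 i2[OF that(1)] that(2,3)] that by simp
  have qy: "q d y \<in> hspace K" if "d \<in> Bd" "y \<in> hspace K" for d y
    using q'(2)[OF that(1)] that(2) by (rule ops_in)
  show "fd_hilbert E" by (rule D(3))
  show "?W ` Bd \<subseteq> ops E E" using Wo by blast
  show "?W (idop hh) = idop E"
    by (rule tensor_ops_eqI[OF T Wo[OF L.C(3)] idop_ops[OF D(3)]])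
      (use Wt[OF L.C(3)] q'(3) D(6) in simp)
  fix S assume S: "S \<in> Bd"
  show "?W (a *\<^sub>C S) = a *\<^sub>C ?W S" for a
  proof (rule tensor_ops_eqI[OF T])
    have aS: "a *\<^sub>C S \<in> Bd" by (rule complex_vector.subspace_scale[OF L.C(2) S])
    show "?W (a *\<^sub>C S) \<in> ops E E" by (rule Wo[OF aS])
    show "a *\<^sub>C ?W S \<in> ops E E" by (rule complex_vector.subspace_scale[OF so Wo[OF S]])
    show "?W (a *\<^sub>C S) (t x y) = (a *\<^sub>C ?W S) (t x y)" if "x \<in> hspace H" "y \<in> hspace K" for x y
      using Wt[OF aS that] Wt[OF S that] q'(5)[OF S, of a] tensor_linear_right(2)[OF T that(1) qy[OF S that(2)]]
      by (simp add: scaleC_fun_def)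
  qed
  show "?W (adj hh hh S) = adj E E (?W S)"
    using tens_adj[OF T T i1 i2[OF S]] adj_idop[OF D(4)] q'(7)[OF S] by simp
  fix R assume R: "R \<in> Bd"
  show "?W (S + R) = ?W S + ?W R"
  proof (rule tensor_ops_eqI[OF T])
    have SR: "S + R \<in> Bd" by (rule complex_vector.subspace_add[OF L.C(2) S R])
    show "?W (S + R) \<in> ops E E" by (rule Wo[OF SR])
    show "?W S + ?W R \<in> ops E E" by (rule complex_vector.subspace_add[OF so Wo[OF S] Wo[OF R]])
    show "?W (S + R) (t x y) = (?W S + ?W R) (t x y)" if "x \<in> hspace H" "y \<in> hspace K" for x y
      using Wt[OF SR that] Wt[OF S that] Wt[OF R that] q'(4)[OF S R]
        tensor_linear_right(1)[OF T that(1) qy[OF S that(2)] qy[OF R that(2)]] by simp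
  qed
  show "?W (S \<circ> R) = ?W S \<circ> ?W R"
    using tens_comp[OF T T T i1 i2[OF R] i1 i2[OF S]] q'(6)[OF S R] comp_idop[OF idop_ops[OF D(4)]] by simp
qed

lemma rep_left:
  assumes T: "is_tensor H r K s E t" and q: "unital_rep hh B H q"
    and comm: "\<And>d b. d \<in> Bd \<Longrightarrow> b \<in> B \<Longrightarrow> q b \<circ> r d = r d \<circ> q b"
  shows "unital_rep hh B E (\<lambda>b. tens H K E t E t (q b) (idop K))"
  using std_base.rep_right[OF swap is_tensor_swap[OF T] q comm]
  unfolding tens_swap[where K = K and H = H and E = E and t = t and E' = E and t' = t] .

text \<open>Positivity of the kernel. The map \<open>p\<close> reads off a pair of vectors from an
  index. This admits pairs as indices, triples over the C*-base, and the triple tensor product,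
  where \<open>E\<close> takes the place of \<open>H\<close>.\<close>

lemma kernel_quot:
  assumes r: "unital_rep hh Bd H r" and s: "unital_rep hh B K s"
    and p: "\<And>a. a \<in> X \<Longrightarrow> fst (p a) \<in> hspace H" "\<And>a. a \<in> X \<Longrightarrow> snd (p a) \<in> hspace K"
    and k: "\<And>a b. a \<in> X \<Longrightarrow> b \<in> X \<Longrightarrow> k a b =
      hinner H (fst (p a)) (r (adj hh K (R.lift s (snd (p a))) \<circ> R.lift s (snd (p b))) (fst (p b)))"
  shows "fd_hilbert (kquot X k)" "cspan (kgen X k ` X) = hspace (kquot X k)"
    "\<And>a b. a \<in> X \<Longrightarrow> b \<in> X \<Longrightarrow> hinner (kquot X k) (kgen X k a) (kgen X k b) = k a b"
proof -
  note r' = unital_repD[OF r] and s' = unital_repD[OF s]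
  interpret H: fd_hilbert H by (rule r'(1))
  obtain n :: nat and \<eta> where \<eta>: "\<And>i. i < n \<Longrightarrow> \<eta> i \<in> intertwiners hh B K s"
    "\<And>v. v \<in> hspace K \<Longrightarrow> (\<Sum>i<n. \<eta> i (adj hh K (\<eta> i) v)) = v"
    by (rule rep_frame[OF R.algC s]) blast
  have \<eta>o: "\<eta> i \<in> ops hh K" if "i < n" for i using \<eta>(1)[OF that] by (rule intertwinersD)
  \<comment> \<open>Inserting the frame gives \<open>R(y)* R(y') = \<Sum> (c i y)* (c i y')\<close>
    with \<open>c i y\<close> in \<open>Bd\<close>, where \<open>R\<close> denotes the lift. Hence
    the kernel is the Gram kernel of the vectors \<open>r (c i y) x\<close>.\<close>
  define c where "c i y = adj hh K (\<eta> i) \<circ> R.lift s y" for i y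
  have c: "c i y \<in> Bd" if "i < n" "y \<in> hspace K" for i y
    unfolding c_def using intertwiner_adj_comp[OF R.algC s \<eta>(1)[OF that(1)] R.lift_intertwiner[OF s that(2)]]
      commutant_B by simp
  have rc: "r (c i y) x \<in> hspace H" if "i < n" "y \<in> hspace K" "x \<in> hspace H" for i x y
    using r'(2)[OF c[OF that(1,2)]] that(3) by (rule ops_in)
  have sum: "(\<Sum>i<n. hinner H (r (c i y) x) (r (c i y') x')) =
      hinner H x (r (adj hh K (R.lift s y) \<circ> R.lift s y') x')"
    if x: "x \<in> hspace H" "x' \<in> hspace H" and y: "y \<in> hspace K" "y' \<in> hspace K" for x x' y y'
  proof -
    note l = R.lift_ops[OF s y(1)] R.lift_ops[OF s y(2)]
    note la = adj_in[OF hh s'(1) l(1)]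
    have cc: "adj hh hh (c i y) \<circ> c i y' \<in> Bd" if "i < n" for i
      using L.C(5)[OF L.C(6)[OF c[OF that y(1)]] c[OF that y(2)]] .
    have e: "(\<Sum>i<n. 1 *\<^sub>C (adj hh hh (c i y) \<circ> c i y')) = adj hh K (R.lift s y) \<circ> R.lift s y'"
    proof
      fix w
      have m: "\<eta> i (adj hh K (\<eta> i) v) \<in> hspace K" if "i < n" "v \<in> hspace K" for i v
        using adj_in[OF hh s'(1) \<eta>o[OF that(1)]] \<eta>o[OF that(1)] that(2) by (auto intro: ops_in)
      have "adj hh hh (c i y) = adj hh K (R.lift s y) \<circ> \<eta> i" if "i < n" for i
        unfolding c_def using adj_comp[OF hh s'(1) hh l(1) adj_in[OF hh s'(1) \<eta>o[OF that]]]
          adj_adj[OF hh s'(1) \<eta>o[OF that]] by simp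
      then have "(\<Sum>i<n. 1 *\<^sub>C (adj hh hh (c i y) \<circ> c i y')) w =
          (\<Sum>i<n. adj hh K (R.lift s y) (\<eta> i (adj hh K (\<eta> i) (R.lift s y' w))))"
        by (simp add: fun_sum_apply c_def)
      also have "\<dots> = adj hh K (R.lift s y) (R.lift s y' w)"
      proof (cases "w \<in> hspace hh")
        case True
        then have w: "R.lift s y' w \<in> hspace K" using l(2) ops_in by blast
        show ?thesis
          using m[OF _ w] ops_sum[OF s'(1) la, of "{..<n}" "\<lambda>i. \<eta> i (adj hh K (\<eta> i) (R.lift s y' w))"]
            \<eta>(2)[OF w] by simp
      next
        case False
        have "\<eta> i (adj hh K (\<eta> i) 0) = 0" if "i < n" for i
          using adj_in[OF hh s'(1) \<eta>o[OF that]] \<eta>o[OF that] by simp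
        then show ?thesis using False la l(2) by (simp add: ops_out)
      qed
      finally show "(\<Sum>i<n. 1 *\<^sub>C (adj hh hh (c i y) \<circ> c i y')) w = (adj hh K (R.lift s y) \<circ> R.lift s y') w"
        by simp
    qed
    have "(\<Sum>i<n. hinner H (r (c i y) x) (r (c i y') x')) =
        (\<Sum>i<n. hinner H x (r (adj hh hh (c i y) \<circ> c i y') x'))"
    proof (rule sum.cong[OF refl])
      fix i assume "i \<in> {..<n}"
      then have i: "i < n" by simp
      note ci = c[OF i y(1)] c[OF i y(2)]
      show "hinner H (r (c i y) x) (r (c i y') x') = hinner H x (r (adj hh hh (c i y) \<circ> c i y') x')"
        using adj_right[OF r'(1,1) r'(2)[OF ci(1)] rc[OF i y(2) x(2)] x(1)]
          r'(6)[OF L.C(6)[OF ci(1)] ci(2)] r'(7)[OF ci(1)] by simp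
    qed
    also have "\<dots> = hinner H x (\<Sum>i<n. r (adj hh hh (c i y) \<circ> c i y') x')"
      using ops_in[OF r'(2)[OF cc] x(2)] x(1) by (subst H.inner_sum_right) auto
    also have "(\<Sum>i<n. r (adj hh hh (c i y) \<circ> c i y') x') = r (\<Sum>i<n. 1 *\<^sub>C (adj hh hh (c i y) \<circ> c i y')) x'"
      using cc by (subst unital_rep_sum[OF L.algC r]) (simp_all add: fun_sum_apply)
    finally show ?thesis unfolding e .
  qed
  interpret finite_rank_kernel H X k "{..<n}" "\<lambda>i a. r (c i (snd (p a))) (fst (p a))"
    by unfold_locales (use rc p k sum in auto)
  show "fd_hilbert (kquot X k)" by (rule kquot_hilbert)
  show "cspan (kgen X k ` X) = hspace (kquot X k)" by (rule kgen_span)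
  show "\<And>a b. a \<in> X \<Longrightarrow> b \<in> X \<Longrightarrow> hinner (kquot X k) (kgen X k a) (kgen X k b) = k a b"
    by (rule hinner_kgen)
qed

text \<open>The kernel sees an index only through \<open>p\<close>, so indices with the same pair
  have the same class, and the section \<open>q\<close> of \<open>p\<close> already reaches all
  generators.\<close>

lemma is_tensor_kquot:
  assumes r: "unital_rep hh Bd H r" and s: "unital_rep hh B K s"
    and p: "\<And>a. a \<in> X \<Longrightarrow> fst (p a) \<in> hspace H" "\<And>a. a \<in> X \<Longrightarrow> snd (p a) \<in> hspace K"
    and k: "\<And>a b. a \<in> X \<Longrightarrow> b \<in> X \<Longrightarrow> k a b =
      hinner H (fst (p a)) (r (adj hh K (R.lift s (snd (p a))) \<circ> R.lift s (snd (p b))) (fst (p b)))"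
    and q: "\<And>x y. x \<in> hspace H \<Longrightarrow> y \<in> hspace K \<Longrightarrow> q x y \<in> X"
      "\<And>x y. x \<in> hspace H \<Longrightarrow> y \<in> hspace K \<Longrightarrow> p (q x y) = (x, y)"
  shows "is_tensor H r K s (kquot X k) (\<lambda>x y. kgen X k (q x y))"
    and "a \<in> X \<Longrightarrow> kgen X k a = kgen X k (q (fst (p a)) (snd (p a)))"
proof -
  note Q = kernel_quot[OF r s, of X p k, OF p k]
  show eq: "kgen X k a = kgen X k (q (fst (p a)) (snd (p a)))" if "a \<in> X" for a
    by (rule kgen_eqI) (use that p q k in simp)
  have im: "kgen X k ` X = (\<lambda>(x, y). kgen X k (q x y)) ` (hspace H \<times> hspace K)"
  proof
    show "kgen X k ` X \<subseteq> (\<lambda>(x, y). kgen X k (q x y)) ` (hspace H \<times> hspace K)"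
    proof
      fix v assume "v \<in> kgen X k ` X"
      then obtain a where a: "a \<in> X" "v = kgen X k a" by blast
      then show "v \<in> (\<lambda>(x, y). kgen X k (q x y)) ` (hspace H \<times> hspace K)"
        using eq[OF a(1)] p[OF a(1)]
        by (intro image_eqI[of _ _ "p a"]) (auto simp: case_prod_beta mem_Times_iff)
    qed
  qed (use q in auto)
  have "kgen X k (q x y) \<in> hspace (kquot X k)" if "x \<in> hspace H" "y \<in> hspace K" for x y
    using Q(2) q(1)[OF that] complex_vector.span_base[of "kgen X k (q x y)" "kgen X k ` X"] by blast
  then show "is_tensor H r K s (kquot X k) (\<lambda>x y. kgen X k (q x y))"
    unfolding is_tensor_def using r s Q im by (simp add: k q)
qed

end

section \<open>The model over the state\<close>

lemma unitary_conj_cancel: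
  assumes hh: "fd_hilbert hh" and G: "fd_hilbert Gs" and U: "unitary_op hh Gs U" and o: "c \<in> ops hh hh"
  shows "adj hh Gs U \<circ> (U \<circ> c \<circ> adj hh Gs U) \<circ> U = c"
proof (rule ops_eqI)
  note U' = unitary_opD[OF U hh G]
  show "adj hh Gs U \<circ> (U \<circ> c \<circ> adj hh Gs U) \<circ> U \<in> ops hh hh"
    by (rule ops_comp[OF ops_comp[OF U'(2) ops_comp[OF ops_comp[OF U'(1) o] U'(2)]] U'(1)])
  show "(adj hh Gs U \<circ> (U \<circ> c \<circ> adj hh Gs U) \<circ> U) w = c w" if "w \<in> hspace hh" for w
    using U'(3) ops_in[OF o] that by simp
qed (rule o)

lemma (in cyc) range_unitary_conj:
  assumes G: "fd_hilbert Gs" and U: "unitary_op hh Gs U"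
    and range: "{U \<circ> c \<circ> adj hh Gs U | c. c \<in> C} = range \<pi>"
  shows "range (\<lambda>b. adj hh Gs U \<circ> \<pi> b \<circ> U) = C"
proof -
  have hh: "fd_hilbert hh" ..
  note * = unitary_conj_cancel[OF hh G U C(4)]
  have "range (\<lambda>b. adj hh Gs U \<circ> \<pi> b \<circ> U) = (\<lambda>T. adj hh Gs U \<circ> T \<circ> U) ` range \<pi>" by blast
  also have "\<dots> = (\<lambda>c. adj hh Gs U \<circ> (U \<circ> c \<circ> adj hh Gs U) \<circ> U) ` C"
    unfolding range[symmetric] by blast
  also have "\<dots> = C" using * by simp
  finally show ?thesis .
qed

text \<open>One statement for both kinds of \<open>R\<close>, with \<open>gns_rep_op\<close> or
  \<open>gns_rep\<close> as \<open>\<pi>\<close>. Since the range of \<open>\<pi>\<close> is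
  \<open>U C U*\<close>, every vector of \<open>Gs\<close> has the form
  \<open>\<pi> b (U z)\<close>, which gives uniqueness.\<close>

lemma (in cyc) the_R_operator:
  assumes L: "unital_rep hh C L r" and x: "x \<in> hspace L"
    and G: "fd_hilbert Gs" and U: "unitary_op hh Gs U"
    and range: "{U \<circ> c \<circ> adj hh Gs U | c. c \<in> C} = range \<pi>"
    and \<rho>: "\<And>b. \<rho> b = r (adj hh Gs U \<circ> \<pi> b \<circ> U)"
  shows "(THE T. T \<in> ops Gs L \<and> (\<forall>b. T (\<pi> b (U z)) = \<rho> b x)) = lift r x \<circ> adj hh Gs U"
proof -
  interpret Gs: fd_hilbert Gs by (rule G)
  have hh: "fd_hilbert hh" ..
  note U' = unitary_opD[OF U hh G]
  have UcU: "\<exists>c\<in>C. \<pi> b = U \<circ> c \<circ> adj hh Gs U" for b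
  proof -
    have "\<pi> b \<in> range \<pi>" by simp
    then show ?thesis unfolding range[symmetric] by blast
  qed
  note * = unitary_conj_cancel[OF hh G U C(4)]
  have lo: "lift r x \<in> ops hh L" by (rule lift_ops[OF L x])
  have val: "(lift r x \<circ> adj hh Gs U) (\<pi> b (U z)) = \<rho> b x" for b
  proof -
    obtain c where c: "c \<in> C" "\<pi> b = U \<circ> c \<circ> adj hh Gs U" using UcU by blast
    have "c z \<in> hspace hh" using C(4)[OF c(1)] z_in by (rule ops_in)
    then have "(lift r x \<circ> adj hh Gs U) (\<pi> b (U z)) = r c x"
      using U'(3) lift_apply[OF c(1)] by (simp add: c(2))
    also have "\<dots> = \<rho> b x" unfolding \<rho> c(2) *[OF c(1)] ..
    finally show ?thesis .
  qed
  show ?thesis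
  proof (rule the_equality)
    show "lift r x \<circ> adj hh Gs U \<in> ops Gs L \<and> (\<forall>b. (lift r x \<circ> adj hh Gs U) (\<pi> b (U z)) = \<rho> b x)"
      using val ops_comp[OF lo U'(2)] by blast
    fix T assume T: "T \<in> ops Gs L \<and> (\<forall>b. T (\<pi> b (U z)) = \<rho> b x)"
    show "T = lift r x \<circ> adj hh Gs U"
    proof (rule ops_eqI)
      fix g assume g: "g \<in> hspace Gs"
      then have "adj hh Gs U g \<in> hspace hh" using U'(2) ops_in by blast
      then obtain c where c: "c \<in> C" "c z = adj hh Gs U g" using cyclic by blast
      have "U \<circ> c \<circ> adj hh Gs U \<in> range \<pi>" unfolding range[symmetric] using c(1) by blast
      then obtain b where b: "\<pi> b = U \<circ> c \<circ> adj hh Gs U" by (metis rangeE)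
      have "\<pi> b (U z) = g" using c(2) g U'(3)[OF z_in] U'(4)[OF g] by (simp add: b)
      moreover have "T (\<pi> b (U z)) = \<rho> b x" using T by blast
      ultimately show "T g = (lift r x \<circ> adj hh Gs U) g" using val[of b] by simp
    qed (use T ops_comp[OF lo U'(2)] in auto)
  qed
qed

context std_base
begin

context
  fixes G :: "('n::cstar_algebra, 'g::complex_vector) gns" and U :: "'k \<Rightarrow> 'g"
  assumes G: "fd_hilbert (gns_space G)" and U: "unitary_op hh (gns_space G) U"
    and rangeB: "{U \<circ> b \<circ> adj hh (gns_space G) U | b. b \<in> B} = range (gns_rep G)"
    and rangeBd: "{U \<circ> b \<circ> adj hh (gns_space G) U | b. b \<in> Bd} = range (gns_rep_op G)"
    and Uz: "U z = gns_vec G"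
begin

lemma R_left_eq:
  assumes "unital_rep hh Bd H r" "\<And>b. \<rho> b = r (adj hh (gns_space G) U \<circ> gns_rep_op G b \<circ> U)" "x \<in> hspace H"
  shows "R_left G H \<rho> x = L.lift r x \<circ> adj hh (gns_space G) U"
  unfolding R_left_def Uz[symmetric] by (rule L.the_R_operator[OF assms(1,3) G U rangeBd assms(2)])

lemma R_right_eq:
  assumes "unital_rep hh B K s" "\<And>b. \<sigma> b = s (adj hh (gns_space G) U \<circ> gns_rep G b \<circ> U)" "y \<in> hspace K"
  shows "R_right G K \<sigma> y = R.lift s y \<circ> adj hh (gns_space G) U"
  unfolding R_right_def Uz[symmetric] by (rule R.the_R_operator[OF assms(1,3) G U rangeB assms(2)])

lemma mu_is_tensor:
  assumes r: "unital_rep hh Bd H r" and s: "unital_rep hh B K s"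
    and \<rho>: "\<And>b. \<rho> b = r (adj hh (gns_space G) U \<circ> gns_rep_op G b \<circ> U)"
    and \<sigma>: "\<And>b. \<sigma> b = s (adj hh (gns_space G) U \<circ> gns_rep G b \<circ> U)"
  shows "is_tensor H r K s (mu_tensor G H \<rho> \<sigma> K) (mu_elem G H \<rho> \<sigma> K)"
proof -
  note U' = unitary_opD[OF U hh G]
  note Rl = R_left_eq[OF r \<rho>] and Rr = R_right_eq[OF s \<sigma>]
  note r' = unital_repD[OF r] and s' = unital_repD[OF s]
  have k: "mu_kernel G H \<rho> \<sigma> K (x, y) (x', y') =
      hinner H x (r (adj hh K (R.lift s y) \<circ> R.lift s y') x')"
    if x: "x \<in> hspace H" "x' \<in> hspace H" and y: "y \<in> hspace K" "y' \<in> hspace K" for x y x' y'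
  proof -
    note l = L.lift_ops[OF r x(1)] L.lift_ops[OF r x(2)] R.lift_ops[OF s y(1)] R.lift_ops[OF s y(2)]
    \<comment> \<open>\<open>mu_kernel\<close> has the left factor in its conjugate-linear slot and
      with \<open>x'\<close> first. Moving it to the other slot replaces it by its adjoint, the
      element that occurs in \<open>kernel_eq\<close>.\<close>
    define b where "b = adj hh H (L.lift r x') \<circ> L.lift r x"
    define d where "d = adj hh K (R.lift s y) \<circ> R.lift s y'"
    have b: "b \<in> B" unfolding b_def by (rule L_lift_in_B[OF r x(2,1)])
    have d: "d \<in> Bd" unfolding d_def by (rule R_lift_in_Bd[OF s y])
    have ba: "adj hh hh b = adj hh H (L.lift r x) \<circ> L.lift r x'"
      unfolding b_def using adj_comp[OF hh r'(1) hh l(1) adj_in[OF hh r'(1) l(2)]]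
        adj_adj[OF hh r'(1) l(2)] by simp
    have m: "b z \<in> hspace hh" "d z \<in> hspace hh"
      using R.C(4)[OF b] L.C(4)[OF d] L.z_in by (auto intro: ops_in)
    have a: "adj (gns_space G) M (T \<circ> adj hh (gns_space G) U) = U \<circ> adj hh M T"
      if "fd_hilbert M" "T \<in> ops hh M" for M :: "'m::complex_vector hilb" and T
      using adj_comp[OF G hh that(1) U'(2) that(2)] adj_adj[OF hh G U'(1)] by simp
    have "mu_kernel G H \<rho> \<sigma> K (x, y) (x', y') = hinner (gns_space G) (U (b z)) (U (d z))"
      using U'(3)[OF L.z_in]
      by (simp add: mu_kernel_def Rl x Rr y a[OF r'(1) l(2)] a[OF s'(1) l(3)] Uz[symmetric] b_def d_def)
    also have "\<dots> = hinner hh (b z) (d z)" by (rule U'(5)[OF m])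
    also have "\<dots> = hinner hh z (adj hh hh b (d z))"
      by (rule adj_right[OF hh hh R.C(4)[OF b] m(2) L.z_in, symmetric])
    finally show ?thesis
      unfolding kernel_eq[OF r s x y] by (simp add: ba d_def)
  qed
  have "is_tensor H r K s (kquot (hspace H \<times> hspace K) (mu_kernel G H \<rho> \<sigma> K))
      (\<lambda>x y. kgen (hspace H \<times> hspace K) (mu_kernel G H \<rho> \<sigma> K) (x, y))"
    by (rule is_tensor_kquot[OF r s, where p = "\<lambda>a. a"]) (use k in auto)
  then show ?thesis unfolding mu_tensor_def mu_elem_def .
qed

end

section \<open>The model over the C*-base\<close>

context
  fixes H :: "'h::complex_vector hilb" and r and K :: "'l::complex_vector hilb" and s and \<alpha> \<beta>
  assumes r: "unital_rep hh Bd H r" and s: "unital_rep hh B K s"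
    and \<alpha>: "\<alpha> = intertwiners hh Bd H r" and \<beta>: "\<beta> = intertwiners hh B K s"
begin

text \<open>The middle component can be fixed to \<open>z\<close>: by \<open>cb_elem_eq\<close>
  these are all generators.\<close>

definition cbt where
  "cbt x y = cb_elem hh H \<alpha> \<beta> K (L.lift r x) z (R.lift s y)"

text \<open>\<open>\<eta>* \<eta>'\<close> commutes with \<open>B\<close>, so it lies in
  \<open>Bd\<close> and passes through the intertwiner \<open>\<xi>'\<close> as a value of
  \<open>r\<close>. The kernel thus depends only on \<open>\<xi> \<omega>\<close> and
  \<open>\<eta> z\<close>.\<close>

lemma cb_kernel_apply:
  assumes "\<xi> \<in> \<alpha>" "\<xi>' \<in> \<alpha>" "\<eta> \<in> \<beta>" "\<eta>' \<in> \<beta>" "\<omega> \<in> hspace hh" "\<omega>' \<in> hspace hh"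
  shows "cb_kernel hh H K (\<xi>, \<omega>, \<eta>) (\<xi>', \<omega>', \<eta>') =
    hinner H (\<xi> \<omega>) (r (adj hh K (R.lift s (\<eta> z)) \<circ> R.lift s (\<eta>' z)) (\<xi>' \<omega>'))"
proof -
  note \<xi> = assms(1,2)[unfolded \<alpha>] and \<eta> = assms(3,4)[unfolded \<beta>]
  define d where "d = adj hh K \<eta> \<circ> \<eta>'"
  have d: "d \<in> Bd" using intertwiner_adj_comp[OF R.algC s \<eta>] commutant_B by (simp add: d_def)
  have dw: "d \<omega>' \<in> hspace hh" using L.C(4)[OF d] assms(6) by (rule ops_in)
  have "cb_kernel hh H K (\<xi>, \<omega>, \<eta>) (\<xi>', \<omega>', \<eta>') = hinner hh \<omega> (adj hh H \<xi> (\<xi>' (d \<omega>')))"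
    by (simp add: cb_kernel_def d_def)
  also have "\<dots> = hinner H (\<xi> \<omega>) (\<xi>' (d \<omega>'))"
    by (rule adj_right[OF hh unital_repD(1)[OF r] intertwinersD(1)[OF \<xi>(1)]
      ops_in[OF intertwinersD(1)[OF \<xi>(2)] dw] assms(5)])
  also have "\<xi>' (d \<omega>') = r d (\<xi>' \<omega>')" by (rule intertwinersD(2)[OF \<xi>(2) d])
  finally show ?thesis unfolding R.lift_eq[OF s \<eta>(1)] R.lift_eq[OF s \<eta>(2)] d_def .
qed

lemma cb_is_tensor: "is_tensor H r K s (cb_tensor hh H \<alpha> \<beta> K) cbt"
  and cb_elem_eq: "\<xi> \<in> \<alpha> \<Longrightarrow> \<omega> \<in> hspace hh \<Longrightarrow> \<eta> \<in> \<beta> \<Longrightarrow>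
    cb_elem hh H \<alpha> \<beta> K \<xi> \<omega> \<eta> = cbt (\<xi> \<omega>) (\<eta> z)"
proof -
  let ?X = "\<alpha> \<times> hspace hh \<times> \<beta>" and ?p = "\<lambda>(\<xi>, \<omega>, \<eta>). (\<xi> \<omega>, \<eta> z)"
    and ?q = "\<lambda>x y. (L.lift r x, z, R.lift s y)"
  have p: "fst (?p a) \<in> hspace H" "snd (?p a) \<in> hspace K" if "a \<in> ?X" for a
    using that ops_in[OF intertwinersD(1)] L.z_in unfolding \<alpha> \<beta> by (cases a; simp; blast)+
  have q: "?q x y \<in> ?X" "?p (?q x y) = (x, y)" if "x \<in> hspace H" "y \<in> hspace K" for x y
    using that L.lift_intertwiner[OF r] R.lift_intertwiner[OF s] L.lift_z[OF r] R.lift_z[OF s]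
    by (auto simp: \<alpha> \<beta>)
  have k: "cb_kernel hh H K a b =
      hinner H (fst (?p a)) (r (adj hh K (R.lift s (snd (?p a))) \<circ> R.lift s (snd (?p b))) (fst (?p b)))"
    if "a \<in> ?X" "b \<in> ?X" for a b
  proof -
    obtain \<xi> \<omega> \<eta> \<xi>' \<omega>' \<eta>' where "a = (\<xi>, \<omega>, \<eta>)" "b = (\<xi>', \<omega>', \<eta>')" by (metis prod_cases3)
    with that cb_kernel_apply[of \<xi> \<xi>' \<eta> \<eta>' \<omega> \<omega>'] show ?thesis by simp
  qed
  have "is_tensor H r K s (kquot ?X (cb_kernel hh H K)) (\<lambda>x y. kgen ?X (cb_kernel hh H K) (?q x y))"
    by (rule is_tensor_kquot(1)[OF r s p k q])
  then show "is_tensor H r K s (cb_tensor hh H \<alpha> \<beta> K) cbt"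
    unfolding cb_tensor_def cbt_def cb_elem_def .
  show "cb_elem hh H \<alpha> \<beta> K \<xi> \<omega> \<eta> = cbt (\<xi> \<omega>) (\<eta> z)"
    if "\<xi> \<in> \<alpha>" "\<omega> \<in> hspace hh" "\<eta> \<in> \<beta>" for \<xi> \<omega> \<eta>
    using is_tensor_kquot(2)[OF r s p k q, of "(\<xi>, \<omega>, \<eta>)"] that
    by (simp add: cb_elem_def cbt_def)
qed

text \<open>\<open>cb_elem_eq\<close> absorbs \<open>\<omega>\<close> in the left factor, whereas
  \<open>ket1\<close> is applied to \<open>\<eta> \<omega>\<close> on the right, so
  \<open>\<omega>\<close> has to change sides.\<close>

lemma ket1_eq:
  assumes \<xi>: "\<xi> \<in> \<alpha>"
  shows "ket1 hh H \<alpha> \<beta> K \<xi> = ket K cbt (\<xi> z)"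
  unfolding ket1_def
proof (rule the_equality)
  note T = cb_is_tensor
  note D = is_tensorD[OF T]
  have \<xi>z: "\<xi> w \<in> hspace H" if "w \<in> hspace hh" for w
    using ops_in[OF intertwinersD(1)[OF \<xi>[unfolded \<alpha>]] that] .
  have \<eta>w: "\<eta> w \<in> hspace K" if "\<eta> \<in> \<beta>" "w \<in> hspace hh" for \<eta> w
    using ops_in[OF intertwinersD(1)[OF that(1)[unfolded \<beta>]] that(2)] .
  have val: "ket K cbt (\<xi> z) (\<eta> \<omega>) = cb_elem hh H \<alpha> \<beta> K \<xi> \<omega> \<eta>"
    if \<eta>: "\<eta> \<in> \<beta>" and \<omega>: "\<omega> \<in> hspace hh" for \<eta> \<omega>
  proof -
    \<comment> \<open>With \<open>\<omega> = b z\<close> the vector \<open>\<eta> \<omega>\<close>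
      is \<open>s b (\<eta> z)\<close>, and balancing moves \<open>b\<close> to the left factor,
      where it gives \<open>\<xi> (b z)\<close>.\<close>
    obtain b where b: "b \<in> B" "b z = \<omega>" using R.cyclic[OF \<omega>] by blast
    have "\<eta> \<omega> = s b (\<eta> z)" using intertwinersD(2)[of \<eta> hh B K s b z] \<eta> b by (simp add: \<beta>)
    then have "cbt (\<xi> z) (\<eta> \<omega>) = cbt (L.lift r (\<xi> z) (b z)) (\<eta> z)"
      using tensor_balanced_right[OF T \<xi>z \<eta>w b(1)] \<eta> L.z_in by simp
    then show ?thesis
      using \<eta>w[OF \<eta> \<omega>] L.lift_eq[OF r \<xi>[unfolded \<alpha>]] cb_elem_eq[OF \<xi> \<omega> \<eta>] b by (simp add: ket_def)
  qed
  note k = ket_ops[OF T \<xi>z[OF L.z_in]]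
  show "ket K cbt (\<xi> z) \<in> ops K (cb_tensor hh H \<alpha> \<beta> K) \<and>
    (\<forall>\<eta>\<in>\<beta>. \<forall>\<omega>\<in>hspace hh. ket K cbt (\<xi> z) (\<eta> \<omega>) = cb_elem hh H \<alpha> \<beta> K \<xi> \<omega> \<eta>)"
    using k val by blast
  fix S assume S: "S \<in> ops K (cb_tensor hh H \<alpha> \<beta> K) \<and>
    (\<forall>\<eta>\<in>\<beta>. \<forall>\<omega>\<in>hspace hh. S (\<eta> \<omega>) = cb_elem hh H \<alpha> \<beta> K \<xi> \<omega> \<eta>)"
  show "S = ket K cbt (\<xi> z)"
  proof (rule ops_eqI[OF _ k])
    fix y assume y: "y \<in> hspace K"
    have "R.lift s y \<in> \<beta>" unfolding \<beta> by (rule R.lift_intertwiner[OF s y])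
    then have "S (R.lift s y z) = ket K cbt (\<xi> z) (R.lift s y z)"
      unfolding val[OF \<open>R.lift s y \<in> \<beta>\<close> L.z_in] using S L.z_in by blast
    then show "S y = ket K cbt (\<xi> z) y" unfolding R.lift_z[OF s y] .
  qed (use S in blast)
qed

lemma ket2_eq:
  assumes \<eta>: "\<eta> \<in> \<beta>"
  shows "ket2 hh H \<alpha> \<beta> K \<eta> = ket H (\<lambda>y x. cbt x y) (\<eta> z)"
  unfolding ket2_def
proof (rule the_equality)
  note T = cb_is_tensor
  have \<xi>w: "\<xi> w \<in> hspace H" if "\<xi> \<in> \<alpha>" "w \<in> hspace hh" for \<xi> w
    using ops_in[OF intertwinersD(1)[OF that(1)[unfolded \<alpha>]] that(2)] .
  have \<eta>z: "\<eta> z \<in> hspace K"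
    using ops_in[OF intertwinersD(1)[OF \<eta>[unfolded \<beta>]] L.z_in] .
  have val: "ket H (\<lambda>y x. cbt x y) (\<eta> z) (\<xi> \<omega>) = cb_elem hh H \<alpha> \<beta> K \<xi> \<omega> \<eta>"
    if "\<xi> \<in> \<alpha>" "\<omega> \<in> hspace hh" for \<xi> \<omega>
    using \<xi>w[OF that] cb_elem_eq[OF that \<eta>] by (simp add: ket_def)
  note k = std_base.ket_ops[OF swap is_tensor_swap[OF T] \<eta>z]
  show "ket H (\<lambda>y x. cbt x y) (\<eta> z) \<in> ops H (cb_tensor hh H \<alpha> \<beta> K) \<and>
    (\<forall>\<xi>\<in>\<alpha>. \<forall>\<omega>\<in>hspace hh. ket H (\<lambda>y x. cbt x y) (\<eta> z) (\<xi> \<omega>) = cb_elem hh H \<alpha> \<beta> K \<xi> \<omega> \<eta>)"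
    using k val by blast
  fix S assume S: "S \<in> ops H (cb_tensor hh H \<alpha> \<beta> K) \<and>
    (\<forall>\<xi>\<in>\<alpha>. \<forall>\<omega>\<in>hspace hh. S (\<xi> \<omega>) = cb_elem hh H \<alpha> \<beta> K \<xi> \<omega> \<eta>)"
  show "S = ket H (\<lambda>y x. cbt x y) (\<eta> z)"
  proof (rule ops_eqI[OF _ k])
    fix x assume x: "x \<in> hspace H"
    have "L.lift r x \<in> \<alpha>" unfolding \<alpha> by (rule L.lift_intertwiner[OF r x])
    then have "S (L.lift r x z) = ket H (\<lambda>y x. cbt x y) (\<eta> z) (L.lift r x z)"
      unfolding val[OF \<open>L.lift r x \<in> \<alpha>\<close> L.z_in] using S L.z_in by blast
    then show "S x = ket H (\<lambda>y x. cbt x y) (\<eta> z) x" unfolding L.lift_z[OF r x] .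
  qed (use S in blast)
qed

end

end

lemma ops_span:
  assumes T: "T \<in> ops E F" and E: "fd_hilbert E" and G: "cspan G = hspace E" and e: "e \<in> hspace E"
  shows "T e \<in> cspan (T ` G)"
proof -
  have "e \<in> cspan G" using e G by simp
  then show ?thesis
  proof (induction rule: cspan_induct)
    case zero
    then show ?case using ops_zero_arg[OF T] complex_vector.span_zero by simp
  next
    case (base g)
    then show ?case by (intro complex_vector.span_base imageI)
  next
    case (add x y)
    then show ?case using G ops_add[OF T, of x y] complex_vector.span_add by force
  next
    case (scale c x)
    then show ?case using G ops_scale[OF T, of x c] complex_vector.span_scale by force
  qed
qed

lemma mu_fiber_eq_fib:
  "mu_fiber G H A \<rho> \<sigma> K B = fib H A K B (mu_tensor G H \<rho> \<sigma> K) (mu_elem G H \<rho> \<sigma> K)"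
  by (simp only: mu_fiber_def fib_def mu_op_def tens_def)

lemma mu_fiber_map_eq_fibmap:
  "mu_fiber_map G H A \<rho> \<sigma> K B L C \<upsilon> \<tau> M D \<phi> \<psi> =
    fibmap H A K B (mu_tensor G H \<rho> \<sigma> K) (mu_elem G H \<rho> \<sigma> K) L C M D
      (mu_tensor G L \<upsilon> \<tau> M) (mu_elem G L \<upsilon> \<tau> M) \<phi> \<psi>"
  by (simp only: mu_fiber_map_def fibmap_def mu_fiber_eq_fib mu_op_def tens_def)

section \<open>Morphisms\<close>

context cyc
begin

context
  fixes H :: "'h::complex_vector hilb" and A r and L :: "'l::complex_vector hilb" and D l \<phi> \<alpha> \<gamma>
  assumes A: "unital_alg H A" and r: "unital_rep hh C H r" and l: "unital_rep hh C L l"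
    and rA: "r ` C \<subseteq> A" and \<phi>: "star_hom H A L D \<phi>" and D: "D \<subseteq> ops L L"
    and \<alpha>: "\<alpha> = intertwiners hh C H r" and \<gamma>: "\<gamma> = intertwiners hh C L l"
begin

text \<open>\<alpha> and \<gamma> consist of all intertwiners. If \<open>\<phi>\<close> carries
  \<open>r\<close> to \<open>l\<close>, composition with \<open>V\<close> or \<open>V*\<close>
  respects these representations, so both inclusions hold automatically.\<close>

lemma mor_ops_eq:
  assumes \<phi>r: "\<And>c. c \<in> C \<Longrightarrow> \<phi> (r c) = l c"
  shows "mor_ops H A \<alpha> L \<gamma> \<phi> = intertwiners H A L \<phi>"
proof
  show "mor_ops H A \<alpha> L \<gamma> \<phi> \<subseteq> intertwiners H A L \<phi>" by (auto simp: mor_ops_def)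
  show "intertwiners H A L \<phi> \<subseteq> mor_ops H A \<alpha> L \<gamma> \<phi>"
  proof
    fix V assume V: "V \<in> intertwiners H A L \<phi>"
    have hh: "fd_hilbert hh" ..
    note r' = unital_repD[OF r] and l' = unital_repD[OF l]
    have i: "V \<in> iop C H r L l" using V rA \<phi>r by (rule intertwiners_iop)
    have comp: "X \<circ> \<xi> \<in> intertwiners hh C L' l'"
      if "X \<in> iop C H' r' L' l'" "\<xi> \<in> intertwiners hh C H' r'" "unital_rep hh C L' l'"
      for X \<xi> and H' :: "'x::complex_vector hilb" and r' and L' :: "'y::complex_vector hilb" and l'
      using iopD[OF that(1)] intertwinersD[OF that(2)] C(4) unital_repD(2)[OF that(3)]
      by (intro intertwinersI) (auto intro: ops_comp)
    show "V \<in> mor_ops H A \<alpha> L \<gamma> \<phi>"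
      using V comp[OF i _ l] comp[OF iop_adj[OF algC r l i] _ r]
      unfolding mor_ops_def op_prods_def \<alpha> \<gamma> by blast
  qed
qed

text \<open>For a morphism the vectors \<open>V (\<xi> z)\<close> span \<open>L\<close>, and on them
  \<open>\<phi> (r c) V \<xi> z = V r(c) \<xi> z = V \<xi> c z = l c V \<xi> z\<close>, the last
  step because \<open>V \<xi>\<close> belongs to \<gamma>. Conversely, a frame \<open>X\<close> of
  \<phi> writes \<open>T \<in> \<gamma>\<close> as the sum of \<open>X i (X i* T)\<close>, where
  \<open>X i* T\<close> belongs to \<alpha>.\<close>

lemma Mor_iff: "\<phi> \<in> Mor H A \<alpha> L D \<gamma> \<longleftrightarrow> (\<forall>c\<in>C. \<phi> (r c) = l c)"
proof
  have hh: "fd_hilbert hh" ..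
  note r' = unital_repD[OF r] and l' = unital_repD[OF l]
  {
    assume "\<phi> \<in> Mor H A \<alpha> L D \<gamma>"
    then have g: "\<gamma> = cspan (mor_ops H A \<alpha> L \<gamma> \<phi> \<odot> \<alpha>)" by (simp add: Mor_def)
    let ?G = "(\<lambda>T. T z) ` (mor_ops H A \<alpha> L \<gamma> \<phi> \<odot> \<alpha>)"
    have le: "mor_ops H A \<alpha> L \<gamma> \<phi> \<odot> \<alpha> \<subseteq> \<gamma>"
      using complex_vector.span_superset[of "mor_ops H A \<alpha> L \<gamma> \<phi> \<odot> \<alpha>"] g by simp
    have span: "cspan ?G = hspace L"
    proof
      interpret L: fd_hilbert L by (rule l'(1))
      show "cspan ?G \<subseteq> hspace L"
      proof (rule L.span_in)
        show "?G \<subseteq> hspace L"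
        proof
          fix v assume "v \<in> ?G"
          then obtain T where "T \<in> \<gamma>" "v = T z" using le by blast
          then show "v \<in> hspace L" using ops_in[OF intertwinersD(1)[of T hh C L l] z_in] by (simp add: \<gamma>)
        qed
      qed
      show "hspace L \<subseteq> cspan ?G"
      proof
        fix y assume y: "y \<in> hspace L"
        have "T z \<in> cspan ?G" if "T \<in> cspan (mor_ops H A \<alpha> L \<gamma> \<phi> \<odot> \<alpha>)" for T
          using that
        proof (induction rule: cspan_induct)
          case zero
          then show ?case using complex_vector.span_zero by simp
        next
          case (base T)
          then show ?case by (intro complex_vector.span_base imageI)
        next
          case (add S T)
          then show ?case using complex_vector.span_add by simp
        next
          case (scale c T)
          then show ?case using complex_vector.span_scale by (simp add: scaleC_fun_def)
        qed
        note Tz = this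
        have "lift l y \<in> \<gamma>" unfolding \<gamma> by (rule lift_intertwiner[OF l y])
        then have "lift l y \<in> cspan (mor_ops H A \<alpha> L \<gamma> \<phi> \<odot> \<alpha>)" by (simp only: g[symmetric])
        from Tz[OF this] show "y \<in> cspan ?G" unfolding lift_z[OF l y] .
      qed
    qed
    show "\<forall>c\<in>C. \<phi> (r c) = l c"
    proof
      fix c assume c: "c \<in> C"
      have rc: "r c \<in> A" using rA c by blast
      show "\<phi> (r c) = l c"
      proof (rule ops_eqI_span[OF _ l'(2)[OF c] span])
        show "\<phi> (r c) \<in> ops L L" using \<phi> D rc unfolding star_hom_def by blast
        fix g assume "g \<in> ?G"
        then obtain V \<xi> where V: "V \<in> mor_ops H A \<alpha> L \<gamma> \<phi>" "\<xi> \<in> \<alpha>" "g = V (\<xi> z)"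
          by (auto simp: op_prods_def)
        have "V \<circ> \<xi> \<in> intertwiners hh C L l"
          unfolding \<gamma>[symmetric] using V(1,2) by (intro subsetD[OF le]) (auto simp: op_prods_def)
        from intertwinersD(2)[OF this c, of z] have "l c (V (\<xi> z)) = V (\<xi> (c z))" by simp
        moreover have "V \<in> intertwiners H A L \<phi>" using V(1) by (simp add: mor_ops_def)
        from intertwinersD(2)[OF this rc, of "\<xi> z"]
        have "\<phi> (r c) (V (\<xi> z)) = V (r c (\<xi> z))" by simp
        moreover have "r c (\<xi> z) = \<xi> (c z)" using intertwinersD(2)[OF V(2)[unfolded \<alpha>] c] by simp
        ultimately show "\<phi> (r c) g = l c g" using V(3) by simp
      qed
    qed
  }
  assume \<phi>r: "\<forall>c\<in>C. \<phi> (r c) = l c"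
  have m: "mor_ops H A \<alpha> L \<gamma> \<phi> = intertwiners H A L \<phi>" by (rule mor_ops_eq) (use \<phi>r in blast)
  have "\<phi> (idop H) = idop L" using \<phi>r[rule_format, OF C(3)] r'(3) l'(3) by simp
  then have \<phi>': "unital_rep H A L \<phi>" by (rule unital_rep_of_star_hom[OF \<phi> _ D l'(1)])
  have sub: "intertwiners H A L \<phi> \<odot> \<alpha> \<subseteq> \<gamma>" using m unfolding mor_ops_def op_prods_def by blast
  have "\<gamma> \<subseteq> cspan (intertwiners H A L \<phi> \<odot> \<alpha>)"
  proof
    fix T assume T: "T \<in> \<gamma>"
    have To: "T \<in> ops hh L" using T unfolding \<gamma> by (rule intertwinersD)
    obtain n :: nat and X where X: "\<And>i. i < n \<Longrightarrow> X i \<in> intertwiners H A L \<phi>"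
      "\<And>v. v \<in> hspace L \<Longrightarrow> (\<Sum>i<n. X i (adj H L (X i) v)) = v"
      by (rule rep_frame[OF A \<phi>']) blast
    have Xo: "X i \<in> ops H L" if "i < n" for i using X(1)[OF that] by (rule intertwinersD)
    have "T = (\<Sum>i<n. X i \<circ> (adj H L (X i) \<circ> T))"
    proof (rule ops_eqI[OF To])
      show "(\<Sum>i<n. X i \<circ> (adj H L (X i) \<circ> T)) \<in> ops hh L"
        by (rule complex_vector.subspace_sum[OF csubspace_ops[OF l'(1)]])
          (auto intro!: ops_comp Xo To adj_in[OF r'(1) l'(1)])
      show "T w = (\<Sum>i<n. X i \<circ> (adj H L (X i) \<circ> T)) w" if "w \<in> hspace hh" for w
        using X(2)[OF ops_in[OF To that]] by (simp add: fun_sum_apply)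
    qed
    also have "\<dots> \<in> cspan (intertwiners H A L \<phi> \<odot> \<alpha>)"
    proof (rule complex_vector.span_sum, rule complex_vector.span_base)
      fix i assume "i \<in> {..<n}"
      then have Xi: "X i \<in> intertwiners H A L \<phi>" using X(1) by simp
      then have "X i \<in> mor_ops H A \<alpha> L \<gamma> \<phi>" using m by simp
      then have "adj H L (X i) \<circ> T \<in> \<alpha>" using T unfolding mor_ops_def op_prods_def by blast
      then show "X i \<circ> (adj H L (X i) \<circ> T) \<in> intertwiners H A L \<phi> \<odot> \<alpha>"
        using Xi unfolding op_prods_def by blast
    qed
    finally show "T \<in> cspan (intertwiners H A L \<phi> \<odot> \<alpha>)" .
  qed
  moreover have "cspan (intertwiners H A L \<phi> \<odot> \<alpha>) \<subseteq> \<gamma>"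
    using sub unfolding \<gamma> by (rule complex_vector.span_minimal) (rule csubspace_intertwiners[OF l'(1,2)])
  ultimately have "\<gamma> = cspan (mor_ops H A \<alpha> L \<gamma> \<phi> \<odot> \<alpha>)" unfolding m by (rule equalityI)
  then show "\<phi> \<in> Mor H A \<alpha> L D \<gamma>" using \<phi> unfolding Mor_def by blast
qed

end

end

section \<open>Fiber products over the C*-base in terms of intertwiners\<close>

context std_base
begin

lemma cb_op_eq:
  assumes r: "unital_rep hh Bd H r" and s: "unital_rep hh B K s"
    and \<alpha>: "\<alpha> = intertwiners hh Bd H r" and \<beta>: "\<beta> = intertwiners hh B K s"
    and l: "unital_rep hh Bd L l" and m: "unital_rep hh B M m"
    and \<gamma>: "\<gamma> = intertwiners hh Bd L l" and \<delta>: "\<delta> = intertwiners hh B M m"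
    and S: "S \<in> iop Bd H r L l" and T: "T \<in> iop B K s M m"
  shows "cb_op hh H \<alpha> \<beta> K L \<gamma> \<delta> M S T = tens H K (cb_tensor hh H \<alpha> \<beta> K) (cbt H r K s \<alpha> \<beta>)
    (cb_tensor hh L \<gamma> \<delta> M) (cbt L l M m \<gamma> \<delta>) S T"
proof -
  have Sx: "S \<circ> \<xi> \<in> \<gamma>" if "\<xi> \<in> \<alpha>" for \<xi>
    using iopD[OF S] intertwinersD[OF that[unfolded \<alpha>]] L.C(4) unital_repD(2)[OF l]
    unfolding \<gamma> by (intro intertwinersI) (auto intro: ops_comp)
  have Ty: "T \<circ> \<eta> \<in> \<delta>" if "\<eta> \<in> \<beta>" for \<eta>
    using iopD[OF T] intertwinersD[OF that[unfolded \<beta>]] R.C(4) unital_repD(2)[OF m]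
    unfolding \<delta> by (intro intertwinersI) (auto intro: ops_comp)
  have "(\<forall>\<xi>\<in>\<alpha>. \<forall>\<omega>\<in>hspace hh. \<forall>\<eta>\<in>\<beta>. X (cb_elem hh H \<alpha> \<beta> K \<xi> \<omega> \<eta>) =
        cb_elem hh L \<gamma> \<delta> M (S \<circ> \<xi>) \<omega> (T \<circ> \<eta>)) \<longleftrightarrow>
      (\<forall>x\<in>hspace H. \<forall>y\<in>hspace K. X (cbt H r K s \<alpha> \<beta> x y) = cbt L l M m \<gamma> \<delta> (S x) (T y))"
    (is "?P X \<longleftrightarrow> ?Q X") for X
  proof
    have eq: "cb_elem hh L \<gamma> \<delta> M (S \<circ> \<xi>) \<omega> (T \<circ> \<eta>) = cbt L l M m \<gamma> \<delta> (S (\<xi> \<omega>)) (T (\<eta> z))"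
      if "\<xi> \<in> \<alpha>" "\<omega> \<in> hspace hh" "\<eta> \<in> \<beta>" for \<xi> \<omega> \<eta>
      using cb_elem_eq[OF l m \<gamma> \<delta> Sx[OF that(1)] that(2) Ty[OF that(3)]] by simp
    show "?Q X" if P: "?P X"
    proof (intro ballI)
      fix x y assume x: "x \<in> hspace H" and y: "y \<in> hspace K"
      have "L.lift r x \<in> \<alpha>" "R.lift s y \<in> \<beta>"
        unfolding \<alpha> \<beta> by (rule L.lift_intertwiner[OF r x], rule R.lift_intertwiner[OF s y])
      note l = this
      have "X (cb_elem hh H \<alpha> \<beta> K (L.lift r x) z (R.lift s y)) =
          cb_elem hh L \<gamma> \<delta> M (S \<circ> L.lift r x) z (T \<circ> R.lift s y)"
        using P l L.z_in by blast
      also have "\<dots> = cbt L l M m \<gamma> \<delta> (S x) (T y)"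
        unfolding eq[OF l(1) L.z_in l(2)] L.lift_z[OF r x] R.lift_z[OF s y] ..
      finally show "X (cbt H r K s \<alpha> \<beta> x y) = cbt L l M m \<gamma> \<delta> (S x) (T y)"
        unfolding cbt_def[OF r s \<alpha> \<beta>] .
    qed
    show "?P X" if Q: "?Q X"
    proof (intro ballI)
      fix \<xi> \<omega> \<eta> assume a: "\<xi> \<in> \<alpha>" "\<omega> \<in> hspace hh" "\<eta> \<in> \<beta>"
      have "\<xi> \<omega> \<in> hspace H" "\<eta> z \<in> hspace K"
        using ops_in[OF intertwinersD(1)[OF a(1)[unfolded \<alpha>]] a(2)]
          ops_in[OF intertwinersD(1)[OF a(3)[unfolded \<beta>]] L.z_in] by auto
      then show "X (cb_elem hh H \<alpha> \<beta> K \<xi> \<omega> \<eta>) = cb_elem hh L \<gamma> \<delta> M (S \<circ> \<xi>) \<omega> (T \<circ> \<eta>)"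
        unfolding cb_elem_eq[OF r s \<alpha> \<beta> a] eq[OF a] using Q by blast
    qed
  qed
  then show ?thesis by (simp only: cb_op_def tens_def)
qed

lemma ket1_image:
  assumes r: "unital_rep hh Bd H r" and s: "unital_rep hh B K s"
    and \<alpha>: "\<alpha> = intertwiners hh Bd H r" and \<beta>: "\<beta> = intertwiners hh B K s"
  shows "ket1 hh H \<alpha> \<beta> K ` \<alpha> = ket K (cbt H r K s \<alpha> \<beta>) ` hspace H"
proof
  show "ket1 hh H \<alpha> \<beta> K ` \<alpha> \<subseteq> ket K (cbt H r K s \<alpha> \<beta>) ` hspace H"
    using ket1_eq[OF r s \<alpha> \<beta>] ops_in[OF intertwinersD(1) L.z_in] unfolding \<alpha> by fastforce
  show "ket K (cbt H r K s \<alpha> \<beta>) ` hspace H \<subseteq> ket1 hh H \<alpha> \<beta> K ` \<alpha>"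
  proof
    fix v assume "v \<in> ket K (cbt H r K s \<alpha> \<beta>) ` hspace H"
    then obtain x where x: "x \<in> hspace H" "v = ket K (cbt H r K s \<alpha> \<beta>) x" by blast
    have "L.lift r x \<in> \<alpha>" unfolding \<alpha> by (rule L.lift_intertwiner[OF r x(1)])
    then show "v \<in> ket1 hh H \<alpha> \<beta> K ` \<alpha>"
      using ket1_eq[OF r s \<alpha> \<beta>, of "L.lift r x"] L.lift_z[OF r x(1)] x(2) by (metis image_eqI)
  qed
qed

lemma ket2_image:
  assumes r: "unital_rep hh Bd H r" and s: "unital_rep hh B K s"
    and \<alpha>: "\<alpha> = intertwiners hh Bd H r" and \<beta>: "\<beta> = intertwiners hh B K s"
  shows "ket2 hh H \<alpha> \<beta> K ` \<beta> = ket H (\<lambda>y x. cbt H r K s \<alpha> \<beta> x y) ` hspace K"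
proof
  show "ket2 hh H \<alpha> \<beta> K ` \<beta> \<subseteq> ket H (\<lambda>y x. cbt H r K s \<alpha> \<beta> x y) ` hspace K"
    using ket2_eq[OF r s \<alpha> \<beta>] ops_in[OF intertwinersD(1) L.z_in] unfolding \<beta> by fastforce
  show "ket H (\<lambda>y x. cbt H r K s \<alpha> \<beta> x y) ` hspace K \<subseteq> ket2 hh H \<alpha> \<beta> K ` \<beta>"
  proof
    fix v assume "v \<in> ket H (\<lambda>y x. cbt H r K s \<alpha> \<beta> x y) ` hspace K"
    then obtain y where y: "y \<in> hspace K" "v = ket H (\<lambda>y x. cbt H r K s \<alpha> \<beta> x y) y" by blast
    have "R.lift s y \<in> \<beta>" unfolding \<beta> by (rule R.lift_intertwiner[OF s y(1)])
    then show "v \<in> ket2 hh H \<alpha> \<beta> K ` \<beta>"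
      using ket2_eq[OF r s \<alpha> \<beta>, of "R.lift s y"] R.lift_z[OF s y(1)] y(2) by (metis image_eqI)
  qed
qed

text \<open>The conditions on the adjoint in \<open>cb_fiber\<close> follow from those on the
  operator itself, because by \<open>fib_iff\<close> these describe a commutant that is closed under
  adjoints.\<close>

lemma cb_fiber_eq_fib:
  assumes r: "unital_rep hh Bd H r" and s: "unital_rep hh B K s"
    and \<alpha>: "\<alpha> = intertwiners hh Bd H r" and \<beta>: "\<beta> = intertwiners hh B K s"
    and A: "unital_alg H A" and B0: "unital_alg K B0" and rA: "r ` Bd \<subseteq> A" and sB: "s ` B \<subseteq> B0"
  shows "cb_fiber hh H A \<alpha> \<beta> K B0 = fib H A K B0 (cb_tensor hh H \<alpha> \<beta> K) (cbt H r K s \<alpha> \<beta>)"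
proof -
  note T = cb_is_tensor[OF r s \<alpha> \<beta>]
  note iff = fib_iff[OF T A B0 rA sB]
  note alg = unital_algD[OF fib_alg[OF T A B0 rA sB]]
  show ?thesis
    unfolding cb_fiber_def Let_def ket1_image[OF r s \<alpha> \<beta>] ket2_image[OF r s \<alpha> \<beta>]
    using iff alg(6) by blast
qed

text \<open>The two characterizations quantify over different operators, \<open>mor_ops\<close> and
  all intertwiners. They coincide by \<open>mor_ops_eq\<close>, once \<phi> and \<psi> respect the
  representations.\<close>

lemma cb_fiber_map_eq_fibmap:
  assumes r: "unital_rep hh Bd H r" and s: "unital_rep hh B K s"
    and \<alpha>: "\<alpha> = intertwiners hh Bd H r" and \<beta>: "\<beta> = intertwiners hh B K s"
    and l: "unital_rep hh Bd L l" and m: "unital_rep hh B M m"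
    and \<gamma>: "\<gamma> = intertwiners hh Bd L l" and \<delta>: "\<delta> = intertwiners hh B M m"
    and A: "unital_alg H A" and B0: "unital_alg K B0" and rA: "r ` Bd \<subseteq> A" and sB: "s ` B \<subseteq> B0"
    and C: "unital_alg L C" and D: "unital_alg M D" and lC: "l ` Bd \<subseteq> C" and mD: "m ` B \<subseteq> D"
    and \<phi>: "star_hom H A L C \<phi>" "\<And>d. d \<in> Bd \<Longrightarrow> \<phi> (r d) = l d"
    and \<psi>: "star_hom K B0 M D \<psi>" "\<And>b. b \<in> B \<Longrightarrow> \<psi> (s b) = m b"
  shows "cb_fiber_map hh H A \<alpha> \<beta> K B0 L C \<gamma> \<delta> M D \<phi> \<psi> =
    fibmap H A K B0 (cb_tensor hh H \<alpha> \<beta> K) (cbt H r K s \<alpha> \<beta>) L C M D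
      (cb_tensor hh L \<gamma> \<delta> M) (cbt L l M m \<gamma> \<delta>) \<phi> \<psi>"
proof -
  have Co: "C \<subseteq> ops L L" and Do: "D \<subseteq> ops M M" using unital_algD(4)[OF C] unital_algD(4)[OF D] by blast+
  have mo: "mor_ops H A \<alpha> L \<gamma> \<phi> = intertwiners H A L \<phi>" "mor_ops K B0 \<beta> M \<delta> \<psi> = intertwiners K B0 M \<psi>"
    by (rule L.mor_ops_eq[OF A r l rA \<phi>(1) Co \<alpha> \<gamma> \<phi>(2)], assumption)
      (rule R.mor_ops_eq[OF B0 s m sB \<psi>(1) Do \<beta> \<delta> \<psi>(2)], assumption)
  have op: "cb_op hh H \<alpha> \<beta> K L \<gamma> \<delta> M X Y = tens H K (cb_tensor hh H \<alpha> \<beta> K) (cbt H r K s \<alpha> \<beta>)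
      (cb_tensor hh L \<gamma> \<delta> M) (cbt L l M m \<gamma> \<delta>) X Y"
    if X: "X \<in> intertwiners H A L \<phi>" and Y: "Y \<in> intertwiners K B0 M \<psi>" for X Y
  proof (rule cb_op_eq[OF r s \<alpha> \<beta> l m \<gamma> \<delta>])
    show "X \<in> iop Bd H r L l" using X rA \<phi>(2) by (rule intertwiners_iop)
    show "Y \<in> iop B K s M m" using Y sB \<psi>(2) by (rule intertwiners_iop)
  qed
  show ?thesis
    unfolding cb_fiber_map_def fibmap_def cb_fiber_eq_fib[OF r s \<alpha> \<beta> A B0 rA sB]
      cb_fiber_eq_fib[OF l m \<gamma> \<delta> C D lC mD] mo
    by (simp only: op cong: ball_cong)
qed

text \<open>For \<open>q = r\<close>, and for \<open>s\<close> after \<open>swap\<close>, this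
  describes \<open>tri_right\<close> and \<open>tri_left\<close>, so that the iterated tensor
  products are again instances of \<open>is_tensor\<close>. The operator
  \<open>ket K t x \<circ> L.lift q y\<close> has the value \<open>t x y\<close> at
  \<open>z\<close>, whence \<open>intertwiners_full\<close> applies.\<close>

lemma ket_comp_intertwiners:
  assumes T: "is_tensor H r K s E t" and q: "unital_rep hh Bd K q"
    and comm: "\<And>d b. d \<in> Bd \<Longrightarrow> b \<in> B \<Longrightarrow> q d \<circ> s b = s b \<circ> q d"
  shows "cspan ((ket K t ` hspace H) \<odot> intertwiners hh Bd K q) =
    intertwiners hh Bd E (\<lambda>d. tens H K E t E t (idop H) (q d))" (is "cspan ?G = intertwiners hh Bd E ?q2")
proof -
  note D = is_tensorD[OF T] and q' = unital_repD[OF q]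
  interpret E: fd_hilbert E by (rule D(3))
  have q2: "unital_rep hh Bd E ?q2" by (rule rep_right[OF T q comm])
  have sub: "csubspace (cspan ?G)" by (rule complex_vector.subspace_span)
  have q2t: "?q2 d (t x y) = t x (q d y)" if "d \<in> Bd" "x \<in> hspace H" "y \<in> hspace K" for d x y
  proof -
    have i: "q d \<in> iop B K s K s" using q'(2)[OF that(1)] comm[OF that(1)] by (simp add: iop_def)
    show ?thesis using tens_apply[OF T T iop_idop[OF D(1)] i that(2,3)] that(2) by simp
  qed
  have G: "?G \<subseteq> intertwiners hh Bd E ?q2"
  proof
    fix V assume "V \<in> ?G"
    then obtain x \<eta> where V: "x \<in> hspace H" "\<eta> \<in> intertwiners hh Bd K q" "V = ket K t x \<circ> \<eta>"
      by (auto simp: op_prods_def)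
    note \<eta> = intertwinersD[OF V(2)]
    show "V \<in> intertwiners hh Bd E ?q2"
    proof (rule intertwinersI)
      show "V \<in> ops hh E" unfolding V(3) by (rule ops_comp[OF ket_ops[OF T V(1)] \<eta>(1)])
      fix d w assume d: "d \<in> Bd" and w: "w \<in> hspace hh"
      have "\<eta> w \<in> hspace K" "q d (\<eta> w) \<in> hspace K"
        using ops_in[OF \<eta>(1) w] ops_in[OF q'(2)[OF d]] by auto
      then show "V (d w) = ?q2 d (V w)"
        using \<eta>(2)[OF d, of w] q2t[OF d V(1)] by (simp add: V(3) ket_def)
    qed (use L.C(4) unital_repD(2)[OF q2] in auto)
  qed
  then have le: "cspan ?G \<subseteq> intertwiners hh Bd E ?q2"
    by (rule complex_vector.span_minimal) (rule csubspace_intertwiners[OF unital_repD(1,2)[OF q2]])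
  have "cspan ((\<lambda>T. T z) ` cspan ?G) = hspace E"
  proof
    have "T z \<in> hspace E" if "T \<in> cspan ?G" for T
      using ops_in[OF intertwinersD(1)[OF subsetD[OF le that]] L.z_in] .
    then show "cspan ((\<lambda>T. T z) ` cspan ?G) \<subseteq> hspace E" by (intro E.span_in) blast
    have "t x y \<in> (\<lambda>T. T z) ` cspan ?G" if "x \<in> hspace H" "y \<in> hspace K" for x y
    proof (rule image_eqI[of _ _ "ket K t x \<circ> L.lift q y"])
      show "t x y = (ket K t x \<circ> L.lift q y) z" using L.lift_z[OF q that(2)] that(2) by (simp add: ket_def)
      show "ket K t x \<circ> L.lift q y \<in> cspan ?G"
        using L.lift_intertwiner[OF q that(2)] that(1)
        by (intro complex_vector.span_base) (auto simp: op_prods_def)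
    qed
    then have "(\<lambda>(x, y). t x y) ` (hspace H \<times> hspace K) \<subseteq> (\<lambda>T. T z) ` cspan ?G" by auto
    then show "hspace E \<subseteq> cspan ((\<lambda>T. T z) ` cspan ?G)"
      unfolding D(7)[symmetric] by (rule complex_vector.span_mono)
  qed
  with q2 sub le show ?thesis by (rule L.intertwiners_full)
qed

section \<open>Coassociativity\<close>

lemma tens_idop:
  assumes "is_tensor H r K s E t"
  shows "tens H K E t E t (idop H) (idop K) = idop E"
  by (rule tens_unique[OF assms]) (use is_tensorD[OF assms] idop_ops in auto)

lemma tens_unitary:
  assumes T: "is_tensor H r K s E t" and T': "is_tensor H' r' K' s' E' t'"
    and X: "X \<in> iop Bd H r H' r'" "unitary_op H H' X" and Y: "Y \<in> iop B K s K' s'" "unitary_op K K' Y"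
  shows "unitary_op E E' (tens H K E t E' t' X Y)"
proof -
  note D = is_tensorD[OF T] and D' = is_tensorD[OF T']
  have Xa: "adj H H' X \<in> iop Bd H' r' H r" and Ya: "adj K K' Y \<in> iop B K' s' K s"
    by (rule iop_adj[OF L.algC D(1) D'(1) X(1)], rule iop_adj[OF R.algC D(2) D'(2) Y(1)])
  note a = tens_adj[OF T T' X(1) Y(1)]
  show ?thesis
    using X(2) Y(2) tens_ops[OF T T' X(1) Y(1)] tens_idop[OF T] tens_idop[OF T']
      tens_comp[OF T T' T X(1) Y(1) Xa Ya] tens_comp[OF T' T T' Xa Ya X(1) Y(1)]
    by (simp add: unitary_op_def a)
qed

text \<open>The unitaries \<open>p\<close> and \<open>q\<close> implement the passage from \<phi>,
  \<psi> to \<phi>', \<psi>'. Composing with their adjoints turns intertwiners \<open>X'\<close>,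
  \<open>Y'\<close> into \<open>X\<close>, \<open>Y\<close>, and \<open>X' \<otimes> Y'\<close>
  after \<open>u\<close> equals \<open>p \<otimes> q\<close> after \<open>X \<otimes> Y\<close>. So
  the conjugated operator satisfies the characterization of the new fiber product.\<close>

lemma fibmap_transport:
  assumes T1: "is_tensor H r K s E t" and T2: "is_tensor H r K s E' t'"
    and F1: "is_tensor L l M m F f" and F2: "is_tensor L' l' M' m' F' f'"
    and A: "unital_alg H A" and B0: "unital_alg K B0" and rA: "r ` Bd \<subseteq> A" and sB: "s ` B \<subseteq> B0"
    and \<phi>: "star_hom H A L C \<phi>" "\<phi> (idop H) = idop L" "C \<subseteq> ops L L" "\<And>d. d \<in> Bd \<Longrightarrow> \<phi> (r d) = l d"
    and \<psi>: "star_hom K B0 M D \<psi>" "\<psi> (idop K) = idop M" "D \<subseteq> ops M M" "\<And>b. b \<in> B \<Longrightarrow> \<psi> (s b) = m b"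
    and \<phi>': "star_hom H A L' C' \<phi>'" "\<phi>' (idop H) = idop L'" "C' \<subseteq> ops L' L'" "\<And>d. d \<in> Bd \<Longrightarrow> \<phi>' (r d) = l' d"
    and \<psi>': "star_hom K B0 M' D' \<psi>'" "\<psi>' (idop K) = idop M'" "D' \<subseteq> ops M' M'" "\<And>b. b \<in> B \<Longrightarrow> \<psi>' (s b) = m' b"
    and p: "p \<in> iop Bd L l L' l'" "unitary_op L L' p" "\<And>a. a \<in> A \<Longrightarrow> \<phi>' a = p \<circ> \<phi> a \<circ> adj L L' p"
    and q: "q \<in> iop B M m M' m'" "unitary_op M M' q" "\<And>b. b \<in> B0 \<Longrightarrow> \<psi>' b = q \<circ> \<psi> b \<circ> adj M M' q"
    and u: "u = tens H K E t E' t' (idop H) (idop K)"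
    and S: "S \<in> fib H A K B0 E t" and S': "S' \<in> fib H A K B0 E' t'" "S' = u \<circ> S \<circ> adj E E' u"
  shows "fibmap H A K B0 E' t' L' C' M' D' F' f' \<phi>' \<psi>' S' =
    tens L M F f F' f' p q \<circ> fibmap H A K B0 E t L C M D F f \<phi> \<psi> S \<circ>
      adj F F' (tens L M F f F' f' p q)" (is "_ = ?w \<circ> ?Z \<circ> adj F F' ?w")
proof (rule fibmap_eqI[OF T2 F2 A B0 rA sB \<phi>' \<psi>' S'(1), symmetric])
  note D1 = is_tensorD[OF T1] and D2 = is_tensorD[OF T2] and G1 = is_tensorD[OF F1] and G2 = is_tensorD[OF F2]
  have fm: "?Z \<in> ops F F" by (rule fibmap(1)[OF T1 F1 A B0 rA sB \<phi> \<psi> S])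
  have w: "unitary_op F F' ?w" by (rule tens_unitary[OF F1 F2 p(1,2) q(1,2)])
  note w' = unitary_opD[OF w G1(3) G2(3)]
  note p' = unitary_opD[OF p(2) G1(4) G2(4)] and q' = unitary_opD[OF q(2) G1(5) G2(5)]
  have "unitary_op H H (idop H)" "unitary_op K K (idop K)"
    using D1(4,5) by (auto simp: unitary_op_def idop_ops adj_idop comp_idop[OF idop_ops])
  then have un: "unitary_op E E' u"
    unfolding u by (intro tens_unitary[OF T1 T2] iop_idop[OF D1(1)] iop_idop[OF D1(2)])
  note u' = unitary_opD[OF un D1(3) D2(3)]
  have So: "S \<in> ops E E" using unital_algD(4)[OF fib_alg[OF T1 A B0 rA sB] S] .
  show "?w \<circ> ?Z \<circ> adj F F' ?w \<in> ops F' F'"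
    by (rule ops_comp[OF ops_comp[OF w'(1) fm] w'(2)])
  fix X' Y' e' assume X': "X' \<in> intertwiners H A L' \<phi>'" and Y': "Y' \<in> intertwiners K B0 M' \<psi>'" and e': "e' \<in> hspace E'"
  define X where "X = adj L L' p \<circ> X'"
  define Y where "Y = adj M M' q \<circ> Y'"
  define e where "e = adj E E' u e'"
  have e: "e \<in> hspace E" unfolding e_def using u'(2) e' by (rule ops_in)
  have X: "X \<in> intertwiners H A L \<phi>"
  proof (rule intertwinersI)
    show "X \<in> ops H L" unfolding X_def by (rule ops_comp[OF p'(2) intertwinersD(1)[OF X']])
    show \<phi>o: "\<phi> a \<in> ops L L" if "a \<in> A" for a using \<phi>(1,3) that unfolding star_hom_def by blast
    fix a x assume a: "a \<in> A" and x: "x \<in> hspace H"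
    have "adj L L' p (X' x) \<in> hspace L" using p'(2) ops_in[OF intertwinersD(1)[OF X'] x] by (rule ops_in)
    from ops_in[OF \<phi>o[OF a] this] show "X (a x) = \<phi> a (X x)"
      using intertwinersD(2)[OF X' a, of x] p'(3) by (simp add: X_def p(3)[OF a])
  qed (use unital_algD(4)[OF A] in blast)
  have Y: "Y \<in> intertwiners K B0 M \<psi>"
  proof (rule intertwinersI)
    show "Y \<in> ops K M" unfolding Y_def by (rule ops_comp[OF q'(2) intertwinersD(1)[OF Y']])
    show \<psi>o: "\<psi> a \<in> ops M M" if "a \<in> B0" for a using \<psi>(1,3) that unfolding star_hom_def by blast
    fix a x assume a: "a \<in> B0" and x: "x \<in> hspace K"
    have "adj M M' q (Y' x) \<in> hspace M" using q'(2) ops_in[OF intertwinersD(1)[OF Y'] x] by (rule ops_in)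
    from ops_in[OF \<psi>o[OF a] this] show "Y (a x) = \<psi> a (Y x)"
      using intertwinersD(2)[OF Y' a, of x] q'(3) by (simp add: Y_def q(3)[OF a])
  qed (use unital_algD(4)[OF B0] in blast)
  have pX: "p \<circ> X = X'" "q \<circ> Y = Y'"
    by (rule ops_eqI[OF ops_comp[OF p'(1) intertwinersD(1)[OF X]] intertwinersD(1)[OF X']],
        use p'(4) ops_in[OF intertwinersD(1)[OF X']] in \<open>simp add: X_def\<close>)
      (rule ops_eqI[OF ops_comp[OF q'(1) intertwinersD(1)[OF Y]] intertwinersD(1)[OF Y']],
        use q'(4) ops_in[OF intertwinersD(1)[OF Y']] in \<open>simp add: Y_def\<close>)
  have i: "X \<in> iop Bd H r L l" "Y \<in> iop B K s M m" "X' \<in> iop Bd H r L' l'" "Y' \<in> iop B K s M' m'"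
    by (rule intertwiners_iop[OF X rA], erule \<phi>(4), rule intertwiners_iop[OF Y sB], erule \<psi>(4),
        rule intertwiners_iop[OF X' rA], erule \<phi>'(4), rule intertwiners_iop[OF Y' sB], erule \<psi>'(4))
  let ?W' = "tens H K E' t' F' f' X' Y'" and ?W = "tens H K E t F f X Y"
  have WW: "?W' \<circ> u = ?w \<circ> ?W"
    unfolding u tens_comp[OF T1 F1 F2 i(1,2) p(1) q(1)] pX
    by (subst tens_comp[OF T1 T2 F2 iop_idop[OF D1(1)] iop_idop[OF D1(2)] i(3,4)])
      (simp add: comp_idop[OF iopD(1)[OF i(3)]] comp_idop[OF iopD(1)[OF i(4)]])
  have WW': "?W' (u v) = ?w (?W v)" for v using fun_cong[OF WW, of v] by simp
  have Wo: "?W v \<in> hspace F" if "v \<in> hspace E" for v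
    using tens_ops[OF T1 F1 i(1,2)] that by (rule ops_in)
  have ue: "u e = e'" unfolding e_def by (rule u'(4)[OF e'])
  have "(?w \<circ> ?Z \<circ> adj F F' ?w) (?W' e') = ?w (?Z (?W e))"
    using WW'[of e] w'(3)[OF Wo[OF e]] by (simp add: ue)
  also have "?Z (?W e) = ?W (S e)" by (rule fibmap(2)[OF T1 F1 A B0 rA sB \<phi> \<psi> S X Y])
  also have "?w (?W (S e)) = ?W' (S' e')" unfolding WW'[symmetric] S'(2) by (simp add: e_def)
  finally show "(?w \<circ> ?Z \<circ> adj F F' ?w) (?W' e') = ?W' (S' e')" .
qed

end

section \<open>Iterated tensor products and transport of coassociativity\<close>

definition assoc_op where
  "assoc_op H t E2 t2 E3 t3 = (THE V. V \<in> ops E2 E3 \<and>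
     (\<forall>x\<in>hspace H. \<forall>y\<in>hspace H. \<forall>w\<in>hspace H. V (t2 (t x y) w) = t3 x (t y w)))"

text \<open>The form without adjoints, to which the conjugations in both notions of bimodule reduce
  by unitarity.\<close>

definition coassoc where
  "coassoc H A E t E2 t2 E3 t3 \<Delta> \<longleftrightarrow> (\<forall>a\<in>A.
     assoc_op H t E2 t2 E3 t3 \<circ> fibmap H A H A E t E (fib H A H A E t) H A E2 t2 \<Delta> id (\<Delta> a) =
     fibmap H A H A E t H A E (fib H A H A E t) E3 t3 id \<Delta> (\<Delta> a) \<circ> assoc_op H t E2 t2 E3 t3)"

lemma unitary_conj_iff:
  assumes W: "unitary_op E F W" and P: "P \<in> ops E E" and Q: "Q \<in> ops F F"
  shows "W \<circ> P \<circ> adj E F W = Q \<longleftrightarrow> W \<circ> P = Q \<circ> W"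
proof
  have c: "W \<in> ops E F" "adj E F W \<circ> W = idop E" "W \<circ> adj E F W = idop F"
    using W unfolding unitary_op_def by blast+
  {
    assume eq: "W \<circ> P \<circ> adj E F W = Q"
    have "Q \<circ> W = W \<circ> P \<circ> (adj E F W \<circ> W)" unfolding eq[symmetric] by (simp only: comp_assoc)
    then show "W \<circ> P = Q \<circ> W" unfolding c comp_idop[OF ops_comp[OF c(1) P]] by (rule sym)
  next
    assume eq: "W \<circ> P = Q \<circ> W"
    have "W \<circ> P \<circ> adj E F W = Q \<circ> (W \<circ> adj E F W)" unfolding eq by (simp only: comp_assoc)
    then show "W \<circ> P \<circ> adj E F W = Q" unfolding c comp_idop[OF Q] .
  }
qed

text \<open>Meant for the triple tensor product as \<open>T\<close>, with \<open>V\<close> and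
  \<open>W \<circ> V\<close> as its identifications with the two iterated tensor products.\<close>

lemma unitary_double_conj_iff:
  assumes V: "unitary_op T E V" and W: "unitary_op E F W" and P: "P \<in> ops E E" and Q: "Q \<in> ops F F"
    and fd: "fd_hilbert T" "fd_hilbert E" "fd_hilbert F"
  shows "adj T E V \<circ> P \<circ> V = adj T F (W \<circ> V) \<circ> Q \<circ> (W \<circ> V) \<longleftrightarrow> W \<circ> P = Q \<circ> W"
proof -
  note V' = unitary_opD[OF V fd(1,2)] and W' = unitary_opD[OF W fd(2,3)]
  have c: "adj T E V \<circ> V = idop T" "V \<circ> adj T E V = idop E" "adj E F W \<circ> W = idop E" "W \<circ> adj E F W = idop F"
    using V W unfolding unitary_op_def by blast+
  note WP = ops_comp[OF W'(1) P] and QW = ops_comp[OF Q W'(1)]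
  have adjWV: "adj T F (W \<circ> V) = adj T E V \<circ> adj E F W" by (rule adj_comp[OF fd V'(1) W'(1)])
  show "adj T E V \<circ> P \<circ> V = adj T F (W \<circ> V) \<circ> Q \<circ> (W \<circ> V) \<longleftrightarrow> W \<circ> P = Q \<circ> W"
  proof
    assume eq: "adj T E V \<circ> P \<circ> V = adj T F (W \<circ> V) \<circ> Q \<circ> (W \<circ> V)"
    have "(W \<circ> P) e = (Q \<circ> W) e" if e: "e \<in> hspace E" for e
    proof -
      define v where "v = adj T E V e"
      have v: "V v = e" unfolding v_def by (rule V'(4)[OF e])
      have m: "P e \<in> hspace E" "W e \<in> hspace F" "Q (W e) \<in> hspace F" "adj E F W (Q (W e)) \<in> hspace E"
        using ops_in[OF P e] ops_in[OF W'(1) e] ops_in[OF QW e] ops_in[OF W'(2) ops_in[OF QW e]] by auto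
      have "adj T E V (P e) = adj T E V (adj E F W (Q (W e)))"
        using fun_cong[OF eq, of v] by (simp add: adjWV v)
      then have "V (adj T E V (P e)) = V (adj T E V (adj E F W (Q (W e))))" by (rule arg_cong)
      then have "P e = adj E F W (Q (W e))" unfolding V'(4)[OF m(1)] V'(4)[OF m(4)] .
      then have "W (P e) = W (adj E F W (Q (W e)))" by (rule arg_cong)
      then show ?thesis unfolding W'(4)[OF m(3)] by simp
    qed
    then show "W \<circ> P = Q \<circ> W" by (rule ops_eqI[OF WP QW])
  next
    assume eq: "W \<circ> P = Q \<circ> W"
    have "adj T F (W \<circ> V) \<circ> Q \<circ> (W \<circ> V) = adj T E V \<circ> (adj E F W \<circ> (Q \<circ> W)) \<circ> V"
      by (simp only: adjWV comp_assoc)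
    also have "adj E F W \<circ> (Q \<circ> W) = (adj E F W \<circ> W) \<circ> P" by (simp only: eq[symmetric] comp_assoc)
    finally show "adj T E V \<circ> P \<circ> V = adj T F (W \<circ> V) \<circ> Q \<circ> (W \<circ> V)"
      unfolding c idop_comp[OF fd(2) P] by (rule sym)
  qed
qed

context std_base
begin

text \<open>
  The data of a bialgebroid without coassociativity, for an arbitrary realization of the
  relative tensor products.
\<close>

definition hopf_data where
  "hopf_data H A r s E t E2 t2 E3 t3 \<Delta> \<longleftrightarrow>
     is_tensor H r H s E t \<and> unital_alg H A \<and> r ` Bd \<subseteq> A \<and> s ` B \<subseteq> A \<and>
     (\<forall>d\<in>Bd. \<forall>b\<in>B. r d \<circ> s b = s b \<circ> r d) \<and>
     is_tensor E (\<lambda>d. tens H H E t E t (idop H) (r d)) H s E2 t2 \<and>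
     is_tensor H r E (\<lambda>b. tens H H E t E t (s b) (idop H)) E3 t3 \<and>
     star_hom H A E (fib H A H A E t) \<Delta> \<and>
     (\<forall>d\<in>Bd. \<Delta> (r d) = tens H H E t E t (idop H) (r d)) \<and>
     (\<forall>b\<in>B. \<Delta> (s b) = tens H H E t E t (s b) (idop H))"

lemma tens_one_apply:
  assumes T: "is_tensor H r H s E t" and comm: "\<forall>d\<in>Bd. \<forall>b\<in>B. r d \<circ> s b = s b \<circ> r d"
    and x: "x \<in> hspace H" and y: "y \<in> hspace H"
  shows "d \<in> Bd \<Longrightarrow> tens H H E t E t (idop H) (r d) (t x y) = t x (r d y)"
    "b \<in> B \<Longrightarrow> tens H H E t E t (s b) (idop H) (t x y) = t (s b x) y"
proof -
  note D = is_tensorD[OF T]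
  note r = unital_repD[OF D(1)] and s = unital_repD[OF D(2)]
  show "tens H H E t E t (idop H) (r d) (t x y) = t x (r d y)" if d: "d \<in> Bd"
  proof -
    have "r d \<in> iop B H s H s" using r(2)[OF d] comm d unfolding iop_def by blast
    from tens_apply[OF T T iop_idop[OF D(1)] this x y] show ?thesis using x by simp
  qed
  show "tens H H E t E t (s b) (idop H) (t x y) = t (s b x) y" if b: "b \<in> B"
  proof -
    have "s b \<in> iop Bd H r H r" using s(2)[OF b] comm b unfolding iop_def by fastforce
    from tens_apply[OF T T this iop_idop[OF D(2)] x y] show ?thesis using y by simp
  qed
qed

text \<open>In both bracketings the outer vectors act on the middle one, \<open>x\<close> through
  \<open>s\<close> and \<open>w\<close> through \<open>r\<close>, and these actions commute. The
  common value, also that of \<open>triple_kernel\<close>, makes the associativity map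
  unitary.\<close>

lemma triple_inner:
  assumes T: "is_tensor H r H s E t" and comm: "\<forall>d\<in>Bd. \<forall>b\<in>B. r d \<circ> s b = s b \<circ> r d"
    and v: "x \<in> hspace H" "y \<in> hspace H" "w \<in> hspace H" "x' \<in> hspace H" "y' \<in> hspace H" "w' \<in> hspace H"
  shows "is_tensor E (\<lambda>d. tens H H E t E t (idop H) (r d)) H s E2 t2 \<Longrightarrow>
      hinner E2 (t2 (t x y) w) (t2 (t x' y') w') =
      hinner H y (s (adj hh H (L.lift r x) \<circ> L.lift r x') (r (adj hh H (R.lift s w) \<circ> R.lift s w') y'))"
    and "is_tensor H r E (\<lambda>b. tens H H E t E t (s b) (idop H)) E3 t3 \<Longrightarrow>
      hinner E3 (t3 x (t y w)) (t3 x' (t y' w')) =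
      hinner H y (s (adj hh H (L.lift r x) \<circ> L.lift r x') (r (adj hh H (R.lift s w) \<circ> R.lift s w') y'))"
proof -
  note D = is_tensorD[OF T]
  note r = unital_repD[OF D(1)] and s = unital_repD[OF D(2)]
  define b where "b = adj hh H (L.lift r x) \<circ> L.lift r x'"
  define d where "d = adj hh H (R.lift s w) \<circ> R.lift s w'"
  have b: "b \<in> B" unfolding b_def by (rule L_lift_in_B[OF D(1) v(1,4)])
  have d: "d \<in> Bd" unfolding d_def by (rule R_lift_in_Bd[OF D(2) v(3,6)])
  have m: "r d y' \<in> hspace H" "s b y' \<in> hspace H"
    using ops_in[OF r(2)[OF d] v(5)] ops_in[OF s(2)[OF b] v(5)] by auto
  note t1 = D(6)[OF v(1,2)] D(6)[OF v(4,5)] D(6)[OF v(2,3)] D(6)[OF v(5,6)]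
  have rs: "r d (s b y') = s b (r d y')" using comm b d by (metis comp_apply)
  show "hinner E2 (t2 (t x y) w) (t2 (t x' y') w') =
      hinner H y (s (adj hh H (L.lift r x) \<circ> L.lift r x') (r (adj hh H (R.lift s w) \<circ> R.lift s w') y'))"
    if T2: "is_tensor E (\<lambda>d. tens H H E t E t (idop H) (r d)) H s E2 t2"
    using is_tensorD(8)[OF T2 t1(1) v(3) t1(2) v(6)] tens_one_apply(1)[OF T comm v(4,5) d]
      D(9)[OF v(1,2,4) m(1)] by (simp add: b_def d_def)
  show "hinner E3 (t3 x (t y w)) (t3 x' (t y' w')) =
      hinner H y (s (adj hh H (L.lift r x) \<circ> L.lift r x') (r (adj hh H (R.lift s w) \<circ> R.lift s w') y'))"
    if T3: "is_tensor H r E (\<lambda>b. tens H H E t E t (s b) (idop H)) E3 t3"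
    using is_tensorD(9)[OF T3 v(1) t1(3) v(4) t1(4)] tens_one_apply(2)[OF T comm v(5,6) b]
      D(8)[OF v(2,3) m(2) v(6)] rs by (simp add: b_def d_def)
qed

lemma triple_span:
  assumes T: "is_tensor H r H s E t"
  shows "is_tensor E r2 K s' E2 t2 \<Longrightarrow>
      cspan ((\<lambda>(x, y, w). t2 (t x y) w) ` (hspace H \<times> hspace H \<times> hspace K)) = hspace E2"
    and "is_tensor K r' E s1 E3 t3 \<Longrightarrow>
      cspan ((\<lambda>(x, y, w). t3 x (t y w)) ` (hspace K \<times> hspace H \<times> hspace H)) = hspace E3"
proof -
  note D = is_tensorD[OF T]
  show "cspan ((\<lambda>(x, y, w). t2 (t x y) w) ` (hspace H \<times> hspace H \<times> hspace K)) = hspace E2" (is "cspan ?G = _")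
    if T2: "is_tensor E r2 K s' E2 t2"
  proof
    note D2 = is_tensorD[OF T2]
    interpret E2: fd_hilbert E2 by (rule D2(3))
    show "cspan ?G \<subseteq> hspace E2" using D(6) D2(6) by (intro E2.span_in) auto
    have "t2 e w \<in> cspan ?G" if e: "e \<in> hspace E" and w: "w \<in> hspace K" for e w
    proof -
      have k: "ket E (\<lambda>w e. t2 e w) w \<in> ops E E2"
        by (rule std_base.ket_ops[OF swap is_tensor_swap[OF T2] w])
      have sub: "ket E (\<lambda>w e. t2 e w) w ` (\<lambda>(x, y). t x y) ` (hspace H \<times> hspace H) \<subseteq> ?G"
      proof
        fix v assume "v \<in> ket E (\<lambda>w e. t2 e w) w ` (\<lambda>(x, y). t x y) ` (hspace H \<times> hspace H)"
        then obtain x y where "x \<in> hspace H" "y \<in> hspace H" "v = ket E (\<lambda>w e. t2 e w) w (t x y)" by auto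
        then show "v \<in> ?G" using D(6)[of x y] w by (intro image_eqI[of _ _ "(x, y, w)"]) (auto simp: ket_def)
      qed
      show ?thesis
        using ops_span[OF k D(3,7) e] complex_vector.span_mono[OF sub] e by (auto simp: ket_def)
    qed
    then have "(\<lambda>(x, y). t2 x y) ` (hspace E \<times> hspace K) \<subseteq> cspan ?G" by auto
    from complex_vector.span_minimal[OF this complex_vector.subspace_span]
    show "hspace E2 \<subseteq> cspan ?G" unfolding D2(7) .
  qed
  show "cspan ((\<lambda>(x, y, w). t3 x (t y w)) ` (hspace K \<times> hspace H \<times> hspace H)) = hspace E3" (is "cspan ?G = _")
    if T3: "is_tensor K r' E s1 E3 t3"
  proof
    note D3 = is_tensorD[OF T3]
    interpret E3: fd_hilbert E3 by (rule D3(3))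
    show "cspan ?G \<subseteq> hspace E3" using D(6) D3(6) by (intro E3.span_in) auto
    have "t3 x e \<in> cspan ?G" if x: "x \<in> hspace K" and e: "e \<in> hspace E" for e x
    proof -
      have k: "ket E t3 x \<in> ops E E3" by (rule ket_ops[OF T3 x])
      have sub: "ket E t3 x ` (\<lambda>(x, y). t x y) ` (hspace H \<times> hspace H) \<subseteq> ?G"
      proof
        fix v assume "v \<in> ket E t3 x ` (\<lambda>(x, y). t x y) ` (hspace H \<times> hspace H)"
        then obtain y w where "y \<in> hspace H" "w \<in> hspace H" "v = ket E t3 x (t y w)" by auto
        then show "v \<in> ?G" using D(6)[of y w] x by (intro image_eqI[of _ _ "(x, y, w)"]) (auto simp: ket_def)
      qed
      show ?thesis
        using ops_span[OF k D(3,7) e] complex_vector.span_mono[OF sub] e by (auto simp: ket_def)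
    qed
    then have "(\<lambda>(x, y). t3 x y) ` (hspace K \<times> hspace E) \<subseteq> cspan ?G" by auto
    from complex_vector.span_minimal[OF this complex_vector.subspace_span]
    show "hspace E3 \<subseteq> cspan ?G" unfolding D3(7) .
  qed
qed

lemma assoc_op:
  assumes T: "is_tensor H r H s E t" and comm: "\<forall>d\<in>Bd. \<forall>b\<in>B. r d \<circ> s b = s b \<circ> r d"
    and T2: "is_tensor E (\<lambda>d. tens H H E t E t (idop H) (r d)) H s E2 t2"
    and T3: "is_tensor H r E (\<lambda>b. tens H H E t E t (s b) (idop H)) E3 t3"
  shows "unitary_op E2 E3 (assoc_op H t E2 t2 E3 t3)"
    and "x \<in> hspace H \<Longrightarrow> y \<in> hspace H \<Longrightarrow> w \<in> hspace H \<Longrightarrow>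
      assoc_op H t E2 t2 E3 t3 (t2 (t x y) w) = t3 x (t y w)"
proof -
  let ?J = "hspace H \<times> hspace H \<times> hspace H" and ?g = "\<lambda>(x, y, w). t2 (t x y) w" and ?f = "\<lambda>(x, y, w). t3 x (t y w)"
  note D2 = is_tensorD[OF T2] and D3 = is_tensorD[OF T3]
  have inner: "hinner E3 (?f i) (?f j) = hinner E2 (?g i) (?g j)" if "i \<in> ?J" "j \<in> ?J" for i j
    using that triple_inner(1)[OF T comm _ _ _ _ _ _ T2] triple_inner(2)[OF T comm _ _ _ _ _ _ T3] by auto
  note U = ex1_unitary_generators[OF D2(3) D3(3) triple_span(1)[OF T T2] triple_span(2)[OF T T3] inner]
  have "\<exists>!V. V \<in> ops E2 E3 \<and> (\<forall>x\<in>hspace H. \<forall>y\<in>hspace H. \<forall>w\<in>hspace H. V (t2 (t x y) w) = t3 x (t y w))"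
    using U(1) by simp
  from theI'[OF this] have A: "assoc_op H t E2 t2 E3 t3 \<in> ops E2 E3"
    "\<forall>x\<in>hspace H. \<forall>y\<in>hspace H. \<forall>w\<in>hspace H. assoc_op H t E2 t2 E3 t3 (t2 (t x y) w) = t3 x (t y w)"
    unfolding assoc_op_def by blast+
  show "unitary_op E2 E3 (assoc_op H t E2 t2 E3 t3)" by (rule U(2)[OF _ _ A(1)]) (use A(2) in auto)
  show "x \<in> hspace H \<Longrightarrow> y \<in> hspace H \<Longrightarrow> w \<in> hspace H \<Longrightarrow>
      assoc_op H t E2 t2 E3 t3 (t2 (t x y) w) = t3 x (t y w)" using A(2) by blast
qed

lemma hopf_dataD:
  assumes "hopf_data H A r s E t E2 t2 E3 t3 \<Delta>"
  shows "is_tensor H r H s E t" "unital_alg H A" "r ` Bd \<subseteq> A" "s ` B \<subseteq> A"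
    "\<forall>d\<in>Bd. \<forall>b\<in>B. r d \<circ> s b = s b \<circ> r d"
    "is_tensor E (\<lambda>d. tens H H E t E t (idop H) (r d)) H s E2 t2"
    "is_tensor H r E (\<lambda>b. tens H H E t E t (s b) (idop H)) E3 t3"
    "star_hom H A E (fib H A H A E t) \<Delta>" "\<Delta> (idop H) = idop E" "fib H A H A E t \<subseteq> ops E E"
    "\<And>d. d \<in> Bd \<Longrightarrow> \<Delta> (r d) = tens H H E t E t (idop H) (r d)"
    "\<And>b. b \<in> B \<Longrightarrow> \<Delta> (s b) = tens H H E t E t (s b) (idop H)"
    "star_hom H A H A id" "id (idop H) = idop H" "A \<subseteq> ops H H"
    "a \<in> A \<Longrightarrow> \<Delta> a \<in> fib H A H A E t"
proof -
  note h = assms[unfolded hopf_data_def]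
  show T: "is_tensor H r H s E t" and "unital_alg H A" "r ` Bd \<subseteq> A" "s ` B \<subseteq> A"
    "\<forall>d\<in>Bd. \<forall>b\<in>B. r d \<circ> s b = s b \<circ> r d"
    "is_tensor E (\<lambda>d. tens H H E t E t (idop H) (r d)) H s E2 t2"
    "is_tensor H r E (\<lambda>b. tens H H E t E t (s b) (idop H)) E3 t3"
    "star_hom H A E (fib H A H A E t) \<Delta>"
    and \<Delta>r: "\<And>d. d \<in> Bd \<Longrightarrow> \<Delta> (r d) = tens H H E t E t (idop H) (r d)"
    and "\<And>b. b \<in> B \<Longrightarrow> \<Delta> (s b) = tens H H E t E t (s b) (idop H)"
    using h by blast+
  show "fib H A H A E t \<subseteq> ops E E" by (auto simp: fib_def commutant_def)
  show "\<Delta> (idop H) = idop E"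
    using \<Delta>r[OF L.C(3)] tens_idop[OF T] unital_repD(3)[OF is_tensorD(1)[OF T]] by simp
  show "star_hom H A H A id" by (auto simp: star_hom_def)
  show "id (idop H) = idop H" by simp
  show "A \<subseteq> ops H H" using h by (auto simp: unital_alg_def)
  show "a \<in> A \<Longrightarrow> \<Delta> a \<in> fib H A H A E t" using h by (auto simp: star_hom_def)
qed

lemma hopf_data_fibmap:
  assumes hd: "hopf_data H A r s E t E2 t2 E3 t3 \<Delta>" and a: "a \<in> A"
  shows "fibmap H A H A E t E (fib H A H A E t) H A E2 t2 \<Delta> id (\<Delta> a) \<in> ops E2 E2"
    "fibmap H A H A E t H A E (fib H A H A E t) E3 t3 id \<Delta> (\<Delta> a) \<in> ops E3 E3"
proof -
  note h = hopf_dataD[OF hd]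
  show "fibmap H A H A E t E (fib H A H A E t) H A E2 t2 \<Delta> id (\<Delta> a) \<in> ops E2 E2"
    by (rule fibmap(1)[OF h(1,6,2,2,3,4) h(8-11) h(13-15) _ h(16)[OF a]]) simp_all
  show "fibmap H A H A E t H A E (fib H A H A E t) E3 t3 id \<Delta> (\<Delta> a) \<in> ops E3 E3"
    by (rule fibmap(1)[OF h(1,7,2,2,3,4) h(13-15) _ h(8-10) h(12) h(16)[OF a]]) simp_all
qed

text \<open>\<open>u\<close> maps \<open>t x y\<close> to \<open>t' x y\<close>, and
  \<open>u \<otimes> 1\<close> and \<open>1 \<otimes> u\<close> compare the iterated products. Both
  fiber products of morphisms are conjugated accordingly by \<open>fibmap_transport\<close>.\<close>

lemma coassoc_transport:
  assumes hd: "hopf_data H A r s E t E2 t2 E3 t3 \<Delta>" and hd': "hopf_data H A r s E' t' E2' t2' E3' t3' \<Delta>'"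
    and u: "u = tens H H E t E' t' (idop H) (idop H)"
    and \<Delta>': "\<And>a. a \<in> A \<Longrightarrow> \<Delta>' a = u \<circ> \<Delta> a \<circ> adj E E' u"
  shows "coassoc H A E t E2 t2 E3 t3 \<Delta> \<longleftrightarrow> coassoc H A E' t' E2' t2' E3' t3' \<Delta>'"
proof -
  note h = hopf_dataD[OF hd] and h' = hopf_dataD[OF hd']
  note D = is_tensorD[OF h(1)] and D' = is_tensorD[OF h'(1)]
  note D2 = is_tensorD[OF h(6)] and D2' = is_tensorD[OF h'(6)]
  note D3 = is_tensorD[OF h(7)] and D3' = is_tensorD[OF h'(7)]
  note i1 = iop_idop[OF D(1)] iop_idop[OF D(2)]
  have uid: "unitary_op H H (idop H)"
    using D(4) by (auto simp: unitary_op_def idop_ops adj_idop comp_idop[OF idop_ops])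
  have ut: "u (t x y) = t' x y" if "x \<in> hspace H" "y \<in> hspace H" for x y
    using tens_apply[OF h(1) h'(1) i1 that] that by (simp add: u)
  have uU: "unitary_op E E' u" unfolding u by (rule tens_unitary[OF h(1) h'(1) i1(1) uid i1(2) uid])
  note u' = unitary_opD[OF uU D(3) D'(3)]
  \<comment> \<open>\<open>u \<otimes> 1\<close> is defined only because \<open>u\<close> carries
    the action \<open>1 \<otimes> r\<close> in one model to that in the other.\<close>
  have ui: "u \<in> iop Bd E (\<lambda>d. tens H H E t E t (idop H) (r d)) E' (\<lambda>d. tens H H E' t' E' t' (idop H) (r d))"
    unfolding iop_def
  proof (intro CollectI conjI ballI u'(1))
    fix d assume d: "d \<in> Bd"
    have rd: "r d y \<in> hspace H" if "y \<in> hspace H" for y using unital_repD(2)[OF D(1) d] that by (rule ops_in)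
    show "u \<circ> tens H H E t E t (idop H) (r d) = tens H H E' t' E' t' (idop H) (r d) \<circ> u"
      by (rule tensor_ops_eqI[OF h(1)
            ops_comp[OF u'(1) unital_repD(2)[OF D2(1) d]] ops_comp[OF unital_repD(2)[OF D2'(1) d] u'(1)]])
        (use ut rd tens_one_apply(1)[OF h(1,5) _ _ d] tens_one_apply(1)[OF h'(1,5) _ _ d] in simp)
  qed
  have ui': "u \<in> iop B E (\<lambda>b. tens H H E t E t (s b) (idop H)) E' (\<lambda>b. tens H H E' t' E' t' (s b) (idop H))"
    unfolding iop_def
  proof (intro CollectI conjI ballI u'(1))
    fix b assume b: "b \<in> B"
    have sb: "s b y \<in> hspace H" if "y \<in> hspace H" for y using unital_repD(2)[OF D(2) b] that by (rule ops_in)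
    show "u \<circ> tens H H E t E t (s b) (idop H) = tens H H E' t' E' t' (s b) (idop H) \<circ> u"
      by (rule tensor_ops_eqI[OF h(1)
            ops_comp[OF u'(1) unital_repD(2)[OF D3(2) b]] ops_comp[OF unital_repD(2)[OF D3'(2) b] u'(1)]])
        (use ut sb tens_one_apply(2)[OF h(1,5) _ _ b] tens_one_apply(2)[OF h'(1,5) _ _ b] in simp)
  qed
  define u2 where "u2 = tens E H E2 t2 E2' t2' u (idop H)"
  define u3 where "u3 = tens H E E3 t3 E3' t3' (idop H) u"
  have u2: "unitary_op E2 E2' u2"
    unfolding u2_def by (rule tens_unitary[OF h(6) h'(6) ui uU iop_idop[OF D(2)] uid])
  have u3: "unitary_op E3 E3' u3"
    unfolding u3_def by (rule tens_unitary[OF h(7) h'(7) iop_idop[OF D(1)] uid ui' uU])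
  note u2' = unitary_opD[OF u2 D2(3) D2'(3)] and u3' = unitary_opD[OF u3 D3(3) D3'(3)]
  define V where "V = assoc_op H t E2 t2 E3 t3"
  define V' where "V' = assoc_op H t' E2' t2' E3' t3'"
  note a = assoc_op[OF h(1,5,6,7), folded V_def] and a' = assoc_op[OF h'(1,5,6,7), folded V'_def]
  note Vo = unitary_opD(1)[OF a(1) D2(3) D3(3)] and V'o = unitary_opD(1)[OF a'(1) D2'(3) D3'(3)]
  have VV: "V' \<circ> u2 = u3 \<circ> V"
  proof (rule ops_eqI_span[OF ops_comp[OF V'o u2'(1)] ops_comp[OF u3'(1) Vo] triple_span(1)[OF h(1,6)]])
    fix g assume "g \<in> (\<lambda>(x, y, w). t2 (t x y) w) ` (hspace H \<times> hspace H \<times> hspace H)"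
    then obtain x y w where g: "x \<in> hspace H" "y \<in> hspace H" "w \<in> hspace H" "g = t2 (t x y) w" by auto
    have "u2 g = t2' (t' x y) w"
      using tens_apply[OF h(6) h'(6) ui iop_idop[OF D(2)] D(6)[OF g(1,2)] g(3)] ut[OF g(1,2)] g(3,4)
      by (simp add: u2_def)
    moreover have "u3 (t3 x (t y w)) = t3' x (t' y w)"
      using tens_apply[OF h(7) h'(7) iop_idop[OF D(1)] ui' g(1) D(6)[OF g(2,3)]] ut[OF g(2,3)] g(1)
      by (simp add: u3_def)
    ultimately show "(V' \<circ> u2) g = (u3 \<circ> V) g"
      using a(2)[OF g(1-3)] a'(2)[OF g(1-3)] g(4) by simp
  qed
  have "V \<circ> fibmap H A H A E t E (fib H A H A E t) H A E2 t2 \<Delta> id (\<Delta> a) =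
      fibmap H A H A E t H A E (fib H A H A E t) E3 t3 id \<Delta> (\<Delta> a) \<circ> V \<longleftrightarrow>
      V' \<circ> fibmap H A H A E' t' E' (fib H A H A E' t') H A E2' t2' \<Delta>' id (\<Delta>' a) =
      fibmap H A H A E' t' H A E' (fib H A H A E' t') E3' t3' id \<Delta>' (\<Delta>' a) \<circ> V'"
    (is "V \<circ> ?P = ?Q \<circ> V \<longleftrightarrow> V' \<circ> ?P' = ?Q' \<circ> V'") if a: "a \<in> A" for a
  proof -
    have P': "?P' = u2 \<circ> ?P \<circ> adj E2 E2' u2"
      unfolding u2_def
      by (rule fibmap_transport[OF h(1) h'(1) h(6) h'(6) h(2,2,3,4) h(8-11) h(13-15) _ h'(8-11) h'(13-15) _
            ui uU \<Delta>' iop_idop[OF D(2)] uid _ u h(16)[OF a] h'(16)[OF a] \<Delta>'[OF a]])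
        (use h(15) in \<open>auto simp: adj_idop[OF D(4)] comp_idop[of _ H H] idop_comp[OF D(4), of _ H]\<close>)
    have Q': "?Q' = u3 \<circ> ?Q \<circ> adj E3 E3' u3"
      unfolding u3_def
      by (rule fibmap_transport[OF h(1) h'(1) h(7) h'(7) h(2,2,3,4) h(13-15) _ h(8-10,12) h'(13-15) _ h'(8-10,12)
            iop_idop[OF D(1)] uid _ ui' uU \<Delta>' u h(16)[OF a] h'(16)[OF a] \<Delta>'[OF a]])
        (use h(15) in \<open>auto simp: adj_idop[OF D(4)] comp_idop[of _ H H] idop_comp[OF D(4), of _ H]\<close>)
    note PQ = hopf_data_fibmap[OF hd a] and PQ' = hopf_data_fibmap[OF hd' a]
    have VV': "V' (u2 e) = u3 (V e)" for e using fun_cong[OF VV, of e] by simp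
    have "(V' \<circ> ?P') (u2 e) = u3 ((V \<circ> ?P) e)" "(?Q' \<circ> V') (u2 e) = u3 ((?Q \<circ> V) e)"
      if e: "e \<in> hspace E2" for e
      using u2'(3)[OF e] u3'(3)[OF ops_in[OF Vo e]] VV' unfolding P' Q' by simp_all
    note eqs = this
    show ?thesis
    proof
      assume eq: "V \<circ> ?P = ?Q \<circ> V"
      show "V' \<circ> ?P' = ?Q' \<circ> V'"
      proof (rule ops_eqI[OF ops_comp[OF V'o PQ'(1)] ops_comp[OF PQ'(2) V'o]])
        fix e' assume e': "e' \<in> hspace E2'"
        have e: "adj E2 E2' u2 e' \<in> hspace E2" using u2'(2) e' by (rule ops_in)
        show "(V' \<circ> ?P') e' = (?Q' \<circ> V') e'"
          using eqs[OF e] unfolding eq u2'(4)[OF e'] by (rule trans[OF _ sym])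
      qed
    next
      assume eq: "V' \<circ> ?P' = ?Q' \<circ> V'"
      show "V \<circ> ?P = ?Q \<circ> V"
      proof (rule ops_eqI[OF ops_comp[OF Vo PQ(1)] ops_comp[OF PQ(2) Vo]])
        fix e assume e: "e \<in> hspace E2"
        have m: "(V \<circ> ?P) e \<in> hspace E3" "(?Q \<circ> V) e \<in> hspace E3"
          using ops_in[OF ops_comp[OF Vo PQ(1)] e] ops_in[OF ops_comp[OF PQ(2) Vo] e] by auto
        have "u3 ((V \<circ> ?P) e) = u3 ((?Q \<circ> V) e)" using eqs[OF e] unfolding eq by (rule trans[OF sym])
        then show "(V \<circ> ?P) e = (?Q \<circ> V) e" using u3'(3)[OF m(1)] u3'(3)[OF m(2)] by metis
      qed
    qed
  qed
  then show ?thesis unfolding coassoc_def V_def[symmetric] V'_def[symmetric] by blast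
qed

section \<open>Translation of both notions of bimodule\<close>

lemma tens_conj:
  assumes T: "is_tensor H r K s E t" and T': "is_tensor H r K s E' t'"
    and X: "X \<in> iop Bd H r H r" and Y: "Y \<in> iop B K s K s"
    and u: "u = tens H K E t E' t' (idop H) (idop K)"
  shows "tens H K E' t' E' t' X Y = u \<circ> tens H K E t E t X Y \<circ> adj E E' u"
proof -
  note D = is_tensorD[OF T] and D' = is_tensorD[OF T']
  note i1 = iop_idop[OF D(1)] iop_idop[OF D(2)]
  have ids: "unitary_op H H (idop H)" "unitary_op K K (idop K)"
    using D(4,5) by (auto simp: unitary_op_def idop_ops adj_idop comp_idop[OF idop_ops])
  have un: "unitary_op E E' u" unfolding u by (rule tens_unitary[OF T T' i1(1) ids(1) i1(2) ids(2)])
  have "u \<circ> tens H K E t E t X Y = tens H K E t E' t' X Y"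
    unfolding u tens_comp[OF T T T' X Y i1]
    by (simp only: idop_comp[OF D(4) iopD(1)[OF X]] idop_comp[OF D(5) iopD(1)[OF Y]])
  also have "\<dots> = tens H K E' t' E' t' X Y \<circ> u"
    unfolding u tens_comp[OF T T' T' i1 X Y]
    by (simp only: comp_idop[OF iopD(1)[OF X]] comp_idop[OF iopD(1)[OF Y]])
  finally have "u \<circ> tens H K E t E t X Y \<circ> adj E E' u = tens H K E' t' E' t' X Y \<circ> (u \<circ> adj E E' u)"
    by (simp only: comp_assoc)
  then show ?thesis
    using un comp_idop[OF tens_ops[OF T' T' X Y]] by (simp only: unitary_op_def)
qed

text \<open>The realizations of the iterated tensor products are hidden, since
  \<open>coassoc_transport\<close> needs only that they satisfy \<open>is_tensor\<close>.\<close>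

lemma concrete_hopf_iff:
  fixes H :: "'h::complex_vector hilb"
  assumes r: "unital_rep hh Bd H r" and s: "unital_rep hh B H s"
    and r_def: "r = fact_rep hh H \<alpha>" and s_def: "s = fact_rep hh H \<beta>"
    and \<alpha>: "\<alpha> = intertwiners hh Bd H r" and \<beta>: "\<beta> = intertwiners hh B H s"
    and A: "unital_alg H A" and rA: "r ` Bd \<subseteq> A" and sA: "s ` B \<subseteq> A"
    and comm: "\<forall>d\<in>Bd. \<forall>b\<in>B. r d \<circ> s b = s b \<circ> r d"
    and E: "E = cb_tensor hh H \<alpha> \<beta> H" and t: "t = cbt H r H s \<alpha> \<beta>"
    and \<Delta>: "star_hom H A E (cb_fiber hh H A \<alpha> \<beta> H A) \<Delta>"
  obtains E2 t2 E3 t3 where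
    "is_tensor E (\<lambda>d. tens H H E t E t (idop H) (r d)) H s
      (E2 :: (('k \<Rightarrow> ('k \<Rightarrow> 'h) \<times> 'k \<times> ('k \<Rightarrow> 'h) \<Rightarrow> complex) \<times> 'k \<times> ('k \<Rightarrow> 'h) \<Rightarrow> complex) hilb) t2"
    "is_tensor H r E (\<lambda>b. tens H H E t E t (s b) (idop H))
      (E3 :: (('k \<Rightarrow> 'h) \<times> 'k \<times> ('k \<Rightarrow> ('k \<Rightarrow> 'h) \<times> 'k \<times> ('k \<Rightarrow> 'h) \<Rightarrow> complex) \<Rightarrow> complex) hilb) t3"
    "star_hom H A E (fib H A H A E t) \<Delta>"
    "concrete_hopf_cstar_bimodule hh H A \<alpha> \<beta> \<Delta> \<longleftrightarrow>
      (\<forall>d\<in>Bd. \<Delta> (r d) = tens H H E t E t (idop H) (r d)) \<and>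
      (\<forall>b\<in>B. \<Delta> (s b) = tens H H E t E t (s b) (idop H)) \<and> coassoc H A E t E2 t2 E3 t3 \<Delta>"
proof -
  let ?r2 = "\<lambda>d. tens H H E t E t (idop H) (r d)" and ?s1 = "\<lambda>b. tens H H E t E t (s b) (idop H)"
  let ?AA = "cb_fiber hh H A \<alpha> \<beta> H A"
  define \<alpha>\<alpha> where "\<alpha>\<alpha> = tri_right hh H \<alpha> \<beta>"
  define \<beta>\<beta> where "\<beta>\<beta> = tri_left hh H \<alpha> \<beta>"
  define E2 where "E2 = cb_tensor hh E \<alpha>\<alpha> \<beta> H"
  define t2 where "t2 = cbt E ?r2 H s \<alpha>\<alpha> \<beta>"
  define E3 where "E3 = cb_tensor hh H \<alpha> \<beta>\<beta> E"
  define t3 where "t3 = cbt H r E ?s1 \<alpha> \<beta>\<beta>"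
  have T: "is_tensor H r H s E t" unfolding E t by (rule cb_is_tensor[OF r s \<alpha> \<beta>])
  note D = is_tensorD[OF T]
  have AA: "?AA = fib H A H A E t" unfolding E t by (rule cb_fiber_eq_fib[OF r s \<alpha> \<beta> A A rA sA])
  have c1: "r d \<circ> s b = s b \<circ> r d" if "d \<in> Bd" "b \<in> B" for d b using comm that by blast
  have c2: "s b \<circ> r d = r d \<circ> s b" if "b \<in> B" "d \<in> Bd" for d b using comm that by metis
  have r2: "unital_rep hh Bd E ?r2" by (rule rep_right[OF T r c1])
  have s1: "unital_rep hh B E ?s1" by (rule rep_left[OF T s c2])
  have \<alpha>\<alpha>: "\<alpha>\<alpha> = intertwiners hh Bd E ?r2"
    using ket_comp_intertwiners[OF T r c1]
    unfolding \<alpha>\<alpha>_def tri_right_def ket1_image[OF r s \<alpha> \<beta>] E[symmetric] t[symmetric] \<alpha>[symmetric] .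
  have \<beta>\<beta>: "\<beta>\<beta> = intertwiners hh B E ?s1"
    using std_base.ket_comp_intertwiners[OF swap is_tensor_swap[OF T] s c2]
    unfolding \<beta>\<beta>_def tri_left_def ket2_image[OF r s \<alpha> \<beta>] E[symmetric] t[symmetric] \<beta>[symmetric]
      tens_swap[where K = H and H = H and E = E and t = t and E' = E and t' = t] .
  have T2: "is_tensor E ?r2 H s E2 t2" unfolding E2_def t2_def by (rule cb_is_tensor[OF r2 s \<alpha>\<alpha> \<beta>])
  have T3: "is_tensor H r E ?s1 E3 t3" unfolding E3_def t3_def by (rule cb_is_tensor[OF r s1 \<alpha> \<beta>\<beta>])
  have \<Delta>': "star_hom H A E (fib H A H A E t) \<Delta>" using \<Delta> unfolding AA .
  have fibo: "fib H A H A E t \<subseteq> ops E E" by (auto simp: fib_def commutant_def)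
  have mor1: "\<Delta> \<in> Mor H A \<alpha> E ?AA \<alpha>\<alpha> \<longleftrightarrow> (\<forall>d\<in>Bd. \<Delta> (r d) = ?r2 d)"
    unfolding AA by (rule L.Mor_iff[OF A r r2 rA \<Delta>' fibo \<alpha> \<alpha>\<alpha>])
  have mor2: "\<Delta> \<in> Mor H A \<beta> E ?AA \<beta>\<beta> \<longleftrightarrow> (\<forall>b\<in>B. \<Delta> (s b) = ?s1 b)"
    unfolding AA by (rule R.Mor_iff[OF A s s1 sA \<Delta>' fibo \<beta> \<beta>\<beta>])
  let ?Tr = "triple_tensor hh H \<alpha> \<beta>" and ?V = "triple_to_left hh H \<alpha> \<beta>" and ?W = "triple_to_right hh H \<alpha> \<beta>"
  let ?a = "assoc_op H t E2 t2 E3 t3"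
  note D2 = is_tensorD[OF T2] and D3 = is_tensorD[OF T3]
  note aa = assoc_op[OF T comm T2 T3]
  note ao = unitary_opD(1)[OF aa(1) D2(3) D3(3)]
  let ?X = "\<alpha> \<times> hspace H \<times> \<beta>" and ?k = "triple_kernel hh H \<alpha> \<beta>"
  let ?p = "\<lambda>(\<xi>, x, \<eta>). (t (\<xi> z) x, \<eta> z)" and ?f = "\<lambda>(\<xi>, x, \<eta>). t2 (t (\<xi> z) x) (\<eta> z)"
  have \<alpha>z: "\<xi> z \<in> hspace H" if "\<xi> \<in> \<alpha>" for \<xi>
    by (rule ops_in[OF intertwinersD(1)[OF that[unfolded \<alpha>]] L.z_in])
  have \<beta>z: "\<eta> z \<in> hspace H" if "\<eta> \<in> \<beta>" for \<eta>
    by (rule ops_in[OF intertwinersD(1)[OF that[unfolded \<beta>]] L.z_in])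
  \<comment> \<open>\<open>triple_kernel\<close> is the Gram kernel of triple tensors in
    \<open>E2\<close>. Its positivity and the unitarity of \<open>triple_to_left\<close> come from
    this.\<close>
  have k2: "?k a b = hinner E2 (?f a) (?f b)" if ab: "a \<in> ?X" "b \<in> ?X" for a b
  proof -
    obtain \<xi> x \<eta> \<xi>' x' \<eta>' where e: "a = (\<xi>, x, \<eta>)" "b = (\<xi>', x', \<eta>')" by (metis prod_cases3)
    have m: "\<xi> \<in> \<alpha>" "x \<in> hspace H" "\<eta> \<in> \<beta>" "\<xi>' \<in> \<alpha>" "x' \<in> hspace H" "\<eta>' \<in> \<beta>" using ab e by auto
    show ?thesis
      using triple_inner(1)[OF T comm \<alpha>z[OF m(1)] m(2) \<beta>z[OF m(3)] \<alpha>z[OF m(4)] m(5) \<beta>z[OF m(6)] T2]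
        L.lift_eq[OF r m(1)[unfolded \<alpha>]] L.lift_eq[OF r m(4)[unfolded \<alpha>]]
        R.lift_eq[OF s m(3)[unfolded \<beta>]] R.lift_eq[OF s m(6)[unfolded \<beta>]]
      by (simp add: e triple_kernel_def r_def[symmetric] s_def[symmetric])
  qed
  have p: "fst (?p a) \<in> hspace E" "snd (?p a) \<in> hspace H" if a: "a \<in> ?X" for a
  proof -
    obtain \<xi> x \<eta> where "a = (\<xi>, x, \<eta>)" by (metis prod_cases3)
    then show "fst (?p a) \<in> hspace E" "snd (?p a) \<in> hspace H" using a D(6)[OF \<alpha>z] \<beta>z by auto
  qed
  have k1: "?k a b = hinner E (fst (?p a)) (?r2 (adj hh H (R.lift s (snd (?p a))) \<circ> R.lift s (snd (?p b))) (fst (?p b)))"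
    if ab: "a \<in> ?X" "b \<in> ?X" for a b
    using k2[OF ab] D2(8)[OF p[OF ab(1)] p[OF ab(2)]] by (simp only: case_prod_beta fst_conv snd_conv)
  have Q: "fd_hilbert ?Tr" "cspan (kgen ?X ?k ` ?X) = hspace ?Tr"
    "\<And>a b. a \<in> ?X \<Longrightarrow> b \<in> ?X \<Longrightarrow> hinner ?Tr (kgen ?X ?k a) (kgen ?X ?k b) = ?k a b"
    unfolding triple_tensor_def by (rule kernel_quot[OF r2 s, of ?X ?p ?k, OF p k1]; assumption)+
  have f_im: "?f ` ?X = (\<lambda>(x, y, w). t2 (t x y) w) ` (hspace H \<times> hspace H \<times> hspace H)"
  proof
    show "?f ` ?X \<subseteq> (\<lambda>(x, y, w). t2 (t x y) w) ` (hspace H \<times> hspace H \<times> hspace H)"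
    proof
      fix v assume "v \<in> ?f ` ?X"
      then obtain \<xi> x \<eta> where "\<xi> \<in> \<alpha>" "x \<in> hspace H" "\<eta> \<in> \<beta>" "v = t2 (t (\<xi> z) x) (\<eta> z)" by auto
      then show "v \<in> (\<lambda>(x, y, w). t2 (t x y) w) ` (hspace H \<times> hspace H \<times> hspace H)"
        using \<alpha>z \<beta>z by (intro image_eqI[of _ _ "(\<xi> z, x, \<eta> z)"]) auto
    qed
    show "(\<lambda>(x, y, w). t2 (t x y) w) ` (hspace H \<times> hspace H \<times> hspace H) \<subseteq> ?f ` ?X"
    proof
      fix v assume "v \<in> (\<lambda>(x, y, w). t2 (t x y) w) ` (hspace H \<times> hspace H \<times> hspace H)"
      then obtain x y w where v: "x \<in> hspace H" "y \<in> hspace H" "w \<in> hspace H" "v = t2 (t x y) w" by auto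
      have "L.lift r x \<in> \<alpha>" "R.lift s w \<in> \<beta>"
        unfolding \<alpha> \<beta> by (rule L.lift_intertwiner[OF r v(1)], rule R.lift_intertwiner[OF s v(3)])
      then show "v \<in> ?f ` ?X"
        using v L.lift_z[OF r v(1)] R.lift_z[OF s v(3)]
        by (intro image_eqI[of _ _ "(L.lift r x, y, R.lift s w)"]) auto
    qed
  qed
  have f_span: "cspan (?f ` ?X) = hspace E2" unfolding f_im by (rule triple_span(1)[OF T T2])
  have f_inner: "hinner E2 (?f a) (?f b) = hinner ?Tr (kgen ?X ?k a) (kgen ?X ?k b)"
    if "a \<in> ?X" "b \<in> ?X" for a b
    using k2[OF that] Q(3)[OF that] by simp
  have UV: "\<exists>!S. S \<in> ops ?Tr E2 \<and> (\<forall>j\<in>?X. S (kgen ?X ?k j) = ?f j)"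
    "S \<in> ops ?Tr E2 \<Longrightarrow> \<forall>j\<in>?X. S (kgen ?X ?k j) = ?f j \<Longrightarrow> unitary_op ?Tr E2 S" for S
    by (rule ex1_unitary_generators[OF Q(1) D2(3) Q(2) f_span f_inner]; assumption)+
  have kets: "ket2 hh E \<alpha>\<alpha> \<beta> H \<eta> (ket1 hh H \<alpha> \<beta> H \<xi> x) = t2 (t (\<xi> z) x) (\<eta> z)"
    "ket1 hh H \<alpha> \<beta>\<beta> E \<xi> (ket2 hh H \<alpha> \<beta> H \<eta> x) = t3 (\<xi> z) (t x (\<eta> z))"
    if m: "\<xi> \<in> \<alpha>" "x \<in> hspace H" "\<eta> \<in> \<beta>" for \<xi> x \<eta>
  proof -
    have "ket1 hh H \<alpha> \<beta> H \<xi> x = t (\<xi> z) x" "ket2 hh H \<alpha> \<beta> H \<eta> x = t x (\<eta> z)"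
      unfolding ket1_eq[OF r s \<alpha> \<beta> m(1)] ket2_eq[OF r s \<alpha> \<beta> m(3)] using m(2) by (simp_all add: ket_def t)
    then show "ket2 hh E \<alpha>\<alpha> \<beta> H \<eta> (ket1 hh H \<alpha> \<beta> H \<xi> x) = t2 (t (\<xi> z) x) (\<eta> z)"
      "ket1 hh H \<alpha> \<beta>\<beta> E \<xi> (ket2 hh H \<alpha> \<beta> H \<eta> x) = t3 (\<xi> z) (t x (\<eta> z))"
      unfolding ket2_eq[OF r2 s \<alpha>\<alpha> \<beta> m(3)] ket1_eq[OF r s1 \<alpha> \<beta>\<beta> m(1)]
      using D(6)[OF \<alpha>z[OF m(1)] m(2)] D(6)[OF m(2) \<beta>z[OF m(3)]] by (simp_all add: ket_def t2_def t3_def)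
  qed
  have PV: "(\<forall>\<xi>\<in>\<alpha>. \<forall>x\<in>hspace H. \<forall>\<eta>\<in>\<beta>.
      S (triple_elem hh H \<alpha> \<beta> \<xi> x \<eta>) = ket2 hh E \<alpha>\<alpha> \<beta> H \<eta> (ket1 hh H \<alpha> \<beta> H \<xi> x)) \<longleftrightarrow>
      (\<forall>j\<in>?X. S (kgen ?X ?k j) = ?f j)" for S
    using kets(1) by (simp add: triple_elem_def)
  have "?V = (THE S. S \<in> ops ?Tr E2 \<and> (\<forall>j\<in>?X. S (kgen ?X ?k j) = ?f j))"
    unfolding triple_to_left_def Let_def E[symmetric] \<alpha>\<alpha>_def[symmetric] E2_def[symmetric] PV ..
  with theI'[OF UV(1)] have V: "?V \<in> ops ?Tr E2" "\<forall>j\<in>?X. ?V (kgen ?X ?k j) = ?f j" by simp_all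
  have VU: "unitary_op ?Tr E2 ?V" by (rule UV(2)[OF V])
  \<comment> \<open>The second identification is the first one followed by the associativity map, so
    equality inside the triple tensor product becomes an intertwining relation along
    \<open>assoc_op\<close>.\<close>
  have W: "?W = ?a \<circ> ?V"
    unfolding triple_to_right_def Let_def E[symmetric] \<beta>\<beta>_def[symmetric] E3_def[symmetric]
  proof (rule the_equality)
    have val: "(?a \<circ> ?V) (kgen ?X ?k (\<xi>, x, \<eta>)) = t3 (\<xi> z) (t x (\<eta> z))"
      if m: "\<xi> \<in> \<alpha>" "x \<in> hspace H" "\<eta> \<in> \<beta>" for \<xi> x \<eta>
      using V(2)[rule_format, of "(\<xi>, x, \<eta>)"] m aa(2)[OF \<alpha>z[OF m(1)] m(2) \<beta>z[OF m(3)]] by simp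
    show "?a \<circ> ?V \<in> ops ?Tr E3 \<and> (\<forall>\<xi>\<in>\<alpha>. \<forall>x\<in>hspace H. \<forall>\<eta>\<in>\<beta>.
        (?a \<circ> ?V) (triple_elem hh H \<alpha> \<beta> \<xi> x \<eta>) = ket1 hh H \<alpha> \<beta>\<beta> E \<xi> (ket2 hh H \<alpha> \<beta> H \<eta> x))"
      using ops_comp[OF ao V(1)] val kets(2) unfolding triple_elem_def by metis
    fix S assume S: "S \<in> ops ?Tr E3 \<and> (\<forall>\<xi>\<in>\<alpha>. \<forall>x\<in>hspace H. \<forall>\<eta>\<in>\<beta>.
        S (triple_elem hh H \<alpha> \<beta> \<xi> x \<eta>) = ket1 hh H \<alpha> \<beta>\<beta> E \<xi> (ket2 hh H \<alpha> \<beta> H \<eta> x))"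
    show "S = ?a \<circ> ?V"
    proof (rule ops_eqI_span[OF _ ops_comp[OF ao V(1)] Q(2)])
      fix g assume "g \<in> kgen ?X ?k ` ?X"
      then obtain \<xi> x \<eta> where g: "\<xi> \<in> \<alpha>" "x \<in> hspace H" "\<eta> \<in> \<beta>" "g = kgen ?X ?k (\<xi>, x, \<eta>)" by auto
      show "S g = (?a \<circ> ?V) g"
        unfolding g(4) val[OF g(1-3)] kets(2)[OF g(1-3), symmetric] using S g(1-3) unfolding triple_elem_def by blast
    qed (use S in blast)
  qed
  have id: "star_hom H A H A id" by (auto simp: star_hom_def)
  have "concrete_hopf_cstar_bimodule hh H A \<alpha> \<beta> \<Delta> \<longleftrightarrow>
      (\<forall>d\<in>Bd. \<Delta> (r d) = ?r2 d) \<and> (\<forall>b\<in>B. \<Delta> (s b) = ?s1 b) \<and> coassoc H A E t E2 t2 E3 t3 \<Delta>"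
  \<comment> \<open>Without these equations both sides are false. With them the maps
    \<open>\<Delta> * id\<close> and \<open>id * \<Delta>\<close> are instances of
    \<open>fibmap\<close>, whose characterization requires the target representations to be the
    images of \<open>r\<close> and \<open>s\<close>.\<close>
  proof (cases "(\<forall>d\<in>Bd. \<Delta> (r d) = ?r2 d) \<and> (\<forall>b\<in>B. \<Delta> (s b) = ?s1 b)")
    case True
    then have hd: "hopf_data H A r s E t E2 t2 E3 t3 \<Delta>"
      unfolding hopf_data_def by (intro conjI T A rA sA comm T2 T3 \<Delta>') simp_all
    have falg: "unital_alg E ?AA" unfolding AA by (rule fib_alg[OF T A A rA sA])
    have \<Delta>r: "\<And>d. d \<in> Bd \<Longrightarrow> \<Delta> (r d) = ?r2 d" and \<Delta>s: "\<And>b. b \<in> B \<Longrightarrow> \<Delta> (s b) = ?s1 b"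
      using True by blast+
    have \<Delta>A: "\<Delta> a \<in> ?AA" if "a \<in> A" for a using \<Delta> that unfolding star_hom_def by blast
    have sub: "?r2 ` Bd \<subseteq> ?AA" "?s1 ` B \<subseteq> ?AA"
      using \<Delta>A rA sA by (auto simp only: \<Delta>r[symmetric] \<Delta>s[symmetric] image_subset_iff)
    have "cb_fiber_map hh H A \<alpha> \<beta> H A E ?AA \<alpha>\<alpha> \<beta> H A \<Delta> id =
        fibmap H A H A (cb_tensor hh H \<alpha> \<beta> H) (cbt H r H s \<alpha> \<beta>) E ?AA H A
          (cb_tensor hh E \<alpha>\<alpha> \<beta> H) (cbt E ?r2 H s \<alpha>\<alpha> \<beta>) \<Delta> id"
      by (rule cb_fiber_map_eq_fibmap[OF r s \<alpha> \<beta> r2 s \<alpha>\<alpha> \<beta> A A rA sA falg A sub(1) sA \<Delta> _ id])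
        (simp_all add: \<Delta>r)
    then have F2: "cb_fiber_map hh H A \<alpha> \<beta> H A E ?AA \<alpha>\<alpha> \<beta> H A \<Delta> id =
        fibmap H A H A E t E (fib H A H A E t) H A E2 t2 \<Delta> id"
      by (simp only: E[symmetric] t[symmetric] E2_def[symmetric] t2_def[symmetric] AA)
    have "cb_fiber_map hh H A \<alpha> \<beta> H A H A \<alpha> \<beta>\<beta> E ?AA id \<Delta> =
        fibmap H A H A (cb_tensor hh H \<alpha> \<beta> H) (cbt H r H s \<alpha> \<beta>) H A E ?AA
          (cb_tensor hh H \<alpha> \<beta>\<beta> E) (cbt H r E ?s1 \<alpha> \<beta>\<beta>) id \<Delta>"
      by (rule cb_fiber_map_eq_fibmap[OF r s \<alpha> \<beta> r s1 \<alpha> \<beta>\<beta> A A rA sA A falg rA sub(2) id _ \<Delta>])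
        (simp_all add: \<Delta>s)
    then have F3: "cb_fiber_map hh H A \<alpha> \<beta> H A H A \<alpha> \<beta>\<beta> E ?AA id \<Delta> =
        fibmap H A H A E t H A E (fib H A H A E t) E3 t3 id \<Delta>"
      by (simp only: E[symmetric] t[symmetric] E3_def[symmetric] t3_def[symmetric] AA)
    have "adj ?Tr E2 ?V \<circ> fibmap H A H A E t E (fib H A H A E t) H A E2 t2 \<Delta> id (\<Delta> a) \<circ> ?V =
        adj ?Tr E3 (?a \<circ> ?V) \<circ> fibmap H A H A E t H A E (fib H A H A E t) E3 t3 id \<Delta> (\<Delta> a) \<circ> (?a \<circ> ?V) \<longleftrightarrow>
        ?a \<circ> fibmap H A H A E t E (fib H A H A E t) H A E2 t2 \<Delta> id (\<Delta> a) =
        fibmap H A H A E t H A E (fib H A H A E t) E3 t3 id \<Delta> (\<Delta> a) \<circ> ?a" if "a \<in> A" for a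
      by (rule unitary_double_conj_iff[OF VU aa(1) hopf_data_fibmap[OF hd that] Q(1) D2(3) D3(3)])
    note conj = this
    show ?thesis
      unfolding concrete_hopf_cstar_bimodule_def Let_def E[symmetric] \<alpha>\<alpha>_def[symmetric] \<beta>\<beta>_def[symmetric]
        E2_def[symmetric] E3_def[symmetric] F2 F3 W coassoc_def Int_iff mor1 mor2
      using True conj by simp
  next
    case False
    then show ?thesis
      unfolding concrete_hopf_cstar_bimodule_def Let_def E[symmetric] \<alpha>\<alpha>_def[symmetric] \<beta>\<beta>_def[symmetric]
        Int_iff mor1 mor2 by blast
  qed
  then show thesis by (rule that[OF T2 T3 \<Delta>'])
qed

context
  fixes G :: "('n::cstar_algebra, 'g::complex_vector) gns" and U :: "'k \<Rightarrow> 'g"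
  assumes G: "fd_hilbert (gns_space G)" and U: "unitary_op hh (gns_space G) U"
    and rangeB: "{U \<circ> b \<circ> adj hh (gns_space G) U | b. b \<in> B} = range (gns_rep G)"
    and rangeBd: "{U \<circ> b \<circ> adj hh (gns_space G) U | b. b \<in> Bd} = range (gns_rep_op G)"
    and Uz: "U z = gns_vec G"
begin

lemma hopf_vn_iff:
  assumes r: "unital_rep hh Bd H r" and s: "unital_rep hh B H s"
    and \<rho>: "\<And>b. \<rho> b = r (adj hh (gns_space G) U \<circ> gns_rep_op G b \<circ> U)"
    and \<sigma>: "\<And>b. \<sigma> b = s (adj hh (gns_space G) U \<circ> gns_rep G b \<circ> U)"
    and A: "unital_alg H A" and rA: "r ` Bd \<subseteq> A" and sA: "s ` B \<subseteq> A"
    and comm: "\<forall>d\<in>Bd. \<forall>b\<in>B. r d \<circ> s b = s b \<circ> r d"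
    and E: "E = mu_tensor G H \<rho> \<sigma> H" and t: "t = mu_elem G H \<rho> \<sigma> H"
    and E2: "E2 = mu_tensor G E (rho2 G H \<rho> \<sigma>) \<sigma> H" and t2: "t2 = mu_elem G E (rho2 G H \<rho> \<sigma>) \<sigma> H"
    and E3: "E3 = mu_tensor G H \<rho> (sigma1 G H \<rho> \<sigma>) E" and t3: "t3 = mu_elem G H \<rho> (sigma1 G H \<rho> \<sigma>) E"
    and \<Delta>: "star_hom H A E (fib H A H A E t) \<Delta>"
  shows "is_tensor H r H s E t"
    and "is_tensor E (\<lambda>d. tens H H E t E t (idop H) (r d)) H s E2 t2"
    and "is_tensor H r E (\<lambda>b. tens H H E t E t (s b) (idop H)) E3 t3"
    and "hopf_vn_bimodule G H A \<rho> \<sigma> \<Delta> \<longleftrightarrow>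
      (\<forall>d\<in>Bd. \<Delta> (r d) = tens H H E t E t (idop H) (r d)) \<and>
      (\<forall>b\<in>B. \<Delta> (s b) = tens H H E t E t (s b) (idop H)) \<and> coassoc H A E t E2 t2 E3 t3 \<Delta>"
proof -
  let ?r2 = "\<lambda>d. tens H H E t E t (idop H) (r d)" and ?s1 = "\<lambda>b. tens H H E t E t (s b) (idop H)"
  note mt = mu_is_tensor[OF G U rangeB rangeBd Uz]
  show T: "is_tensor H r H s E t" unfolding E t by (rule mt[OF r s \<rho> \<sigma>])
  note D = is_tensorD[OF T]
  have c1: "r d \<circ> s b = s b \<circ> r d" if "d \<in> Bd" "b \<in> B" for d b using comm that by blast
  have c2: "s b \<circ> r d = r d \<circ> s b" if "b \<in> B" "d \<in> Bd" for d b using comm that by metis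
  have r2: "unital_rep hh Bd E ?r2" by (rule rep_right[OF T r c1])
  have s1: "unital_rep hh B E ?s1" by (rule rep_left[OF T s c2])
  have rho2: "rho2 G H \<rho> \<sigma> b = tens H H E t E t (idop H) (\<rho> b)" for b
    unfolding rho2_def mu_op_def tens_def E t ..
  have sigma1: "sigma1 G H \<rho> \<sigma> b = tens H H E t E t (\<sigma> b) (idop H)" for b
    unfolding sigma1_def mu_op_def tens_def E t ..
  show T2: "is_tensor E ?r2 H s E2 t2" unfolding E2 t2 by (rule mt[OF r2 s _ \<sigma>]) (simp add: rho2 \<rho>)
  show T3: "is_tensor H r E ?s1 E3 t3" unfolding E3 t3 by (rule mt[OF r s1 \<rho>]) (simp add: sigma1 \<sigma>)
  \<comment> \<open>As \<open>b\<close> runs through \<open>N\<close>, the operators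
    \<open>gns_rep_op G b\<close>, conjugated back by \<open>U\<close>, run through exactly
    \<open>Bd\<close>.\<close>
  have rho_iff: "(\<forall>b. \<Delta> (\<rho> b) = rho2 G H \<rho> \<sigma> b) \<longleftrightarrow> (\<forall>d\<in>Bd. \<Delta> (r d) = ?r2 d)"
    unfolding L.range_unitary_conj[OF G U rangeBd, symmetric] by (simp add: rho2 \<rho>)
  have sigma_iff: "(\<forall>b. \<Delta> (\<sigma> b) = sigma1 G H \<rho> \<sigma> b) \<longleftrightarrow> (\<forall>b\<in>B. \<Delta> (s b) = ?s1 b)"
    unfolding R.range_unitary_conj[OF G U rangeB, symmetric] by (simp add: sigma1 \<sigma>)
  have assoc: "mu_assoc G H \<rho> \<sigma> = assoc_op H t E2 t2 E3 t3"
    unfolding mu_assoc_def Let_def assoc_op_def E2 t2 E3 t3 E t ..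
  have fibE: "mu_fiber G H A \<rho> \<sigma> H A = fib H A H A E t" unfolding mu_fiber_eq_fib E t ..
  show "hopf_vn_bimodule G H A \<rho> \<sigma> \<Delta> \<longleftrightarrow> (\<forall>d\<in>Bd. \<Delta> (r d) = ?r2 d) \<and> (\<forall>b\<in>B. \<Delta> (s b) = ?s1 b) \<and>
      coassoc H A E t E2 t2 E3 t3 \<Delta>"
  proof (cases "(\<forall>d\<in>Bd. \<Delta> (r d) = ?r2 d) \<and> (\<forall>b\<in>B. \<Delta> (s b) = ?s1 b)")
    case True
    then have hd: "hopf_data H A r s E t E2 t2 E3 t3 \<Delta>"
      unfolding hopf_data_def by (intro conjI T A rA sA comm T2 T3 \<Delta>) simp_all
    note aa = assoc_op[OF T comm T2 T3]
    have "assoc_op H t E2 t2 E3 t3 \<circ> fibmap H A H A E t E (fib H A H A E t) H A E2 t2 \<Delta> id (\<Delta> a) \<circ>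
          adj E2 E3 (assoc_op H t E2 t2 E3 t3) =
        fibmap H A H A E t H A E (fib H A H A E t) E3 t3 id \<Delta> (\<Delta> a) \<longleftrightarrow>
        assoc_op H t E2 t2 E3 t3 \<circ> fibmap H A H A E t E (fib H A H A E t) H A E2 t2 \<Delta> id (\<Delta> a) =
        fibmap H A H A E t H A E (fib H A H A E t) E3 t3 id \<Delta> (\<Delta> a) \<circ> assoc_op H t E2 t2 E3 t3"
      if "a \<in> A" for a
      by (rule unitary_conj_iff[OF aa(1) hopf_data_fibmap[OF hd that]])
    note conj = this
    show ?thesis
      unfolding hopf_vn_bimodule_def Let_def mu_fiber_map_eq_fibmap assoc fibE rho_iff sigma_iff
        coassoc_def E[symmetric] t[symmetric] E2[symmetric] t2[symmetric] E3[symmetric] t3[symmetric]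
      using True conj \<Delta> by simp
  next
    case False
    then show ?thesis unfolding hopf_vn_bimodule_def Let_def rho_iff sigma_iff by blast
  qed
qed

end

end

theorem proposition3p4:
  fixes H :: "'h::complex_vector hilb" and A :: "('h \<Rightarrow> 'h) set"
    and \<mu> :: "'n::cstar_algebra \<Rightarrow> complex" and G :: "('n, 'g::complex_vector) gns"
    and \<rho> \<sigma> :: "'n \<Rightarrow> 'h \<Rightarrow> 'h"
    and \<HH> :: "'k::complex_vector hilb" and \<BB> \<BB>d :: "('k \<Rightarrow> 'k) set" and \<zeta> :: 'k
    and \<alpha> \<beta> :: "('k \<Rightarrow> 'h) set"
    and U :: "'k \<Rightarrow> 'g"
    and \<Delta>\<^sub>\<mu> :: "('h \<Rightarrow> 'h) \<Rightarrow> ('h \<times> 'h \<Rightarrow> complex) \<Rightarrow> 'h \<times> 'h \<Rightarrow> complex"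
    and \<Delta>\<^sub>H :: "('h \<Rightarrow> 'h) \<Rightarrow> (('k \<Rightarrow> 'h) \<times> 'k \<times> ('k \<Rightarrow> 'h) \<Rightarrow> complex) \<Rightarrow>
                 ('k \<Rightarrow> 'h) \<times> 'k \<times> ('k \<Rightarrow> 'h) \<Rightarrow> complex"
  assumes "fd_hilbert H" and "nondeg_cstar H A"
    and "\<exists>S. finite S \<and> cspan S = (UNIV :: 'n set)"
    and "faithful_state \<mu>" and "gns_representation \<mu> G"
    and "unital_star_rep op_mult H A \<rho>" and "inj \<rho>"
    and "unital_star_rep (*) H A \<sigma>" and "inj \<sigma>"
    and "\<And>b c. \<rho> b \<circ> \<sigma> c = \<sigma> c \<circ> \<rho> b"
    and "cstar_base \<HH> \<BB> \<BB>d" and "bicyclic \<HH> \<BB> \<BB>d \<zeta>"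
    and "\<alpha> \<in> cstar_fact \<HH> \<BB> \<BB>d H A" and "\<beta> \<in> cstar_fact \<HH> \<BB>d \<BB> H A"
    and "compatible_facts \<HH> \<BB> \<BB>d H \<alpha> \<beta>"
    and "unitary_op \<HH> (gns_space G) U"
    and "{U \<circ> b \<circ> adj \<HH> (gns_space G) U | b. b \<in> \<BB>} = range (gns_rep G)"
    and "{U \<circ> b \<circ> adj \<HH> (gns_space G) U | b. b \<in> \<BB>d} = range (gns_rep_op G)"
    and "U \<zeta> = gns_vec G"
    and "\<And>b. \<rho> b = fact_rep \<HH> H \<alpha> (adj \<HH> (gns_space G) U \<circ> gns_rep_op G b \<circ> U)"
    and "\<And>b. \<sigma> b = fact_rep \<HH> H \<beta> (adj \<HH> (gns_space G) U \<circ> gns_rep G b \<circ> U)"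
    and "star_hom H A (mu_tensor G H \<rho> \<sigma> H) (mu_fiber G H A \<rho> \<sigma> H A) \<Delta>\<^sub>\<mu>"
    and "star_hom H A (cb_tensor \<HH> H \<alpha> \<beta> H) (cb_fiber \<HH> H A \<alpha> \<beta> H A) \<Delta>\<^sub>H"
    and "\<And>a. a \<in> A \<Longrightarrow> \<Delta>\<^sub>H a = compare_iso G H \<rho> \<sigma> \<HH> \<alpha> \<beta> U \<zeta> (\<Delta>\<^sub>\<mu> a)"
  shows "hopf_vn_bimodule G H A \<rho> \<sigma> \<Delta>\<^sub>\<mu> \<longleftrightarrow> concrete_hopf_cstar_bimodule \<HH> H A \<alpha> \<beta> \<Delta>\<^sub>H"
proof -
  interpret std_base \<HH> \<BB> \<BB>d \<zeta> by unfold_locales (fact assms(11), fact assms(12))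
  have \<alpha>f: "cstar_factorization \<HH> \<BB> \<BB>d H \<alpha>" and \<beta>f: "cstar_factorization \<HH> \<BB>d \<BB> H \<beta>"
    using assms(13,14) by (simp_all add: cstar_fact_def)
  define r where "r = fact_rep \<HH> H \<alpha>"
  define s where "s = fact_rep \<HH> H \<beta>"
  have rA: "r ` \<BB>d \<subseteq> A" and sA: "s ` \<BB> \<subseteq> A"
    using assms(13,14) by (simp_all add: cstar_fact_def r_def s_def)
  have r: "unital_rep \<HH> \<BB>d H r" unfolding r_def by (rule unital_rep_fact[OF assms(1) \<alpha>f])
  have s: "unital_rep \<HH> \<BB> H s"
    unfolding s_def by (rule std_base.unital_rep_fact[OF swap assms(1) \<beta>f])
  have \<alpha>: "\<alpha> = intertwiners \<HH> \<BB>d H r"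
    unfolding r_def by (rule fact_eq_intertwiners[OF assms(1) \<alpha>f])
  have \<beta>: "\<beta> = intertwiners \<HH> \<BB> H s"
    unfolding s_def by (rule std_base.fact_eq_intertwiners[OF swap assms(1) \<beta>f])
  have "idop H \<in> A" using assms(6) unfolding unital_star_rep_def by (metis rangeI subset_iff)
  then have A: "unital_alg H A"
    using assms(1,2) unfolding unital_alg_def nondeg_cstar_def op_prods_def by blast
  have G: "fd_hilbert (gns_space G)" using assms(5) by (simp add: gns_representation_def)
  note U = assms(16) and ranges = assms(17,18)
  have \<rho>: "\<rho> b = r (adj \<HH> (gns_space G) U \<circ> gns_rep_op G b \<circ> U)" for b
    unfolding r_def by (rule assms(20))
  have \<sigma>: "\<sigma> b = s (adj \<HH> (gns_space G) U \<circ> gns_rep G b \<circ> U)" for b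
    unfolding s_def by (rule assms(21))
  have comm: "\<forall>d\<in>\<BB>d. \<forall>b\<in>\<BB>. r d \<circ> s b = s b \<circ> r d"
  proof (intro ballI)
    fix d b assume "d \<in> \<BB>d" "b \<in> \<BB>"
    then obtain m n where "d = adj \<HH> (gns_space G) U \<circ> gns_rep_op G m \<circ> U"
      "b = adj \<HH> (gns_space G) U \<circ> gns_rep G n \<circ> U"
      using L.range_unitary_conj[OF G U ranges(2)] R.range_unitary_conj[OF G U ranges(1)] by blast
    then show "r d \<circ> s b = s b \<circ> r d" using assms(10)[of m n] \<rho>[of m] \<sigma>[of n] by simp
  qed
  define E where "E = mu_tensor G H \<rho> \<sigma> H"
  define t where "t = mu_elem G H \<rho> \<sigma> H"
  define E' where "E' = cb_tensor \<HH> H \<alpha> \<beta> H"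
  define t' where "t' = cbt H r H s \<alpha> \<beta>"
  have \<Delta>\<mu>: "star_hom H A E (fib H A H A E t) \<Delta>\<^sub>\<mu>"
    using assms(22) unfolding mu_fiber_eq_fib E_def t_def .
  note mu = hopf_vn_iff[OF G U ranges assms(19) r s \<rho> \<sigma> A rA sA comm E_def t_def refl refl refl refl \<Delta>\<mu>]
  obtain E2 t2 E3 t3 where cb:
    "is_tensor E' (\<lambda>d. tens H H E' t' E' t' (idop H) (r d)) H s
      (E2 :: (('k \<Rightarrow> ('k \<Rightarrow> 'h) \<times> 'k \<times> ('k \<Rightarrow> 'h) \<Rightarrow> complex) \<times> 'k \<times> ('k \<Rightarrow> 'h) \<Rightarrow> complex) hilb) t2"
    "is_tensor H r E' (\<lambda>b. tens H H E' t' E' t' (s b) (idop H))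
      (E3 :: (('k \<Rightarrow> 'h) \<times> 'k \<times> ('k \<Rightarrow> ('k \<Rightarrow> 'h) \<times> 'k \<times> ('k \<Rightarrow> 'h) \<Rightarrow> complex) \<Rightarrow> complex) hilb) t3"
    "star_hom H A E' (fib H A H A E' t') \<Delta>\<^sub>H"
    "concrete_hopf_cstar_bimodule \<HH> H A \<alpha> \<beta> \<Delta>\<^sub>H \<longleftrightarrow>
      (\<forall>d\<in>\<BB>d. \<Delta>\<^sub>H (r d) = tens H H E' t' E' t' (idop H) (r d)) \<and>
      (\<forall>b\<in>\<BB>. \<Delta>\<^sub>H (s b) = tens H H E' t' E' t' (s b) (idop H)) \<and> coassoc H A E' t' E2 t2 E3 t3 \<Delta>\<^sub>H"
    by (rule concrete_hopf_iff[OF r s r_def s_def \<alpha> \<beta> A rA sA comm E'_def t'_def assms(23)[folded E'_def]])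
  have T': "is_tensor H r H s E' t'" unfolding E'_def t'_def by (rule cb_is_tensor[OF r s \<alpha> \<beta>])
  note D = is_tensorD[OF mu(1)] and D' = is_tensorD[OF T']
  define u where "u = tens H H E t E' t' (idop H) (idop H)"
  \<comment> \<open>Composed with \<open>U\<close>, both kinds of \<open>R\<close> become lifts. So
    the comparison unitary is \<open>1 \<otimes> 1\<close> between the two realizations of one
    tensor product.\<close>
  have u: "compare_unitary G H \<rho> \<sigma> \<HH> \<alpha> \<beta> U \<zeta> = u"
  proof -
    have "adj \<HH> (gns_space G) U \<circ> U = idop \<HH>" using U by (simp add: unitary_op_def)
    then have "R_left G H \<rho> x \<circ> U = L.lift r x" "R_right G H \<sigma> x \<circ> U = R.lift s x" if "x \<in> hspace H" for x
      unfolding R_left_eq[OF G U ranges assms(19) r \<rho> that] R_right_eq[OF G U ranges assms(19) s \<sigma> that]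
        comp_assoc
      by (simp_all only: comp_idop[OF L.lift_ops[OF r that]] comp_idop[OF R.lift_ops[OF s that]])
    then have "(\<forall>x\<in>hspace H. \<forall>y\<in>hspace H. S (t x y) =
          cb_elem \<HH> H \<alpha> \<beta> H (R_left G H \<rho> x \<circ> U) \<zeta> (R_right G H \<sigma> y \<circ> U)) \<longleftrightarrow>
        (\<forall>x\<in>hspace H. \<forall>y\<in>hspace H. S (t x y) = t' (idop H x) (idop H y))" for S
      by (simp add: t'_def cbt_def[OF r s \<alpha> \<beta>])
    then show ?thesis
      unfolding compare_unitary_def u_def tens_def E_def[symmetric] t_def[symmetric] E'_def[symmetric] by simp
  qed
  have \<Delta>H: "\<Delta>\<^sub>H a = u \<circ> \<Delta>\<^sub>\<mu> a \<circ> adj E E' u" if "a \<in> A" for a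
    using assms(24)[OF that] by (simp only: compare_iso_def u E_def E'_def)
  have idU: "unitary_op H H (idop H)"
    using assms(1) by (auto simp: unitary_op_def idop_ops adj_idop comp_idop[OF idop_ops])
  have "unitary_op E E' u"
    unfolding u_def by (rule tens_unitary[OF mu(1) T' iop_idop[OF r] idU iop_idop[OF s] idU])
  then have uu: "adj E E' u \<circ> u = idop E" by (simp add: unitary_op_def)
  \<comment> \<open>Conjugation by the unitary \<open>u\<close> is injective and carries
    \<open>X \<otimes> Y\<close> in one model to \<open>X \<otimes> Y\<close> in the other.\<close>
  have conj_iff: "\<Delta>\<^sub>\<mu> a = tens H H E t E t X Y \<longleftrightarrow> \<Delta>\<^sub>H a = tens H H E' t' E' t' X Y"
    if a: "a \<in> A" and X: "X \<in> iop \<BB>d H r H r" and Y: "Y \<in> iop \<BB> H s H s" for a X Y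
  proof -
    have inj: "P = adj E E' u \<circ> (u \<circ> P \<circ> adj E E' u) \<circ> u" if "P \<in> ops E E" for P
      using unitary_conj_cancel[OF D(3) D'(3) \<open>unitary_op E E' u\<close> that] by (rule sym)
    have "\<Delta>\<^sub>\<mu> a \<in> ops E E"
      using \<Delta>\<mu> a unfolding star_hom_def fib_def commutant_def[of E] by blast
    from inj[OF this] inj[OF tens_ops[OF mu(1,1) X Y]] show ?thesis
      unfolding \<Delta>H[OF a] tens_conj[OF mu(1) T' X Y u_def] by metis
  qed
  have "r d \<in> iop \<BB> H s H s" "r d \<in> A" if "d \<in> \<BB>d" for d
    using unital_repD(2)[OF r that] comm rA that by (auto simp: iop_def)
  then have rho_iff: "(\<forall>d\<in>\<BB>d. \<Delta>\<^sub>\<mu> (r d) = tens H H E t E t (idop H) (r d)) \<longleftrightarrow>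
      (\<forall>d\<in>\<BB>d. \<Delta>\<^sub>H (r d) = tens H H E' t' E' t' (idop H) (r d))"
    using conj_iff iop_idop[OF r] by blast
  have "s b \<in> iop \<BB>d H r H r" "s b \<in> A" if "b \<in> \<BB>" for b
    using unital_repD(2)[OF s that] comm sA that by (auto simp: iop_def)
  then have sigma_iff: "(\<forall>b\<in>\<BB>. \<Delta>\<^sub>\<mu> (s b) = tens H H E t E t (s b) (idop H)) \<longleftrightarrow>
      (\<forall>b\<in>\<BB>. \<Delta>\<^sub>H (s b) = tens H H E' t' E' t' (s b) (idop H))"
    using conj_iff iop_idop[OF s] by blast
  show ?thesis
  \<comment> \<open>\<open>hopf_data\<close>, and with it the transport of coassociativity, is
    available only when \<Delta> respects both representations.\<close>
  proof (cases "(\<forall>d\<in>\<BB>d. \<Delta>\<^sub>H (r d) = tens H H E' t' E' t' (idop H) (r d)) \<and>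
      (\<forall>b\<in>\<BB>. \<Delta>\<^sub>H (s b) = tens H H E' t' E' t' (s b) (idop H))")
    case True
    note hd = hopf_data_def[THEN iffD2]
    have 1: "hopf_data H A r s E t (mu_tensor G E (rho2 G H \<rho> \<sigma>) \<sigma> H) (mu_elem G E (rho2 G H \<rho> \<sigma>) \<sigma> H)
        (mu_tensor G H \<rho> (sigma1 G H \<rho> \<sigma>) E) (mu_elem G H \<rho> (sigma1 G H \<rho> \<sigma>) E) \<Delta>\<^sub>\<mu>"
      using True by (intro hd conjI mu(1-3) A rA sA comm \<Delta>\<mu>) (simp_all add: rho_iff sigma_iff)
    have 2: "hopf_data H A r s E' t' E2 t2 E3 t3 \<Delta>\<^sub>H"
      using True by (intro hd conjI T' A rA sA comm cb(1-3)) simp_all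
    have "coassoc H A E t (mu_tensor G E (rho2 G H \<rho> \<sigma>) \<sigma> H) (mu_elem G E (rho2 G H \<rho> \<sigma>) \<sigma> H)
        (mu_tensor G H \<rho> (sigma1 G H \<rho> \<sigma>) E) (mu_elem G H \<rho> (sigma1 G H \<rho> \<sigma>) E) \<Delta>\<^sub>\<mu> \<longleftrightarrow>
      coassoc H A E' t' E2 t2 E3 t3 \<Delta>\<^sub>H"
      by (rule coassoc_transport[OF 1 2 u_def \<Delta>H])
    then show ?thesis unfolding mu(4) cb(4) rho_iff sigma_iff by simp
  next
    case False
    then show ?thesis unfolding mu(4) cb(4) rho_iff sigma_iff by blast
  qed
qed

end
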